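(* Let $\Omega\subset\mathbb R^3$ be an arbitrary (possibly unbounded) open set. Coefficients: let $a_0,a_1\in]0,\infty[$ and $a_{ij}=a_{ji}\in L^\infty(\Omega)$ ($i,j=1,2,3$) satisfy $a_0|\xi|^2\le\sum_{i,j=1}^3a_{ij}(x)\xi_i\xi_j\le a_1|\xi|^2$ for all $\xi\in\mathbb R^3$ and a.e. $x\in\Omega$; put $A(x)=(a_{ij}(x))_{i,j}$. Let $\beta\colon\Omega\to\mathbb R$ be measurable such that (a) for every $\nu>0$ there is $C_\nu>0$ with $\int_\Omega|\beta||u|^2\,dx\le\nu\int_\Omega|\nabla u|^2\,dx+C_\nu\int_\Omega|u|^2\,dx$ for all $u\in H^1_0(\Omega)$; (b) there is $\lambda_1>0$ with $\int_\Omega A\nabla u\cdot\nabla u\,dx+\int_\Omega\beta|u|^2\,dx\ge\lambda_1\int_\Omega|u|^2\,dx$ for all $u\in H^1_0(\Omega)$. Nonlinearity: let $f\colon\Omega\times\mathbb R\to\mathbb R$ be such that $f(\cdot,u)$ is measurable for every $u\in\mathbb R$, $f(\cdot,0)\in L^2(\Omega)$, for a.e. $x\in\Omega$ the function $f(x,\cdot)$ is of class $C^1$, $\partial_uf(\cdot,0)\in L^\infty(\Omega)$, and there are constants $C>0$, $0<\gamma\le1$, $1\le\alpha<2$ with $\alpha+\gamma=2$ such that $|\partial_uf(x,u_1)-\partial_uf(x,u_2)|\le C(1+|u_1|^\alpha+|u_2|^\alpha)|u_1-u_2|^\gamma$ for a.e. $x\in\Omega$ and all $u_1,u_2\in\mathbb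 R$. Fix $\epsilon\in]0,1]$. Let $(\bar u(\cdot),\bar v(\cdot))\colon\mathbb R\to Z_0$ be a bounded full solution of the damped wave equation (see context) with $\sup_{t\in\mathbb R}(\|\bar u(t)\|_{H^1_0}^2+\epsilon\|\bar v(t)\|_{L^2}^2)\le R$, and assume that $\bar u(\cdot)\colon\mathbb R\to H^1_0(\Omega)$ is uniformly continuous with modulus of continuity $\omega(\cdot)$. Then $(\bar u(\cdot),\bar v(\cdot))$ is continuous into $Z_1$, is continuously differentiable into $Z_0$, and for all $t\in\mathbb R$ $$(\partial_t\mid Z_0)(\bar u(t),\bar v(t))=\mathbf B_{\epsilon,0}(\bar u(t),\bar v(t))+(0,(1/\epsilon)\hat f(\bar u(t))).$$ Moreover, there exists a constant $\tilde R_\epsilon>0$ such that $$\sup_{t\in\mathbb R}\big(\|\mathbf A_0\bar u(t)\|_{L^2}^2+\|\bar v(t)\|_{H^1_0}^2+\epsilon\|(\partial_t\mid H_0)\bar v(t)\|_{L^2}^2\big)\le\tilde R_\epsilon .$$ The constant $\tilde R_\epsilon$ depends only on $\epsilon$, on $R$, on $\omega(\cdot)$ and on the constants in the assumptions on the coefficients and on the nonlinearity (i.e. $a_0,a_1,\lambda_1$, the map $\nu\mapsto C_\nu$, $C,\alpha,\gamma$, $\|f(\cdot,0)\|_{L^2}$, $\|\partial_uf(\cdot,0)\|_{L^\infty}$).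
   Context: The equation is $\epsilon u_{tt}+u_t+\beta(x)u-\sum_{ij}(a_{ij}(x)u_{x_j})_{x_i}=f(x,u)$ in $\Omega$, with $u=0$ on $\partial\Omega$. Spaces and operators. $H^1_0(\Omega)$ carries the scalar product $\langle u,v\rangle_{H^1_0}=\int_\Omega A\nabla u\cdot\nabla v\,dx+\int_\Omega\beta uv\,dx$ (equivalent to the usual one), with norm $\|\cdot\|_{H^1_0}$. $\mathbf A$ is the positive selfadjoint operator on $L^2(\Omega)$ defined by this form (i.e. by $u\mapsto\beta u-\sum_{ij}(a_{ij}u_{x_j})_{x_i}$). For $\kappa\ge0$, $H_\kappa:=D(\mathbf A^{\kappa/2})$ with $\langle u,v\rangle_{H_\kappa}=\langle\mathbf A^{\kappa/2}u,\mathbf A^{\kappa/2}v\rangle_{L^2}$, and $H_{-\kappa}$ is the dual of $H_\kappa$ with the dual scalar product; thus $H_0=L^2(\Omega)$, $H_1=H^1_0(\Omega)$, $H_{-1}=H^{-1}(\Omega)$, $H_2=D(\mathbf A)$. $\mathbf A$ induces selfadjoint operators $\mathbf A_\kappa\colon H_{\kappa+2}\to H_\kappa$, $\mathbf A_0=\mathbf A$. $Z_\kappa:=H_{\kappa+1}\times H_\kappa$, and $\mathbf B_{\epsilon,\kappa}\colon Z_{\kappa+1}\to Z_\kappa$, $\mathbf B_{\epsilon,\kappa}(u,v)=(v,-(1/\epsilon)(v+\mathbf A_\kappa u))$, which generates a $C^0$-semigroup $\mathbf T_{\epsilon,\kappa}(t)$, $t\ge0$, on $Z_\kappa$. $\hat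 f(u)(x):=f(x,u(x))$; under the assumptions $\hat f$ maps $H^1_0(\Omega)$ into $L^2(\Omega)$ and is $C^1$. A full solution is a function $(u,v)\colon\mathbb R\to Z_0$ such that for all $s\le t$ in $\mathbb R$ $$(u(t),v(t))=\mathbf T_{\epsilon,0}(t-s)(u(s),v(s))+\int_s^t\mathbf T_{\epsilon,0}(t-p)(0,(1/\epsilon)\hat f(u(p)))\,dp,$$ the integral being taken in $Z_0$. $(\partial_t\mid X)$ denotes the derivative with respect to $t$ of a function regarded as taking values in the normed space $X$. A modulus of continuity for $\bar u$ is a continuous nondecreasing $\omega\colon[0,1]\to[0,\infty[$ with $\omega(0)=0$ and $\|\bar u(t)-\bar u(s)\|_{H^1_0}\le\omega(|t-s|)$ whenever $|t-s|\le1$. *)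

theory Defs
  imports "HOL-Analysis.Analysis"
begin

section \<open>The Hilbert space of square-integrable functions\<close>

definition square_integrable :: "'a measure \<Rightarrow> ('a \<Rightarrow> real) \<Rightarrow> bool" where
  "square_integrable M g \<longleftrightarrow> g \<in> borel_measurable M \<and> integrable M (\<lambda>x. (g x)\<^sup>2)"

lemma square_integrable_zero: "square_integrable M (\<lambda>x. 0)"
  by (simp add: square_integrable_def)

lemma square_integrable_scale:
  "square_integrable M g \<Longrightarrow> square_integrable M (\<lambda>x. c * g x)"
  by (auto simp: square_integrable_def power_mult_distrib)

lemma square_integrable_mult:
  assumes "square_integrable M g" "square_integrable M h"
  shows "integrable M (\<lambda>x. g x * h x)"
proof (rule Bochner_Integration.integrable_bound)
  show "integrable M (\<lambda>x. (g x)\<^sup>2 + (h x)\<^sup>2)"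
    using assms by (simp add: square_integrable_def)
  show "(\<lambda>x. g x * h x) \<in> borel_measurable M"
    using assms by (auto simp: square_integrable_def intro: borel_measurable_times)
  have "\<bar>p * q\<bar> \<le> \<bar>p\<^sup>2 + q\<^sup>2\<bar>" for p q :: real
  proof -
    have "2 * (\<bar>p\<bar> * \<bar>q\<bar>) \<le> \<bar>p\<bar>\<^sup>2 + \<bar>q\<bar>\<^sup>2"
      using sum_squares_bound[of "\<bar>p\<bar>" "\<bar>q\<bar>"] by (simp add: mult.assoc)
    moreover have "0 \<le> \<bar>p\<bar> * \<bar>q\<bar>" by simp
    ultimately have "\<bar>p\<bar> * \<bar>q\<bar> \<le> p\<^sup>2 + q\<^sup>2" unfolding power2_abs by linarith
    then show ?thesis by (simp add: abs_mult)
  qed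
  then show "AE x in M. norm (g x * h x) \<le> norm ((g x)\<^sup>2 + (h x)\<^sup>2)"
    by simp
qed

lemma square_integrable_add:
  assumes "square_integrable M g" "square_integrable M h"
  shows "square_integrable M (\<lambda>x. g x + h x)"
  using assms square_integrable_mult[OF assms]
  by (auto simp: square_integrable_def power2_sum mult.assoc)

quotient_type L2 = "real^3 \<Rightarrow> real" / partial:
  "\<lambda>g h. square_integrable lebesgue g \<and> square_integrable lebesgue h \<and>
         (AE x in lebesgue. g x = h x)"
proof (rule part_equivpI)
  show "\<exists>g. square_integrable lebesgue g \<and> square_integrable lebesgue g \<and>
         (AE x in lebesgue. g x = (g :: real^3 \<Rightarrow> real) x)"
    using square_integrable_zero by blast
  show "symp (\<lambda>g h. square_integrable lebesgue g \<and> square_integrable lebesgue h \<and>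
         (AE x in lebesgue. g x = (h :: real^3 \<Rightarrow> real) x))"
    by (auto intro!: sympI)
  show "transp (\<lambda>g h. square_integrable lebesgue g \<and> square_integrable lebesgue h \<and>
         (AE x in lebesgue. g x = (h :: real^3 \<Rightarrow> real) x))"
    by (auto intro!: transpI)
qed

instantiation L2 :: real_inner
begin

lift_definition zero_L2 :: L2 is "\<lambda>x. 0"
  by (simp add: square_integrable_zero)

lift_definition plus_L2 :: "L2 \<Rightarrow> L2 \<Rightarrow> L2" is "\<lambda>g h x. g x + h x"
  by (auto intro: square_integrable_add)

lift_definition scaleR_L2 :: "real \<Rightarrow> L2 \<Rightarrow> L2" is "\<lambda>c g x. c * g x"
  by (auto intro: square_integrable_scale)

lift_definition inner_L2 :: "L2 \<Rightarrow> L2 \<Rightarrow> real" is "\<lambda>g h. LINT x|lebesgue. g x * h x"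
  by (auto intro!: integral_cong_AE simp: square_integrable_def)

definition "- (u :: L2) = (-1) *\<^sub>R u"
definition "(u :: L2) - v = u + (-1) *\<^sub>R v"
definition "norm (u :: L2) = sqrt (inner u u)"
definition "sgn (u :: L2) = inverse (norm u) *\<^sub>R u"
definition "dist (u :: L2) v = norm (u - v)"
definition [code del]:
  "(uniformity :: (L2 \<times> L2) filter) = (INF e\<in>{0<..}. principal {(u, v). dist u v < e})"
definition [code del]:
  "open (S :: L2 set) \<longleftrightarrow> (\<forall>u\<in>S. \<forall>\<^sub>F (u', v) in uniformity. u' = u \<longrightarrow> v \<in> S)"

instance
proof
  fix u v w :: L2 and a b :: real
  show "u + v + w = u + (v + w)"
    by transfer (auto intro!: square_integrable_add simp: add.assoc)
  show "u + v = v + u"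
    by transfer (auto intro!: square_integrable_add simp: add.commute)
  show "0 + u = u"
    by transfer simp
  show "- u + u = 0"
    unfolding uminus_L2_def
    by transfer (auto intro!: square_integrable_add square_integrable_scale square_integrable_zero
        dest: square_integrable_scale[of _ _ "-1"])
  show "u - v = u + - v"
    unfolding uminus_L2_def minus_L2_def ..
  show "a *\<^sub>R (u + v) = a *\<^sub>R u + a *\<^sub>R v"
    by transfer (auto intro!: square_integrable_add square_integrable_scale simp: distrib_left)
  show "(a + b) *\<^sub>R u = a *\<^sub>R u + b *\<^sub>R u"
    by transfer (auto intro!: square_integrable_add square_integrable_scale simp: distrib_right)
  show "a *\<^sub>R b *\<^sub>R u = (a * b) *\<^sub>R u"
    by transfer (auto intro!: square_integrable_scale simp: mult.assoc)
  show "1 *\<^sub>R u = u"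
    by transfer simp
  show "inner u v = inner v u"
    by transfer (simp add: mult.commute)
  show "inner (u + v) w = inner u w + inner v w"
    by transfer (simp add: distrib_right square_integrable_mult)
  show "inner (a *\<^sub>R u) v = a * inner u v"
    by transfer (simp add: mult.assoc)
  show "0 \<le> inner u u"
    by transfer simp
  show "inner u u = 0 \<longleftrightarrow> u = 0"
  proof transfer
    fix g :: "real^3 \<Rightarrow> real"
    assume "square_integrable lebesgue g \<and> square_integrable lebesgue g \<and>
            (AE x in lebesgue. g x = g x)"
    then have g: "square_integrable lebesgue g" by simp
    then have "integrable lebesgue (\<lambda>x. g x * g x)"
      by (simp add: square_integrable_mult)
    then have "(LINT x|lebesgue. g x * g x) = 0 \<longleftrightarrow> (AE x in lebesgue. g x * g x = 0)"
      by (rule integral_nonneg_eq_0_iff_AE) simp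
    then show "(LINT x|lebesgue. g x * g x) = 0 \<longleftrightarrow>
        (square_integrable lebesgue g \<and> square_integrable lebesgue (\<lambda>x::real^3. 0) \<and>
         (AE x in lebesgue. g x = 0))"
      using g by (simp add: square_integrable_zero)
  qed
  show "norm u = sqrt (inner u u)" by (rule norm_L2_def)
  show "sgn u = inverse (norm u) *\<^sub>R u" by (rule sgn_L2_def)
  show "dist u v = norm (u - v)" by (rule dist_L2_def)
  show "(uniformity :: (L2 \<times> L2) filter) = (INF e\<in>{0<..}. principal {(u, v). dist u v < e})"
    by (rule uniformity_L2_def)
  show "open S \<longleftrightarrow> (\<forall>u\<in>S. \<forall>\<^sub>F (u', v) in uniformity. u' = u \<longrightarrow> v \<in> S)" for S :: "L2 set"
    by (rule open_L2_def)
qed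

end

text \<open>
  \<open>L\<^sup>2(\<Omega>)\<close> is identified, via extension by zero, with the subspace of those classes that vanish
  almost everywhere outside \<open>\<Omega>\<close>.  The function \<open>rep_L2\<close> picks some representative of a class;
  it is only used in ways that do not depend on the choice.  \<open>L2_class \<Omega> g\<close> is the class of the
  zero extension of \<open>g\<close>; it is meaningful only if \<open>g\<close> is square-integrable on \<open>\<Omega>\<close>.
\<close>

definition L2_on :: "(real^3) set \<Rightarrow> L2 set" where
  "L2_on \<Omega> = {u. AE x in lebesgue. x \<notin> \<Omega> \<longrightarrow> rep_L2 u x = 0}"

definition L2_class :: "(real^3) set \<Rightarrow> (real^3 \<Rightarrow> real) \<Rightarrow> L2" where
  "L2_class \<Omega> g = abs_L2 (\<lambda>x. if x \<in> \<Omega> then g x else 0)"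

definition Linf :: "'a measure \<Rightarrow> ('a \<Rightarrow> real) set" where
  "Linf M = {g \<in> borel_measurable M. \<exists>c. AE x in M. \<bar>g x\<bar> \<le> c}"

definition Linf_norm :: "'a measure \<Rightarrow> ('a \<Rightarrow> real) \<Rightarrow> real" where
  "Linf_norm M g = Inf {c. 0 \<le> c \<and> (AE x in M. \<bar>g x\<bar> \<le> c)}"


section \<open>Sobolev spaces\<close>

definition partial_deriv :: "3 \<Rightarrow> (real^3 \<Rightarrow> real) \<Rightarrow> real^3 \<Rightarrow> real" where
  "partial_deriv i \<phi> x = frechet_derivative \<phi> (at x) (axis i 1)"

primrec C_k :: "nat \<Rightarrow> (real^3 \<Rightarrow> real) \<Rightarrow> bool" where
  "C_k 0 \<phi> \<longleftrightarrow> continuous_on UNIV \<phi>"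
| "C_k (Suc k) \<phi> \<longleftrightarrow> (\<forall>x. \<phi> differentiable (at x)) \<and> (\<forall>i. C_k k (partial_deriv i \<phi>))"

definition test_function :: "(real^3) set \<Rightarrow> (real^3 \<Rightarrow> real) \<Rightarrow> bool" where
  "test_function \<Omega> \<phi> \<longleftrightarrow>
     (\<forall>k. C_k k \<phi>) \<and> compact (closure {x. \<phi> x \<noteq> 0}) \<and> closure {x. \<phi> x \<noteq> 0} \<subseteq> \<Omega>"

definition weak_gradient :: "(real^3) set \<Rightarrow> L2 \<Rightarrow> L2^3 \<Rightarrow> bool" where
  "weak_gradient \<Omega> u g \<longleftrightarrow> (\<forall>i. g $ i \<in> L2_on \<Omega>) \<and>
     (\<forall>\<phi> i. test_function \<Omega> \<phi> \<longrightarrow>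
        (LINT x|lebesgue_on \<Omega>. rep_L2 u x * partial_deriv i \<phi> x) =
        - (LINT x|lebesgue_on \<Omega>. rep_L2 (g $ i) x * \<phi> x))"

definition H1 :: "(real^3) set \<Rightarrow> L2 set" where
  "H1 \<Omega> = {u \<in> L2_on \<Omega>. \<exists>g. weak_gradient \<Omega> u g}"

definition grad :: "(real^3) set \<Rightarrow> L2 \<Rightarrow> L2^3" where
  "grad \<Omega> u = (THE g. weak_gradient \<Omega> u g)"

definition grad_at :: "(real^3) set \<Rightarrow> L2 \<Rightarrow> real^3 \<Rightarrow> real^3" where
  "grad_at \<Omega> u x = (\<chi> i. rep_L2 (grad \<Omega> u $ i) x)"

text \<open>\<open>H10 \<Omega>\<close> is the closure of the test functions in \<open>H1 \<Omega>\<close> with respect to the usual norm.\<close>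

definition H10 :: "(real^3) set \<Rightarrow> L2 set" where
  "H10 \<Omega> = {u \<in> H1 \<Omega>. \<exists>\<phi>. (\<forall>n::nat. test_function \<Omega> (\<phi> n)) \<and>
     (\<lambda>n. L2_class \<Omega> (\<phi> n)) \<longlonglongrightarrow> u \<and>
     (\<lambda>n. grad \<Omega> (L2_class \<Omega> (\<phi> n))) \<longlonglongrightarrow> grad \<Omega> u}"


section \<open>Vector-valued calculus with respect to a given norm\<close>

text \<open>
  The spaces of the scale carry norms that depend on the coefficients, so a normed space is
  represented by its carrier and its norm.
\<close>

type_synonym 'a nspace = "'a set \<times> ('a \<Rightarrow> real)"

definition prod_nspace :: "'a nspace \<Rightarrow> 'b nspace \<Rightarrow> ('a \<times> 'b) nspace" where
  "prod_nspace X Y = (fst X \<times> fst Y, \<lambda>(u, v). sqrt ((snd X u)\<^sup>2 + (snd Y v)\<^sup>2))"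

definition continuous_into :: "'a::real_vector nspace \<Rightarrow> (real \<Rightarrow> 'a) \<Rightarrow> bool" where
  "continuous_into X F \<longleftrightarrow> (\<forall>t. F t \<in> fst X) \<and> (\<forall>t. ((\<lambda>s. snd X (F s - F t)) \<longlongrightarrow> 0) (at t))"

definition has_deriv_into ::
    "'a::real_vector nspace \<Rightarrow> (real \<Rightarrow> 'a) \<Rightarrow> 'a \<Rightarrow> real \<Rightarrow> bool" where
  "has_deriv_into X F D t \<longleftrightarrow> (\<forall>s. F s \<in> fst X) \<and> D \<in> fst X \<and>
     ((\<lambda>h. snd X ((1 / h) *\<^sub>R (F (t + h) - F t) - D)) \<longlongrightarrow> 0) (at 0)"

text \<open>
  The definition of the integral over a compact interval from the library
  (\<open>has_integral_real\<close>), with the norm of \<open>X\<close> in place of the norm of the type.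
\<close>

definition has_integral_into ::
    "'a::real_vector nspace \<Rightarrow> (real \<Rightarrow> 'a) \<Rightarrow> 'a \<Rightarrow> real \<Rightarrow> real \<Rightarrow> bool" where
  "has_integral_into X g I a b \<longleftrightarrow> (\<forall>p\<in>{a..b}. g p \<in> fst X) \<and> I \<in> fst X \<and>
     (\<forall>e>0. \<exists>\<delta>. gauge \<delta> \<and> (\<forall>\<D>. \<D> tagged_division_of {a..b} \<and> \<delta> fine \<D> \<longrightarrow>
        snd X ((\<Sum>(p, K)\<in>\<D>. measure lborel K *\<^sub>R g p) - I) < e))"

definition C0_semigroup :: "'a::real_vector nspace \<Rightarrow> (real \<Rightarrow> 'a \<Rightarrow> 'a) \<Rightarrow> bool" where
  "C0_semigroup X T \<longleftrightarrow>
     (\<forall>t\<ge>0. (\<forall>x\<in>fst X. T t x \<in> fst X) \<and>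
        (\<forall>x\<in>fst X. \<forall>y\<in>fst X. T t (x + y) = T t x + T t y) \<and>
        (\<forall>c. \<forall>x\<in>fst X. T t (c *\<^sub>R x) = c *\<^sub>R T t x) \<and>
        (\<exists>M. \<forall>x\<in>fst X. snd X (T t x) \<le> M * snd X x)) \<and>
     (\<forall>x\<in>fst X. T 0 x = x) \<and>
     (\<forall>s\<ge>0. \<forall>t\<ge>0. \<forall>x\<in>fst X. T (s + t) x = T s (T t x)) \<and>
     (\<forall>x\<in>fst X. ((\<lambda>h. snd X (T h x - x)) \<longlongrightarrow> 0) (at_right 0))"

text \<open>The infinitesimal generator of \<open>T\<close> on \<open>X\<close> is exactly \<open>B\<close>, with domain \<open>D\<close>.\<close>

definition generates ::
    "'a::real_vector nspace \<Rightarrow> 'a set \<Rightarrow> ('a \<Rightarrow> 'a) \<Rightarrow> (real \<Rightarrow> 'a \<Rightarrow> 'a) \<Rightarrow> bool" where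
  "generates X D B T \<longleftrightarrow> C0_semigroup X T \<and>
     (\<forall>x\<in>fst X. \<forall>y\<in>fst X.
        ((\<lambda>h. snd X ((1 / h) *\<^sub>R (T h x - x) - y)) \<longlongrightarrow> 0) (at_right 0) \<longleftrightarrow> x \<in> D \<and> y = B x)"


section \<open>The elliptic operator and the damped wave equation\<close>

definition H10_inner ::
    "(real^3) set \<Rightarrow> (real^3 \<Rightarrow> real^3^3) \<Rightarrow> (real^3 \<Rightarrow> real) \<Rightarrow> L2 \<Rightarrow> L2 \<Rightarrow> real" where
  "H10_inner \<Omega> A \<beta> u v =
     (LINT x|lebesgue_on \<Omega>. (A x *v grad_at \<Omega> u x) \<bullet> grad_at \<Omega> v x) +
     (LINT x|lebesgue_on \<Omega>. \<beta> x * rep_L2 u x * rep_L2 v x)"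

definition H10_norm ::
    "(real^3) set \<Rightarrow> (real^3 \<Rightarrow> real^3^3) \<Rightarrow> (real^3 \<Rightarrow> real) \<Rightarrow> L2 \<Rightarrow> real" where
  "H10_norm \<Omega> A \<beta> u = sqrt (H10_inner \<Omega> A \<beta> u u)"

text \<open>
  The selfadjoint operator in \<open>L\<^sup>2(\<Omega>)\<close> associated with the form \<open>H10_inner\<close>, with its domain.
\<close>

definition dom_A :: "(real^3) set \<Rightarrow> (real^3 \<Rightarrow> real^3^3) \<Rightarrow> (real^3 \<Rightarrow> real) \<Rightarrow> L2 set" where
  "dom_A \<Omega> A \<beta> =
     {u \<in> H10 \<Omega>. \<exists>w\<in>L2_on \<Omega>. \<forall>v\<in>H10 \<Omega>. H10_inner \<Omega> A \<beta> u v = w \<bullet> v}"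

definition op_A :: "(real^3) set \<Rightarrow> (real^3 \<Rightarrow> real^3^3) \<Rightarrow> (real^3 \<Rightarrow> real) \<Rightarrow> L2 \<Rightarrow> L2" where
  "op_A \<Omega> A \<beta> u = (THE w. w \<in> L2_on \<Omega> \<and> (\<forall>v\<in>H10 \<Omega>. H10_inner \<Omega> A \<beta> u v = w \<bullet> v))"

text \<open>
  The members \<open>H\<^sub>0 = L\<^sup>2(\<Omega>)\<close>, \<open>H\<^sub>1 = H\<^sup>1\<^sub>0(\<Omega>)\<close> and \<open>H\<^sub>2 = D(A)\<close> of the scale, with their norms
  \<open>\<parallel>u\<parallel>\<close>, \<open>\<parallel>A\<^bsup>1/2\<^esup> u\<parallel> = \<langle>u, u\<rangle>\<^bsup>1/2\<^esup>\<close> (the form norm) and \<open>\<parallel>A u\<parallel>\<close>.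
\<close>

definition Hs0 :: "(real^3) set \<Rightarrow> L2 nspace" where
  "Hs0 \<Omega> = (L2_on \<Omega>, norm)"

definition Hs1 :: "(real^3) set \<Rightarrow> (real^3 \<Rightarrow> real^3^3) \<Rightarrow> (real^3 \<Rightarrow> real) \<Rightarrow> L2 nspace" where
  "Hs1 \<Omega> A \<beta> = (H10 \<Omega>, H10_norm \<Omega> A \<beta>)"

definition Hs2 :: "(real^3) set \<Rightarrow> (real^3 \<Rightarrow> real^3^3) \<Rightarrow> (real^3 \<Rightarrow> real) \<Rightarrow> L2 nspace" where
  "Hs2 \<Omega> A \<beta> = (dom_A \<Omega> A \<beta>, \<lambda>u. norm (op_A \<Omega> A \<beta> u))"

definition Z0 ::
    "(real^3) set \<Rightarrow> (real^3 \<Rightarrow> real^3^3) \<Rightarrow> (real^3 \<Rightarrow> real) \<Rightarrow> (L2 \<times> L2) nspace" where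
  "Z0 \<Omega> A \<beta> = prod_nspace (Hs1 \<Omega> A \<beta>) (Hs0 \<Omega>)"

definition Z1 ::
    "(real^3) set \<Rightarrow> (real^3 \<Rightarrow> real^3^3) \<Rightarrow> (real^3 \<Rightarrow> real) \<Rightarrow> (L2 \<times> L2) nspace" where
  "Z1 \<Omega> A \<beta> = prod_nspace (Hs2 \<Omega> A \<beta>) (Hs1 \<Omega> A \<beta>)"

definition op_B ::
    "(real^3) set \<Rightarrow> (real^3 \<Rightarrow> real^3^3) \<Rightarrow> (real^3 \<Rightarrow> real) \<Rightarrow> real \<Rightarrow> L2 \<times> L2 \<Rightarrow> L2 \<times> L2" where
  "op_B \<Omega> A \<beta> \<epsilon> = (\<lambda>(u, v). (v, - ((1 / \<epsilon>) *\<^sub>R (v + op_A \<Omega> A \<beta> u))))"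

text \<open>\<open>T\<close> is the (unique) \<open>C\<^sub>0\<close>-semigroup on \<open>Z0\<close> generated by \<open>op_B\<close> with domain \<open>Z1\<close>.\<close>

definition wave_semigroup ::
    "(real^3) set \<Rightarrow> (real^3 \<Rightarrow> real^3^3) \<Rightarrow> (real^3 \<Rightarrow> real) \<Rightarrow> real \<Rightarrow>
     (real \<Rightarrow> L2 \<times> L2 \<Rightarrow> L2 \<times> L2) \<Rightarrow> bool" where
  "wave_semigroup \<Omega> A \<beta> \<epsilon> T \<longleftrightarrow> generates (Z0 \<Omega> A \<beta>) (fst (Z1 \<Omega> A \<beta>)) (op_B \<Omega> A \<beta> \<epsilon>) T"

definition nemytskii :: "(real^3) set \<Rightarrow> (real^3 \<Rightarrow> real \<Rightarrow> real) \<Rightarrow> L2 \<Rightarrow> L2" where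
  "nemytskii \<Omega> f u = L2_class \<Omega> (\<lambda>x. f x (rep_L2 u x))"

definition full_solution ::
    "(real^3) set \<Rightarrow> (real^3 \<Rightarrow> real^3^3) \<Rightarrow> (real^3 \<Rightarrow> real) \<Rightarrow> (real^3 \<Rightarrow> real \<Rightarrow> real) \<Rightarrow> real \<Rightarrow>
     (real \<Rightarrow> L2 \<times> L2 \<Rightarrow> L2 \<times> L2) \<Rightarrow> (real \<Rightarrow> L2) \<Rightarrow> (real \<Rightarrow> L2) \<Rightarrow> bool" where
  "full_solution \<Omega> A \<beta> f \<epsilon> T u v \<longleftrightarrow>
     (\<forall>t. (u t, v t) \<in> fst (Z0 \<Omega> A \<beta>)) \<and>
     (\<forall>s t. s \<le> t \<longrightarrow>
        (\<exists>I. has_integral_into (Z0 \<Omega> A \<beta>)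
               (\<lambda>p. T (t - p) (0, (1 / \<epsilon>) *\<^sub>R nemytskii \<Omega> f (u p))) I s t \<and>
             (u t, v t) = T (t - s) (u s, v s) + I))"

definition coefficient_assms ::
    "(real^3) set \<Rightarrow> real \<Rightarrow> real \<Rightarrow> real \<Rightarrow> (real \<Rightarrow> real) \<Rightarrow>
     (real^3 \<Rightarrow> real^3^3) \<Rightarrow> (real^3 \<Rightarrow> real) \<Rightarrow> bool" where
  "coefficient_assms \<Omega> a0 a1 lambda1 Cnu A \<beta> \<longleftrightarrow>
     (\<forall>i j. (\<lambda>x. A x $ i $ j) \<in> Linf (lebesgue_on \<Omega>)) \<and>
     (AE x in lebesgue_on \<Omega>. \<forall>i j. A x $ i $ j = A x $ j $ i) \<and>
     (AE x in lebesgue_on \<Omega>. \<forall>\<xi>. a0 * (norm \<xi>)\<^sup>2 \<le> (\<Sum>i\<in>UNIV. \<Sum>j\<in>UNIV. A x $ i $ j * \<xi> $ i * \<xi> $ j) \<and>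
        (\<Sum>i\<in>UNIV. \<Sum>j\<in>UNIV. A x $ i $ j * \<xi> $ i * \<xi> $ j) \<le> a1 * (norm \<xi>)\<^sup>2) \<and>
     \<beta> \<in> borel_measurable (lebesgue_on \<Omega>) \<and>
     (\<forall>\<nu>>0. \<forall>u\<in>H10 \<Omega>.
        (\<integral>\<^sup>+ x. ennreal (\<bar>\<beta> x\<bar> * (rep_L2 u x)\<^sup>2) \<partial>lebesgue_on \<Omega>) \<le>
        ennreal (\<nu> * (LINT x|lebesgue_on \<Omega>. (norm (grad_at \<Omega> u x))\<^sup>2) +
                 Cnu \<nu> * (LINT x|lebesgue_on \<Omega>. (rep_L2 u x)\<^sup>2))) \<and>
     (\<forall>u\<in>H10 \<Omega>.
        (LINT x|lebesgue_on \<Omega>. (A x *v grad_at \<Omega> u x) \<bullet> grad_at \<Omega> u x) +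
        (LINT x|lebesgue_on \<Omega>. \<beta> x * (rep_L2 u x)\<^sup>2) \<ge>
        lambda1 * (LINT x|lebesgue_on \<Omega>. (rep_L2 u x)\<^sup>2))"

definition nonlinearity_assms ::
    "(real^3) set \<Rightarrow> real \<Rightarrow> real \<Rightarrow> real \<Rightarrow> (real^3 \<Rightarrow> real \<Rightarrow> real) \<Rightarrow> bool" where
  "nonlinearity_assms \<Omega> C \<alpha> \<gamma> f \<longleftrightarrow>
     (\<forall>r. (\<lambda>x. f x r) \<in> borel_measurable (lebesgue_on \<Omega>)) \<and>
     square_integrable (lebesgue_on \<Omega>) (\<lambda>x. f x 0) \<and>
     (AE x in lebesgue_on \<Omega>. f x C1_differentiable_on UNIV) \<and>
     (\<lambda>x. deriv (f x) 0) \<in> Linf (lebesgue_on \<Omega>) \<and>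
     (AE x in lebesgue_on \<Omega>. \<forall>r1 r2. \<bar>deriv (f x) r1 - deriv (f x) r2\<bar> \<le>
        C * (1 + \<bar>r1\<bar> powr \<alpha> + \<bar>r2\<bar> powr \<alpha>) * \<bar>r1 - r2\<bar> powr \<gamma>)"

definition modulus_function :: "(real \<Rightarrow> real) \<Rightarrow> bool" where
  "modulus_function \<omega> \<longleftrightarrow>
     continuous_on {0..1} \<omega> \<and> mono_on {0..1} \<omega> \<and> \<omega> 0 = 0 \<and> (\<forall>r\<in>{0..1}. 0 \<le> \<omega> r)"

definition has_modulus ::
    "(L2 \<Rightarrow> real) \<Rightarrow> (real \<Rightarrow> real) \<Rightarrow> (real \<Rightarrow> L2) \<Rightarrow> bool" where
  "has_modulus N \<omega> u \<longleftrightarrow> (\<forall>t s. \<bar>t - s\<bar> \<le> 1 \<longrightarrow> N (u t - u s) \<le> \<omega> \<bar>t - s\<bar>)"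

end

theory Submission
  imports Defs
begin

text \<open>A difference quotient of \<open>(u, v)\<close> is a bounded mild solution of the linear damped wave equation; as the
  semigroup decays exponentially, it is controlled by its forcing, the difference quotient of \<open>f(u)\<close>.  The
  growth of \<open>f\<close> being critical, that forcing is only bounded by the norm of \<open>u\<^sup>2 w\<close> in \<open>L2\<close>, where \<open>w\<close> is
  the difference quotient of \<open>u\<close>.  Now the mean of \<open>u\<close> over \<open>[t, t + \<eta>]\<close> solves an elliptic equation whose
  right-hand side is bounded in \<open>L2\<close>, and so it is bounded in \<open>L\<^sup>1\<^sup>8\<close>, while the modulus of continuity makes
  it close to \<open>u(t)\<close> in \<open>H10\<close>.  Hence the square of the norm of \<open>u\<^sup>2 w\<close> is at most \<open>\<delta> \<parallel>\<nabla>w\<parallel>\<^sup>2 + C(\<delta>) \<parallel>w\<parallel>\<^sup>2\<close>,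
  uniformly in time.  The first term is absorbed, and \<open>\<parallel>w\<parallel>\<close> is bounded because \<open>v\<close> is bounded in \<open>L2\<close>.
  This bounds the quotients in \<open>Z0\<close>.  The same argument for the difference of two quotients, with
  \<open>\<parallel>w - v(t)\<parallel> = O(h)\<close>, shows that they are uniformly Cauchy, so \<open>(u, v)\<close> is differentiable in \<open>Z0\<close>, and the
  equation expresses \<open>A u\<close> through bounded quantities.\<close>

section \<open>Square-integrable functions\<close>

text \<open>The obstacle is that \<open>f\<close> grows like \<open>u^3\<close> while in dimension
  three \<open>H10\<close> embeds into \<open>L^6\<close> and no further: the superposition maps
  \<open>H10\<close> to \<open>L2\<close> with nothing to spare, and the wave semigroup does not
  smooth. Sobolev alone bounds the forcing by a fixed multiple of the quotient, which cannot be
  absorbed. Averaging in time supplies the small factor, because the time integral of a mild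
  solution lies in the domain of the generator. Since \<Omega> is arbitrary and the coefficients are
  merely bounded and measurable, \<open>D(A)\<close> gives no second derivatives; testing the
  elliptic equation with a regularised \<open>u^5\<close> controls the gradient of
  \<open>u^3\<close>, whence 18 = 3 * 6. Any exponent above 6 would serve the truncation that
  follows. Absorption requires a finite supremum over all times, so the linear estimates concern
  solutions bounded on the whole line: no initial value enters, and a preliminary bound that blows
  up with the step size is good enough. All constants, including the averaging length, are built
  from the a priori data alone, which yields the uniformity of the final bound.\<close>

lemma square_integrable_rep_L2: "square_integrable lebesgue (rep_L2 u)"
  using Quotient3_rep_reflp[OF Quotient3_L2] by blast

lemma rep_L2_measurable [measurable]: "rep_L2 u \<in> borel_measurable lebesgue"
  using square_integrable_rep_L2 by (auto simp: square_integrable_def)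

lemma rep_L2_integrable_square: "integrable lebesgue (\<lambda>x. (rep_L2 u x)\<^sup>2)"
  using square_integrable_rep_L2 by (auto simp: square_integrable_def)

lemma rep_abs_L2: "square_integrable lebesgue g \<Longrightarrow> AE x in lebesgue. rep_L2 (abs_L2 g) x = g x"
  using Quotient3_rep_abs[OF Quotient3_L2, of g] by blast

lemma L2_eqI: "AE x in lebesgue. rep_L2 u x = rep_L2 v x \<Longrightarrow> u = v"
  using Quotient3_rel_rep[OF Quotient3_L2, of u v] square_integrable_rep_L2 by blast

lemma square_integrable_diff:
  "square_integrable M g \<Longrightarrow> square_integrable M h \<Longrightarrow> square_integrable M (\<lambda>x. g x - h x)"
  using square_integrable_add[of M g "\<lambda>x. (-1) * h x"] square_integrable_scale[of M h "-1"] by simp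

lemma rep_L2_add: "AE x in lebesgue. rep_L2 (u + v) x = rep_L2 u x + rep_L2 v x"
  unfolding plus_L2_def map_fun_def o_def id_def
  by (rule rep_abs_L2) (intro square_integrable_add square_integrable_rep_L2)

lemma rep_L2_scaleR: "AE x in lebesgue. rep_L2 (c *\<^sub>R u) x = c * rep_L2 u x"
  unfolding scaleR_L2_def map_fun_def o_def id_def
  by (rule rep_abs_L2) (intro square_integrable_scale square_integrable_rep_L2)

lemma rep_L2_zero: "AE x in lebesgue. rep_L2 0 x = 0"
  unfolding zero_L2_def by (rule rep_abs_L2) (rule square_integrable_zero)

lemma rep_L2_diff: "AE x in lebesgue. rep_L2 (u - v) x = rep_L2 u x - rep_L2 v x"
  unfolding minus_L2_def using rep_L2_add[of u "(-1) *\<^sub>R v"] rep_L2_scaleR[of "-1" v] by eventually_elim simp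

lemma inner_L2: "u \<bullet> v = (LINT x|lebesgue. rep_L2 u x * rep_L2 v x)"
  unfolding inner_L2_def by simp

lemma integrable_rep_L2_mult: "integrable lebesgue (\<lambda>x. rep_L2 u x * rep_L2 v x)"
  by (intro square_integrable_mult square_integrable_rep_L2)

lemma norm_L2_square: "(norm (u::L2))\<^sup>2 = (LINT x|lebesgue. (rep_L2 u x)\<^sup>2)"
  using power2_norm_eq_inner[of u] unfolding inner_L2 by (simp add: power2_eq_square)

lemma nn_norm_L2: "(\<integral>\<^sup>+ x. ennreal ((rep_L2 u x)\<^sup>2) \<partial>lebesgue) = ennreal ((norm u)\<^sup>2)"
  unfolding norm_L2_square by (rule nn_integral_eq_integral[OF rep_L2_integrable_square]) simp

lemma square_integrable_nn:
  assumes "g \<in> borel_measurable M" "(\<integral>\<^sup>+ x. ennreal ((g x)\<^sup>2) \<partial>M) < \<infinity>"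
  shows "square_integrable M g"
  unfolding square_integrable_def using assms by (auto intro!: integrableI_nonneg)

lemma nn_norm_diff_L2:
  "(\<integral>\<^sup>+ x. ennreal ((rep_L2 u x - rep_L2 v x)\<^sup>2) \<partial>lebesgue) = ennreal ((norm (u - v))\<^sup>2)"
  unfolding nn_norm_L2[symmetric] using rep_L2_diff[of u v] by (intro nn_integral_cong_AE) auto

section \<open>Fatou's lemma and completeness of \<open>L2\<close>\<close>

lemma Fatou_LIMSEQ:
  fixes f :: "nat \<Rightarrow> 'a \<Rightarrow> real"
  assumes f: "\<And>n. f n \<in> borel_measurable M" and lim: "AE x in M. (\<lambda>n. f n x) \<longlonglongrightarrow> g x"
    and bound: "\<forall>\<^sub>F n in sequentially. (\<integral>\<^sup>+ x. ennreal (f n x) \<partial>M) \<le> C n" and C: "C \<longlonglongrightarrow> c"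
  shows "(\<integral>\<^sup>+ x. ennreal (g x) \<partial>M) \<le> c"
proof -
  have "(\<integral>\<^sup>+ x. ennreal (g x) \<partial>M) = (\<integral>\<^sup>+ x. liminf (\<lambda>n. ennreal (f n x)) \<partial>M)"
    using lim by (intro nn_integral_cong_AE) (auto elim!: eventually_mono
        intro!: lim_imp_Liminf[symmetric] tendsto_ennrealI)
  also have "\<dots> \<le> liminf (\<lambda>n. \<integral>\<^sup>+ x. ennreal (f n x) \<partial>M)"
    using f by (intro nn_integral_liminf) auto
  also have "\<dots> \<le> liminf C"
    by (rule Liminf_mono) (rule bound)
  also have "\<dots> = c" using C by (intro lim_imp_Liminf) auto
  finally show ?thesis .
qed

lemma Fatou_LIMSEQ_const:
  fixes f :: "nat \<Rightarrow> 'a \<Rightarrow> real"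
  assumes f: "\<And>n. f n \<in> borel_measurable M" and lim: "AE x in M. (\<lambda>n. f n x) \<longlonglongrightarrow> g x"
    and bound: "\<forall>\<^sub>F n in sequentially. (\<integral>\<^sup>+ x. ennreal (f n x) \<partial>M) \<le> c"
  shows "(\<integral>\<^sup>+ x. ennreal (g x) \<partial>M) \<le> c"
  by (rule Fatou_LIMSEQ[OF f lim bound]) simp

lemma Cauchy_fast_subseq:
  fixes X :: "nat \<Rightarrow> 'a::real_normed_vector"
  assumes "Cauchy X"
  obtains r :: "nat \<Rightarrow> nat" where "strict_mono r" "\<And>k. norm (X (r (Suc k)) - X (r k)) \<le> (1/2) ^ k"
proof -
  have "\<exists>N. \<forall>m\<ge>N. \<forall>n\<ge>N. norm (X m - X n) < (1/2) ^ k" for k :: nat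
    using assms unfolding Cauchy_iff by auto
  then obtain N where N: "\<And>k m n. m \<ge> N k \<Longrightarrow> n \<ge> N k \<Longrightarrow> norm (X m - X n) < (1/2) ^ k" by metis
  define r where "r = rec_nat (N 0) (\<lambda>k m. max (N (Suc k)) (Suc m))"
  have r: "r 0 = N 0" "r (Suc k) = max (N (Suc k)) (Suc (r k))" for k by (auto simp: r_def)
  have mono: "strict_mono r" by (rule strict_mono_Suc_iff[THEN iffD2]) (auto simp: r less_max_iff_disj)
  have "N k \<le> r k" for k by (cases k) (auto simp: r)
  moreover have "r k \<le> r (Suc k)" for k using mono by (simp add: strict_mono_less_eq)
  ultimately have "norm (X (r (Suc k)) - X (r k)) \<le> (1/2) ^ k" for k
    using N[of k "r (Suc k)" "r k"] by (meson less_imp_le order_trans)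
  then show thesis using mono that by blast
qed

text \<open>The weights \<open>2^k\<close> do the work: the squared increments have integrals at
  most \<open>4^(-k)\<close>, so the weighted series still has a finite integral and is finite
  almost everywhere. At such a point the \<open>k\<close>-th increment is at most a constant times
  \<open>2^(-k/2)\<close>, and the sequence telescopes along a geometric series.\<close>

lemma fast_subseq_convergent_AE:
  assumes fast: "\<And>k. norm (X (Suc k) - X k) \<le> (1/2) ^ k"
  shows "AE x in lebesgue. convergent (\<lambda>k. rep_L2 (X k) x)"
proof -
  define d where "d k x = rep_L2 (X (Suc k)) x - rep_L2 (X k) x" for k x
  have [measurable]: "d k \<in> borel_measurable lebesgue" for k unfolding d_def by measurable
  have "(\<integral>\<^sup>+ x. (\<Sum>k. ennreal (2 ^ k * (d k x)\<^sup>2)) \<partial>lebesgue) = (\<Sum>k. \<integral>\<^sup>+ x. ennreal (2 ^ k * (d k x)\<^sup>2) \<partial>lebesgue)"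
    by (rule nn_integral_suminf) measurable
  also have "\<dots> \<le> (\<Sum>k. ennreal ((1/2) ^ k))"
  proof (intro suminf_le summableI)
    fix k
    have "(\<integral>\<^sup>+ x. ennreal (2 ^ k * (d k x)\<^sup>2) \<partial>lebesgue) = ennreal (2 ^ k) * (\<integral>\<^sup>+ x. ennreal ((d k x)\<^sup>2) \<partial>lebesgue)"
      by (subst nn_integral_cmult[symmetric]) (auto simp: ennreal_mult)
    also have "\<dots> = ennreal (2 ^ k * (norm (X (Suc k) - X k))\<^sup>2)"
      unfolding d_def nn_norm_diff_L2 by (simp add: ennreal_mult)
    also have "\<dots> \<le> ennreal (2 ^ k * ((1/2) ^ k)\<^sup>2)"
      using fast[of k] by (intro ennreal_leI mult_left_mono power_mono) auto
    also have "2 ^ k * ((1/2::real) ^ k)\<^sup>2 = (1/2) ^ k"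
      by (simp add: power2_eq_square power_divide)
    finally show "(\<integral>\<^sup>+ x. ennreal (2 ^ k * (d k x)\<^sup>2) \<partial>lebesgue) \<le> ennreal ((1/2) ^ k)" .
  qed
  also have "\<dots> < \<infinity>"
    by (subst suminf_ennreal2) (auto simp: summable_geometric)
  finally have "(\<integral>\<^sup>+ x. (\<Sum>k. ennreal (2 ^ k * (d k x)\<^sup>2)) \<partial>lebesgue) \<noteq> \<infinity>" by simp
  then have "AE x in lebesgue. (\<Sum>k. ennreal (2 ^ k * (d k x)\<^sup>2)) \<noteq> \<infinity>"
    by (intro nn_integral_PInf_AE) measurable
  then show ?thesis
  proof eventually_elim
    case (elim x)
    define c where "c = enn2real (\<Sum>k. ennreal (2 ^ k * (d k x)\<^sup>2))"
    have c: "(\<Sum>k. ennreal (2 ^ k * (d k x)\<^sup>2)) = ennreal c" "0 \<le> c"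
      using elim unfolding c_def by (simp_all only: ennreal_enn2real_if infinity_ennreal_def if_False enn2real_nonneg)
    have "norm (d k x) \<le> sqrt c * (1 / sqrt 2) ^ k" for k
    proof -
      have "(\<Sum>j\<in>{k}. ennreal (2 ^ j * (d j x)\<^sup>2)) \<le> (\<Sum>j. ennreal (2 ^ j * (d j x)\<^sup>2))"
        by (rule sum_le_suminf) (auto intro: summableI)
      then have "ennreal (2 ^ k * (d k x)\<^sup>2) \<le> ennreal c"
        by (simp only: c(1) sum.insert sum.empty finite.emptyI empty_iff not_False_eq_True add_0_right)
      then have "2 ^ k * (d k x)\<^sup>2 \<le> c" using c(2) by (simp add: ennreal_le_iff)
      then have "(d k x)\<^sup>2 \<le> c / 2 ^ k" by (simp add: field_simps)
      then have "sqrt ((d k x)\<^sup>2) \<le> sqrt (c / 2 ^ k)" by (rule real_sqrt_le_mono)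
      then have "\<bar>d k x\<bar> \<le> sqrt (c / 2 ^ k)" by (simp only: real_sqrt_abs)
      then show ?thesis by (simp add: real_sqrt_divide real_sqrt_power power_divide)
    qed
    then have "summable (\<lambda>k. d k x)"
      by (intro summable_comparison_test'[OF summable_mult[OF summable_geometric], of "1 / sqrt 2" 0 _ "sqrt c"]) auto
    then have "convergent (\<lambda>n. \<Sum>k<n. d k x)" by (simp add: summable_iff_convergent)
    moreover have "(\<lambda>n. \<Sum>k<n. d k x) = (\<lambda>n. rep_L2 (X n) x - rep_L2 (X 0) x)"
      unfolding d_def by (rule ext) (rule sum_lessThan_telescope[of "\<lambda>k. rep_L2 (X k) x"])
    ultimately have "convergent (\<lambda>n. (rep_L2 (X n) x - rep_L2 (X 0) x) + rep_L2 (X 0) x)"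
      by (intro convergent_add convergent_const) simp
    then show ?case by simp
  qed
qed

text \<open>Riesz-Fischer: a fast subsequence converges almost everywhere, and Fatou applied to its
  differences with a fixed \<open>X j\<close> shows that the pointwise limit is close to every late
  \<open>X j\<close>. Hence the full sequence converges, with no separate return from the
  subsequence. Completeness is what the uniform boundedness principle and the calculus of
  Banach-valued functions rest on below.\<close>

instance L2 :: banach
proof
  fix X :: "nat \<Rightarrow> L2" assume X: "Cauchy X"
  obtain r where r: "strict_mono r" "\<And>k. norm (X (r (Suc k)) - X (r k)) \<le> (1/2) ^ k"
    using Cauchy_fast_subseq[OF X] by blast
  define g where "g x = lim (\<lambda>k. rep_L2 (X (r k)) x)" for x
  have [measurable]: "g \<in> borel_measurable lebesgue" unfolding g_def by measurable
  have lim: "AE x in lebesgue. (\<lambda>k. rep_L2 (X (r k)) x) \<longlonglongrightarrow> g x"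
    using fast_subseq_convergent_AE[of "\<lambda>k. X (r k)"] r(2) by (auto simp: g_def convergent_LIMSEQ_iff)
  have close: "\<exists>N. \<forall>j\<ge>N. (\<integral>\<^sup>+ x. ennreal ((g x - rep_L2 (X j) x)\<^sup>2) \<partial>lebesgue) \<le> ennreal (e\<^sup>2)" if e: "0 < e" for e
  proof -
    obtain N where N: "\<And>m n. m \<ge> N \<Longrightarrow> n \<ge> N \<Longrightarrow> norm (X m - X n) < e"
      using X e unfolding Cauchy_iff by blast
    have "(\<integral>\<^sup>+ x. ennreal ((g x - rep_L2 (X j) x)\<^sup>2) \<partial>lebesgue) \<le> ennreal (e\<^sup>2)" if j: "j \<ge> N" for j
    proof (rule Fatou_LIMSEQ_const)
      show "AE x in lebesgue. (\<lambda>n. (rep_L2 (X (r n)) x - rep_L2 (X j) x)\<^sup>2) \<longlonglongrightarrow> (g x - rep_L2 (X j) x)\<^sup>2"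
        using lim by eventually_elim (intro tendsto_intros)
      show "\<forall>\<^sub>F n in sequentially. (\<integral>\<^sup>+ x. ennreal ((rep_L2 (X (r n)) x - rep_L2 (X j) x)\<^sup>2) \<partial>lebesgue) \<le> ennreal (e\<^sup>2)"
        using eventually_ge_at_top[of N]
      proof eventually_elim
        case (elim n)
        then have "norm (X (r n) - X j) \<le> e"
          using N[of "r n" j] seq_suble[OF r(1), of n] j by (meson less_imp_le order_trans)
        then show ?case unfolding nn_norm_diff_L2 using e by (intro ennreal_leI power_mono) auto
      qed
    qed measurable
    then show ?thesis by blast
  qed
  have sq: "square_integrable lebesgue (\<lambda>x. g x - rep_L2 (X j) x)" if "(\<integral>\<^sup>+ x. ennreal ((g x - rep_L2 (X j) x)\<^sup>2) \<partial>lebesgue) \<le> ennreal (e\<^sup>2)" for j e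
    using that by (intro square_integrable_nn) (auto intro: le_less_trans)
  \<comment> \<open>The limit inherits square integrability from one single difference
    \<open>g - X j\<close>.\<close>
  obtain j where "square_integrable lebesgue (\<lambda>x. g x - rep_L2 (X j) x)" using close[of 1] sq[of _ 1] by auto
  from square_integrable_add[OF this square_integrable_rep_L2[of "X j"]]
  have g: "square_integrable lebesgue g" by simp
  have eq: "(\<integral>\<^sup>+ x. ennreal ((g x - rep_L2 (X j) x)\<^sup>2) \<partial>lebesgue) = ennreal ((norm (abs_L2 g - X j))\<^sup>2)" for j
    unfolding nn_norm_diff_L2[symmetric] using rep_abs_L2[OF g] by (intro nn_integral_cong_AE) auto
  have "X \<longlonglongrightarrow> abs_L2 g"
  proof (rule LIMSEQ_I)
    fix e :: real assume e: "0 < e"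
    obtain N where N: "\<And>j. j \<ge> N \<Longrightarrow> (norm (abs_L2 g - X j))\<^sup>2 \<le> (e / 2)\<^sup>2"
      using close[of "e / 2"] e unfolding eq by (auto simp: ennreal_le_iff)
    have "norm (X j - abs_L2 g) < e" if "j \<ge> N" for j
    proof -
      have "norm (abs_L2 g - X j) \<le> e / 2" 
        by (rule power2_le_imp_le[OF N[OF that]]) (use e in simp)
      then show ?thesis using e by (simp add: norm_minus_commute)
    qed
    then show "\<exists>N. \<forall>n\<ge>N. norm (X n - abs_L2 g) < e" by blast
  qed
  then show "convergent X" by (rule convergentI)
qed

lemma L2_tendsto_AE_subseq:
  assumes "X \<longlonglongrightarrow> u"
  obtains r :: "nat \<Rightarrow> nat" where "strict_mono r" "AE x in lebesgue. (\<lambda>n. rep_L2 (X (r n)) x) \<longlonglongrightarrow> rep_L2 u x"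
proof -
  have "\<exists>r::nat\<Rightarrow>nat. strict_mono r \<and> (AE x in lebesgue. (\<lambda>n. (rep_L2 (X (r n)) x - rep_L2 u x)\<^sup>2) \<longlonglongrightarrow> 0)"
  proof (rule tendsto_L1_AE_subseq)
    show "integrable lebesgue (\<lambda>x. (rep_L2 (X n) x - rep_L2 u x)\<^sup>2)" for n
      using square_integrable_diff[OF square_integrable_rep_L2 square_integrable_rep_L2] by (auto simp: square_integrable_def)
    have "(LINT x|lebesgue. norm ((rep_L2 (X n) x - rep_L2 u x)\<^sup>2)) = (norm (X n - u))\<^sup>2" for n
      unfolding norm_L2_square using rep_L2_diff[of "X n" u] by (intro integral_cong_AE) auto
    moreover have "(\<lambda>n. (norm (X n - u))\<^sup>2) \<longlonglongrightarrow> 0"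
      using assms by (auto intro!: tendsto_eq_intros simp: LIM_zero_iff tendsto_norm_zero_iff)
    ultimately show "(\<lambda>n. LINT x|lebesgue. norm ((rep_L2 (X n) x - rep_L2 u x)\<^sup>2)) \<longlonglongrightarrow> 0" by simp
  qed
  then obtain r where r: "strict_mono r" "AE x in lebesgue. (\<lambda>n. (rep_L2 (X (r n)) x - rep_L2 u x)\<^sup>2) \<longlonglongrightarrow> 0" by blast
  have "AE x in lebesgue. (\<lambda>n. rep_L2 (X (r n)) x) \<longlonglongrightarrow> rep_L2 u x"
    using r(2)
  proof eventually_elim
    case (elim x)
    then have "(\<lambda>n. sqrt ((rep_L2 (X (r n)) x - rep_L2 u x)\<^sup>2)) \<longlonglongrightarrow> sqrt 0" by (intro tendsto_intros)
    then have "(\<lambda>n. rep_L2 (X (r n)) x - rep_L2 u x) \<longlonglongrightarrow> 0" by (simp add: tendsto_rabs_zero_iff)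
    then show ?case by (simp add: LIM_zero_iff)
  qed
  then show thesis using r(1) that by blast
qed

section \<open>Test functions\<close>

lemma partial_deriv_eq:
  "(\<phi> has_derivative \<phi>') (at x) \<Longrightarrow> partial_deriv i \<phi> x = \<phi>' (axis i 1)"
  unfolding partial_deriv_def using frechet_derivative_at by metis

lemma partial_deriv_const: "partial_deriv i (\<lambda>x. c) = (\<lambda>x. 0)"
  by (simp add: partial_deriv_def fun_eq_iff)

lemma C_k_const: "C_k k (\<lambda>x. c)"
  by (induction k arbitrary: c) (auto simp: partial_deriv_const)

lemma C_k_SucD: "C_k (Suc k) \<phi> \<Longrightarrow> C_k k \<phi>"
proof (induction k arbitrary: \<phi>)
  case 0
  then show ?case
    by (auto intro!: differentiable_imp_continuous_on simp: differentiable_on_def)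
next
  case (Suc k)
  then show ?case by (metis C_k.simps(2))
qed

lemma C_k_coordinate: "C_k k (\<lambda>x. x $ i)"
proof (cases k)
  case 0
  then show ?thesis by (auto intro!: continuous_intros)
next
  case (Suc m)
  have d: "((\<lambda>x::real^3. x $ i) has_derivative (\<lambda>h. h $ i)) (at x)" for x
    by (rule bounded_linear_imp_has_derivative) (rule bounded_linear_vec_nth)
  then have "partial_deriv j (\<lambda>x. x $ i) = (\<lambda>x. axis j 1 $ i)" for j
    by (auto simp: fun_eq_iff dest: partial_deriv_eq)
  then show ?thesis using Suc d by (auto simp: C_k_const differentiable_def)
qed

lemma differentiable_has_frechet: "\<phi> differentiable (at x) \<Longrightarrow> (\<phi> has_derivative frechet_derivative \<phi> (at x)) (at x)"
  by (simp add: frechet_derivative_works)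

lemma partial_deriv_add:
  "\<phi> differentiable (at x) \<Longrightarrow> \<psi> differentiable (at x) \<Longrightarrow>
    partial_deriv i (\<lambda>x. \<phi> x + \<psi> x) x = partial_deriv i \<phi> x + partial_deriv i \<psi> x"
  by (subst partial_deriv_eq, rule has_derivative_add, (erule differentiable_has_frechet)+) (simp add: partial_deriv_def)

lemma partial_deriv_mult:
  "\<phi> differentiable (at x) \<Longrightarrow> \<psi> differentiable (at x) \<Longrightarrow>
    partial_deriv i (\<lambda>x. \<phi> x * \<psi> x) x = \<phi> x * partial_deriv i \<psi> x + partial_deriv i \<phi> x * \<psi> x"
  by (subst partial_deriv_eq, rule has_derivative_mult, (erule differentiable_has_frechet)+) (simp add: partial_deriv_def)

lemma has_derivative_chain_real:
  fixes \<phi> :: "real^3 \<Rightarrow> real"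
  assumes "\<phi> differentiable (at x)" "(g has_real_derivative g') (at (\<phi> x))"
  shows "((\<lambda>x. g (\<phi> x)) has_derivative (\<lambda>h. g' * frechet_derivative \<phi> (at x) h)) (at x)"
proof -
  have "(g \<circ> \<phi> has_derivative (\<lambda>h. g' * h) \<circ> frechet_derivative \<phi> (at x)) (at x)"
    using assms(2) differentiable_has_frechet[OF assms(1)]
    by (intro diff_chain_at) (auto simp: has_field_derivative_def)
  then show ?thesis by (simp add: o_def)
qed

lemma partial_deriv_chain:
  assumes "\<phi> differentiable (at x)" "(g has_real_derivative g') (at (\<phi> x))"
  shows "partial_deriv i (\<lambda>x. g (\<phi> x)) x = g' * partial_deriv i \<phi> x"
  using partial_deriv_eq[OF has_derivative_chain_real[OF assms]] by (simp add: partial_deriv_def)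

lemma C_k_add: "C_k k \<phi> \<Longrightarrow> C_k k \<psi> \<Longrightarrow> C_k k (\<lambda>x. \<phi> x + \<psi> x)"
proof (induction k arbitrary: \<phi> \<psi>)
  case (Suc k)
  then have "partial_deriv i (\<lambda>x. \<phi> x + \<psi> x) = (\<lambda>x. partial_deriv i \<phi> x + partial_deriv i \<psi> x)" for i
    by (auto simp: fun_eq_iff intro!: partial_deriv_add)
  then show ?case using Suc by auto
qed (auto intro: continuous_intros)

lemma C_k_mult: "C_k k \<phi> \<Longrightarrow> C_k k \<psi> \<Longrightarrow> C_k k (\<lambda>x. \<phi> x * \<psi> x)"
proof (induction k arbitrary: \<phi> \<psi>)
  case (Suc k)
  then have "partial_deriv i (\<lambda>x. \<phi> x * \<psi> x) = (\<lambda>x. \<phi> x * partial_deriv i \<psi> x + partial_deriv i \<phi> x * \<psi> x)" for i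
    by (auto simp: fun_eq_iff intro!: partial_deriv_mult)
  moreover have "C_k k (\<lambda>x. \<phi> x * partial_deriv i \<psi> x + partial_deriv i \<phi> x * \<psi> x)" for i
    using Suc.prems by (intro C_k_add Suc.IH) (auto dest: C_k_SucD simp del: C_k.simps(2), auto)
  ultimately show ?case using Suc.prems by auto
qed (auto intro: continuous_intros)

lemma C_k_scale: "C_k k \<phi> \<Longrightarrow> C_k k (\<lambda>x. c * \<phi> x)"
  by (intro C_k_mult C_k_const)

lemma C_k_diff: "C_k k \<phi> \<Longrightarrow> C_k k \<psi> \<Longrightarrow> C_k k (\<lambda>x. \<phi> x - \<psi> x)"
  using C_k_add[of k \<phi> "\<lambda>x. (-1) * \<psi> x"] C_k_scale[of k \<psi> "-1"] by simp

lemma C_k_power: "C_k k \<phi> \<Longrightarrow> C_k k (\<lambda>x. \<phi> x ^ n)"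
  by (induction n) (auto intro: C_k_mult C_k_const)

lemma C_k_prod: "finite I \<Longrightarrow> (\<And>i. i \<in> I \<Longrightarrow> C_k k (\<phi> i)) \<Longrightarrow> C_k k (\<lambda>x. \<Prod>i\<in>I. \<phi> i x)"
  by (induction I rule: finite_induct) (auto intro: C_k_mult C_k_const)

lemma C_k_inverse: "C_k k \<phi> \<Longrightarrow> (\<And>x. \<phi> x \<noteq> 0) \<Longrightarrow> C_k k (\<lambda>x. inverse (\<phi> x))"
proof (induction k)
  case (Suc k)
  have "partial_deriv i (\<lambda>x. inverse (\<phi> x)) = (\<lambda>x. - ((inverse (\<phi> x))\<^sup>2) * partial_deriv i \<phi> x)" for i
  proof
    fix x
    have "(inverse has_real_derivative - ((inverse (\<phi> x))\<^sup>2)) (at (\<phi> x))"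
      using Suc.prems(2)[of x] by (auto intro!: derivative_eq_intros simp: power2_eq_square)
    then show "partial_deriv i (\<lambda>x. inverse (\<phi> x)) x = - ((inverse (\<phi> x))\<^sup>2) * partial_deriv i \<phi> x"
      using Suc.prems(1) by (intro partial_deriv_chain) auto
  qed
  moreover have "C_k k (\<lambda>x. - ((inverse (\<phi> x))\<^sup>2) * partial_deriv i \<phi> x)" for i
  proof -
    have "C_k k (\<lambda>x. inverse (\<phi> x))" using Suc.IH Suc.prems C_k_SucD by blast
    moreover have "C_k k (partial_deriv i \<phi>)" using Suc.prems by simp
    ultimately have "C_k k (\<lambda>x. (-1) * (inverse (\<phi> x) ^ 2 * partial_deriv i \<phi> x))"
      by (intro C_k_scale C_k_mult C_k_power)
    then show ?thesis by simp
  qed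
  moreover have "(\<lambda>x. inverse (\<phi> x)) differentiable (at x)" for x
    using Suc.prems by (auto intro!: differentiable_inverse)
  ultimately show ?case by auto
qed (auto intro!: continuous_intros)

text \<open>\<open>flat 0\<close> is the function \<open>exp (-1/s)\<close> that is flat at the origin; the factors \<open>s\<^sup>-\<^sup>n\<close> make the
  family closed under differentiation.\<close>

definition flat :: "nat \<Rightarrow> real \<Rightarrow> real" where
  "flat n s = (if 0 < s then (1 / s) ^ n * exp (- (1 / s)) else 0)"

lemma flat_tendsto_0: "(flat n \<longlongrightarrow> 0) (at 0)"
proof -
  have "((\<lambda>s. (inverse s) ^ n / exp (inverse s)) \<longlongrightarrow> 0) (at_right (0::real))"
    by (rule filterlim_compose[OF tendsto_power_div_exp_0 filterlim_inverse_at_top_right])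
  moreover have "\<forall>\<^sub>F s in at_right 0. (inverse s) ^ n / exp (inverse s) = flat n s"
    unfolding eventually_at_right_field
    by (intro exI[of _ 1]) (auto simp: flat_def exp_minus divide_inverse)
  ultimately have "(flat n \<longlongrightarrow> 0) (at_right 0)" by (simp add: filterlim_cong)
  moreover have "(flat n \<longlongrightarrow> 0) (at_left 0)"
    by (rule tendsto_eventually) (auto simp: eventually_at_left_field flat_def intro!: exI[of _ "-1"])
  ultimately show ?thesis by (simp add: filterlim_at_split)
qed

text \<open>At the origin the difference quotient of \<open>flat n\<close> is literally
  \<open>flat (Suc n)\<close>, so differentiability there is the statement that each member of the
  family tends to zero. To the right, the power contributes one further factor \<open>1/s\<close>
  and the exponential contributes two.\<close>

lemma flat_derivative: "(flat n has_real_derivative (- real n * flat (Suc n) s + flat (Suc (Suc n)) s)) (at s)"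
proof -
  consider "0 < s" | "s < 0" | "s = 0" by linarith
  then show ?thesis
  proof cases
    case 1
    have "((\<lambda>s. (1 / s) ^ n * exp (- (1 / s))) has_real_derivative
        (- real n * flat (Suc n) s + flat (Suc (Suc n)) s)) (at s)"
    proof (cases n)
      case 0
      then show ?thesis using 1
        by (auto intro!: derivative_eq_intros simp: flat_def power2_eq_square field_simps)
    next
      case (Suc m)
      have "((\<lambda>s. inverse s ^ n * exp (- inverse s)) has_real_derivative
          real n * (- (inverse s * 1 * inverse s)) * inverse s ^ (n - Suc 0) * exp (- inverse s)
          + exp (- inverse s) * (inverse s * 1 * inverse s) * inverse s ^ n) (at s)"
        using 1 by (auto intro!: derivative_eq_intros)
      moreover have "inverse s ^ (n - Suc 0) = inverse s ^ m" "inverse s ^ n = inverse s * inverse s ^ m"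
        "flat (Suc n) s = inverse s * (inverse s * inverse s ^ m) * exp (- inverse s)"
        "flat (Suc (Suc n)) s = inverse s * (inverse s * (inverse s * inverse s ^ m)) * exp (- inverse s)"
        using Suc 1 by (simp_all add: flat_def inverse_eq_divide)
      ultimately show ?thesis by (simp add: inverse_eq_divide[symmetric] algebra_simps)
    qed
    then show ?thesis
      by (rule has_field_derivative_transform_within_open[of _ _ _ "{0<..}"]) (use 1 in \<open>auto simp: flat_def\<close>)
  next
    case 2
    have "((\<lambda>s. 0::real) has_real_derivative 0) (at s)" by simp
    then have "(flat n has_real_derivative 0) (at s)"
      by (rule has_field_derivative_transform_within_open[of _ _ _ "{..<0}"]) (use 2 in \<open>auto simp: flat_def\<close>)
    then show ?thesis using 2 by (simp add: flat_def)
  next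
    case 3
    have "flat (Suc n) h = (flat n (0 + h) - flat n 0) / h" for h by (auto simp: flat_def)
    then have "((\<lambda>h. (flat n (0 + h) - flat n 0) / h) \<longlongrightarrow> 0) (at 0)"
      using flat_tendsto_0[of "Suc n"] by (metis (no_types, lifting) ext)
    then show ?thesis using 3 by (simp add: DERIV_def flat_def)
  qed
qed

text \<open>The index \<open>n\<close> is generalised because a derivative of \<open>flat n\<close>
  leads to the indices \<open>n + 1\<close> and \<open>n + 2\<close>.\<close>

lemma C_k_flat: "(\<And>k. C_k k q) \<Longrightarrow> C_k k (\<lambda>x. flat n (q x))"
proof (induction k arbitrary: n)
  case 0
  have "isCont (flat n) s" for s using flat_derivative DERIV_isCont by blast
  then have "continuous_on UNIV (flat n)" by (simp add: continuous_at_imp_continuous_on)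
  then show ?case using 0[of 0] by (auto intro: continuous_on_compose2)
next
  case (Suc k)
  have q: "q differentiable (at x)" for x using Suc.prems[of 1] by simp
  have "partial_deriv i (\<lambda>x. flat n (q x)) = (\<lambda>x. (- real n * flat (Suc n) (q x) + flat (Suc (Suc n)) (q x)) * partial_deriv i q x)" for i
    using q flat_derivative by (auto simp: fun_eq_iff intro!: partial_deriv_chain)
  moreover have "C_k k (\<lambda>x. (- real n * flat (Suc n) (q x) + flat (Suc (Suc n)) (q x)) * partial_deriv i q x)" for i
    using Suc.prems[of "Suc k"] by (intro C_k_mult C_k_add C_k_scale Suc.IH Suc.prems) auto
  moreover have "(\<lambda>x. flat n (q x)) differentiable (at x)" for x
    using has_derivative_chain_real[OF q flat_derivative] by (auto simp: differentiable_def)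
  ultimately show ?case by auto
qed

section \<open>Supports, bounds and integrals of test functions\<close>

lemma test_functionI:
  assumes "\<And>k. C_k k \<phi>" "{x. \<phi> x \<noteq> 0} \<subseteq> K" "compact K" "K \<subseteq> \<Omega>"
  shows "test_function \<Omega> \<phi>"
proof -
  have "closure {x. \<phi> x \<noteq> 0} \<subseteq> K" using assms by (simp add: closure_minimal compact_imp_closed)
  then show ?thesis
    using assms by (auto simp: test_function_def intro: compact_closure[THEN iffD2] bounded_subset compact_imp_bounded)
qed

lemma test_function_supportI:
  assumes "test_function \<Omega> \<phi>" "\<And>k. C_k k \<psi>" "\<And>x. \<phi> x = 0 \<Longrightarrow> \<psi> x = 0"
  shows "test_function \<Omega> \<psi>"
proof (rule test_functionI[OF assms(2)])
  show "{x. \<psi> x \<noteq> 0} \<subseteq> closure {x. \<phi> x \<noteq> 0}" using assms(3) closure_subset by fastforce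
qed (use assms(1) in \<open>auto simp: test_function_def\<close>)

lemma test_function_C_k: "test_function \<Omega> \<phi> \<Longrightarrow> C_k k \<phi>"
  by (simp add: test_function_def)

lemma test_function_differentiable: "test_function \<Omega> \<phi> \<Longrightarrow> \<phi> differentiable (at x)"
  using test_function_C_k[of \<Omega> \<phi> 1] by simp

lemma test_function_outside: "test_function \<Omega> \<phi> \<Longrightarrow> x \<notin> \<Omega> \<Longrightarrow> \<phi> x = 0"
  using closure_subset[of "{x. \<phi> x \<noteq> 0}"] unfolding test_function_def by blast

lemma test_function_continuous: "test_function \<Omega> \<phi> \<Longrightarrow> continuous_on UNIV \<phi>"
  using test_function_C_k[of \<Omega> \<phi> 0] by simp

lemma test_function_borel: "test_function \<Omega> \<phi> \<Longrightarrow> \<phi> \<in> borel_measurable borel"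
  by (rule borel_measurable_continuous_onI[OF test_function_continuous])

lemma test_function_lebesgue: "test_function \<Omega> \<phi> \<Longrightarrow> \<phi> \<in> borel_measurable lebesgue"
  by (rule measurable_completion) (simp add: test_function_borel)

lemma test_function_partial: "test_function \<Omega> \<phi> \<Longrightarrow> test_function \<Omega> (partial_deriv i \<phi>)"
proof (rule test_functionI)
  assume \<phi>: "test_function \<Omega> \<phi>"
  show "C_k k (partial_deriv i \<phi>)" for k using test_function_C_k[OF \<phi>, of "Suc k"] by simp
  have "partial_deriv i \<phi> x = 0" if x: "x \<notin> closure {x. \<phi> x \<noteq> 0}" for x
  proof -
    have "((\<lambda>_. 0) has_derivative (\<lambda>_. 0)) (at x)" by simp
    then have "(\<phi> has_derivative (\<lambda>_. 0)) (at x)"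
      by (rule has_derivative_transform_within_open[of _ _ _ _ "- closure {x. \<phi> x \<noteq> 0}"])
        (use x closure_subset[of "{x. \<phi> x \<noteq> 0}"] in \<open>auto simp: open_Compl\<close>)
    then show ?thesis using partial_deriv_eq[of \<phi> "\<lambda>_. 0" x i] by simp
  qed
  then show "{x. partial_deriv i \<phi> x \<noteq> 0} \<subseteq> closure {x. \<phi> x \<noteq> 0}" by auto
qed (auto simp: test_function_def)

lemma test_function_bounded:
  assumes \<phi>: "test_function \<Omega> \<phi>"
  obtains r c where "0 < r" "0 \<le> c" "\<And>x. \<bar>\<phi> x\<bar> \<le> c * indicator (cball 0 r) x"
proof -
  let ?K = "closure {x. \<phi> x \<noteq> 0}"
  have K: "compact ?K" using \<phi> by (simp add: test_function_def)
  then obtain r where r: "0 < r" "?K \<subseteq> cball 0 r" using bounded_subset_cbox_symmetric bounded_pos compact_imp_bounded[OF K] by (metis mem_cball_0 subsetI)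
  have "compact (\<phi> ` cball 0 r)"
    using test_function_continuous[OF \<phi>] by (intro compact_continuous_image) (auto elim: continuous_on_subset)
  then obtain c where c: "\<And>x. x \<in> cball 0 r \<Longrightarrow> \<bar>\<phi> x\<bar> \<le> c"
    using compact_imp_bounded[of "\<phi> ` cball 0 r"] unfolding bounded_iff by (metis imageI real_norm_def)
  have "\<bar>\<phi> x\<bar> \<le> \<bar>c\<bar> * indicator (cball 0 r) x" for x
  proof (cases "x \<in> cball 0 r")
    case True then show ?thesis using c[OF True] by simp
  next
    case False
    then have "x \<notin> {x. \<phi> x \<noteq> 0}" using r(2) closure_subset[of "{x. \<phi> x \<noteq> 0}"] by blast
    then show ?thesis by simp
  qed
  then show thesis using r(1) that[of r "\<bar>c\<bar>"] by auto
qed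

lemma integrable_indicator_cball: "integrable lborel (indicator (cball a r) :: 'a::euclidean_space \<Rightarrow> real)"
  by (rule integrable_real_indicator) (use emeasure_bounded_finite[OF bounded_cball, of a r] in simp_all)

lemma test_function_integrable: "test_function \<Omega> \<phi> \<Longrightarrow> integrable lborel \<phi>"
proof -
  assume \<phi>: "test_function \<Omega> \<phi>"
  obtain r c where rc: "0 < r" "0 \<le> c" "\<And>x. \<bar>\<phi> x\<bar> \<le> c * indicator (cball 0 r) x" using test_function_bounded[OF \<phi>] by blast
  have "integrable lborel (\<lambda>x. c * indicator (cball (0::real^3) r) x)"
    by (intro integrable_mult_right integrable_indicator_cball)
  then show ?thesis
    by (rule Bochner_Integration.integrable_bound) (use rc test_function_borel[OF \<phi>] in \<open>auto intro: order_trans\<close>)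
qed

lemma test_function_mult: "test_function \<Omega> \<phi> \<Longrightarrow> (\<And>k. C_k k \<psi>) \<Longrightarrow> test_function \<Omega> (\<lambda>x. \<phi> x * \<psi> x)"
  by (rule test_function_supportI) (auto intro: C_k_mult test_function_C_k)

lemma test_function_square_integrable: "test_function \<Omega> \<phi> \<Longrightarrow> square_integrable lebesgue \<phi>"
  unfolding square_integrable_def
  using test_function_integrable[of \<Omega> "\<lambda>x. \<phi> x * \<phi> x"] test_function_mult[of \<Omega> \<phi> \<phi>] test_function_C_k[of \<Omega> \<phi>] test_function_lebesgue[of \<Omega> \<phi>]
  by (auto simp: power2_eq_square integrable_completion test_function_borel)

lemma test_function_line_derivative:
  assumes "\<phi> differentiable (at (x + t *\<^sub>R axis i 1))"
  shows "((\<lambda>t. \<phi> (x + t *\<^sub>R axis i 1)) has_real_derivative partial_deriv i \<phi> (x + t *\<^sub>R axis i 1)) (at t)"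
proof -
  let ?F = "frechet_derivative \<phi> (at (x + t *\<^sub>R axis i 1))"
  have F: "(\<phi> has_derivative ?F) (at (x + t *\<^sub>R axis i 1))" by (rule differentiable_has_frechet[OF assms])
  have "(\<phi> \<circ> (\<lambda>t. x + t *\<^sub>R axis i 1) has_derivative ?F \<circ> (\<lambda>t. t *\<^sub>R axis i 1)) (at t)"
    by (rule diff_chain_at[where f = "\<lambda>t. x + t *\<^sub>R axis i 1" and g = \<phi>]) (auto intro!: derivative_eq_intros F)
  moreover have "?F \<circ> (\<lambda>t. t *\<^sub>R axis i 1) = (*) (partial_deriv i \<phi> (x + t *\<^sub>R axis i 1))"
    using linear_cmul[OF has_derivative_linear[OF F]] by (auto simp: fun_eq_iff partial_deriv_def)
  ultimately show ?thesis by (simp add: has_field_derivative_def o_def)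
qed

text \<open>Translation invariance makes the integral of every difference quotient vanish. By the
  mean value theorem the quotients are dominated by the supremum of the partial derivative on a ball
  that is one unit larger than the support, as the steps are at most 1; dominated convergence
  finishes.\<close>

lemma integral_partial_deriv_test_function:
  assumes \<phi>: "test_function \<Omega> \<phi>"
  shows "(LINT x|lborel. partial_deriv i \<phi> x) = 0"
proof -
  let ?e = "axis i 1 :: real^3"
  define h where "h n = inverse (real (Suc n))" for n
  have h: "0 < h n" "h n \<le> 1" "h \<longlonglongrightarrow> 0" for n
    using LIMSEQ_inverse_real_of_nat by (auto simp: h_def[abs_def] inverse_le_1_iff)
  define q where "q n x = (\<phi> (x + h n *\<^sub>R ?e) - \<phi> x) / h n" for n x
  obtain r c where rc: "0 < r" "0 \<le> c" "\<And>x. \<bar>partial_deriv i \<phi> x\<bar> \<le> c * indicator (cball 0 r) x"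
    using test_function_bounded[OF test_function_partial[OF \<phi>]] by blast
  obtain r' c' where rc': "0 < r'" "0 \<le> c'" "\<And>x. \<bar>\<phi> x\<bar> \<le> c' * indicator (cball 0 r') x"
    using test_function_bounded[OF \<phi>] by blast
  have \<phi>0: "\<phi> x = 0" if "norm x > r'" for x using rc'(3)[of x] that by (auto simp: indicator_def)
  have int0: "(LINT x|lborel. q n x) = 0" for n
  proof -
    have m: "(+) (h n *\<^sub>R ?e) \<in> borel_measurable borel" by measurable
    have "(LINT x|lborel. \<phi> x) = (LINT x|distr lborel borel ((+) (h n *\<^sub>R ?e)). \<phi> x)"
      by (simp add: lborel_distr_plus)
    also have "\<dots> = (LINT x|lborel. \<phi> (x + h n *\<^sub>R ?e))"
      using m test_function_borel[OF \<phi>] by (subst integral_distr) (auto simp: add.commute)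
    finally have eq: "(LINT x|lborel. \<phi> x) = (LINT x|lborel. \<phi> (x + h n *\<^sub>R ?e))" .
    have "integrable (distr lborel borel ((+) (h n *\<^sub>R ?e))) \<phi>"
      using test_function_integrable[OF \<phi>] by (simp add: lborel_distr_plus)
    then have "integrable lborel (\<lambda>x. \<phi> (x + h n *\<^sub>R ?e))"
      using m test_function_borel[OF \<phi>] by (subst (asm) integrable_distr_eq) (auto simp: add.commute)
    then show ?thesis using eq test_function_integrable[OF \<phi>] by (simp add: q_def)
  qed
  have "(\<lambda>n. LINT x|lborel. q n x) \<longlonglongrightarrow> (LINT x|lborel. partial_deriv i \<phi> x)"
  proof (rule integral_dominated_convergence)
    show "partial_deriv i \<phi> \<in> borel_measurable lborel" using test_function_borel[OF test_function_partial[OF \<phi>]] by simp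
    have [measurable]: "\<phi> \<in> borel_measurable borel" by (rule test_function_borel[OF \<phi>])
    show "q n \<in> borel_measurable lborel" for n unfolding q_def by measurable
    show "integrable lborel (\<lambda>x. c * indicator (cball (0::real^3) (r' + 1)) x)"
      by (intro integrable_mult_right integrable_indicator_cball)
    show "AE x in lborel. (\<lambda>n. q n x) \<longlonglongrightarrow> partial_deriv i \<phi> x"
    proof (rule AE_I2)
      fix x
      have "((\<lambda>t. \<phi> (x + t *\<^sub>R ?e)) has_real_derivative partial_deriv i \<phi> x) (at 0)"
        using test_function_line_derivative[of \<phi> x 0 i] test_function_differentiable[OF \<phi>] by simp
      then have "((\<lambda>t. (\<phi> (x + t *\<^sub>R ?e) - \<phi> x) / t) \<longlongrightarrow> partial_deriv i \<phi> x) (at 0)"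
        by (simp add: DERIV_def)
      moreover have "filterlim h (at 0) sequentially" using h(1,3) by (simp add: filterlim_at less_imp_neq[THEN not_sym])
      ultimately show "(\<lambda>n. q n x) \<longlonglongrightarrow> partial_deriv i \<phi> x" unfolding q_def by (rule filterlim_compose)
    qed
    show "AE x in lborel. norm (q n x) \<le> c * indicator (cball 0 (r' + 1)) x" for n
    proof (rule AE_I2)
      fix x
      show "norm (q n x) \<le> c * indicator (cball 0 (r' + 1)) x"
      proof (cases "x \<in> cball 0 (r' + 1)")
        case True
        have "\<exists>z>0. z < h n \<and> \<phi> (x + h n *\<^sub>R ?e) - \<phi> (x + 0 *\<^sub>R ?e) = (h n - 0) * partial_deriv i \<phi> (x + z *\<^sub>R ?e)"
          using test_function_line_derivative test_function_differentiable[OF \<phi>] h(1)[of n] by (intro MVT2) blast+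
        then obtain z where "\<phi> (x + h n *\<^sub>R ?e) - \<phi> x = h n * partial_deriv i \<phi> (x + z *\<^sub>R ?e)" by auto
        then have "q n x = partial_deriv i \<phi> (x + z *\<^sub>R ?e)" using h(1)[of n] by (simp add: q_def)
        moreover have "c * indicator (cball 0 r) (x + z *\<^sub>R ?e) \<le> c" using rc(2) by (simp add: indicator_def)
        ultimately show ?thesis using rc(3)[of "x + z *\<^sub>R ?e"] True by simp
      next
        case False
        then have "norm x > r' + 1" by simp
        moreover have "norm x \<le> norm (x + h n *\<^sub>R ?e) + norm (h n *\<^sub>R ?e)" by (metis add_diff_cancel_right' norm_triangle_ineq4)
        moreover have "norm (h n *\<^sub>R ?e) \<le> 1" using h(1,2)[of n] by (simp add: norm_axis_1)
        ultimately have "\<phi> x = 0" "\<phi> (x + h n *\<^sub>R ?e) = 0" by (intro \<phi>0; linarith)+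
        then show ?thesis using False by (simp add: q_def)
      qed
    qed
  qed
  then show ?thesis by (simp add: int0 LIMSEQ_const_iff)
qed

text \<open>The bump is a product over the coordinates of \<open>exp (-1/s)\<close> with
  \<open>s = (n+1) (x_i - a_i) (b_i - x_i)\<close>. The quadratic is positive exactly between the
  two faces, and growing \<open>n\<close> drives the exponential to 1 there. All these functions
  stay below the indicator, as dominated convergence requires.\<close>

lemma box_test_functions:
  assumes sub: "cbox a b \<subseteq> \<Omega>"
  obtains \<phi> :: "nat \<Rightarrow> real^3 \<Rightarrow> real" where "\<And>n. test_function \<Omega> (\<phi> n)" "\<And>n x. 0 \<le> \<phi> n x \<and> \<phi> n x \<le> indicator (box a b) x"
    "\<And>x. (\<lambda>n. \<phi> n x) \<longlonglongrightarrow> indicator (box a b) x"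
proof (cases "box a b = {}")
  case True
  have "test_function \<Omega> (\<lambda>x. 0)" by (rule test_functionI[of _ "{}"]) (auto simp: C_k_const)
  then show ?thesis using True that[of "\<lambda>_ _. 0"] by auto
next
  case False
  then have ab: "a $ i < b $ i" for i by (auto simp: mem_box_cart) (meson less_trans)
  define \<phi> where "\<phi> n x = (\<Prod>i\<in>UNIV. flat 0 (real (Suc n) * ((x $ i - a $ i) * (b $ i - x $ i))))" for n and x :: "real^3"
  have flat01: "0 \<le> flat 0 s" "flat 0 s \<le> 1" for s by (auto simp: flat_def)
  have pos_iff: "0 < (x - c) * (d - x) \<longleftrightarrow> c < x \<and> x < d" if "c < d" for x c d :: real
    using that by (auto simp: zero_less_mult_iff)
  have out: "\<phi> n x = 0" if "x \<notin> box a b" for n x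
  proof -
    from that obtain i where "\<not> (a $ i < x $ i \<and> x $ i < b $ i)" by (auto simp: mem_box_cart)
    then have "\<not> 0 < (x $ i - a $ i) * (b $ i - x $ i)" using pos_iff[OF ab] by blast
    then have "\<not> 0 < real (Suc n) * ((x $ i - a $ i) * (b $ i - x $ i))" by (metis zero_less_mult_pos of_nat_0_less_iff zero_less_Suc)
    then have "flat 0 (real (Suc n) * ((x $ i - a $ i) * (b $ i - x $ i))) = 0" by (simp add: flat_def)
    then show ?thesis unfolding \<phi>_def by (intro prod_zero) auto
  qed
  show ?thesis
  proof (rule that[of \<phi>])
    show "test_function \<Omega> (\<phi> n)" for n
    proof (rule test_functionI[OF _ _ compact_cbox sub])
      show "C_k k (\<phi> n)" for k unfolding \<phi>_def
        by (intro C_k_prod C_k_flat C_k_scale C_k_mult C_k_diff C_k_coordinate C_k_const) auto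
      show "{x. \<phi> n x \<noteq> 0} \<subseteq> cbox a b" using out box_subset_cbox by blast
    qed
    show "0 \<le> \<phi> n x \<and> \<phi> n x \<le> indicator (box a b) x" for n x
    proof (cases "x \<in> box a b")
      case True
      then show ?thesis unfolding \<phi>_def using flat01 by (auto intro: prod_nonneg prod_le_1)
    qed (simp add: out)
    show "(\<lambda>n. \<phi> n x) \<longlonglongrightarrow> indicator (box a b) x" for x
    proof (cases "x \<in> box a b")
      case True
      have "(\<lambda>n. flat 0 (real (Suc n) * ((x $ i - a $ i) * (b $ i - x $ i)))) \<longlonglongrightarrow> 1" for i
      proof -
        have c: "0 < (x $ i - a $ i) * (b $ i - x $ i)" using True by (auto simp: mem_box_cart)
        have "(\<lambda>n. exp (- (inverse (real (Suc n)) * (1 / ((x $ i - a $ i) * (b $ i - x $ i)))))) \<longlonglongrightarrow> exp (- (0 * (1 / ((x $ i - a $ i) * (b $ i - x $ i)))))"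
          by (intro tendsto_intros LIMSEQ_inverse_real_of_nat)
        moreover have "exp (- (inverse (real (Suc n)) * (1 / ((x $ i - a $ i) * (b $ i - x $ i))))) = flat 0 (real (Suc n) * ((x $ i - a $ i) * (b $ i - x $ i)))" for n
          using c mult_pos_pos[of "real (Suc n)", OF _ c] by (simp add: flat_def inverse_eq_divide)
        ultimately show ?thesis by simp
      qed
      then have "(\<lambda>n. \<phi> n x) \<longlonglongrightarrow> (\<Prod>i\<in>(UNIV::3 set). 1)" unfolding \<phi>_def by (intro tendsto_prod)
      then show ?thesis using True by simp
    qed (simp add: out)
  qed
qed

section \<open>Sobolev spaces\<close>

lemma integral_box_eq_0:
  fixes h :: "real^3 \<Rightarrow> real"
  assumes h: "square_integrable lborel h" and test: "\<And>\<phi>. test_function \<Omega> \<phi> \<Longrightarrow> (LINT x|lborel. h x * \<phi> x) = 0"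
    and sub: "cbox a b \<subseteq> \<Omega>"
  shows "(LINT x|lborel. h x * indicator (box a b) x) = 0"
proof -
  obtain \<phi> where \<phi>: "\<And>n. test_function \<Omega> (\<phi> n)" "\<And>n x. 0 \<le> \<phi> n x \<and> \<phi> n x \<le> indicator (box a b) x"
    "\<And>x. (\<lambda>n. \<phi> n x) \<longlonglongrightarrow> indicator (box a b) x"
    using box_test_functions[OF sub] by blast
  have [measurable]: "h \<in> borel_measurable borel" using h by (simp add: square_integrable_def)
  have [measurable]: "\<phi> n \<in> borel_measurable borel" for n by (rule test_function_borel[OF \<phi>(1)])
  have "square_integrable lborel (indicator (box a b) :: real^3 \<Rightarrow> real)"
    unfolding square_integrable_def
    using emeasure_bounded_finite[OF bounded_box, of a b] by (auto simp: power2_eq_square indicator_inter_arith[symmetric])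
  then have int: "integrable lborel (\<lambda>x. h x * indicator (box a b) x)"
    using h by (intro square_integrable_mult)
  have "(\<lambda>n. LINT x|lborel. h x * \<phi> n x) \<longlonglongrightarrow> (LINT x|lborel. h x * indicator (box a b) x)"
  proof (rule integral_dominated_convergence[where w = "\<lambda>x. norm (h x * indicator (box a b) x)"])
    show "integrable lborel (\<lambda>x. norm (h x * indicator (box a b) x))" using int by (rule integrable_norm)
    show "AE x in lborel. (\<lambda>n. h x * \<phi> n x) \<longlonglongrightarrow> h x * indicator (box a b) x"
      by (intro AE_I2 tendsto_intros \<phi>(3))
    show "AE x in lborel. norm (h x * \<phi> n x) \<le> norm (h x * indicator (box a b) x)" for n
      using \<phi>(2)[of n] by (intro AE_I2) (auto simp: abs_mult intro!: mult_left_mono)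
  qed measurable
  then show ?thesis by (simp add: test[OF \<phi>(1)] LIMSEQ_const_iff)
qed

text \<open>On \<open>box c d\<close> the positive and the negative part of \<open>h\<close> are
  densities of two finite measures. They agree on all open boxes, by the previous lemma applied to
  the intersection with \<open>box c d\<close>; open boxes form an intersection-stable generator of
  the Borel sets, so the measures coincide, and so do the densities almost everywhere.\<close>

lemma AE_box_eq_0:
  fixes h :: "real^3 \<Rightarrow> real"
  assumes h: "square_integrable lborel h" and test: "\<And>\<phi>. test_function \<Omega> \<phi> \<Longrightarrow> (LINT x|lborel. h x * \<phi> x) = 0"
    and sub: "cbox c d \<subseteq> \<Omega>"
  shows "AE x in lborel. x \<in> box c d \<longrightarrow> h x = 0"
proof -
  define F where "F s x = ennreal (max 0 (s * h x) * indicator (box c d) x)" for s :: real and x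
  have [measurable]: "h \<in> borel_measurable borel" using h by (simp add: square_integrable_def)
  have "square_integrable lborel (indicator X :: real^3 \<Rightarrow> real)" if "bounded X" "X \<in> sets borel" for X
    unfolding square_integrable_def
    using emeasure_bounded_finite[OF that(1)] that(2) by (auto simp: power2_eq_square indicator_inter_arith[symmetric])
  then have int: "integrable lborel (\<lambda>x. h x * indicator X x)" if "bounded X" "X \<in> sets borel" for X
    using h that by (intro square_integrable_mult) auto
  have [measurable]: "F s \<in> borel_measurable borel" for s unfolding F_def by measurable
  have int': "integrable lborel (\<lambda>x. max 0 (s * h x) * indicator X x)" if "bounded X" "X \<in> sets borel" for s X
  proof (rule Bochner_Integration.integrable_bound)
    show "integrable lborel (\<lambda>x. s * (h x * indicator X x))" by (intro integrable_mult_right int that)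
    show "AE x in lborel. norm (max 0 (s * h x) * indicator X x) \<le> norm (s * (h x * indicator X x))"
    proof (rule AE_I2)
      fix x
      have "\<bar>max 0 (s * h x)\<bar> \<le> \<bar>s * h x\<bar>" by simp
      then show "norm (max 0 (s * h x) * indicator X x) \<le> norm (s * (h x * indicator X x))"
        by (cases "x \<in> X") (simp_all add: abs_mult)
    qed
  qed (use that(2) in simp)
  have F: "emeasure (density lborel (F s)) X = ennreal (LINT x|lborel. max 0 (s * h x) * indicator (box c d \<inter> X) x)"
    if "X \<in> sets borel" for s X
  proof -
    have "emeasure (density lborel (F s)) X = (\<integral>\<^sup>+ x. ennreal (max 0 (s * h x) * indicator (box c d \<inter> X) x) \<partial>lborel)"
      using that by (subst emeasure_density) (auto simp: F_def indicator_def intro!: nn_integral_cong)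
    also have "\<dots> = ennreal (LINT x|lborel. max 0 (s * h x) * indicator (box c d \<inter> X) x)"
      using that by (intro nn_integral_eq_integral int') (auto intro: bounded_subset[OF bounded_box])
    finally show ?thesis .
  qed
  have "density lborel (F 1) = density lborel (F (-1))"
  proof (rule measure_eqI_generator_eq)
    let ?E = "range (\<lambda>(a, b). box a b::(real^3) set)"
    show "Int_stable ?E" by (auto simp: Int_stable_def box_Int_box)
    show "?E \<subseteq> Pow UNIV" "sets (density lborel (F 1)) = sigma_sets UNIV ?E" "sets (density lborel (F (-1))) = sigma_sets UNIV ?E"
      by (simp_all add: borel_eq_box)
    let ?A = "\<lambda>n::nat. box (- (real n *\<^sub>R One)) (real n *\<^sub>R One) :: (real^3) set"
    show "range ?A \<subseteq> ?E" "(\<Union>i. ?A i) = UNIV" unfolding UN_box_eq_UNIV by auto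
    show "emeasure (density lborel (F 1)) (?A i) \<noteq> \<infinity>" for i by (simp add: F)
    show "emeasure (density lborel (F 1)) X = emeasure (density lborel (F (-1))) X" if "X \<in> ?E" for X
    proof -
      have "\<exists>p. X = (case p of (a, b) \<Rightarrow> box a b)" using \<open>X \<in> ?E\<close> by blast
      then obtain p where "X = (case p of (a, b) \<Rightarrow> box a b)" by blast
      then have "X = box (fst p) (snd p)" by (simp add: case_prod_beta)
      then obtain a b where X: "X = box a b" by (rule that)
      have "\<exists>a' b'. box c d \<inter> box a b = box a' b'" by (intro exI) (rule box_Int_box)
      then obtain a' b' where ab': "box c d \<inter> box a b = box a' b'" by (elim exE)
      have "(LINT x|lborel. h x * indicator (box a' b') x) = 0"
      proof (cases "box a' b' = {}")
        case False
        \<comment> \<open>Only a nonempty intersection controls its corner points. Its closure then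
          stays inside \<open>cbox c d\<close>, hence inside \<Omega>, so test functions approximate
          its indicator.\<close>
        then have "cbox a' b' = closure (box a' b')" by (simp add: closure_box)
        also have "\<dots> \<subseteq> cbox c d" unfolding ab'[symmetric] by (rule closure_minimal) (use box_subset_cbox in \<open>auto simp: closed_cbox\<close>)
        finally show ?thesis using sub by (intro integral_box_eq_0[OF h test, of \<Omega>]) auto
      qed simp
      moreover have "(LINT x|lborel. h x * indicator (box a' b') x) =
          (LINT x|lborel. max 0 (1 * h x) * indicator (box a' b') x - max 0 ((-1) * h x) * indicator (box a' b') x)"
        by (intro Bochner_Integration.integral_cong) (auto simp: max_def algebra_simps)
      moreover have "\<dots> = (LINT x|lborel. max 0 (1 * h x) * indicator (box a' b') x) - (LINT x|lborel. max 0 ((-1) * h x) * indicator (box a' b') x)"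
        by (intro Bochner_Integration.integral_diff int' bounded_box) auto
      ultimately have "(LINT x|lborel. max 0 (1 * h x) * indicator (box a' b') x) = (LINT x|lborel. max 0 ((-1) * h x) * indicator (box a' b') x)"
        by linarith
      then show ?thesis using F[of X] X by (simp only: ab') simp
    qed
  qed
  then have "AE x in lborel. F 1 x = F (-1) x"
    by (rule sigma_finite_measure.density_unique[OF sigma_finite_lborel, rotated 2]) (auto simp: F_def)
  then show ?thesis by eventually_elim (auto simp: F_def max_def indicator_def split: if_splits)
qed

text \<open>The uniqueness of densities is a statement about Borel functions, so \<open>h\<close> is
  first replaced by a Borel version. The open set is a countable union of closed boxes, and the
  faces lost in passing to open boxes are null.\<close>

lemma fundamental_lemma_variations:
  fixes h :: "real^3 \<Rightarrow> real"
  assumes \<Omega>: "open \<Omega>" and h: "square_integrable lebesgue h"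
    and test: "\<And>\<phi>. test_function \<Omega> \<phi> \<Longrightarrow> (LINT x|lebesgue. h x * \<phi> x) = 0"
  shows "AE x in lebesgue. x \<in> \<Omega> \<longrightarrow> h x = 0"
proof -
  obtain h' where h': "h' \<in> borel_measurable lborel" "AE x in lborel. h x = h' x"
    using completion_ex_borel_measurable_real[of h lborel] h by (auto simp: square_integrable_def)
  have ae: "AE x in lebesgue. h x = h' x" using h'(2) by (rule AE_completion)
  have [measurable]: "h' \<in> borel_measurable borel" using h'(1) by simp
  have "integrable lebesgue (\<lambda>x. (h' x)\<^sup>2)"
    using h ae h'(1) by (subst integrable_cong_AE[of _ _ "\<lambda>x. (h x)\<^sup>2"]) (auto simp: square_integrable_def intro: measurable_completion)
  then have sq: "square_integrable lborel h'"
    using h'(1) by (simp add: square_integrable_def integrable_completion)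
  have test': "(LINT x|lborel. h' x * \<phi> x) = 0" if \<phi>: "test_function \<Omega> \<phi>" for \<phi>
  proof -
    have [measurable]: "\<phi> \<in> borel_measurable borel" by (rule test_function_borel[OF \<phi>])
    have "(LINT x|lborel. h' x * \<phi> x) = (LINT x|lebesgue. h' x * \<phi> x)" by (rule integral_completion[symmetric]) measurable
    also have "\<dots> = (LINT x|lebesgue. h x * \<phi> x)"
    proof (rule integral_cong_AE)
      show "(\<lambda>x. h' x * \<phi> x) \<in> borel_measurable lebesgue" by (rule measurable_completion) measurable
      show "(\<lambda>x. h x * \<phi> x) \<in> borel_measurable lebesgue"
        using h test_function_lebesgue[OF \<phi>] by (auto simp: square_integrable_def)
    qed (use ae in auto)
    finally show ?thesis using test[OF \<phi>] by simp
  qed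
  obtain \<D> where D: "countable \<D>" "\<D> \<subseteq> Pow \<Omega>" "\<And>X. X \<in> \<D> \<Longrightarrow> \<exists>a b. X = cbox a b" "\<Union>\<D> = \<Omega>"
    using open_countable_Union_open_cbox[OF \<Omega>] by metis
  have "AE x in lebesgue. x \<in> X \<longrightarrow> h' x = 0" if X: "X \<in> \<D>" for X
  proof -
    obtain a b where ab: "X = cbox a b" using D(3) X by blast
    have "AE x in lebesgue. x \<in> box a b \<longrightarrow> h' x = 0"
      using D(2) X ab by (intro AE_completion AE_box_eq_0[OF sq test']) auto
    moreover have "AE x in lebesgue. x \<notin> cbox a b - box a b"
      using negligible_frontier_interval[of a b] by (intro AE_not_in) (simp add: negligible_iff_null_sets)
    ultimately show ?thesis by eventually_elim (auto simp: ab)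
  qed
  then have "AE x in lebesgue. \<forall>X\<in>\<D>. x \<in> X \<longrightarrow> h' x = 0" unfolding AE_ball_countable[OF D(1)] by blast
  then show ?thesis using ae by eventually_elim (use D(4) in auto)
qed

section \<open>Classes supported in \<Omega>, weak gradients and \<open>H10\<close>\<close>

lemma integral_lebesgue_on:
  assumes "\<Omega> \<in> sets lebesgue"
  shows "(LINT x|lebesgue_on \<Omega>. k x) = (LINT x|lebesgue. indicator \<Omega> x * (k x :: real))"
  using assms by (subst integral_restrict_space) auto

lemma nn_integral_lebesgue_on:
  assumes "\<Omega> \<in> sets lebesgue"
  shows "(\<integral>\<^sup>+ x. k x \<partial>lebesgue_on \<Omega>) = (\<integral>\<^sup>+ x. k x * indicator \<Omega> x \<partial>lebesgue)"
  using assms by (subst nn_integral_restrict_space) auto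

lemma AE_lebesgue_on:
  assumes "\<Omega> \<in> sets lebesgue"
  shows "(AE x in lebesgue_on \<Omega>. P x) \<longleftrightarrow> (AE x in lebesgue. x \<in> \<Omega> \<longrightarrow> P x)"
  using assms by (subst AE_restrict_space_iff) auto

lemma abs_L2_add: "square_integrable lebesgue g \<Longrightarrow> square_integrable lebesgue h \<Longrightarrow>
    abs_L2 (\<lambda>x. g x + h x) = abs_L2 g + abs_L2 h"
proof (rule L2_eqI)
  assume g: "square_integrable lebesgue g" and h: "square_integrable lebesgue h"
  show "AE x in lebesgue. rep_L2 (abs_L2 (\<lambda>x. g x + h x)) x = rep_L2 (abs_L2 g + abs_L2 h) x"
    using rep_abs_L2[OF g] rep_abs_L2[OF h] rep_abs_L2[OF square_integrable_add[OF g h]] rep_L2_add[of "abs_L2 g" "abs_L2 h"]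
    by eventually_elim simp
qed

lemma abs_L2_scale: "square_integrable lebesgue g \<Longrightarrow> abs_L2 (\<lambda>x. c * g x) = c *\<^sub>R abs_L2 g"
proof (rule L2_eqI)
  assume g: "square_integrable lebesgue g"
  show "AE x in lebesgue. rep_L2 (abs_L2 (\<lambda>x. c * g x)) x = rep_L2 (c *\<^sub>R abs_L2 g) x"
    using rep_abs_L2[OF g] rep_abs_L2[OF square_integrable_scale[OF g, of c]] rep_L2_scaleR[of c "abs_L2 g"]
    by eventually_elim simp
qed

lemma inner_abs_L2: "square_integrable lebesgue g \<Longrightarrow> u \<bullet> abs_L2 g = (LINT x|lebesgue. rep_L2 u x * g x)"
  unfolding inner_L2 using rep_abs_L2[of g] by (intro integral_cong_AE) (auto simp: square_integrable_def)

lemma L2_class_test: "test_function \<Omega> \<phi> \<Longrightarrow> L2_class \<Omega> \<phi> = abs_L2 \<phi>"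
  unfolding L2_class_def by (rule arg_cong[where f = abs_L2]) (auto simp: fun_eq_iff test_function_outside)

lemma L2_on_subspace: "subspace (L2_on \<Omega>)"
proof (rule subspaceI)
  show "0 \<in> L2_on \<Omega>" unfolding L2_on_def using rep_L2_zero by auto
next
  fix u v assume "u \<in> L2_on \<Omega>" "v \<in> L2_on \<Omega>"
  then show "u + v \<in> L2_on \<Omega>" unfolding L2_on_def using rep_L2_add[of u v] by auto
next
  fix u c assume "u \<in> L2_on \<Omega>"
  then show "c *\<^sub>R u \<in> L2_on \<Omega>" unfolding L2_on_def using rep_L2_scaleR[of c u] by auto
qed

lemma L2_on_closed: "closed (L2_on \<Omega>)"
  unfolding closed_sequential_limits
proof (intro allI impI)
  fix X u assume X: "(\<forall>n. X n \<in> L2_on \<Omega>) \<and> X \<longlonglongrightarrow> u"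
  obtain r :: "nat \<Rightarrow> nat" where r: "AE x in lebesgue. (\<lambda>n. rep_L2 (X (r n)) x) \<longlonglongrightarrow> rep_L2 u x"
    using L2_tendsto_AE_subseq X by blast
  have "AE x in lebesgue. \<forall>n. x \<notin> \<Omega> \<longrightarrow> rep_L2 (X (r n)) x = 0"
    unfolding AE_all_countable using X by (auto simp: L2_on_def)
  with r have "AE x in lebesgue. x \<notin> \<Omega> \<longrightarrow> rep_L2 u x = 0"
    by eventually_elim (auto simp: LIMSEQ_const_iff)
  then show "u \<in> L2_on \<Omega>" by (simp add: L2_on_def)
qed

lemma abs_L2_in_L2_on: "square_integrable lebesgue g \<Longrightarrow> (\<And>x. x \<notin> \<Omega> \<Longrightarrow> g x = 0) \<Longrightarrow> abs_L2 g \<in> L2_on \<Omega>"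
  unfolding L2_on_def using rep_abs_L2[of g] by auto

lemma test_in_L2_on: "test_function \<Omega> \<phi> \<Longrightarrow> abs_L2 \<phi> \<in> L2_on \<Omega>"
  by (intro abs_L2_in_L2_on test_function_square_integrable test_function_outside)

text \<open>Test functions separate the points of \<open>L2_on \<Omega>\<close>. This is what gives
  the definite descriptions behind \<open>grad\<close> and \<open>op_A\<close> their
  meaning.\<close>

lemma L2_on_eqI:
  assumes \<Omega>: "open \<Omega>" and uv: "u \<in> L2_on \<Omega>" "v \<in> L2_on \<Omega>"
    and test: "\<And>\<phi>. test_function \<Omega> \<phi> \<Longrightarrow> u \<bullet> abs_L2 \<phi> = v \<bullet> abs_L2 \<phi>"
  shows "u = v"
proof -
  have "AE x in lebesgue. x \<in> \<Omega> \<longrightarrow> rep_L2 (u - v) x = 0"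
  proof (rule fundamental_lemma_variations[OF \<Omega> square_integrable_rep_L2])
    fix \<phi> assume \<phi>: "test_function \<Omega> \<phi>"
    show "(LINT x|lebesgue. rep_L2 (u - v) x * \<phi> x) = 0"
      using test[OF \<phi>] inner_abs_L2[OF test_function_square_integrable[OF \<phi>], of "u - v"] by (simp add: inner_diff_left)
  qed
  moreover have "AE x in lebesgue. x \<notin> \<Omega> \<longrightarrow> rep_L2 (u - v) x = 0"
    using subspace_diff[OF L2_on_subspace uv] by (simp add: L2_on_def)
  ultimately have "AE x in lebesgue. rep_L2 (u - v) x = rep_L2 0 x" using rep_L2_zero by eventually_elim auto
  then have "u - v = 0" by (rule L2_eqI)
  then show ?thesis by simp
qed

lemma open_lebesgue: "open \<Omega> \<Longrightarrow> \<Omega> \<in> sets lebesgue"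
  by (simp add: borel_open)

text \<open>Written as inner products with fixed classes, the defining identities are visibly linear
  and continuous in \<open>u\<close> and \<open>g\<close>, so sums, multiples and limits of weak
  gradients need no integrals.\<close>

lemma weak_gradient_iff_inner:
  assumes \<Omega>: "open \<Omega>"
  shows "weak_gradient \<Omega> u g \<longleftrightarrow> (\<forall>i. g $ i \<in> L2_on \<Omega>) \<and>
     (\<forall>\<phi> i. test_function \<Omega> \<phi> \<longrightarrow> u \<bullet> abs_L2 (partial_deriv i \<phi>) = - (g $ i \<bullet> abs_L2 \<phi>))"
proof -
  have *: "(LINT x|lebesgue_on \<Omega>. rep_L2 w x * \<phi> x) = w \<bullet> abs_L2 \<phi>" if \<phi>: "test_function \<Omega> \<phi>" for w \<phi>
  proof -
    have "(LINT x|lebesgue_on \<Omega>. rep_L2 w x * \<phi> x) = (LINT x|lebesgue. rep_L2 w x * \<phi> x)"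
      unfolding integral_lebesgue_on[OF open_lebesgue[OF \<Omega>]]
      by (rule Bochner_Integration.integral_cong) (auto simp: indicator_def test_function_outside[OF \<phi>])
    then show ?thesis using inner_abs_L2[OF test_function_square_integrable[OF \<phi>]] by simp
  qed
  show ?thesis unfolding weak_gradient_def by (auto simp: * test_function_partial)
qed

context
  fixes \<Omega> :: "(real^3) set"
  assumes \<Omega>: "open \<Omega>"
begin

lemma weak_gradient_unique: "weak_gradient \<Omega> u g \<Longrightarrow> weak_gradient \<Omega> u g' \<Longrightarrow> g = g'"
  unfolding weak_gradient_iff_inner[OF \<Omega>] vec_eq_iff
  by (auto intro!: L2_on_eqI[OF \<Omega>])

lemma grad_eq: "weak_gradient \<Omega> u g \<Longrightarrow> grad \<Omega> u = g"
  unfolding grad_def using weak_gradient_unique by blast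

lemma weak_gradient_grad: "u \<in> H1 \<Omega> \<Longrightarrow> weak_gradient \<Omega> u (grad \<Omega> u)"
  using grad_eq by (auto simp: H1_def)

lemma weak_gradient_add: "weak_gradient \<Omega> u g \<Longrightarrow> weak_gradient \<Omega> v h \<Longrightarrow> weak_gradient \<Omega> (u + v) (g + h)"
  unfolding weak_gradient_iff_inner[OF \<Omega>] by (auto simp: inner_add_left subspace_add[OF L2_on_subspace])

lemma weak_gradient_scale: "weak_gradient \<Omega> u g \<Longrightarrow> weak_gradient \<Omega> (c *\<^sub>R u) (c *\<^sub>R g)"
  unfolding weak_gradient_iff_inner[OF \<Omega>] by (auto simp: subspace_scale[OF L2_on_subspace])

text \<open>Integration by parts is the product rule for \<phi>\<psi> combined with the vanishing
  integral of a partial derivative of that test function.\<close>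

lemma weak_gradient_test:
  assumes \<phi>: "test_function \<Omega> \<phi>"
  shows "weak_gradient \<Omega> (abs_L2 \<phi>) (\<chi> i. abs_L2 (partial_deriv i \<phi>))"
  unfolding weak_gradient_iff_inner[OF \<Omega>]
proof (intro conjI allI impI)
  show "(\<chi> i. abs_L2 (partial_deriv i \<phi>)) $ i \<in> L2_on \<Omega>" for i
    using test_in_L2_on[OF test_function_partial[OF \<phi>]] by simp
  fix \<psi> i assume \<psi>: "test_function \<Omega> \<psi>"
  have [measurable]: "\<phi> \<in> borel_measurable borel" "\<psi> \<in> borel_measurable borel"
    "partial_deriv i \<phi> \<in> borel_measurable borel" "partial_deriv i \<psi> \<in> borel_measurable borel"
    using \<phi> \<psi> by (auto intro: test_function_borel test_function_partial)
  have eq: "abs_L2 f \<bullet> abs_L2 g = (LINT x|lborel. f x * g x)" if f: "test_function \<Omega> f" and g: "test_function \<Omega> g" for f g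
  proof -
    have [measurable]: "f \<in> borel_measurable borel" "g \<in> borel_measurable borel" using f g by (auto intro: test_function_borel)
    have "abs_L2 f \<bullet> abs_L2 g = (LINT x|lebesgue. f x * g x)"
      unfolding inner_abs_L2[OF test_function_square_integrable[OF g]]
      using rep_abs_L2[OF test_function_square_integrable[OF f]] test_function_lebesgue[OF f] test_function_lebesgue[OF g]
      by (intro integral_cong_AE) auto
    then show ?thesis by (subst (asm) integral_completion) measurable
  qed
  have int: "integrable lborel (\<lambda>x. f x * g x)" if f: "test_function \<Omega> f" and g: "test_function \<Omega> g" for f g
    using test_function_integrable[OF test_function_mult[OF f test_function_C_k[OF g]]] .
  have "0 = (LINT x|lborel. partial_deriv i (\<lambda>x. \<phi> x * \<psi> x) x)"
    using integral_partial_deriv_test_function[OF test_function_mult[OF \<phi> test_function_C_k[OF \<psi>]]] by simp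
  also have "\<dots> = (LINT x|lborel. \<phi> x * partial_deriv i \<psi> x + partial_deriv i \<phi> x * \<psi> x)"
    using \<phi> \<psi> by (simp add: partial_deriv_mult test_function_differentiable)
  also have "\<dots> = abs_L2 \<phi> \<bullet> abs_L2 (partial_deriv i \<psi>) + abs_L2 (partial_deriv i \<phi>) \<bullet> abs_L2 \<psi>"
    using \<phi> \<psi> test_function_partial by (simp add: eq int)
  finally show "abs_L2 \<phi> \<bullet> abs_L2 (partial_deriv i \<psi>) = - ((\<chi> i. abs_L2 (partial_deriv i \<phi>)) $ i \<bullet> abs_L2 \<psi>)" by simp
qed

lemma test_in_H1: "test_function \<Omega> \<phi> \<Longrightarrow> abs_L2 \<phi> \<in> H1 \<Omega>"
  unfolding H1_def using weak_gradient_test test_in_L2_on by blast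

lemma grad_test: "test_function \<Omega> \<phi> \<Longrightarrow> grad \<Omega> (abs_L2 \<phi>) = (\<chi> i. abs_L2 (partial_deriv i \<phi>))"
  by (rule grad_eq[OF weak_gradient_test])

lemma H10_approx:
  assumes "u \<in> H10 \<Omega>"
  obtains \<phi> where "\<And>n. test_function \<Omega> (\<phi> n)" "(\<lambda>n. abs_L2 (\<phi> n)) \<longlonglongrightarrow> u" "(\<lambda>n. grad \<Omega> (abs_L2 (\<phi> n))) \<longlonglongrightarrow> grad \<Omega> u"
  using assms unfolding H10_def by (auto simp: L2_class_test intro!: that)

lemma H10I:
  assumes "u \<in> H1 \<Omega>" "\<And>n. test_function \<Omega> (\<phi> n)" "(\<lambda>n. abs_L2 (\<phi> n)) \<longlonglongrightarrow> u" "(\<lambda>n. grad \<Omega> (abs_L2 (\<phi> n))) \<longlonglongrightarrow> grad \<Omega> u"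
  shows "u \<in> H10 \<Omega>"
  using assms L2_class_test unfolding H10_def by (auto intro!: exI[of _ \<phi>])

lemma test_in_H10: "test_function \<Omega> \<phi> \<Longrightarrow> abs_L2 \<phi> \<in> H10 \<Omega>"
  by (rule H10I[of _ "\<lambda>_. \<phi>"]) (auto intro: test_in_H1)

lemma H10_H1: "u \<in> H10 \<Omega> \<Longrightarrow> u \<in> H1 \<Omega>" by (simp add: H10_def)

lemma H10_L2_on: "u \<in> H10 \<Omega> \<Longrightarrow> u \<in> L2_on \<Omega>" by (simp add: H10_def H1_def)

lemma grad_L2_on: "u \<in> H10 \<Omega> \<Longrightarrow> grad \<Omega> u $ i \<in> L2_on \<Omega>"
  using weak_gradient_grad[OF H10_H1] by (auto simp: weak_gradient_def)

lemma test_add: "test_function \<Omega> \<phi> \<Longrightarrow> test_function \<Omega> \<psi> \<Longrightarrow> test_function \<Omega> (\<lambda>x. \<phi> x + \<psi> x)"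
proof (rule test_functionI[of _ "closure {x. \<phi> x \<noteq> 0} \<union> closure {x. \<psi> x \<noteq> 0}"])
  have "{x. \<phi> x + \<psi> x \<noteq> 0} \<subseteq> {x. \<phi> x \<noteq> 0} \<union> {x. \<psi> x \<noteq> 0}" by auto
  then show "{x. \<phi> x + \<psi> x \<noteq> 0} \<subseteq> closure {x. \<phi> x \<noteq> 0} \<union> closure {x. \<psi> x \<noteq> 0}"
    using closure_subset[of "{x. \<phi> x \<noteq> 0}"] closure_subset[of "{x. \<psi> x \<noteq> 0}"] by blast
qed (auto simp: test_function_def intro: C_k_add compact_Un)

lemma test_scale: "test_function \<Omega> \<phi> \<Longrightarrow> test_function \<Omega> (\<lambda>x. c * \<phi> x)"
  by (rule test_function_supportI) (auto intro: C_k_scale test_function_C_k)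

lemma grad_add: "u \<in> H10 \<Omega> \<Longrightarrow> v \<in> H10 \<Omega> \<Longrightarrow> grad \<Omega> (u + v) = grad \<Omega> u + grad \<Omega> v"
  by (intro grad_eq weak_gradient_add weak_gradient_grad H10_H1)

lemma grad_scale: "u \<in> H10 \<Omega> \<Longrightarrow> grad \<Omega> (c *\<^sub>R u) = c *\<^sub>R grad \<Omega> u"
  by (intro grad_eq weak_gradient_scale weak_gradient_grad H10_H1)

lemma H10_add:
  assumes u: "u \<in> H10 \<Omega>" and v: "v \<in> H10 \<Omega>"
  shows "u + v \<in> H10 \<Omega>"
proof -
  obtain \<phi> where \<phi>: "\<And>n. test_function \<Omega> (\<phi> n)" "(\<lambda>n. abs_L2 (\<phi> n)) \<longlonglongrightarrow> u" "(\<lambda>n. grad \<Omega> (abs_L2 (\<phi> n))) \<longlonglongrightarrow> grad \<Omega> u"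
    using H10_approx[OF u] by blast
  obtain \<psi> where \<psi>: "\<And>n. test_function \<Omega> (\<psi> n)" "(\<lambda>n. abs_L2 (\<psi> n)) \<longlonglongrightarrow> v" "(\<lambda>n. grad \<Omega> (abs_L2 (\<psi> n))) \<longlonglongrightarrow> grad \<Omega> v"
    using H10_approx[OF v] by blast
  have eq: "abs_L2 (\<lambda>x. \<phi> n x + \<psi> n x) = abs_L2 (\<phi> n) + abs_L2 (\<psi> n)" for n
    using \<phi>(1) \<psi>(1) by (intro abs_L2_add test_function_square_integrable) auto
  show ?thesis
  proof (rule H10I[of _ "\<lambda>n x. \<phi> n x + \<psi> n x"])
    show "u + v \<in> H1 \<Omega>"
      using weak_gradient_add[OF weak_gradient_grad[OF H10_H1[OF u]] weak_gradient_grad[OF H10_H1[OF v]]]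
        subspace_add[OF L2_on_subspace H10_L2_on[OF u] H10_L2_on[OF v]] by (auto simp: H1_def)
  qed (use \<phi> \<psi> u v in \<open>auto simp: eq grad_add test_in_H10 intro!: test_add tendsto_add\<close>)
qed

lemma H10_scale:
  assumes u: "u \<in> H10 \<Omega>"
  shows "c *\<^sub>R u \<in> H10 \<Omega>"
proof -
  obtain \<phi> where \<phi>: "\<And>n. test_function \<Omega> (\<phi> n)" "(\<lambda>n. abs_L2 (\<phi> n)) \<longlonglongrightarrow> u" "(\<lambda>n. grad \<Omega> (abs_L2 (\<phi> n))) \<longlonglongrightarrow> grad \<Omega> u"
    using H10_approx[OF u] by blast
  have eq: "abs_L2 (\<lambda>x. c * \<phi> n x) = c *\<^sub>R abs_L2 (\<phi> n)" for n
    using \<phi>(1) by (intro abs_L2_scale test_function_square_integrable) auto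
  show ?thesis
  proof (rule H10I[of _ "\<lambda>n x. c * \<phi> n x"])
    show "c *\<^sub>R u \<in> H1 \<Omega>"
      using weak_gradient_scale[OF weak_gradient_grad[OF H10_H1[OF u]]]
        subspace_scale[OF L2_on_subspace H10_L2_on[OF u]] by (auto simp: H1_def)
  qed (use \<phi> u in \<open>auto simp: eq grad_scale test_in_H10 intro!: test_scale tendsto_scaleR\<close>)
qed

lemma H10_subspace: "subspace (H10 \<Omega>)"
proof (rule subspaceI)
  have "test_function \<Omega> (\<lambda>x. 0)" by (rule test_functionI[of _ "{}"]) (auto simp: C_k_const)
  from H10_scale[OF test_in_H10[OF this], of 0] show "0 \<in> H10 \<Omega>" by simp
qed (auto intro: H10_add H10_scale)

lemma grad_diff: "u \<in> H10 \<Omega> \<Longrightarrow> v \<in> H10 \<Omega> \<Longrightarrow> grad \<Omega> (u - v) = grad \<Omega> u - grad \<Omega> v"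
  using grad_add[of u "(-1) *\<^sub>R v"] grad_scale[of v "-1"] H10_scale[of v "-1"] by simp

text \<open>The gradient passes to the limit because each defining identity is a continuous
  equation; membership in the closure of the test functions then follows by a diagonal choice. This
  is the source of the closedness of the state space \<open>ZS\<close>.\<close>

lemma H10_graph_closed:
  assumes X: "\<And>n. X n \<in> H10 \<Omega>" and u: "X \<longlonglongrightarrow> u" and g: "(\<lambda>n. grad \<Omega> (X n)) \<longlonglongrightarrow> g"
  shows "u \<in> H10 \<Omega>" "grad \<Omega> u = g"
proof -
  have wg: "weak_gradient \<Omega> u g"
    unfolding weak_gradient_iff_inner[OF \<Omega>]
  proof (intro conjI allI impI)
    show "g $ i \<in> L2_on \<Omega>" for i
      by (rule closed_sequentially[OF L2_on_closed _ tendsto_vec_nth[OF g]]) (use grad_L2_on[OF X] in auto)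
    fix \<phi> i assume \<phi>: "test_function \<Omega> \<phi>"
    have "X n \<bullet> abs_L2 (partial_deriv i \<phi>) = - (grad \<Omega> (X n) $ i \<bullet> abs_L2 \<phi>)" for n
      using weak_gradient_grad[OF H10_H1[OF X]] \<phi> unfolding weak_gradient_iff_inner[OF \<Omega>] by blast
    moreover have "(\<lambda>n. X n \<bullet> abs_L2 (partial_deriv i \<phi>)) \<longlonglongrightarrow> u \<bullet> abs_L2 (partial_deriv i \<phi>)"
      by (intro tendsto_intros u)
    moreover have "(\<lambda>n. - (grad \<Omega> (X n) $ i \<bullet> abs_L2 \<phi>)) \<longlonglongrightarrow> - (g $ i \<bullet> abs_L2 \<phi>)"
      by (intro tendsto_intros g)
    ultimately show "u \<bullet> abs_L2 (partial_deriv i \<phi>) = - (g $ i \<bullet> abs_L2 \<phi>)"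
      using LIMSEQ_unique by auto
  qed
  have "u \<in> L2_on \<Omega>" by (rule closed_sequentially[OF L2_on_closed _ u]) (use H10_L2_on[OF X] in auto)
  then have uH1: "u \<in> H1 \<Omega>" using wg by (auto simp: H1_def)
  show gr: "grad \<Omega> u = g" by (rule grad_eq[OF wg])
  define \<eta> where "\<eta> n = inverse (real (Suc n))" for n
  have \<eta>: "\<eta> \<longlonglongrightarrow> 0" "0 < \<eta> n" for n using LIMSEQ_inverse_real_of_nat by (auto simp: \<eta>_def[abs_def])
  have "\<exists>\<phi>. test_function \<Omega> \<phi> \<and> norm (abs_L2 \<phi> - X n) < \<eta> n \<and> norm (grad \<Omega> (abs_L2 \<phi>) - grad \<Omega> (X n)) < \<eta> n" for n
  proof -
    obtain \<phi> where \<phi>: "\<And>n. test_function \<Omega> (\<phi> n)" "(\<lambda>n. abs_L2 (\<phi> n)) \<longlonglongrightarrow> X n" "(\<lambda>m. grad \<Omega> (abs_L2 (\<phi> m))) \<longlonglongrightarrow> grad \<Omega> (X n)"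
      using H10_approx[OF X[of n]] by blast
    have "\<forall>\<^sub>F m in sequentially. norm (abs_L2 (\<phi> m) - X n) < \<eta> n \<and> norm (grad \<Omega> (abs_L2 (\<phi> m)) - grad \<Omega> (X n)) < \<eta> n"
      using tendstoD[OF \<phi>(2) \<eta>(2)[of n]] tendstoD[OF \<phi>(3) \<eta>(2)[of n]] by eventually_elim (simp add: dist_norm)
    then obtain m where "norm (abs_L2 (\<phi> m) - X n) < \<eta> n \<and> norm (grad \<Omega> (abs_L2 (\<phi> m)) - grad \<Omega> (X n)) < \<eta> n"
      by (auto simp: eventually_sequentially)
    then show ?thesis using \<phi>(1) by blast
  qed
  then obtain \<phi> where \<phi>: "\<And>n. test_function \<Omega> (\<phi> n)" "\<And>n. norm (abs_L2 (\<phi> n) - X n) < \<eta> n"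
    "\<And>n. norm (grad \<Omega> (abs_L2 (\<phi> n)) - grad \<Omega> (X n)) < \<eta> n" by metis
  have "(\<lambda>n. (abs_L2 (\<phi> n) - X n) + X n) \<longlonglongrightarrow> 0 + u"
    by (intro tendsto_add u Lim_null_comparison[OF _ \<eta>(1)]) (use \<phi>(2) in \<open>auto intro!: always_eventually less_imp_le\<close>)
  moreover have "(\<lambda>n. (grad \<Omega> (abs_L2 (\<phi> n)) - grad \<Omega> (X n)) + grad \<Omega> (X n)) \<longlonglongrightarrow> 0 + g"
    by (intro tendsto_add g Lim_null_comparison[OF _ \<eta>(1)]) (use \<phi>(3) in \<open>auto intro!: always_eventually less_imp_le\<close>)
  ultimately show "u \<in> H10 \<Omega>" using \<phi>(1) gr by (intro H10I[OF uH1, of \<phi>]) auto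
qed

end

section \<open>The Sobolev inequality\<close>

text \<open>The pointwise hypothesis is on squares so that callers never take roots of extended
  nonnegative functions; the root \<open>r\<close> appears only inside this proof.\<close>

lemma nn_integral_Cauchy_Schwarz_square:
  assumes [measurable]: "w \<in> borel_measurable M" "f \<in> borel_measurable M" "g \<in> borel_measurable M"
    and le: "\<And>x. x \<in> space M \<Longrightarrow> (w x)\<^sup>2 \<le> f x * (g x :: ennreal)"
  shows "(\<integral>\<^sup>+ x. w x \<partial>M)\<^sup>2 \<le> (\<integral>\<^sup>+ x. f x \<partial>M) * (\<integral>\<^sup>+ x. g x \<partial>M)"
proof -
  define r where "r a = (if a = top then top else ennreal (sqrt (enn2real a)))" for a
  have [measurable]: "r \<in> borel_measurable borel" unfolding r_def[abs_def] by measurable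
  have r2: "(r a)\<^sup>2 = a" for a
    by (cases a) (auto simp: r_def power2_eq_square ennreal_mult[symmetric] ennreal_top_mult)
  have "w x \<le> r (f x) * r (g x)" if x: "x \<in> space M" for x
  proof -
    have "(w x)\<^sup>2 \<le> (r (f x) * r (g x))\<^sup>2" using le[OF x] by (simp add: power_mult_distrib r2)
    then show ?thesis
    proof (rule contrapos_pp)
      assume "\<not> w x \<le> r (f x) * r (g x)"
      then have lt: "r (f x) * r (g x) < w x" by simp
      then obtain b where b: "r (f x) * r (g x) = ennreal b" "0 \<le> b"
        by (cases "r (f x) * r (g x)") auto
      have "(ennreal b)\<^sup>2 < (w x)\<^sup>2"
      proof (cases "w x")
        case (real a)
        then show ?thesis using lt b by (auto simp: ennreal_power ennreal_less_iff intro!: power_strict_mono)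
      next
        case top
        then show ?thesis using b by (simp add: power2_eq_square ennreal_top_mult ennreal_mult_less_top)
      qed
      then show "\<not> (w x)\<^sup>2 \<le> (r (f x) * r (g x))\<^sup>2" using b by simp
    qed
  qed
  then have "(\<integral>\<^sup>+ x. w x \<partial>M)\<^sup>2 \<le> (\<integral>\<^sup>+ x. r (f x) * r (g x) \<partial>M)\<^sup>2"
    by (intro power_mono nn_integral_mono) auto
  also have "\<dots> \<le> (\<integral>\<^sup>+ x. (r (f x))\<^sup>2 \<partial>M) * (\<integral>\<^sup>+ x. (r (g x))\<^sup>2 \<partial>M)"
    by (rule Cauchy_Schwarz_nn_integral) measurable
  finally show ?thesis by (simp add: r2)
qed

text \<open>Cauchy-Schwarz is applied once per variable. In the \<open>z\<close> integral
  \<open>h x y\<close> is a constant and the integrand splits as \<open>(h g) f\<close>; this leaves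
  \<open>h x y * G x\<close> against \<open>F y\<close>. In \<open>y\<close> the factor
  \<open>G x\<close> is constant and leaves \<open>H x * G x\<close> against the integral of
  \<open>F\<close>; in \<open>x\<close> the last pair \<open>H\<close>, \<open>G\<close>
  separates.\<close>

lemma Loomis_Whitney_nn_integral:
  fixes w :: "real \<Rightarrow> real \<Rightarrow> real \<Rightarrow> ennreal" and f g h :: "real \<Rightarrow> real \<Rightarrow> ennreal"
  assumes [measurable]: "(\<lambda>(x, y, z). w x y z) \<in> borel_measurable borel"
      "(\<lambda>(x, y). f x y) \<in> borel_measurable borel" "(\<lambda>(x, y). g x y) \<in> borel_measurable borel"
      "(\<lambda>(x, y). h x y) \<in> borel_measurable borel"
    and le: "\<And>x y z. (w x y z)\<^sup>2 \<le> f y z * g x z * h x y"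
  shows "(\<integral>\<^sup>+ x. \<integral>\<^sup>+ y. \<integral>\<^sup>+ z. w x y z \<partial>lborel \<partial>lborel \<partial>lborel)\<^sup>2 \<le>
    (\<integral>\<^sup>+ y. \<integral>\<^sup>+ z. f y z \<partial>lborel \<partial>lborel) * (\<integral>\<^sup>+ x. \<integral>\<^sup>+ z. g x z \<partial>lborel \<partial>lborel) *
    (\<integral>\<^sup>+ x. \<integral>\<^sup>+ y. h x y \<partial>lborel \<partial>lborel)"
proof -
  note borel_prod[symmetric, measurable_cong]
  have w1: "(\<lambda>(x, y, z). w x y z) \<in> borel_measurable (borel \<Otimes>\<^sub>M (borel \<Otimes>\<^sub>M borel))"
    and f1: "(\<lambda>(x, y). f x y) \<in> borel_measurable (borel \<Otimes>\<^sub>M borel)"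
    and g1: "(\<lambda>(x, y). g x y) \<in> borel_measurable (borel \<Otimes>\<^sub>M borel)"
    and h1: "(\<lambda>(x, y). h x y) \<in> borel_measurable (borel \<Otimes>\<^sub>M borel)"
    using assms(1-4) by (simp_all add: borel_prod)
  have [measurable]: "f y \<in> borel_measurable borel" "g y \<in> borel_measurable borel" "h y \<in> borel_measurable borel"
      "w y z \<in> borel_measurable borel" for y z
    using measurable_compose[OF measurable_Pair1' f1] measurable_compose[OF measurable_Pair1' g1]
      measurable_compose[OF measurable_Pair1' h1] measurable_compose[OF measurable_Pair1' measurable_compose[OF measurable_Pair1' w1]]
    by simp_all
  define F where "F y = (\<integral>\<^sup>+ z. f y z \<partial>lborel)" for y
  define G where "G x = (\<integral>\<^sup>+ z. g x z \<partial>lborel)" for x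
  define H where "H x = (\<integral>\<^sup>+ y. h x y \<partial>lborel)" for x
  have [measurable]: "F \<in> borel_measurable borel" "G \<in> borel_measurable borel" "H \<in> borel_measurable borel"
    unfolding F_def[abs_def] G_def[abs_def] H_def[abs_def]
    using f1 g1 h1 by (auto intro!: lborel.borel_measurable_nn_integral)
  have W1m: "(\<lambda>(x, y). \<integral>\<^sup>+ z. w x y z \<partial>lborel) \<in> borel_measurable (borel \<Otimes>\<^sub>M borel)"
  proof -
    have "(\<lambda>((x, y), z). w x y z) = (\<lambda>(x, y, z). w x y z) \<circ> (\<lambda>p. (fst (fst p), snd (fst p), snd p))" by auto
    then have "(\<lambda>((x, y), z). w x y z) \<in> borel_measurable ((borel \<Otimes>\<^sub>M borel) \<Otimes>\<^sub>M borel)"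
      using w1 by (auto intro!: measurable_comp[of _ _ "borel \<Otimes>\<^sub>M (borel \<Otimes>\<^sub>M borel)"])
    then show ?thesis by (auto intro!: lborel.borel_measurable_nn_integral simp: split_beta')
  qed
  have [measurable]: "(\<lambda>y. \<integral>\<^sup>+ z. w x y z \<partial>lborel) \<in> borel_measurable borel" for x
    using measurable_compose[OF measurable_Pair1' W1m] by simp
  have W2m: "(\<lambda>x. \<integral>\<^sup>+ y. \<integral>\<^sup>+ z. w x y z \<partial>lborel \<partial>lborel) \<in> borel_measurable borel"
    using W1m by (auto intro!: lborel.borel_measurable_nn_integral)
  have 1: "(\<integral>\<^sup>+ z. w x y z \<partial>lborel)\<^sup>2 \<le> (h x y * G x) * F y" for x y
  proof -
    have "(\<integral>\<^sup>+ z. w x y z \<partial>lborel)\<^sup>2 \<le> (\<integral>\<^sup>+ z. h x y * g x z \<partial>lborel) * (\<integral>\<^sup>+ z. f y z \<partial>lborel)"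
      by (rule nn_integral_Cauchy_Schwarz_square) (use le in \<open>auto simp: mult_ac\<close>)
    then show ?thesis by (simp add: G_def F_def nn_integral_cmult)
  qed
  have 2: "(\<integral>\<^sup>+ y. \<integral>\<^sup>+ z. w x y z \<partial>lborel \<partial>lborel)\<^sup>2 \<le> (H x * G x) * (\<integral>\<^sup>+ y. F y \<partial>lborel)" for x
  proof -
    have "(\<integral>\<^sup>+ y. \<integral>\<^sup>+ z. w x y z \<partial>lborel \<partial>lborel)\<^sup>2 \<le> (\<integral>\<^sup>+ y. h x y * G x \<partial>lborel) * (\<integral>\<^sup>+ y. F y \<partial>lborel)"
      by (rule nn_integral_Cauchy_Schwarz_square) (use 1 in auto)
    then show ?thesis by (simp add: H_def nn_integral_multc)
  qed
  have "(\<integral>\<^sup>+ x. \<integral>\<^sup>+ y. \<integral>\<^sup>+ z. w x y z \<partial>lborel \<partial>lborel \<partial>lborel)\<^sup>2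
      \<le> (\<integral>\<^sup>+ x. H x \<partial>lborel) * (\<integral>\<^sup>+ x. G x * (\<integral>\<^sup>+ y. F y \<partial>lborel) \<partial>lborel)"
    by (rule nn_integral_Cauchy_Schwarz_square) (use 2 W2m in \<open>auto simp: mult_ac\<close>)
  also have "(\<integral>\<^sup>+ x. G x * (\<integral>\<^sup>+ y. F y \<partial>lborel) \<partial>lborel) = (\<integral>\<^sup>+ x. G x \<partial>lborel) * (\<integral>\<^sup>+ y. F y \<partial>lborel)"
    by (rule nn_integral_multc) measurable
  finally show ?thesis by (simp add: F_def G_def H_def mult_ac)
qed

text \<open>Iterated integrals live on the product type; this bijection preserves Lebesgue measure
  and carries them to \<open>real^3\<close>.\<close>

definition vec3 :: "real \<times> real \<times> real \<Rightarrow> real^3" where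
  "vec3 p = vector [fst p, fst (snd p), snd (snd p)]"

lemma vec3_nth: "vec3 (x, y, z) $ 1 = x" "vec3 (x, y, z) $ 2 = y" "vec3 (x, y, z) $ 3 = z"
  by (simp_all add: vec3_def)

lemma vec3_continuous: "continuous_on UNIV vec3"
proof -
  have "vec3 = (\<lambda>p. fst p *\<^sub>R axis 1 1 + fst (snd p) *\<^sub>R axis 2 1 + snd (snd p) *\<^sub>R axis 3 1)"
    by (auto simp: fun_eq_iff vec3_def vec_eq_iff forall_3 axis_def)
  then show ?thesis by (rule ssubst) (auto intro!: continuous_intros)
qed

lemma vec3_measurable [measurable]: "vec3 \<in> borel_measurable borel"
  by (rule borel_measurable_continuous_onI[OF vec3_continuous])

lemma distr_vec3: "distr lborel borel vec3 = lborel"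
proof (rule lborel_eqI[symmetric])
  fix l u :: "real^3" assume lu: "\<And>b. b \<in> Basis \<Longrightarrow> l \<bullet> b \<le> u \<bullet> b"
  have le: "l $ i \<le> u $ i" for i using lu[of "axis i 1"] by (simp add: inner_axis axis_in_Basis_iff)
  have "vec3 -` box l u = box (l $ 1) (u $ 1) \<times> box (l $ 2) (u $ 2) \<times> box (l $ 3) (u $ 3)"
    by (auto simp: mem_box_cart forall_3 vec3_nth mem_box)
  then have "emeasure (distr lborel borel vec3) (box l u) =
      emeasure lborel (box (l $ 1) (u $ 1) \<times> box (l $ 2) (u $ 2) \<times> box (l $ 3) (u $ 3))"
    by (subst emeasure_distr) auto
  also have "\<dots> = emeasure lborel (box (l $ 1) (u $ 1)) * (emeasure lborel (box (l $ 2) (u $ 2)) * emeasure lborel (box (l $ 3) (u $ 3)))"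
    by (subst lborel_prod[symmetric], subst lborel.emeasure_pair_measure_Times, simp, simp add: borel_Times,
        subst lborel_prod[symmetric], subst lborel.emeasure_pair_measure_Times, simp_all)
  also have "\<dots> = ennreal ((u $ 1 - l $ 1) * ((u $ 2 - l $ 2) * (u $ 3 - l $ 3)))"
    using le by (simp add: ennreal_mult)
  also have "(u $ 1 - l $ 1) * ((u $ 2 - l $ 2) * (u $ 3 - l $ 3)) = (\<Prod>b\<in>Basis. (u - l) \<bullet> b)"
  proof -
    have B: "(Basis :: (real^3) set) = (\<lambda>i. axis i 1) ` UNIV" by (auto simp: Basis_vec_def)
    have "inj (\<lambda>i::3. axis i (1::real))" by (auto simp: inj_on_def axis_eq_axis)
    then have "(\<Prod>b\<in>Basis. (u - l) \<bullet> b) = (\<Prod>i\<in>UNIV. (u - l) \<bullet> axis i 1)" unfolding B by (subst prod.reindex) auto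
    then show ?thesis unfolding UNIV_3 by (simp add: inner_axis)
  qed
  finally show "emeasure (distr lborel borel vec3) (box l u) = ennreal (\<Prod>b\<in>Basis. (u - l) \<bullet> b)" .
qed simp

lemma nn_integral_vec3:
  assumes [measurable]: "f \<in> borel_measurable borel"
  shows "(\<integral>\<^sup>+ x. f x \<partial>lborel) = (\<integral>\<^sup>+ x. \<integral>\<^sup>+ y. \<integral>\<^sup>+ z. f (vec3 (x, y, z)) \<partial>lborel \<partial>lborel \<partial>lborel)"
proof -
  have "(\<integral>\<^sup>+ x. f x \<partial>lborel) = (\<integral>\<^sup>+ p. f (vec3 p) \<partial>lborel)"
    by (subst distr_vec3[symmetric]) (simp add: nn_integral_distr)
  also have "\<dots> = (\<integral>\<^sup>+ p. f (vec3 p) \<partial>(lborel \<Otimes>\<^sub>M lborel))" by (simp add: lborel_prod)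
  also have "\<dots> = (\<integral>\<^sup>+ x. \<integral>\<^sup>+ q. f (vec3 (x, q)) \<partial>lborel \<partial>lborel)"
    by (rule lborel.nn_integral_fst[symmetric]) (simp add: lborel_prod)
  also have "\<dots> = (\<integral>\<^sup>+ x. \<integral>\<^sup>+ q. f (vec3 (x, q)) \<partial>(lborel \<Otimes>\<^sub>M lborel) \<partial>lborel)" by (simp add: lborel_prod)
  also have "\<dots> = (\<integral>\<^sup>+ x. \<integral>\<^sup>+ y. \<integral>\<^sup>+ z. f (vec3 (x, y, z)) \<partial>lborel \<partial>lborel \<partial>lborel)"
    by (intro nn_integral_cong lborel.nn_integral_fst[symmetric]) (simp add: lborel_prod)
  finally show ?thesis .
qed

text \<open>The fundamental theorem of calculus for \<phi>^4 along the line, started at a point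
  outside the support. The power 4 is the one for which Loomis-Whitney, applied to \<phi>^6,
  reproduces the integral of \<phi>^6 on the right with an exponent that can be cancelled.\<close>

lemma test_function_line_bound:
  assumes \<phi>: "test_function \<Omega> \<phi>"
  shows "ennreal (\<phi> x ^ 4) \<le> (\<integral>\<^sup>+ t. ennreal (4 * \<bar>\<phi> (x + (t - x $ i) *\<^sub>R axis i 1)\<bar> ^ 3 * \<bar>partial_deriv i \<phi> (x + (t - x $ i) *\<^sub>R axis i 1)\<bar>) \<partial>lborel)"
proof -
  define y where "y t = x + (t - x $ i) *\<^sub>R axis i 1" for t
  define g where "g t = \<phi> (y t) ^ 4" for t
  define g' where "g' t = 4 * \<phi> (y t) ^ 3 * partial_deriv i \<phi> (y t)" for t
  obtain r c where rc: "0 < r" "0 \<le> c" "\<And>x. \<bar>\<phi> x\<bar> \<le> c * indicator (cball 0 r) x" using test_function_bounded[OF \<phi>] by blast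
  have yt: "y t = (x - (x $ i) *\<^sub>R axis i 1) + t *\<^sub>R axis i 1" for t by (simp add: y_def algebra_simps)
  have dphi: "((\<lambda>t. \<phi> (y t)) has_real_derivative partial_deriv i \<phi> (y t)) (at t)" for t
    unfolding yt by (rule test_function_line_derivative[OF test_function_differentiable[OF \<phi>]])
  have deriv: "(g has_real_derivative g' t) (at t)" for t
    unfolding g_def g'_def using dphi[of t] by (auto intro!: derivative_eq_intros)
  have cont: "continuous_on UNIV g'"
    unfolding g'_def y_def
    by (intro continuous_intros continuous_on_compose2[OF test_function_continuous[OF \<phi>]]
        continuous_on_compose2[OF test_function_continuous[OF test_function_partial[OF \<phi>]]]) auto
  \<comment> \<open>The \<open>i\<close>-th coordinate of \<open>y a\<close> is \<open>a\<close>,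
    which lies below \<open>-r\<close>, so \<open>y a\<close> is outside the ball carrying \<phi>;
    the minimum also keeps \<open>a\<close> to the left of \<open>x $ i\<close>.\<close>
  define a where "a = min (x $ i) (- r - 1)"
  have "\<phi> (y a) = 0"
  proof -
    have "y a $ i = a" by (simp add: y_def)
    then have "\<bar>a\<bar> \<le> norm (y a)" using component_le_norm_cart[of "y a" i] by simp
    then have "y a \<notin> cball 0 r" using rc(1) by (auto simp: a_def)
    then show ?thesis using rc(3)[of "y a"] by simp
  qed
  then have ga: "g a = 0" by (simp add: g_def)
  have ax: "a \<le> x $ i" by (simp add: a_def)
  have yx: "y (x $ i) = x" by (simp add: y_def)
  have "has_bochner_integral lborel (\<lambda>t. g' t * indicator {a..x $ i} t) (g (x $ i) - g a)"
    using deriv cont ax by (intro has_bochner_integral_FTC_Icc_real) (auto simp: continuous_on_eq_continuous_at)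
  then have "norm (g (x $ i)) \<le> (\<integral>\<^sup>+ t. norm (g' t * indicator {a..x $ i} t) \<partial>lborel)"
    using integral_norm_bound_ennreal[of lborel "\<lambda>t. g' t * indicator {a..x $ i} t"] ga
    by (simp add: has_bochner_integral_iff)
  also have "\<dots> \<le> (\<integral>\<^sup>+ t. ennreal (4 * \<bar>\<phi> (y t)\<bar> ^ 3 * \<bar>partial_deriv i \<phi> (y t)\<bar>) \<partial>lborel)"
    by (intro nn_integral_mono ennreal_leI) (auto simp: g'_def indicator_def abs_mult power_abs)
  finally show ?thesis unfolding g_def yx y_def by simp
qed

text \<open>Gagliardo and Nirenberg: along each coordinate line \<open>\<phi>\<^sup>4\<close> is bounded by the integral of
  \<open>4 \<bar>\<phi>\<bar>\<^sup>3 \<bar>\<partial>\<^sub>i \<phi>\<bar>\<close>, and the Loomis--Whitney inequality bounds the integral of \<open>\<phi>\<^sup>6\<close>.\<close>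

lemma Sobolev_test_function:
  assumes \<phi>: "test_function \<Omega> \<phi>"
  shows "(\<integral>\<^sup>+ x. ennreal (\<phi> x ^ 6) \<partial>lborel) \<le>
    ennreal ((16 * (\<Sum>i\<in>UNIV. LINT x|lborel. (partial_deriv i \<phi> x)\<^sup>2)) ^ 3)"
proof -
  have [measurable]: "\<phi> \<in> borel_measurable borel" by (rule test_function_borel[OF \<phi>])
  have [measurable]: "partial_deriv i \<phi> \<in> borel_measurable borel" for i
    by (rule test_function_borel[OF test_function_partial[OF \<phi>]])
  define D where "D i x = ennreal (4 * \<bar>\<phi> x\<bar> ^ 3 * \<bar>partial_deriv i \<phi> x\<bar>)" for i x
  have [measurable]: "D i \<in> borel_measurable borel" for i unfolding D_def[abs_def] by measurable
  define w where "w x y z = ennreal (\<phi> (vec3 (x, y, z)) ^ 6)" for x y z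
  define f where "f y z = (\<integral>\<^sup>+ x. D 1 (vec3 (x, y, z)) \<partial>lborel)" for y z
  define g where "g x z = (\<integral>\<^sup>+ y. D 2 (vec3 (x, y, z)) \<partial>lborel)" for x z
  define h where "h x y = (\<integral>\<^sup>+ z. D 3 (vec3 (x, y, z)) \<partial>lborel)" for x y
  have line: "ennreal (\<phi> v ^ 4) \<le> (\<integral>\<^sup>+ t. D i (v + (t - v $ i) *\<^sub>R axis i 1) \<partial>lborel)" for v i
    unfolding D_def by (rule test_function_line_bound[OF \<phi>])
  have shift: "vec3 (x, y, z) + (t - x) *\<^sub>R axis 1 1 = vec3 (t, y, z)"
    "vec3 (x, y, z) + (t - y) *\<^sub>R axis 2 1 = vec3 (x, t, z)"
    "vec3 (x, y, z) + (t - z) *\<^sub>R axis 3 1 = vec3 (x, y, t)" for x y z t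
    by (simp_all add: vec_eq_iff forall_3 vec3_nth axis_def)
  have fb: "ennreal (\<phi> (vec3 (x, y, z)) ^ 4) \<le> f y z" for x y z
    using line[of "vec3 (x, y, z)" 1] by (simp add: f_def vec3_nth shift)
  have gb: "ennreal (\<phi> (vec3 (x, y, z)) ^ 4) \<le> g x z" for x y z
    using line[of "vec3 (x, y, z)" 2] by (simp add: g_def vec3_nth shift)
  have hb: "ennreal (\<phi> (vec3 (x, y, z)) ^ 4) \<le> h x y" for x y z
    using line[of "vec3 (x, y, z)" 3] by (simp add: h_def vec3_nth shift)
  have wle: "(w x y z)\<^sup>2 \<le> f y z * g x z * h x y" for x y z
  proof -
    let ?a = "\<phi> (vec3 (x, y, z))"
    have "(w x y z)\<^sup>2 = ennreal (?a ^ 4) * ennreal (?a ^ 4) * ennreal (?a ^ 4)"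
      by (simp add: w_def ennreal_power ennreal_mult[symmetric] flip: power_mult power_add)
    also have "\<dots> \<le> f y z * g x z * h x y" by (intro mult_mono fb gb hb) auto
    finally show ?thesis .
  qed
  have cont3: "continuous_on UNIV (\<lambda>p. vec3 (k p))" if "continuous_on UNIV k" for k :: "'b::topological_space \<Rightarrow> _"
    by (rule continuous_on_compose2[OF vec3_continuous that]) auto
  have m3: "(\<lambda>p. D i (vec3 (k p))) \<in> borel_measurable borel" if "continuous_on UNIV k" for i and k :: "'b::topological_space \<Rightarrow> _"
    by (rule measurable_compose[OF borel_measurable_continuous_onI[OF cont3[OF that]]]) measurable
  have par: "(\<lambda>q. \<integral>\<^sup>+ t. D i (vec3 (k q t)) \<partial>lborel) \<in> borel_measurable borel"
    if "continuous_on UNIV (\<lambda>p. k (fst p) (snd p))" for i and k :: "'b::second_countable_topology \<Rightarrow> real \<Rightarrow> _"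
  proof -
    have "(\<lambda>p. D i (vec3 (k (fst p) (snd p)))) \<in> borel_measurable (borel \<Otimes>\<^sub>M lborel)"
      using m3[OF that, of i] by (simp add: borel_prod[symmetric] cong: measurable_cong_sets)
    then have "(\<lambda>(q, t). D i (vec3 (k q t))) \<in> borel_measurable (borel \<Otimes>\<^sub>M lborel)" by (simp add: split_beta')
    then show ?thesis by (rule lborel.borel_measurable_nn_integral)
  qed
  have fm: "(\<lambda>(y, z). f y z) \<in> borel_measurable borel" and gm: "(\<lambda>(y, z). g y z) \<in> borel_measurable borel"
    and hm: "(\<lambda>(y, z). h y z) \<in> borel_measurable borel"
    unfolding f_def g_def h_def split_beta' by (intro par continuous_intros)+
  have wm: "(\<lambda>(x, y, z). w x y z) \<in> borel_measurable borel" 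
  proof -
    have "(\<lambda>(x, y, z). w x y z) = (\<lambda>p. ennreal (\<phi> (vec3 p) ^ 6))" by (auto simp: w_def)
    then show ?thesis by simp
  qed
  define P where "P = (\<integral>\<^sup>+ x. ennreal (\<phi> x ^ 6) \<partial>lborel)"
  have I1: "(\<integral>\<^sup>+ y. \<integral>\<^sup>+ z. f y z \<partial>lborel \<partial>lborel) = (\<integral>\<^sup>+ x. D 1 x \<partial>lborel)"
  proof -
    have "(\<integral>\<^sup>+ z. f y z \<partial>lborel) = (\<integral>\<^sup>+ x. \<integral>\<^sup>+ z. D 1 (vec3 (x, y, z)) \<partial>lborel \<partial>lborel)" for y
      unfolding f_def
      by (rule lborel_pair.Fubini') (auto simp: lborel_prod split_beta' intro!: m3 continuous_intros)
    moreover have "(\<integral>\<^sup>+ y. \<integral>\<^sup>+ x. \<integral>\<^sup>+ z. D 1 (vec3 (x, y, z)) \<partial>lborel \<partial>lborel \<partial>lborel)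
      = (\<integral>\<^sup>+ x. \<integral>\<^sup>+ y. \<integral>\<^sup>+ z. D 1 (vec3 (x, y, z)) \<partial>lborel \<partial>lborel \<partial>lborel)"
      by (rule lborel_pair.Fubini') (auto simp: lborel_prod split_beta' intro!: par continuous_intros)
    ultimately show ?thesis by (simp add: nn_integral_vec3)
  qed
  have I2: "(\<integral>\<^sup>+ x. \<integral>\<^sup>+ z. g x z \<partial>lborel \<partial>lborel) = (\<integral>\<^sup>+ x. D 2 x \<partial>lborel)"
  proof -
    have "(\<integral>\<^sup>+ z. g x z \<partial>lborel) = (\<integral>\<^sup>+ y. \<integral>\<^sup>+ z. D 2 (vec3 (x, y, z)) \<partial>lborel \<partial>lborel)" for x
      unfolding g_def
      by (rule lborel_pair.Fubini') (auto simp: lborel_prod split_beta' intro!: m3 continuous_intros)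
    then show ?thesis by (simp add: nn_integral_vec3)
  qed
  have I3: "(\<integral>\<^sup>+ x. \<integral>\<^sup>+ y. h x y \<partial>lborel \<partial>lborel) = (\<integral>\<^sup>+ x. D 3 x \<partial>lborel)"
    by (simp add: h_def nn_integral_vec3)
  have PD: "P\<^sup>2 \<le> (\<integral>\<^sup>+ x. D 1 x \<partial>lborel) * (\<integral>\<^sup>+ x. D 2 x \<partial>lborel) * (\<integral>\<^sup>+ x. D 3 x \<partial>lborel)"
    using Loomis_Whitney_nn_integral[OF wm fm gm hm wle] unfolding I1 I2 I3 P_def w_def
    by (simp add: nn_integral_vec3)
  define p where "p = (LINT x|lborel. \<phi> x ^ 6)"
  define d where "d i = (LINT x|lborel. (partial_deriv i \<phi> x)\<^sup>2)" for i
  have int6: "integrable lborel (\<lambda>x. \<phi> x ^ 6)"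
    using test_function_integrable[OF test_function_mult[OF \<phi> C_k_power[OF test_function_C_k[OF \<phi>], of _ 5]]]
    by (simp add: power_Suc[symmetric] del: power_Suc)
  have int2: "integrable lborel (\<lambda>x. (partial_deriv i \<phi> x)\<^sup>2)" for i
    using test_function_integrable[OF test_function_mult[OF test_function_partial[OF \<phi>] test_function_C_k[OF test_function_partial[OF \<phi>]]]]
    by (simp add: power2_eq_square)
  have Pp: "P = ennreal p" unfolding P_def p_def by (rule nn_integral_eq_integral[OF int6]) simp
  have p0: "0 \<le> p" and d0: "0 \<le> d i" for i unfolding p_def d_def by (auto intro!: integral_nonneg_AE)
  have Dle: "(\<integral>\<^sup>+ x. D i x \<partial>lborel)\<^sup>2 \<le> ennreal (16 * p * d i)" for i
  proof -
    have "(\<integral>\<^sup>+ x. D i x \<partial>lborel)\<^sup>2 \<le> (\<integral>\<^sup>+ x. ennreal (16 * \<phi> x ^ 6) \<partial>lborel) * (\<integral>\<^sup>+ x. ennreal ((partial_deriv i \<phi> x)\<^sup>2) \<partial>lborel)"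
    proof (rule nn_integral_Cauchy_Schwarz_square)
      show "(D i x)\<^sup>2 \<le> ennreal (16 * \<phi> x ^ 6) * ennreal ((partial_deriv i \<phi> x)\<^sup>2)" for x
        by (simp add: D_def ennreal_power ennreal_mult[symmetric] power_mult_distrib flip: power_mult)
    qed measurable
    also have "(\<integral>\<^sup>+ x. ennreal (16 * \<phi> x ^ 6) \<partial>lborel) = ennreal (16 * p)"
      unfolding p_def using int6 by (subst nn_integral_eq_integral) auto
    also have "(\<integral>\<^sup>+ x. ennreal ((partial_deriv i \<phi> x)\<^sup>2) \<partial>lborel) = ennreal (d i)"
      unfolding d_def using int2 by (subst nn_integral_eq_integral) auto
    finally show ?thesis using p0 d0 by (simp add: ennreal_mult[symmetric])
  qed
  \<comment> \<open>The bounds \<open>Dle\<close> concern squares of the three integrals, so the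
    Loomis-Whitney estimate is squared once more. This gives
    \<open>p^4 \<le> (16 p)^3 d1 d2 d3\<close>, and since \<open>p\<close> is finite by compact
    support, \<open>p^3\<close> can be cancelled.\<close>
  have "(P\<^sup>2)\<^sup>2 \<le> ((\<integral>\<^sup>+ x. D 1 x \<partial>lborel) * (\<integral>\<^sup>+ x. D 2 x \<partial>lborel) * (\<integral>\<^sup>+ x. D 3 x \<partial>lborel))\<^sup>2"
    by (intro power_mono PD) simp
  also have "\<dots> \<le> ennreal (16 * p * d 1) * ennreal (16 * p * d 2) * ennreal (16 * p * d 3)"
    unfolding power_mult_distrib by (intro mult_mono Dle) auto
  finally have "ennreal ((p\<^sup>2)\<^sup>2) \<le> ennreal ((16 * p * d 1) * (16 * p * d 2) * (16 * p * d 3))"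
    using p0 d0 by (simp add: Pp ennreal_power ennreal_mult[symmetric])
  then have p4: "p ^ 4 \<le> (16 * p * d 1) * (16 * p * d 2) * (16 * p * d 3)"
    using p0 d0 by (simp add: ennreal_le_iff flip: power_mult)
  have "p \<le> (16 * (\<Sum>i\<in>UNIV. d i)) ^ 3"
  proof (cases "p = 0")
    case True then show ?thesis using d0 by (simp add: sum_nonneg)
  next
    case False
    then have pp: "0 < p" using p0 by simp
    have "p ^ 3 * p \<le> p ^ 3 * (16 ^ 3 * (d 1 * d 2 * d 3))"
      using p4 by (simp add: power_numeral_reduce algebra_simps)
    then have "p \<le> 16 ^ 3 * (d 1 * d 2 * d 3)" using pp by (simp only: mult_le_cancel_left_pos zero_less_power)
    also have "d 1 * d 2 * d 3 \<le> (\<Sum>i\<in>UNIV. d i) * (\<Sum>i\<in>UNIV. d i) * (\<Sum>i\<in>UNIV. d i)"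
      using d0 by (intro mult_mono member_le_sum mult_nonneg_nonneg sum_nonneg) auto
    finally show ?thesis by (simp add: power3_eq_cube)
  qed
  then show ?thesis unfolding P_def[symmetric] Pp d_def by (rule ennreal_leI)
qed

lemma norm_vec_L2_square: "(norm (g :: L2^3))\<^sup>2 = (\<Sum>i\<in>UNIV. (norm (g $ i))\<^sup>2)"
  unfolding norm_vec_def L2_set_def by (simp add: sum_nonneg)

text \<open>Density of the test functions and Fatou along an almost everywhere convergent
  subsequence. The constant 4 is the root of the 16 that the factor 4 in the line bound leaves
  behind.\<close>

lemma Sobolev_H10:
  assumes \<Omega>: "open \<Omega>" and u: "u \<in> H10 \<Omega>"
  shows "(\<integral>\<^sup>+ x. ennreal (rep_L2 u x ^ 6) \<partial>lebesgue) \<le> ennreal ((4 * norm (grad \<Omega> u)) ^ 6)"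
proof -
  have test: "(\<integral>\<^sup>+ x. ennreal (rep_L2 (abs_L2 \<phi>) x ^ 6) \<partial>lebesgue) \<le> ennreal ((4 * norm (grad \<Omega> (abs_L2 \<phi>))) ^ 6)"
    if \<phi>: "test_function \<Omega> \<phi>" for \<phi>
  proof -
    have "(norm (abs_L2 (partial_deriv i \<phi>)))\<^sup>2 = (LINT x|lborel. (partial_deriv i \<phi> x)\<^sup>2)" for i
    proof -
      have [measurable]: "partial_deriv i \<phi> \<in> borel_measurable borel"
        by (rule test_function_borel[OF test_function_partial[OF \<phi>]])
      have "(norm (abs_L2 (partial_deriv i \<phi>)))\<^sup>2 = (LINT x|lebesgue. (partial_deriv i \<phi> x)\<^sup>2)"
        unfolding norm_L2_square
        using rep_abs_L2[OF test_function_square_integrable[OF test_function_partial[OF \<phi>]], of i]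
          test_function_lebesgue[OF test_function_partial[OF \<phi>]]
        by (intro integral_cong_AE) auto
      then show ?thesis by (subst (asm) integral_completion) measurable
    qed
    then have eq: "16 * (\<Sum>i\<in>UNIV. LINT x|lborel. (partial_deriv i \<phi> x)\<^sup>2) = (4 * norm (grad \<Omega> (abs_L2 \<phi>)))\<^sup>2"
      by (simp add: grad_test[OF \<Omega> \<phi>] power_mult_distrib norm_vec_L2_square)
    have "(\<integral>\<^sup>+ x. ennreal (rep_L2 (abs_L2 \<phi>) x ^ 6) \<partial>lebesgue) = (\<integral>\<^sup>+ x. ennreal (\<phi> x ^ 6) \<partial>lebesgue)"
      using rep_abs_L2[OF test_function_square_integrable[OF \<phi>]] by (intro nn_integral_cong_AE) auto
    also have "\<dots> = (\<integral>\<^sup>+ x. ennreal (\<phi> x ^ 6) \<partial>lborel)" by (rule nn_integral_completion)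
    also have "\<dots> \<le> ennreal (((4 * norm (grad \<Omega> (abs_L2 \<phi>)))\<^sup>2) ^ 3)"
      using Sobolev_test_function[OF \<phi>] unfolding eq .
    finally show ?thesis by (simp flip: power_mult)
  qed
  obtain \<phi> where \<phi>: "\<And>n. test_function \<Omega> (\<phi> n)" "(\<lambda>n. abs_L2 (\<phi> n)) \<longlonglongrightarrow> u" "(\<lambda>n. grad \<Omega> (abs_L2 (\<phi> n))) \<longlonglongrightarrow> grad \<Omega> u"
    using H10_approx[OF \<Omega> u] by blast
  obtain r :: "nat \<Rightarrow> nat" where r: "strict_mono r" "AE x in lebesgue. (\<lambda>n. rep_L2 (abs_L2 (\<phi> (r n))) x) \<longlonglongrightarrow> rep_L2 u x"
    using L2_tendsto_AE_subseq[OF \<phi>(2)] by blast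
  have lim: "(\<lambda>n. grad \<Omega> (abs_L2 (\<phi> (r n)))) \<longlonglongrightarrow> grad \<Omega> u"
    using LIMSEQ_subseq_LIMSEQ[OF \<phi>(3) r(1)] unfolding o_def .
  show ?thesis
  proof (rule Fatou_LIMSEQ)
    show "AE x in lebesgue. (\<lambda>n. rep_L2 (abs_L2 (\<phi> (r n))) x ^ 6) \<longlonglongrightarrow> rep_L2 u x ^ 6"
      using r(2) by eventually_elim (intro tendsto_intros)
    show "\<forall>\<^sub>F n in sequentially. (\<integral>\<^sup>+ x. ennreal (rep_L2 (abs_L2 (\<phi> (r n))) x ^ 6) \<partial>lebesgue)
        \<le> ennreal ((4 * norm (grad \<Omega> (abs_L2 (\<phi> (r n))))) ^ 6)"
      using test[OF \<phi>(1)] by simp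
    show "(\<lambda>n. ennreal ((4 * norm (grad \<Omega> (abs_L2 (\<phi> (r n))))) ^ 6)) \<longlonglongrightarrow> ennreal ((4 * norm (grad \<Omega> u)) ^ 6)"
      by (intro tendsto_ennrealI tendsto_intros lim)
  qed measurable
qed

section \<open>Semigroups and mild solutions\<close>

text \<open>A gliding hump in place of Baire's theorem, which keeps the argument inside the
  subspace. With operator norms \<open>N (n k) > 4^k\<close>, vectors of size \<open>3^(-k)\<close>
  almost attaining them are added or subtracted; of \<open>L (x + \<xi>)\<close> and
  \<open>L (x - \<xi>)\<close> at least one is as large as \<open>L \<xi>\<close>, because their
  difference is \<open>2 L \<xi>\<close>. The later terms are too short to undo the growth.\<close>

lemma uniform_boundedness_on_subspace:
  fixes L :: "nat \<Rightarrow> 'a::banach \<Rightarrow> 'b::real_normed_vector"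
  assumes S: "subspace S" "closed S"
    and add: "\<And>n x y. x \<in> S \<Longrightarrow> y \<in> S \<Longrightarrow> L n (x + y) = L n x + L n y"
    and scale: "\<And>n c x. x \<in> S \<Longrightarrow> L n (c *\<^sub>R x) = c *\<^sub>R L n x"
    and bdd: "\<And>n. \<exists>M. \<forall>x\<in>S. norm (L n x) \<le> M * norm x"
    and ptw: "\<And>x. x \<in> S \<Longrightarrow> \<exists>c. \<forall>n. norm (L n x) \<le> c"
  shows "\<exists>M. \<forall>n. \<forall>x\<in>S. norm (L n x) \<le> M * norm x"
proof (rule ccontr)
  assume contra: "\<not> ?thesis"
  have zero: "0 \<in> S" using S(1) by (rule subspace_0)
  define V where "V n = (\<lambda>x. norm (L n x)) ` {x \<in> S. norm x \<le> 1}" for n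
  define N where "N n = Sup (V n)" for n
  have L0: "L n 0 = 0" for n using scale[OF zero, of n 0] by simp
  have ne: "V n \<noteq> {}" for n using zero by (auto simp: V_def)
  have above: "bdd_above (V n)" for n
  proof -
    obtain M where M: "\<forall>x\<in>S. norm (L n x) \<le> M * norm x" using bdd by blast
    have "norm (L n x) \<le> \<bar>M\<bar>" if "x \<in> S" "norm x \<le> 1" for x
    proof -
      have "norm (L n x) \<le> M * norm x" using M that by simp
      also have "\<dots> \<le> \<bar>M\<bar> * norm x" by (intro mult_right_mono) auto
      also have "\<dots> \<le> \<bar>M\<bar> * 1" using that by (intro mult_left_mono) auto
      finally show ?thesis by simp
    qed
    then show ?thesis by (auto simp: V_def intro!: bdd_aboveI)
  qed
  have N: "norm (L n x) \<le> N n * norm x" if "x \<in> S" for n x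
  proof (cases "x = 0")
    case False
    have "norm (L n ((1 / norm x) *\<^sub>R x)) \<in> V n"
      using that S(1) False by (auto simp: V_def intro!: imageI subspace_scale)
    then have "norm (L n ((1 / norm x) *\<^sub>R x)) \<le> N n"
      unfolding N_def using above by (intro cSup_upper)
    then show ?thesis using scale[OF that] False by (simp add: field_simps)
  qed (simp add: L0)
  have N0: "0 \<le> N n" for n
  proof -
    have "norm (L n 0) \<in> V n" using zero by (auto simp: V_def simp del: L0 intro!: imageI)
    then show ?thesis unfolding N_def using cSup_upper[OF _ above] L0 by fastforce
  qed
  have "\<exists>n. N n > 4 ^ k" for k :: nat
  proof (rule ccontr)
    assume "\<not> ?thesis"
    then have "N n \<le> 4 ^ k" for n by (simp add: not_less)
    then have "norm (L n x) \<le> 4 ^ k * norm x" if "x \<in> S" for n x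
      using N[OF that, of n] by (meson mult_right_mono norm_ge_zero order_trans)
    then show False using contra by blast
  qed
  then obtain n where n: "\<And>k. N (n k) > 4 ^ k" by metis
  have "\<exists>\<xi>\<in>S. norm \<xi> \<le> (1/3) ^ k \<and> norm (L (n k) \<xi>) \<ge> 2/3 * (1/3) ^ k * N (n k)" for k
  proof -
    have "0 < (4::real) ^ k" by simp
    then have "2/3 * N (n k) < N (n k)" using n[of k] by linarith
    then obtain y where "y \<in> V (n k)" "2/3 * N (n k) < y"
      unfolding N_def using less_cSup_iff[OF ne above] by blast
    then obtain z where "z \<in> S" "norm z \<le> 1" "2/3 * N (n k) < norm (L (n k) z)"
      by (auto simp: V_def)
    then show ?thesis
      using S(1) by (intro bexI[of _ "(1/3) ^ k *\<^sub>R z"]) (auto simp: scale subspace_scale mult_left_mono)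
  qed
  then obtain \<xi> where \<xi>: "\<And>k. \<xi> k \<in> S" "\<And>k. norm (\<xi> k) \<le> (1/3) ^ k"
      "\<And>k. norm (L (n k) (\<xi> k)) \<ge> 2/3 * (1/3) ^ k * N (n k)" by metis
  \<comment> \<open>The sign of each increment is the one that keeps the image of the new partial
    sum large.\<close>
  define x where "x = rec_nat 0 (\<lambda>k y. if norm (L (n k) (y + \<xi> k)) \<ge> 2/3 * (1/3) ^ k * N (n k)
      then y + \<xi> k else y - \<xi> k)"
  have x0: "x 0 = 0" by (simp add: x_def)
  have xS: "x (Suc k) = (if norm (L (n k) (x k + \<xi> k)) \<ge> 2/3 * (1/3) ^ k * N (n k)
      then x k + \<xi> k else x k - \<xi> k)" for k by (simp add: x_def)
  have xin: "x k \<in> S" for k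
    by (induction k) (use zero S(1) \<xi>(1) in \<open>auto simp: x0 xS subspace_add subspace_diff\<close>)
  have diff: "L m (a - b) = L m a - L m b" if "a \<in> S" "b \<in> S" for m a b
    using add[of a "(-1) *\<^sub>R b" m] scale[of b m "-1"] that subspace_scale[OF S(1) that(2), of "-1"] by simp
  have big: "norm (L (n k) (x (Suc k))) \<ge> 2/3 * (1/3) ^ k * N (n k)" for k
  proof (cases "norm (L (n k) (x k + \<xi> k)) \<ge> 2/3 * (1/3) ^ k * N (n k)")
    case False
    have "2 * norm (L (n k) (\<xi> k)) = norm (L (n k) (x k + \<xi> k) - L (n k) (x k - \<xi> k))"
    proof -
      have "L (n k) (x k + \<xi> k) - L (n k) (x k - \<xi> k) = 2 *\<^sub>R L (n k) (\<xi> k)"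
        using add[OF xin \<xi>(1)] diff[OF xin \<xi>(1)] by (simp add: scaleR_2)
      then show ?thesis by simp
    qed
    also have "\<dots> \<le> norm (L (n k) (x k + \<xi> k)) + norm (L (n k) (x k - \<xi> k))"
      by (rule norm_triangle_ineq4)
    finally show ?thesis using False \<xi>(3)[of k] by (simp add: xS)
  qed (simp add: xS)
  define d where "d k = x (Suc k) - x k" for k
  have d: "norm (d k) \<le> (1/3) ^ k" for k using \<xi>(2)[of k] by (auto simp: d_def xS)
  have geo: "summable (\<lambda>k. (1/3 :: real) ^ k)" by (simp add: summable_geometric)
  have sd: "summable d" by (rule summable_comparison_test'[OF geo, of 0]) (simp add: d)
  have xsum: "x k = sum d {..<k}" for k
    by (induction k) (auto simp: d_def x0)
  define z where "z = suminf d"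
  have "(\<lambda>k. x k) \<longlonglongrightarrow> z" using summable_LIMSEQ[OF sd] by (simp add: xsum z_def)
  then have zS: "z \<in> S" using closed_sequentially[OF S(2)] xin by blast
  have tail: "norm (z - x (Suc k)) \<le> 1/2 * (1/3) ^ k" for k
  proof -
    have "z - x (Suc k) = (\<Sum>j. d (j + Suc k))"
      unfolding z_def using suminf_split_initial_segment[OF sd, of "Suc k"] by (simp add: xsum)
    also have "norm \<dots> \<le> (\<Sum>j. (1/3) ^ (j + Suc k))"
    proof (rule norm_suminf_le)
      show "summable (\<lambda>j. (1/3::real) ^ (j + Suc k))"
        using summable_ignore_initial_segment[OF geo, of "Suc k"] .
    qed (rule d)
    also have "\<dots> = 1/2 * (1/3) ^ k"
    proof -
      have "(\<lambda>j. (1/3::real) ^ Suc k * (1/3) ^ j) sums ((1/3) ^ Suc k * (1 / (1 - 1/3)))"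
        by (intro sums_mult geometric_sums) simp
      then show ?thesis by (simp add: sums_iff power_add mult.commute)
    qed
    finally show ?thesis .
  qed
  obtain c where c: "\<And>m. norm (L m z) \<le> c" using ptw[OF zS] by blast
  have bound: "1/6 * (4/3) ^ k \<le> c" for k
  proof -
    have "norm (L (n k) (z - x (Suc k))) \<le> N (n k) * (1/2 * (1/3) ^ k)"
      using N[of "z - x (Suc k)" "n k"] tail[of k] N0[of "n k"] subspace_diff[OF S(1) zS xin]
      by (meson mult_left_mono order_trans)
    moreover have "norm (L (n k) (x (Suc k))) \<le> norm (L (n k) z) + norm (L (n k) (z - x (Suc k)))"
      using diff[OF zS xin, of "n k" "Suc k"] by (metis norm_triangle_sub norm_minus_commute)
    \<comment> \<open>The factor 1/6 is what remains of 2/3, the share attained at step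
      \<open>k\<close>, after the tail has taken 1/2.\<close>
    ultimately have "1/6 * (1/3) ^ k * N (n k) \<le> c"
      using big[of k] c[of "n k"] by (simp add: algebra_simps)
    moreover have "1/6 * (1/3) ^ k * 4 ^ k \<le> 1/6 * (1/3) ^ k * N (n k)"
      using n[of k] by (intro mult_left_mono) auto
    moreover have "(1/3::real) ^ k * 4 ^ k = (4/3) ^ k" by (simp add: power_divide)
    ultimately show ?thesis by (simp add: mult.assoc)
  qed
  obtain k where "(4/3 :: real) ^ k > 6 * c" using real_arch_pow[of "4/3" "6 * c"] by auto
  then show False using bound[of k] by simp
qed

text \<open>The map is linear and bounded on \<open>S\<close> only. The Riemann sums of
  \<open>f\<close> stay in the subspace, so \<open>h\<close> may be applied to each of them; the
  semigroup operators, which mean nothing outside the carrier, are integrated this way.\<close>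

lemma has_integral_linear_on_subspace:
  fixes f :: "real \<Rightarrow> 'a::real_normed_vector" and h :: "'a \<Rightarrow> 'b::real_normed_vector"
  assumes f: "(f has_integral i) {a..b}" and S: "subspace S" "\<And>p. p \<in> {a..b} \<Longrightarrow> f p \<in> S" "i \<in> S"
    and add: "\<And>x y. x \<in> S \<Longrightarrow> y \<in> S \<Longrightarrow> h (x + y) = h x + h y"
    and scale: "\<And>c x. x \<in> S \<Longrightarrow> h (c *\<^sub>R x) = c *\<^sub>R h x"
    and bdd: "\<And>x. x \<in> S \<Longrightarrow> norm (h x) \<le> M * norm x"
  shows "((\<lambda>p. h (f p)) has_integral h i) {a..b}"
  unfolding has_integral_real
proof (intro allI impI)
  fix e :: real assume e: "0 < e"
  define e' where "e' = e / (\<bar>M\<bar> + 1)"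
  have "0 < e'" using e by (simp add: e'_def)
  from f[unfolded has_integral_real, rule_format, OF this]
  obtain \<gamma> where \<gamma>: "gauge \<gamma>" "\<And>\<D>. \<D> tagged_division_of {a..b} \<Longrightarrow> \<gamma> fine \<D> \<Longrightarrow>
      norm ((\<Sum>(x, k)\<in>\<D>. measure lborel k *\<^sub>R f x) - i) < e'"
    by auto
  have zero: "0 \<in> S" using S(1) by (rule subspace_0)
  have h0: "h 0 = 0" using scale[OF zero, of 0] by simp
  have "norm ((\<Sum>(x, k)\<in>\<D>. measure lborel k *\<^sub>R h (f x)) - h i) < e"
    if D: "\<D> tagged_division_of {a..b}" "\<gamma> fine \<D>" for \<D>
  proof -
    have in_ab: "x \<in> {a..b}" if "(x, k) \<in> \<D>" for x k
      using D(1) that by (meson subsetD tag_in_interval)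
    have "finite E \<Longrightarrow> E \<subseteq> \<D> \<Longrightarrow> (\<Sum>(x, k)\<in>E. measure lborel k *\<^sub>R f x) \<in> S \<and>
        (\<Sum>(x, k)\<in>E. measure lborel k *\<^sub>R h (f x)) = h (\<Sum>(x, k)\<in>E. measure lborel k *\<^sub>R f x)" for E
    proof (induction E rule: finite_induct)
      case (insert z E)
      obtain x k where z: "z = (x, k)" by (cases z)
      have fx: "f x \<in> S" using in_ab[of x k] S(2) insert.prems by (auto simp: z)
      then show ?case using insert fx S(1) by (auto simp: z add scale subspace_add subspace_scale)
    qed (simp add: zero h0)
    then have *: "(\<Sum>(x, k)\<in>\<D>. measure lborel k *\<^sub>R f x) \<in> S"
       "(\<Sum>(x, k)\<in>\<D>. measure lborel k *\<^sub>R h (f x)) = h (\<Sum>(x, k)\<in>\<D>. measure lborel k *\<^sub>R f x)"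
      using tagged_division_of_finite[OF D(1)] by auto
    define y where "y = (\<Sum>(x, k)\<in>\<D>. measure lborel k *\<^sub>R f x)"
    have "h y - h i = h (y - i)"
      using add[of y "(-1) *\<^sub>R i"] scale[of i "-1"] *(1) S(1,3) subspace_scale[OF S(1) S(3), of "-1"]
      by (simp add: y_def)
    moreover have "norm (h (y - i)) \<le> M * norm (y - i)"
      using *(1) S(1,3) by (intro bdd) (auto simp: y_def intro: subspace_diff)
    moreover have "M * norm (y - i) \<le> (\<bar>M\<bar> + 1) * norm (y - i)" by (intro mult_right_mono) auto
    moreover have "(\<bar>M\<bar> + 1) * norm (y - i) < (\<bar>M\<bar> + 1) * e'"
      using \<gamma>(2)[OF D] by (intro mult_strict_left_mono) (auto simp: y_def)
    moreover have "(\<bar>M\<bar> + 1) * e' = e" by (simp add: e'_def)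
    ultimately show ?thesis using *(2) by (simp add: y_def)
  qed
  then show "\<exists>\<gamma>. gauge \<gamma> \<and> (\<forall>\<D>. \<D> tagged_division_of {a..b} \<and> \<gamma> fine \<D> \<longrightarrow>
      norm ((\<Sum>(x, k)\<in>\<D>. measure lborel k *\<^sub>R h (f x)) - h i) < e)" using \<gamma>(1) by blast
qed

lemma has_integral_in_closed_subspace:
  fixes f :: "real \<Rightarrow> 'a::real_normed_vector"
  assumes f: "(f has_integral i) {a..b}" and S: "subspace S" "closed S" "\<And>p. p \<in> {a..b} \<Longrightarrow> f p \<in> S"
  shows "i \<in> S"
proof -
  have "\<exists>y\<in>S. dist y i < e" if e: "0 < e" for e
  proof -
    from f[unfolded has_integral_real, rule_format, OF e]
    obtain \<gamma> where \<gamma>: "gauge \<gamma>" "\<And>\<D>. \<D> tagged_division_of {a..b} \<Longrightarrow> \<gamma> fine \<D> \<Longrightarrow>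
        norm ((\<Sum>(x, k)\<in>\<D>. measure lborel k *\<^sub>R f x) - i) < e"
      by auto
    obtain \<D> where D: "\<D> tagged_division_of {a..b}" "\<gamma> fine \<D>"
      using fine_division_exists_real[OF \<gamma>(1)] by blast
    have "(\<Sum>(x, k)\<in>\<D>. measure lborel k *\<^sub>R f x) \<in> S"
      using D(1) S(1,3) by (intro subspace_sum) (auto intro!: subspace_scale dest: tag_in_interval)
    then show ?thesis using \<gamma>(2)[OF D] by (auto simp: dist_norm)
  qed
  then have "i \<in> closure S" by (simp add: closure_approachable)
  then show ?thesis using S(2) by simp
qed

lemma average_tendsto_at_right:
  fixes g :: "real \<Rightarrow> 'a::banach"
  assumes "continuous_on {a..a + 1} g"
  shows "((\<lambda>k. (1 / k) *\<^sub>R integral {a..a + k} g) \<longlongrightarrow> g a) (at_right 0)"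
proof (rule tendstoI)
  fix e :: real assume e: "0 < e"
  then obtain d where d: "0 < d" "\<And>x. x \<in> {a..a + 1} \<Longrightarrow> dist x a < d \<Longrightarrow> dist (g x) (g a) < e / 2"
    using assms[unfolded continuous_on_iff, rule_format, of a "e / 2"] by auto
  have "dist ((1 / k) *\<^sub>R integral {a..a + k} g) (g a) < e" if k: "0 < k" "k < min d 1" for k
  proof -
    have int: "g integrable_on {a..a + k}"
      by (rule integrable_continuous_real, rule continuous_on_subset[OF assms]) (use k in auto)
    have "((\<lambda>x. g x - g a) has_integral (integral {a..a + k} g - k *\<^sub>R g a)) (cbox a (a + k))"
      using has_integral_diff[OF integrable_integral[OF int] has_integral_const_real[of "g a" a "a + k"]] k
      by (simp add: cbox_interval)
    then have "norm (integral {a..a + k} g - k *\<^sub>R g a) \<le> e / 2 * measure lborel (cbox a (a + k))"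
    proof (rule has_integral_bound[rotated])
      fix x assume "x \<in> cbox a (a + k)"
      then show "norm (g x - g a) \<le> e / 2" using d(2)[of x] k by (auto simp: dist_norm)
    qed (use e in auto)
    then have *: "norm (integral {a..a + k} g - k *\<^sub>R g a) \<le> e / 2 * k" using k by (simp add: cbox_interval)
    have "(1 / k) *\<^sub>R integral {a..a + k} g - g a = (1 / k) *\<^sub>R (integral {a..a + k} g - k *\<^sub>R g a)"
      using k by (simp add: algebra_simps)
    then have "norm ((1 / k) *\<^sub>R integral {a..a + k} g - g a) = norm (integral {a..a + k} g - k *\<^sub>R g a) / k"
      using k by (simp only: norm_scaleR) simp
    then have "norm ((1 / k) *\<^sub>R integral {a..a + k} g - g a) \<le> e / 2"
      using * k by (simp add: divide_le_eq)
    then show ?thesis using e by (simp add: dist_norm)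
  qed
  then show "\<forall>\<^sub>F k in at_right 0. dist ((1 / k) *\<^sub>R integral {a..a + k} g) (g a) < e"
    unfolding eventually_at_right_field using d(1) by (intro exI[of _ "min d 1"]) auto
qed

text \<open>The carrier is a closed subspace of a Banach type because the state space depends on
  \<Omega>. The assumption \<open>generator\<close> is an equivalence: one direction differentiates
  orbits, the other one places an element into \<open>D\<close> as soon as its right derivative is
  known.\<close>

locale c0_semigroup =
  fixes S :: "'a::banach set" and T :: "real \<Rightarrow> 'a \<Rightarrow> 'a" and D :: "'a set" and B :: "'a \<Rightarrow> 'a"
  assumes subspace_S: "subspace S" and closed_S: "closed S"
    and T_in: "0 \<le> t \<Longrightarrow> x \<in> S \<Longrightarrow> T t x \<in> S"
    and T_add: "0 \<le> t \<Longrightarrow> x \<in> S \<Longrightarrow> y \<in> S \<Longrightarrow> T t (x + y) = T t x + T t y"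
    and T_scale: "0 \<le> t \<Longrightarrow> x \<in> S \<Longrightarrow> T t (c *\<^sub>R x) = c *\<^sub>R T t x"
    and T_bounded: "0 \<le> t \<Longrightarrow> \<exists>M. \<forall>x\<in>S. norm (T t x) \<le> M * norm x"
    and T_0: "x \<in> S \<Longrightarrow> T 0 x = x"
    and T_plus: "0 \<le> s \<Longrightarrow> 0 \<le> t \<Longrightarrow> x \<in> S \<Longrightarrow> T (s + t) x = T s (T t x)"
    and T_right: "x \<in> S \<Longrightarrow> ((\<lambda>h. T h x) \<longlongrightarrow> x) (at_right 0)"
    and D_S: "D \<subseteq> S" and B_S: "x \<in> D \<Longrightarrow> B x \<in> S"
    and generator: "x \<in> S \<Longrightarrow> y \<in> S \<Longrightarrow>
      ((\<lambda>h. (1 / h) *\<^sub>R (T h x - x)) \<longlongrightarrow> y) (at_right 0) \<longleftrightarrow> x \<in> D \<and> y = B x"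
begin

lemma T_diff: "0 \<le> t \<Longrightarrow> x \<in> S \<Longrightarrow> y \<in> S \<Longrightarrow> T t (x - y) = T t x - T t y"
  using T_add[of t x "(-1) *\<^sub>R y"] T_scale[of t y "-1"] subspace_scale[OF subspace_S, of y "-1"] by simp

lemma T_tendsto_0: "x \<in> S \<Longrightarrow> ((\<lambda>h. T h x) \<longlongrightarrow> T 0 x) (at 0 within {0..})"
  using T_right T_0 at_within_Ici_at_right[of "0::real"] by simp

text \<open>Otherwise there are times tending to zero with operator norms exceeding every bound.
  Along them all orbits converge, so the operators are pointwise bounded, and uniform boundedness
  gives a contradiction.\<close>

lemma T_bounded_near_0: "\<exists>\<delta>>0. \<exists>M\<ge>0. \<forall>t\<in>{0..\<delta>}. \<forall>x\<in>S. norm (T t x) \<le> M * norm x"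
proof (rule ccontr)
  assume contra: "\<not> ?thesis"
  have "\<exists>t\<in>{0..1 / real (Suc n)}. \<exists>x\<in>S. norm (T t x) > real n * norm x" for n
  proof -
    have "(0::real) < 1 / real (Suc n)" "0 \<le> real n" by auto
    then show ?thesis using contra by (meson not_less)
  qed
  then obtain t where t: "\<And>n. t n \<in> {0..1 / real (Suc n)}"
      "\<And>n. \<exists>x\<in>S. norm (T (t n) x) > real n * norm x" by metis
  have t0: "t \<longlonglongrightarrow> 0"
    by (rule tendsto_sandwich[OF _ _ tendsto_const LIMSEQ_inverse_real_of_nat])
       (use t(1) in \<open>auto simp: inverse_eq_divide\<close>)
  have nn: "0 \<le> t n" for n using t(1)[of n] by simp
  have "\<exists>M. \<forall>n. \<forall>x\<in>S. norm (T (t n) x) \<le> M * norm x"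
  proof (rule uniform_boundedness_on_subspace[OF subspace_S closed_S])
    fix x assume x: "x \<in> S"
    have "continuous (at 0 within {0..}) (\<lambda>h. T h x)"
      using T_tendsto_0[OF x] by (simp add: continuous_within)
    then have "(\<lambda>n. T (t n) x) \<longlonglongrightarrow> T 0 x"
      unfolding continuous_within_sequentially using t0 nn by (auto simp: o_def)
    then have "Bseq (\<lambda>n. T (t n) x)" using convergentI convergent_imp_Bseq by blast
    then show "\<exists>c. \<forall>n. norm (T (t n) x) \<le> c" unfolding Bseq_def by blast
  qed (use T_add T_scale T_bounded nn in auto)
  then obtain M where M: "\<And>n x. x \<in> S \<Longrightarrow> norm (T (t n) x) \<le> M * norm x" by blast
  obtain n where n: "M < real n" using reals_Archimedean2 by blast
  obtain x where "x \<in> S" "norm (T (t n) x) > real n * norm x" using t(2) by blast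
  moreover have "M * norm x \<le> real n * norm x" using n by (intro mult_right_mono) auto
  ultimately show False using M[of x n] by linarith
qed

lemma T_bounded_on: "\<exists>M\<ge>0. \<forall>t\<in>{0..b}. \<forall>x\<in>S. norm (T t x) \<le> M * norm x"
proof -
  obtain \<delta> M where \<delta>: "0 < \<delta>" "0 \<le> M" "\<And>t x. t \<in> {0..\<delta>} \<Longrightarrow> x \<in> S \<Longrightarrow> norm (T t x) \<le> M * norm x"
    using T_bounded_near_0 by blast
  have *: "t \<in> {0..real (Suc n) * \<delta>} \<Longrightarrow> x \<in> S \<Longrightarrow> norm (T t x) \<le> max M 1 ^ Suc n * norm x" for t x n
  proof (induction n arbitrary: t x)
    case 0
    then have "norm (T t x) \<le> M * norm x" using \<delta>(3) by simp
    also have "\<dots> \<le> max M 1 * norm x" by (intro mult_right_mono) auto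
    finally show ?case by simp
  next
    case (Suc n)
    show ?case
    proof (cases "t \<le> \<delta>")
      case True
      then have "norm (T t x) \<le> M * norm x" using \<delta>(3) Suc.prems by simp
      also have "\<dots> \<le> max M 1 ^ Suc (Suc n) * norm x"
      proof (intro mult_right_mono)
        have "max M 1 ^ 1 \<le> max M 1 ^ Suc (Suc n)" by (intro power_increasing) auto
        then show "M \<le> max M 1 ^ Suc (Suc n)" by (simp add: le_max_iff_disj)
      qed auto
      finally show ?thesis .
    next
      case False
      have "T t x = T (t - \<delta>) (T \<delta> x)" using T_plus[of "t - \<delta>" \<delta> x] False Suc.prems \<delta>(1) by simp
      also have "norm \<dots> \<le> max M 1 ^ Suc n * norm (T \<delta> x)"
        using Suc.prems False \<delta>(1) by (intro Suc.IH T_in) (auto simp: algebra_simps)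
      also have "\<dots> \<le> max M 1 ^ Suc n * (max M 1 * norm x)"
      proof (intro mult_left_mono)
        have "norm (T \<delta> x) \<le> M * norm x" using \<delta>(1,3) Suc.prems by simp
        also have "\<dots> \<le> max M 1 * norm x" by (intro mult_right_mono) auto
        finally show "norm (T \<delta> x) \<le> max M 1 * norm x" .
      qed auto
      finally show ?thesis by (simp add: mult_ac)
    qed
  qed
  obtain n where "b / \<delta> < real n" using reals_Archimedean2 by blast
  then have "b \<le> real (Suc n) * \<delta>" using \<delta>(1) by (simp add: field_simps)
  then have "\<forall>t\<in>{0..b}. \<forall>x\<in>S. norm (T t x) \<le> max M 1 ^ Suc n * norm x" using *[of _ n] by auto
  then show ?thesis by (intro exI[of _ "max M 1 ^ Suc n"]) auto
qed

text \<open>Strong continuity together with local boundedness of the operators. Continuity in both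
  arguments is needed since in the convolution \<open>T (t - p) (G p)\<close> both vary; on a
  compact rectangle it becomes uniform.\<close>

lemma T_joint_continuous:
  fixes G :: "'c::metric_space \<Rightarrow> 'a"
  assumes G: "continuous_on I G" "\<And>p. p \<in> I \<Longrightarrow> G p \<in> S"
  shows "continuous_on ({0..b} \<times> I) (\<lambda>(r, p). T r (G p))"
proof -
  obtain M where M: "0 \<le> M" "\<And>t x. t \<in> {0..b} \<Longrightarrow> x \<in> S \<Longrightarrow> norm (T t x) \<le> M * norm x"
    using T_bounded_on by metis
  have "\<exists>d>0. \<forall>r p. r \<in> {0..b} \<and> p \<in> I \<and> dist (r, p) (r0, p0) < d \<longrightarrow> dist (T r (G p)) (T r0 (G p0)) < e"
    if r0: "r0 \<in> {0..b}" and p0: "p0 \<in> I" and e: "0 < e" for r0 p0 e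
  proof -
    define e' where "e' = e / (2 * (M + 1))"
    have e': "0 < e'" using e M(1) by (simp add: e'_def)
    obtain d1 where d1: "0 < d1" "\<And>p. p \<in> I \<Longrightarrow> dist p p0 < d1 \<Longrightarrow> dist (G p) (G p0) < e'"
      using G(1) p0 e' unfolding continuous_on_iff by blast
    have "\<forall>\<^sub>F h in at 0 within {0..}. dist (T h (G p0)) (G p0) < e'"
      using tendstoD[OF T_tendsto_0[OF G(2)[OF p0]] e'] T_0[OF G(2)[OF p0]] by simp
    then obtain d2 where d2: "0 < d2" "\<And>h. 0 \<le> h \<Longrightarrow> h < d2 \<Longrightarrow> dist (T h (G p0)) (G p0) < e'"
    proof -
      assume *: "\<And>d2. 0 < d2 \<Longrightarrow> (\<And>h. 0 \<le> h \<Longrightarrow> h < d2 \<Longrightarrow> dist (T h (G p0)) (G p0) < e') \<Longrightarrow> thesis"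
      assume "\<forall>\<^sub>F h in at 0 within {0..}. dist (T h (G p0)) (G p0) < e'"
      then obtain d where "0 < d" "\<And>h. 0 \<le> h \<Longrightarrow> h \<noteq> 0 \<Longrightarrow> dist h 0 < d \<Longrightarrow> dist (T h (G p0)) (G p0) < e'"
        unfolding eventually_at by (metis atLeast_iff)
      then show thesis
        using e' T_0[OF G(2)[OF p0]] by (intro *[of d]) (metis abs_of_nonneg diff_zero dist_real_def dist_self)+
    qed
    \<comment> \<open>Factoring out the earlier time,
      \<open>T c - T a = T a (T (c - a) - 1)\<close>, gives one estimate for approach from either
      side.\<close>
    have key: "dist (T a (G p0)) (T c (G p0)) \<le> M * e'" if "a \<in> {0..b}" "c \<in> {0..b}" "\<bar>a - c\<bar> < d2" "a \<le> c" for a c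
    proof -
      have "T c (G p0) = T a (T (c - a) (G p0))" using T_plus[of a "c - a" "G p0"] that G(2)[OF p0] by simp
      then have "T c (G p0) - T a (G p0) = T a (T (c - a) (G p0) - G p0)"
        using that T_in[OF _ G(2)[OF p0]] G(2)[OF p0] by (simp add: T_diff)
      also have "norm \<dots> \<le> M * norm (T (c - a) (G p0) - G p0)"
        using that T_in[OF _ G(2)[OF p0]] G(2)[OF p0] by (intro M(2) subspace_diff[OF subspace_S]) auto
      also have "\<dots> \<le> M * e'"
        using d2(2)[of "c - a"] that M(1) by (intro mult_left_mono) (auto simp: dist_norm)
      finally show ?thesis by (simp add: dist_norm norm_minus_commute)
    qed
    show ?thesis
    proof (intro exI[of _ "min d1 d2"] conjI allI impI)
      fix r p assume rp: "r \<in> {0..b} \<and> p \<in> I \<and> dist (r, p) (r0, p0) < min d1 d2"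
      have "dist r r0 \<le> dist (r, p) (r0, p0)" "dist p p0 \<le> dist (r, p) (r0, p0)"
        using dist_fst_le[of "(r, p)" "(r0, p0)"] dist_snd_le[of "(r, p)" "(r0, p0)"] by auto
      then have dr: "\<bar>r - r0\<bar> < d2" and dp: "dist p p0 < d1" using rp by (auto simp: dist_real_def)
      have "dist (T r (G p)) (T r (G p0)) = norm (T r (G p - G p0))"
        using rp p0 by (auto simp: dist_norm T_diff G(2))
      also have "\<dots> \<le> M * norm (G p - G p0)"
        using rp p0 G(2) by (intro M(2) subspace_diff[OF subspace_S]) auto
      also have "\<dots> \<le> M * e'" using d1(2)[of p] rp dp M(1) by (intro mult_left_mono) (auto simp: dist_norm)
      finally have 1: "dist (T r (G p)) (T r (G p0)) \<le> M * e'" .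
      have 2: "dist (T r (G p0)) (T r0 (G p0)) \<le> M * e'"
      proof (cases "r \<le> r0")
        case True then show ?thesis using key[of r r0] rp r0 dr by auto
      next
        case False
        then have "dist (T r0 (G p0)) (T r (G p0)) \<le> M * e'" using key[of r0 r] rp r0 dr by auto
        then show ?thesis by (simp add: dist_commute)
      qed
      have "2 * (M + 1) * e' = e" using M(1) by (simp add: e'_def)
      then have "M * e' + M * e' < e" using e' by (simp add: algebra_simps)
      then show "dist (T r (G p)) (T r0 (G p0)) < e"
        using 1 2 dist_triangle[of "T r (G p)" "T r0 (G p0)" "T r (G p0)"] by linarith
    qed (use d1 d2 in auto)
  qed
  then show ?thesis
    unfolding continuous_on_iff by fastforce
qed

lemma T_orbit_continuous: "x \<in> S \<Longrightarrow> continuous_on {0..} (\<lambda>t. T t x)"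
proof -
  assume x: "x \<in> S"
  have "continuous_on {0..b} (\<lambda>t. T t x)" for b
  proof -
    have "continuous_on ({0..b} \<times> {0::real}) (\<lambda>(r, p). T r x)"
      using T_joint_continuous[of "{0::real}" "\<lambda>_. x" b] x by auto
    then have "continuous_on {0..b} ((\<lambda>(r, p). T r x) \<circ> (\<lambda>t. (t, 0::real)))"
      by (intro continuous_on_compose continuous_intros) (auto elim!: continuous_on_subset)
    then show ?thesis by (simp add: o_def)
  qed
  then have *: "continuous_on {0..b} (\<lambda>t. T t x)" for b .
  show ?thesis
  proof (rule continuous_on_eq_continuous_within[THEN iffD2], rule ballI)
    fix t :: real assume t: "t \<in> {0..}"
    have "continuous (at t within {0..t + 1}) (\<lambda>t. T t x)"
      using *[of "t + 1"] t by (simp add: continuous_on_eq_continuous_within)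
    moreover have "at t within {0..t + 1} = at t within {0..}"
      by (rule at_within_nhd[of _ "{..<t + 1}"]) auto
    ultimately show "continuous (at t within {0..}) (\<lambda>t. T t x)" by simp
  qed
qed

lemma integral_in_S:
  fixes s t :: real
  assumes "continuous_on {s..t} f" "\<And>p. p \<in> {s..t} \<Longrightarrow> f p \<in> S"
  shows "integral {s..t} f \<in> S"
  using has_integral_in_closed_subspace[OF integrable_integral[OF integrable_continuous_real[OF assms(1)]]
      subspace_S closed_S] assms(2) by blast

end

context c0_semigroup
begin

text \<open>For the integral \<open>I\<close> of \<open>U\<close> one has that
  \<open>T k I - I\<close> equals \<open>integral {t..t+k} U - integral {s..s+k} U - integral {s..t}
  (N k)\<close>, where \<open>N k p = U (p + k) - T k (U p)\<close> is \<open>k G p\<close> up to an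
  error \<open>o(k)\<close> uniform in \<open>p\<close>. Dividing by \<open>k\<close> yields the
  right derivative, and \<open>generator\<close> places \<open>I\<close> in the domain. The data
  reach up to \<open>t + 1\<close> to leave room for the shift by \<open>k\<close>.\<close>

lemma integral_of_mild:
  assumes st: "s \<le> t"
    and U: "continuous_on {s..t + 1} U" "\<And>p. p \<in> {s..t + 1} \<Longrightarrow> U p \<in> S"
    and G: "continuous_on {s..t + 1} G" "\<And>p. p \<in> {s..t + 1} \<Longrightarrow> G p \<in> S"
    and mild: "\<And>p k. p \<in> {s..t} \<Longrightarrow> k \<in> {0..1} \<Longrightarrow>
      ((\<lambda>q. T (p + k - q) (G q)) has_integral (U (p + k) - T k (U p))) {p..p + k}"
  shows "integral {s..t} U \<in> D" "B (integral {s..t} U) = U t - U s - integral {s..t} G"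
proof -
  define I where "I = integral {s..t} U"
  define y where "y = U t - U s - integral {s..t} G"
  have Uc: "continuous_on {a..b} U" and Gc: "continuous_on {a..b} G"
    if "s \<le> a" "b \<le> t + 1" for a b
    using U(1) G(1) that by (auto elim!: continuous_on_subset)
  have Uint: "U integrable_on {a..b}" if "s \<le> a" "b \<le> t + 1" for a b
    using Uc[OF that] by (rule integrable_continuous_real)
  have Gint: "G integrable_on {a..b}" if "s \<le> a" "b \<le> t + 1" for a b
    using Gc[OF that] by (rule integrable_continuous_real)
  have IS: "I \<in> S" unfolding I_def using U st by (intro integral_in_S Uc) auto
  have GS: "integral {s..t} G \<in> S" using G st by (intro integral_in_S Gc) auto
  have yS: "y \<in> S"
    unfolding y_def using U(2) GS st by (intro subspace_diff[OF subspace_S]) auto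
  define N where "N k p = U (p + k) - T k (U p)" for k p
  have TkU: "((\<lambda>p. T k (U p)) has_integral T k I) {s..t}" if k: "0 \<le> k" for k
  proof -
    obtain M where M: "\<And>x. x \<in> S \<Longrightarrow> norm (T k x) \<le> M * norm x" using T_bounded[OF k] by blast
    show ?thesis
    proof (rule has_integral_linear_on_subspace[OF _ subspace_S _ IS])
      show "(U has_integral I) {s..t}" unfolding I_def using Uint[of s t] st by (simp add: integrable_integral)
    qed (use U(2) T_add[OF k] T_scale[OF k] M in auto)
  qed
  have shift: "((\<lambda>p. U (p + k)) has_integral integral {s + k..t + k} U) {s..t}" if k: "k \<in> {0..1}" for k
  proof -
    have "(U has_integral integral {s + k..t + k} U) {s + k..t + k}"
      using Uint[of "s + k" "t + k"] k by (simp add: integrable_integral)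
    then show ?thesis using has_integral_shift_Icc_real[of U k _ s t] by (simp add: o_def add.commute)
  qed
  have Nint: "(N k has_integral integral {s + k..t + k} U - T k I) {s..t}" if k: "k \<in> {0..1}" for k
    unfolding N_def[abs_def] using shift[OF k] TkU[of k] k by (intro has_integral_diff) auto
  have split: "(1 / k) *\<^sub>R (T k I - I) = (1 / k) *\<^sub>R integral {t..t + k} U
      - (1 / k) *\<^sub>R integral {s..s + k} U - (1 / k) *\<^sub>R integral {s..t} (N k)" if k: "k \<in> {0..1}" for k
  proof -
    define W where "W = integral {s..t + k} U"
    have "I + integral {t..t + k} U = W"
      unfolding I_def W_def using st k by (intro Henstock_Kurzweil_Integration.integral_combine Uint) auto
    then have 1: "I = W - integral {t..t + k} U" by (simp add: eq_diff_eq)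
    have "integral {s..s + k} U + integral {s + k..t + k} U = W"
      unfolding W_def using st k by (intro Henstock_Kurzweil_Integration.integral_combine Uint) auto
    then have 2: "integral {s + k..t + k} U = W - integral {s..s + k} U" by (simp add: eq_diff_eq add.commute)
    have 3: "T k I = integral {s + k..t + k} U - integral {s..t} (N k)"
      using Nint[OF k] by (auto dest!: integral_unique)
    have "T k I - I = (W - integral {s..s + k} U - integral {s..t} (N k)) - (W - integral {t..t + k} U)"
      using 1 2 3 by metis
    then have "T k I - I = integral {t..t + k} U - integral {s..s + k} U - integral {s..t} (N k)" by simp
    then show ?thesis by (simp only: scaleR_right_diff_distrib)
  qed
  have lim1: "((\<lambda>k. (1 / k) *\<^sub>R integral {t..t + k} U) \<longlongrightarrow> U t) (at_right 0)"
    using st by (intro average_tendsto_at_right Uc) auto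
  have lim2: "((\<lambda>k. (1 / k) *\<^sub>R integral {s..s + k} U) \<longlongrightarrow> U s) (at_right 0)"
    using st by (intro average_tendsto_at_right Uc) auto
  have "((\<lambda>k. (1 / k) *\<^sub>R integral {s..t} (N k)) \<longlongrightarrow> integral {s..t} G) (at_right 0)"
  proof (rule tendstoI)
    fix e :: real assume e: "0 < e"
    define e' where "e' = e / (2 * (t - s + 1))"
    have e': "0 < e'" using e st by (simp add: e'_def)
    \<comment> \<open>Uniformity in the base point \<open>p\<close> is essential: the remainder of
      \<open>N k p\<close> is integrated over all of \<open>{s..t}\<close> before \<open>k\<close>
      tends to zero.\<close>
    have "uniformly_continuous_on ({0..1} \<times> {s..t + 1}) (\<lambda>(r, p). T r (G p))"
      using G by (intro compact_uniformly_continuous T_joint_continuous compact_Times) auto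
    then obtain d where d: "0 < d" "\<And>r p r' p'. r \<in> {0..1} \<Longrightarrow> p \<in> {s..t + 1} \<Longrightarrow> r' \<in> {0..1} \<Longrightarrow> p' \<in> {s..t + 1} \<Longrightarrow>
        dist (r', p') (r, p) < d \<Longrightarrow> dist (T r' (G p')) (T r (G p)) < e'"
      unfolding uniformly_continuous_on_def using e' by fastforce
    have "dist ((1 / k) *\<^sub>R integral {s..t} (N k)) (integral {s..t} G) < e" if k: "0 < k" "k < min (d / 2) 1" for k
    proof -
      have Nb: "norm (N k p - k *\<^sub>R G p) \<le> e' * k" if p: "p \<in> {s..t}" for p
      proof -
        have "((\<lambda>q. T (p + k - q) (G q) - G p) has_integral (N k p - k *\<^sub>R G p)) (cbox p (p + k))"
          using has_integral_diff[OF mild[OF p, of k] has_integral_const_real[of "G p" p "p + k"]] k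
          by (simp add: N_def)
        then have "norm (N k p - k *\<^sub>R G p) \<le> e' * measure lborel (cbox p (p + k))"
        proof (rule has_integral_bound[rotated])
          fix q assume q: "q \<in> cbox p (p + k)"
          have "dist (p + k - q, q) (0, p) \<le> \<bar>p + k - q\<bar> + \<bar>q - p\<bar>"
            by (auto simp: dist_prod_def dist_real_def intro: sqrt_sum_squares_le_sum_abs[THEN order_trans])
          then have "dist (p + k - q, q) (0, p) < d" using q k by (auto simp: cbox_interval)
          then have "dist (T (p + k - q) (G q)) (T 0 (G p)) < e'"
            using q k p by (intro d(2)) (auto simp: cbox_interval)
          then show "norm (T (p + k - q) (G q) - G p) \<le> e'"
            using T_0[OF G(2)[of p]] p by (simp add: dist_norm)
        qed (use e' in auto)
        then show ?thesis using k by simp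
      qed
      have "((\<lambda>p. N k p - k *\<^sub>R G p) has_integral (integral {s..t} (N k) - k *\<^sub>R integral {s..t} G)) (cbox s t)"
      proof -
        have "(N k has_integral integral {s..t} (N k)) {s..t}" using Nint[of k] k by (auto simp: has_integral_iff)
        moreover have "(G has_integral integral {s..t} G) {s..t}" using Gint[of s t] by (simp add: integrable_integral)
        ultimately show ?thesis by (auto intro!: has_integral_diff has_integral_cmul simp: cbox_interval)
      qed
      then have "norm (integral {s..t} (N k) - k *\<^sub>R integral {s..t} G) \<le> e' * k * measure lborel (cbox s t)"
        by (rule has_integral_bound[rotated]) (use e' k Nb in \<open>auto simp: cbox_interval\<close>)
      then have *: "norm (integral {s..t} (N k) - k *\<^sub>R integral {s..t} G) \<le> e' * k * (t - s)"
        using st by simp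
      have "(1 / k) *\<^sub>R integral {s..t} (N k) - integral {s..t} G
          = (1 / k) *\<^sub>R (integral {s..t} (N k) - k *\<^sub>R integral {s..t} G)" using k by (simp add: algebra_simps)
      then have "norm ((1 / k) *\<^sub>R integral {s..t} (N k) - integral {s..t} G)
          = norm (integral {s..t} (N k) - k *\<^sub>R integral {s..t} G) / k"
        using k by (simp only: norm_scaleR) simp
      also have "\<dots> \<le> e' * (t - s)"
        using * k by (simp add: divide_le_eq mult_ac)
      also have "\<dots> < e" 
      proof -
        have "e' * (t - s) < e' * (2 * (t - s + 1))" using e' st by (intro mult_strict_left_mono) auto
        then show ?thesis using st by (simp add: e'_def)
      qed
      finally show ?thesis by (simp add: dist_norm)
    qed
    then show "\<forall>\<^sub>F k in at_right 0. dist ((1 / k) *\<^sub>R integral {s..t} (N k)) (integral {s..t} G) < e"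
      unfolding eventually_at_right_field using d(1) by (intro exI[of _ "min (d / 2) 1"]) auto
  qed
  then have "((\<lambda>k. (1 / k) *\<^sub>R integral {t..t + k} U - (1 / k) *\<^sub>R integral {s..s + k} U
      - (1 / k) *\<^sub>R integral {s..t} (N k)) \<longlongrightarrow> y) (at_right 0)"
    unfolding y_def using lim1 lim2 by (intro tendsto_diff)
  moreover have "\<forall>\<^sub>F k in at_right 0. (1 / k) *\<^sub>R integral {t..t + k} U - (1 / k) *\<^sub>R integral {s..s + k} U
      - (1 / k) *\<^sub>R integral {s..t} (N k) = (1 / k) *\<^sub>R (T k I - I)"
    unfolding eventually_at_right_field by (intro exI[of _ 1]) (use split in auto)
  ultimately have "((\<lambda>k. (1 / k) *\<^sub>R (T k I - I)) \<longlongrightarrow> y) (at_right 0)"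
    by (simp add: filterlim_cong)
  then have "I \<in> D \<and> y = B I" using generator[OF IS yS] by blast
  then show "integral {s..t} U \<in> D" "B (integral {s..t} U) = U t - U s - integral {s..t} G"
    by (auto simp: I_def y_def)
qed

lemma D_scale: "x \<in> D \<Longrightarrow> c *\<^sub>R x \<in> D \<and> B (c *\<^sub>R x) = c *\<^sub>R B x"
proof -
  assume x: "x \<in> D"
  then have xS: "x \<in> S" using D_S by blast
  have "((\<lambda>h. (1 / h) *\<^sub>R (T h x - x)) \<longlongrightarrow> B x) (at_right 0)"
    using generator[OF xS B_S[OF x]] x by blast
  then have "((\<lambda>h. c *\<^sub>R ((1 / h) *\<^sub>R (T h x - x))) \<longlongrightarrow> c *\<^sub>R B x) (at_right 0)"
    by (intro tendsto_intros)
  moreover have "\<forall>\<^sub>F h in at_right 0. c *\<^sub>R ((1 / h) *\<^sub>R (T h x - x)) = (1 / h) *\<^sub>R (T h (c *\<^sub>R x) - c *\<^sub>R x)"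
    unfolding eventually_at_right_field
    by (intro exI[of _ 1]) (use xS in \<open>auto simp: T_scale algebra_simps\<close>)
  ultimately have "((\<lambda>h. (1 / h) *\<^sub>R (T h (c *\<^sub>R x) - c *\<^sub>R x)) \<longlongrightarrow> c *\<^sub>R B x) (at_right 0)"
    by (simp add: filterlim_cong)
  then show ?thesis
    using generator[of "c *\<^sub>R x" "c *\<^sub>R B x"] xS B_S[OF x] subspace_scale[OF subspace_S] by metis
qed

text \<open>An orbit is a mild solution with zero forcing, so its time integrals lie in
  \<open>D\<close>; their averages over shrinking intervals tend to the starting point.\<close>

lemma D_dense:
  assumes x: "x \<in> S"
  shows "\<exists>y. (\<forall>n. y n \<in> D) \<and> y \<longlonglongrightarrow> x"
proof -
  have cont: "continuous_on {0..b} (\<lambda>t. T t x)" for b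
    using T_orbit_continuous[OF x] by (rule continuous_on_subset) auto
  have in_D: "integral {0..h} (\<lambda>t. T t x) \<in> D" if h: "0 \<le> h" for h
  proof (rule integral_of_mild(1)[OF h, where G = "\<lambda>_. 0"])
    fix p k :: real assume pk: "p \<in> {0..h}" "k \<in> {0..1}"
    have "T (p + k) x = T k (T p x)" using T_plus[of k p x] pk x by (simp add: add.commute)
    moreover have "((\<lambda>q. T (p + k - q) 0) has_integral 0) {p..p + k}"
      by (rule has_integral_eq[OF _ has_integral_0]) (use T_scale[of _ "0" 0] subspace_0[OF subspace_S] in auto)
    ultimately show "((\<lambda>q. T (p + k - q) 0) has_integral T (p + k) x - T k (T p x)) {p..p + k}" by simp
  qed (use cont x T_in subspace_0[OF subspace_S] in auto)
  have "((\<lambda>k. (1 / k) *\<^sub>R integral {0..0 + k} (\<lambda>t. T t x)) \<longlongrightarrow> T 0 x) (at_right 0)"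
    using cont by (intro average_tendsto_at_right) auto
  then have lim: "((\<lambda>k. (1 / k) *\<^sub>R integral {0..k} (\<lambda>t. T t x)) \<longlongrightarrow> x) (at_right 0)" using T_0[OF x] by simp
  have "filterlim (\<lambda>n. inverse (real (Suc n))) (at_right 0) sequentially"
    unfolding filterlim_at using LIMSEQ_inverse_real_of_nat by auto
  then have "(\<lambda>n. (1 / inverse (real (Suc n))) *\<^sub>R integral {0..inverse (real (Suc n))} (\<lambda>t. T t x)) \<longlonglongrightarrow> x"
    by (rule filterlim_compose[OF lim])
  then show ?thesis
    using in_D D_scale by (intro exI[of _ "\<lambda>n. (1 / inverse (real (Suc n))) *\<^sub>R integral {0..inverse (real (Suc n))} (\<lambda>t. T t x)"]) auto
qed

lemma T_generator_commute:
  assumes x: "x \<in> D" and t: "0 \<le> t"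
  shows "T t x \<in> D" "B (T t x) = T t (B x)"
proof -
  have xS: "x \<in> S" using x D_S by blast
  obtain M where M: "\<And>z. z \<in> S \<Longrightarrow> norm (T t z) \<le> M * norm z" using T_bounded[OF t] by blast
  have lim: "((\<lambda>h. (1 / h) *\<^sub>R (T h x - x)) \<longlongrightarrow> B x) (at_right 0)"
    using generator[OF xS B_S[OF x]] x by blast
  have "((\<lambda>h. (1 / h) *\<^sub>R (T h (T t x) - T t x)) \<longlongrightarrow> T t (B x)) (at_right 0)"
  proof (rule Lim_null[THEN iffD2], rule tendsto_0_le[where K = M])
    show "((\<lambda>h. (1 / h) *\<^sub>R (T h x - x) - B x) \<longlongrightarrow> 0) (at_right 0)" using lim by (simp add: Lim_null[symmetric])
    show "\<forall>\<^sub>F h in at_right 0. norm ((1 / h) *\<^sub>R (T h (T t x) - T t x) - T t (B x))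
        \<le> norm ((1 / h) *\<^sub>R (T h x - x) - B x) * M"
      unfolding eventually_at_right_field
    proof (intro exI[of _ 1] conjI allI impI)
      fix h :: real assume h: "0 < h"
      have S1: "T h x - x \<in> S" "(1 / h) *\<^sub>R (T h x - x) \<in> S" "(1 / h) *\<^sub>R (T h x - x) - B x \<in> S"
        using h xS B_S[OF x] T_in[of h x] subspace_S by (auto intro!: subspace_diff subspace_scale)
      have "T h (T t x) = T t (T h x)" using T_plus[of h t x] T_plus[of t h x] h t xS by (simp add: add.commute)
      then have "(1 / h) *\<^sub>R (T h (T t x) - T t x) - T t (B x) = T t ((1 / h) *\<^sub>R (T h x - x) - B x)"
        using S1 T_in[of h x] h t xS B_S[OF x] by (simp add: T_diff T_scale)
      then show "norm ((1 / h) *\<^sub>R (T h (T t x) - T t x) - T t (B x)) \<le> norm ((1 / h) *\<^sub>R (T h x - x) - B x) * M"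
        using M[OF S1(3)] by (simp add: mult.commute)
    qed auto
  qed
  then show "T t x \<in> D" "B (T t x) = T t (B x)"
    using generator[OF T_in[OF t xS] T_in[OF t B_S[OF x]]] by auto
qed

text \<open>The generator gives a right derivative at zero only. The left derivative comes from
  \<open>T t x - T (t - h) x = T (t - h) (T h x - x)\<close>, with the operators
  \<open>T (t - h)\<close> bounded uniformly on the compact time interval.\<close>

lemma T_orbit_derivative:
  assumes x: "x \<in> D" and t: "0 < t"
  shows "((\<lambda>s. (1 / (s - t)) *\<^sub>R (T s x - T t x)) \<longlongrightarrow> T t (B x)) (at t)"
proof -
  have xS: "x \<in> S" and BS: "B x \<in> S" using x D_S B_S by auto
  obtain M where M: "0 \<le> M" "\<And>s z. s \<in> {0..t} \<Longrightarrow> z \<in> S \<Longrightarrow> norm (T s z) \<le> M * norm z"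
    using T_bounded_on[of t] by blast
  have lim: "((\<lambda>h. (1 / h) *\<^sub>R (T h x - x)) \<longlongrightarrow> B x) (at_right 0)"
    using generator[OF xS BS] x by blast
  have right: "((\<lambda>h. (1 / h) *\<^sub>R (T (t + h) x - T t x)) \<longlongrightarrow> T t (B x)) (at_right 0)"
  proof (rule filterlim_cong[THEN iffD1, OF refl refl])
    show "((\<lambda>h. (1 / h) *\<^sub>R (T h (T t x) - T t x)) \<longlongrightarrow> T t (B x)) (at_right 0)"
      using generator[of "T t x" "T t (B x)"] T_generator_commute[OF x, of t] t xS BS T_in by auto
    show "\<forall>\<^sub>F h in at_right 0. (1 / h) *\<^sub>R (T h (T t x) - T t x) = (1 / h) *\<^sub>R (T (t + h) x - T t x)"
      unfolding eventually_at_right_field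
      by (intro exI[of _ 1]) (use T_plus[of _ t x] t xS in \<open>auto simp: add.commute\<close>)
  qed
  have left: "((\<lambda>h. (1 / (- h)) *\<^sub>R (T (t + - h) x - T t x)) \<longlongrightarrow> T t (B x)) (at_right 0)"
  proof (rule Lim_null[THEN iffD2], rule Lim_null_comparison)
    have cont: "((\<lambda>h. T (t - h) (B x)) \<longlongrightarrow> T t (B x)) (at_right 0)"
    proof -
      have "isCont (\<lambda>s. T s (B x)) t"
        using T_orbit_continuous[OF BS] t by (intro continuous_on_interior[of "{0..}"]) auto
      moreover have "((\<lambda>h. t - h) \<longlongrightarrow> t - 0) (at_right 0)" by (intro tendsto_intros)
      ultimately show ?thesis using isCont_tendsto_compose[of t "\<lambda>s. T s (B x)"] by simp
    qed
    show "((\<lambda>h. M * norm ((1 / h) *\<^sub>R (T h x - x) - B x) + norm (T (t - h) (B x) - T t (B x))) \<longlongrightarrow> 0) (at_right 0)"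
    proof -
      have "((\<lambda>h. M * norm ((1 / h) *\<^sub>R (T h x - x) - B x) + norm (T (t - h) (B x) - T t (B x))) \<longlongrightarrow>
          M * norm (B x - B x) + norm (T t (B x) - T t (B x))) (at_right 0)"
        using lim cont by (intro tendsto_intros)
      then show ?thesis by simp
    qed
    show "\<forall>\<^sub>F h in at_right 0. norm ((1 / (- h)) *\<^sub>R (T (t + - h) x - T t x) - T t (B x))
        \<le> M * norm ((1 / h) *\<^sub>R (T h x - x) - B x) + norm (T (t - h) (B x) - T t (B x))"
      unfolding eventually_at_right_field
    proof (intro exI[of _ t] conjI allI impI)
      fix h :: real assume h: "0 < h" "h < t"
      have S1: "T h x - x \<in> S" "(1 / h) *\<^sub>R (T h x - x) \<in> S" "(1 / h) *\<^sub>R (T h x - x) - B x \<in> S"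
        using h xS BS T_in[of h x] subspace_S by (auto intro!: subspace_diff subspace_scale)
      have "T t x = T (t - h) (T h x)" using T_plus[of "t - h" h x] h xS by simp
      moreover have "T (t - h) ((1 / h) *\<^sub>R (T h x - x) - B x) = (1 / h) *\<^sub>R (T (t - h) (T h x) - T (t - h) x) - T (t - h) (B x)"
        using S1 T_in[of h x] h xS BS by (simp only: T_diff T_scale diff_ge_0_iff_ge less_imp_le)
      ultimately have "(1 / (- h)) *\<^sub>R (T (t + - h) x - T t x) - T t (B x)
         = T (t - h) ((1 / h) *\<^sub>R (T h x - x) - B x) + (T (t - h) (B x) - T t (B x))"
        by (simp add: algebra_simps)
      also have "norm \<dots> \<le> norm (T (t - h) ((1 / h) *\<^sub>R (T h x - x) - B x)) + norm (T (t - h) (B x) - T t (B x))"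
        by (rule norm_triangle_ineq)
      also have "norm (T (t - h) ((1 / h) *\<^sub>R (T h x - x) - B x)) \<le> M * norm ((1 / h) *\<^sub>R (T h x - x) - B x)"
        using h S1 by (intro M(2)) auto
      finally show "norm ((1 / (- h)) *\<^sub>R (T (t + - h) x - T t x) - T t (B x))
        \<le> M * norm ((1 / h) *\<^sub>R (T h x - x) - B x) + norm (T (t - h) (B x) - T t (B x))" by simp
    qed (use t in auto)
  qed
  have "((\<lambda>h. (1 / h) *\<^sub>R (T (t + h) x - T t x)) \<longlongrightarrow> T t (B x)) (at 0)"
    unfolding filterlim_at_split using right left by (auto simp: filterlim_at_left_to_right)
  then show ?thesis
    by (intro LIM_offset_zero_cancel[where f = "\<lambda>s. (1 / (s - t)) *\<^sub>R (T s x - T t x)"]) simp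
qed

text \<open>The Lyapunov method: on \<open>D\<close> the function
  \<open>exp (2 \<mu> t) E (T t x) (T t x)\<close> has nonpositive derivative for positive times and
  is continuous at zero. Density of \<open>D\<close> and boundedness of the bilinear form extend the
  inequality to the whole carrier.\<close>

lemma energy_decay:
  fixes E :: "'a \<Rightarrow> 'a \<Rightarrow> real"
  assumes E_add: "\<And>x y z. x \<in> S \<Longrightarrow> y \<in> S \<Longrightarrow> z \<in> S \<Longrightarrow> E (x + y) z = E x z + E y z"
    and E_scale: "\<And>c x z. x \<in> S \<Longrightarrow> z \<in> S \<Longrightarrow> E (c *\<^sub>R x) z = c * E x z"
    and E_sym: "\<And>x z. x \<in> S \<Longrightarrow> z \<in> S \<Longrightarrow> E x z = E z x"
    and E_upper: "\<And>x z. x \<in> S \<Longrightarrow> z \<in> S \<Longrightarrow> \<bar>E x z\<bar> \<le> c * norm x * norm z"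
    and diss: "\<And>x. x \<in> D \<Longrightarrow> E x (B x) \<le> - \<mu> * E x x"
    and x: "x \<in> S" and t: "0 \<le> t"
  shows "E (T t x) (T t x) \<le> exp (- 2 * \<mu> * t) * E x x"
proof -
  have E_diff: "E (x - y) z = E x z - E y z" if "x \<in> S" "y \<in> S" "z \<in> S" for x y z
    using E_add[of x "(-1) *\<^sub>R y" z] E_scale[of y z "-1"] that subspace_scale[OF subspace_S, of y "-1"] by simp
  have E_tendsto: "((\<lambda>s. E (f s) (g s)) \<longlongrightarrow> E a b) F"
    if "(f \<longlongrightarrow> a) F" "(g \<longlongrightarrow> b) F" "a \<in> S" "b \<in> S" "\<forall>\<^sub>F s in F. f s \<in> S \<and> g s \<in> S"
    for f g :: "'d \<Rightarrow> 'a" and a b F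
  proof (rule Lim_null[THEN iffD2], rule Lim_null_comparison)
    have "((\<lambda>s. c * norm (f s - a) * norm (g s) + c * norm a * norm (g s - b)) \<longlongrightarrow> c * norm (a - a) * norm b + c * norm a * norm (b - b)) F"
      using that by (intro tendsto_intros)
    then show "((\<lambda>s. c * norm (f s - a) * norm (g s) + c * norm a * norm (g s - b)) \<longlongrightarrow> 0) F" by simp
    show "\<forall>\<^sub>F s in F. norm (E (f s) (g s) - E a b) \<le> c * norm (f s - a) * norm (g s) + c * norm a * norm (g s - b)"
      using that(5)
    proof eventually_elim
      case (elim s)
      have "E (f s) (g s) - E a b = E (f s - a) (g s) + E a (g s - b)"
        using E_diff[of "f s" a "g s"] E_diff[of "g s" b a] E_sym[of a] elim that(3,4)
        by (simp add: subspace_diff[OF subspace_S])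
      then show ?case
        using E_upper[of "f s - a" "g s"] E_upper[of a "g s - b"] elim that(3,4)
        by (simp add: subspace_diff[OF subspace_S])
    qed
  qed
  have on_D: "E (T t x) (T t x) \<le> exp (- 2 * \<mu> * t) * E x x" if x: "x \<in> D" for x
  proof -
    have xS: "x \<in> S" using x D_S by blast
    define e where "e s = exp (2 * \<mu> * s) * E (T s x) (T s x)" for s
    have orbit: "((\<lambda>s. T s x) \<longlongrightarrow> T r x) (at r within {0..})" if "0 \<le> r" for r
      using T_orbit_continuous[OF xS] that by (auto simp: continuous_on_def)
    have "((\<lambda>s. E (T s x) (T s x)) has_field_derivative 2 * E (T r x) (B (T r x))) (at r)" if r: "0 < r" for r
    proof -
      have rS: "T r x \<in> S" "T r x \<in> D" using T_in[OF _ xS] T_generator_commute[OF x] r by auto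
      have BS: "B (T r x) \<in> S" using B_S rS by blast
      have ev: "\<forall>\<^sub>F s in at r. 0 < s" using r by (intro order_tendstoD(1)[OF tendsto_ident_at])
      \<comment> \<open>A difference of squares: \<open>E (a - b) (a + b) = E a a - E b b\<close>
        reduces the derivative of the quadratic form to the derivative of the orbit and
        continuity.\<close>
      have "((\<lambda>s. E ((1 / (s - r)) *\<^sub>R (T s x - T r x)) (T s x + T r x)) \<longlongrightarrow> E (B (T r x)) (T r x + T r x)) (at r)"
      proof (rule E_tendsto)
        show "((\<lambda>s. (1 / (s - r)) *\<^sub>R (T s x - T r x)) \<longlongrightarrow> B (T r x)) (at r)"
          using T_orbit_derivative[OF x r] T_generator_commute(2)[OF x] r by simp
        have "isCont (\<lambda>s. T s x) r"
          using T_orbit_continuous[OF xS] r by (intro continuous_on_interior[of "{0..}"]) auto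
        then show "((\<lambda>s. T s x + T r x) \<longlongrightarrow> T r x + T r x) (at r)"
          by (intro tendsto_intros) (simp add: isCont_def)
        show "\<forall>\<^sub>F s in at r. (1 / (s - r)) *\<^sub>R (T s x - T r x) \<in> S \<and> T s x + T r x \<in> S"
          using ev by eventually_elim
            (use T_in[OF _ xS] rS subspace_S in \<open>auto intro!: subspace_scale subspace_diff subspace_add simp del: scaleR_right_diff_distrib\<close>)
      qed (use rS BS subspace_S in \<open>auto intro: subspace_add\<close>)
      moreover have "E (B (T r x)) (T r x + T r x) = 2 * E (T r x) (B (T r x))"
        using E_add[of "T r x" "T r x" "B (T r x)"] E_sym[of "B (T r x)" "T r x + T r x"] rS BS subspace_S
        by (simp add: subspace_add)
      moreover have "\<forall>\<^sub>F s in at r. E ((1 / (s - r)) *\<^sub>R (T s x - T r x)) (T s x + T r x)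
          = (E (T s x) (T s x) - E (T r x) (T r x)) / (s - r)"
        using ev
      proof eventually_elim
        case (elim s)
        then have sS: "T s x \<in> S" using T_in[OF _ xS] by auto
        have "E (T s x - T r x) (T s x + T r x) = E (T s x) (T s x) - E (T r x) (T r x)"
          using E_add[of "T s x" "T r x" "T s x"] E_add[of "T s x" "T r x" "T r x"] E_sym[of "T s x" "T s x + T r x"]
            E_sym[of "T r x" "T s x + T r x"] E_sym[of "T s x" "T r x"] E_diff[of "T s x" "T r x" "T s x + T r x"] sS rS(1)
          by (simp add: subspace_add[OF subspace_S])
        then show ?case
          using E_scale[of "T s x - T r x" "T s x + T r x" "1 / (s - r)"] sS rS(1)
          by (simp add: subspace_add[OF subspace_S] subspace_diff[OF subspace_S] del: scaleR_right_diff_distrib)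
      qed
      ultimately show ?thesis
        unfolding has_field_derivative_iff by (simp add: filterlim_cong)
    qed note deriv = this
    have e': "(e has_field_derivative (2 * \<mu> * exp (2 * \<mu> * r) * E (T r x) (T r x) + exp (2 * \<mu> * r) * (2 * E (T r x) (B (T r x))))) (at r)"
      if r: "0 < r" for r
      unfolding e_def by (auto intro!: derivative_eq_intros deriv[OF r])
    have neg: "2 * \<mu> * exp (2 * \<mu> * r) * E (T r x) (T r x) + exp (2 * \<mu> * r) * (2 * E (T r x) (B (T r x))) \<le> 0"
      if r: "0 < r" for r
    proof -
      have "\<mu> * E (T r x) (T r x) + E (T r x) (B (T r x)) \<le> 0"
        using diss[OF T_generator_commute(1)[OF x, of r]] r by simp
      then have "(2 * exp (2 * \<mu> * r)) * (\<mu> * E (T r x) (T r x) + E (T r x) (B (T r x))) \<le> 0"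
        by (intro mult_nonneg_nonpos) auto
      then show ?thesis by (simp add: algebra_simps)
    qed
    have "e t \<le> e 0"
    proof (cases "t = 0")
      case False
      then have t': "0 < t" using t by simp
      show ?thesis
      proof (rule DERIV_nonpos_imp_decreasing_open[OF less_imp_le[OF t']])
        have "((\<lambda>s. e s) \<longlongrightarrow> e r) (at r within {0..t})" if "r \<in> {0..t}" for r
        proof -
          have "((\<lambda>s. T s x) \<longlongrightarrow> T r x) (at r within {0..t})"
            using orbit[of r] that by (auto elim: tendsto_within_subset)
          moreover have "\<forall>\<^sub>F s in at r within {0..t}. T s x \<in> S \<and> T s x \<in> S"
            by (auto simp: eventually_at_filter T_in xS)
          ultimately have "((\<lambda>s. E (T s x) (T s x)) \<longlongrightarrow> E (T r x) (T r x)) (at r within {0..t})"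
            using E_tendsto[of "\<lambda>s. T s x" "T r x"] T_in[OF _ xS] that by auto
          then show ?thesis unfolding e_def by (intro tendsto_intros)
        qed
        then show "continuous_on {0..t} e" by (simp add: continuous_on_def)
      qed (use e' neg in blast)
    qed simp
    then show ?thesis using T_0[OF xS] by (simp add: e_def exp_minus field_simps)
  qed
  obtain y where y: "\<And>n. y n \<in> D" "y \<longlonglongrightarrow> x" using D_dense[OF x] by blast
  have yS: "y n \<in> S" for n using y(1) D_S by blast
  obtain M where M: "\<And>z. z \<in> S \<Longrightarrow> norm (T t z) \<le> M * norm z" using T_bounded[OF t] by blast
  have "(\<lambda>n. T t (y n)) \<longlonglongrightarrow> T t x"
  proof (rule Lim_null[THEN iffD2], rule tendsto_0_le[where K = M])
    show "(\<lambda>n. y n - x) \<longlonglongrightarrow> 0" using y(2) by (simp add: Lim_null[symmetric])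
    show "\<forall>\<^sub>F n in sequentially. norm (T t (y n) - T t x) \<le> norm (y n - x) * M"
      using M[of "y _ - x"] T_diff[OF t yS x] subspace_diff[OF subspace_S yS x] by (simp add: mult.commute)
  qed
  then have "(\<lambda>n. E (T t (y n)) (T t (y n))) \<longlonglongrightarrow> E (T t x) (T t x)"
    using T_in[OF t] yS x by (intro E_tendsto) auto
  moreover have "(\<lambda>n. exp (- 2 * \<mu> * t) * E (y n) (y n)) \<longlonglongrightarrow> exp (- 2 * \<mu> * t) * E x x"
    using y yS x by (intro tendsto_intros E_tendsto) auto
  ultimately show ?thesis by (rule LIMSEQ_le) (use on_D y in auto)
qed

section \<open>Mild solutions on the whole time axis\<close>

definition mild :: "(real \<Rightarrow> 'a) \<Rightarrow> (real \<Rightarrow> 'a) \<Rightarrow> bool" where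
  "mild U G \<longleftrightarrow> (\<forall>t. U t \<in> S \<and> G t \<in> S) \<and>
     (\<forall>s t. s \<le> t \<longrightarrow> ((\<lambda>p. T (t - p) (G p)) has_integral (U t - T (t - s) (U s))) {s..t})"

lemma mild_in_S: "mild U G \<Longrightarrow> U t \<in> S" "mild U G \<Longrightarrow> G t \<in> S"
  by (auto simp: mild_def)

lemma mild_shift:
  assumes "mild U G"
  shows "mild (\<lambda>t. U (t + h)) (\<lambda>t. G (t + h))"
  unfolding mild_def
proof (intro conjI allI impI)
  fix s t :: real assume "s \<le> t"
  then have "((\<lambda>p. T ((t + h) - p) (G p)) has_integral (U (t + h) - T ((t + h) - (s + h)) (U (s + h)))) {s + h..t + h}"
    using assms unfolding mild_def by (meson add_le_cancel_right)
  then show "((\<lambda>p. T (t - p) (G (p + h))) has_integral (U (t + h) - T (t - s) (U (s + h)))) {s..t}"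
    using has_integral_shift_Icc_real[of "\<lambda>p. T ((t + h) - p) (G p)" h] by (simp add: o_def add.commute)
qed (use assms in \<open>auto simp: mild_def\<close>)

lemma mild_diff:
  assumes 1: "mild U1 G1" and 2: "mild U2 G2"
  shows "mild (\<lambda>t. U1 t - U2 t) (\<lambda>t. G1 t - G2 t)"
  unfolding mild_def
proof (intro conjI allI impI)
  fix s t :: real assume st: "s \<le> t"
  have int: "((\<lambda>p. T (t - p) (G1 p) - T (t - p) (G2 p)) has_integral
      ((U1 t - T (t - s) (U1 s)) - (U2 t - T (t - s) (U2 s)))) {s..t}"
    using 1 2 st unfolding mild_def by (intro has_integral_diff) blast+
  have eq: "(U1 t - T (t - s) (U1 s)) - (U2 t - T (t - s) (U2 s))
      = (U1 t - U2 t) - T (t - s) (U1 s - U2 s)"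
    using T_diff[of "t - s" "U1 s" "U2 s"] mild_in_S(1)[OF 1] mild_in_S(1)[OF 2] st by simp
  show "((\<lambda>p. T (t - p) (G1 p - G2 p)) has_integral
      ((U1 t - U2 t) - T (t - s) (U1 s - U2 s))) {s..t}"
    unfolding eq[symmetric]
    by (rule has_integral_eq[OF _ int]) (simp add: T_diff mild_in_S(2)[OF 1] mild_in_S(2)[OF 2])
qed (use 1 2 subspace_S in \<open>auto simp: mild_def intro: subspace_diff\<close>)

lemma mild_scale:
  assumes 1: "mild U G"
  shows "mild (\<lambda>t. c *\<^sub>R U t) (\<lambda>t. c *\<^sub>R G t)"
  unfolding mild_def
proof (intro conjI allI impI)
  fix s t :: real assume st: "s \<le> t"
  have int: "((\<lambda>p. c *\<^sub>R T (t - p) (G p)) has_integral c *\<^sub>R (U t - T (t - s) (U s))) {s..t}"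
    using 1 st unfolding mild_def by (intro has_integral_cmul) blast
  have eq: "c *\<^sub>R (U t - T (t - s) (U s)) = c *\<^sub>R U t - T (t - s) (c *\<^sub>R U s)"
    using st mild_in_S(1)[OF 1] by (simp add: T_scale algebra_simps)
  show "((\<lambda>p. T (t - p) (c *\<^sub>R G p)) has_integral (c *\<^sub>R U t - T (t - s) (c *\<^sub>R U s))) {s..t}"
    unfolding eq[symmetric]
    by (rule has_integral_eq[OF _ int]) (simp add: T_scale mild_in_S(2)[OF 1])
qed (use 1 subspace_S in \<open>auto simp: mild_def intro: subspace_scale\<close>)

text \<open>Let \<open>m\<close> be the supremum of the norm of \<open>U\<close>, finite because of
  the bound \<open>R\<close>. Restarting the solution a time \<tau> earlier gives
  \<open>m \<le> m/2 + K g \<tau>\<close>. The result contains the forcing only: a solution bounded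
  for all past times has forgotten its initial state.\<close>

lemma mild_bound:
  assumes mild: "mild U G"
    and K: "\<And>t x. 0 \<le> t \<Longrightarrow> x \<in> S \<Longrightarrow> norm (T t x) \<le> K * norm x"
    and \<tau>: "0 < \<tau>" "\<And>x. x \<in> S \<Longrightarrow> norm (T \<tau> x) \<le> 1/2 * norm x"
    and U: "\<And>t. norm (U t) \<le> R" and G: "\<And>t. norm (G t) \<le> g" and K0: "0 \<le> K"
  shows "norm (U t) \<le> 2 * K * \<tau> * g"
proof -
  define m where "m = (SUP t. norm (U t))"
  have bdd: "bdd_above (range (\<lambda>t. norm (U t)))" using U by (auto intro!: bdd_aboveI)
  have le: "norm (U t) \<le> m" for t unfolding m_def by (rule cSUP_upper[OF _ bdd]) simp
  have step: "norm (U t) \<le> 1/2 * m + K * g * \<tau>" for t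
  proof -
    have "((\<lambda>p. T (t - p) (G p)) has_integral (U t - T (t - (t - \<tau>)) (U (t - \<tau>)))) {t - \<tau>..t}"
      using mild \<tau>(1) unfolding mild_def by (meson diff_le_self less_imp_le le_diff_eq diff_le_eq less_add_same_cancel1)
    then have "norm (U t - T \<tau> (U (t - \<tau>))) \<le> K * g * measure lborel (cbox (t - \<tau>) t)"
    proof (intro has_integral_bound[where f = "\<lambda>p. T (t - p) (G p)"])
      fix p assume p: "p \<in> cbox (t - \<tau>) t"
      then have "norm (T (t - p) (G p)) \<le> K * norm (G p)" using mild_in_S(2)[OF mild] by (intro K) auto
      also have "\<dots> \<le> K * g" using G K0 by (intro mult_left_mono)
      finally show "norm (T (t - p) (G p)) \<le> K * g" .
    qed (use K0 order_trans[OF norm_ge_zero G] in auto)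
    moreover have "norm (T \<tau> (U (t - \<tau>))) \<le> 1/2 * m"
      using \<tau>(2)[OF mild_in_S(1)[OF mild], of "t - \<tau>"] le[of "t - \<tau>"] by linarith
    ultimately show ?thesis
      using \<tau>(1) norm_triangle_sub[of "U t" "T \<tau> (U (t - \<tau>))"] by simp
  qed
  have "m \<le> 1/2 * m + K * g * \<tau>" unfolding m_def by (rule cSUP_least) (use step in \<open>auto simp: m_def\<close>)
  then show ?thesis using le[of t] by (simp add: mult_ac)
qed

lemma mild_average:
  assumes mild: "mild U G" and U: "continuous_on UNIV U" and G: "continuous_on UNIV G" and st: "s \<le> t"
  shows "integral {s..t} U \<in> D" "B (integral {s..t} U) = U t - U s - integral {s..t} G"
proof -
  have "((\<lambda>q. T (p + k - q) (G q)) has_integral (U (p + k) - T k (U p))) {p..p + k}" if "0 \<le> k" for p k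
    using mild that unfolding mild_def by (metis add_diff_cancel_left' le_add_same_cancel1)
  note mild' = this
  have "continuous_on {s..t + 1} U" "continuous_on {s..t + 1} G"
    using U G by (auto elim: continuous_on_subset)
  note * = integral_of_mild[OF st this(1) mild_in_S(1)[OF mild] this(2) mild_in_S(2)[OF mild] mild']
  show "integral {s..t} U \<in> D" "B (integral {s..t} U) = U t - U s - integral {s..t} G"
    using * by auto
qed

text \<open>Uniform Cauchy quotients have a continuous uniform limit \<open>Y\<close>, which is the
  right derivative; uniformity in \<open>t\<close> turns it into a two-sided one. Membership in the
  domain is read off at each time by subtracting from the quotient of \<open>U\<close> the part due
  to the forcing: what is left is the quotient of the semigroup.\<close>

lemma mild_C1:
  assumes mild: "mild U G" and U: "continuous_on UNIV U" and G: "continuous_on UNIV G"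
    and Cauchy: "\<And>e. 0 < e \<Longrightarrow> \<exists>d>0. \<forall>h\<in>{0<..<d}. \<forall>k\<in>{0<..<d}. \<forall>t.
      norm ((1 / h) *\<^sub>R (U (t + h) - U t) - (1 / k) *\<^sub>R (U (t + k) - U t)) \<le> e"
    and L: "\<And>h t. 0 < h \<Longrightarrow> h < 1 \<Longrightarrow> norm ((1 / h) *\<^sub>R (U (t + h) - U t)) \<le> L"
  obtains Y where "continuous_on UNIV Y" "\<And>t. Y t \<in> S" "\<And>t. U t \<in> D" "\<And>t. Y t = B (U t) + G t"
    "\<And>t. ((\<lambda>h. (1 / h) *\<^sub>R (U (t + h) - U t)) \<longlongrightarrow> Y t) (at 0)" "\<And>t. norm (Y t) \<le> L"
proof -
  define W where "W h t = (1 / h) *\<^sub>R (U (t + h) - U t)" for h t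
  define \<eta> where "\<eta> n = inverse (real (Suc n))" for n
  have \<eta>: "filterlim \<eta> (at_right 0) sequentially"
    unfolding \<eta>_def filterlim_at using LIMSEQ_inverse_real_of_nat by auto
  have \<eta>_small: "\<forall>\<^sub>F n in sequentially. \<eta> n \<in> {0<..<d}" if "0 < d" for d
    by (rule eventually_compose_filterlim[OF _ \<eta>]) (use that in \<open>auto simp: eventually_at_right_field\<close>)
  have US: "U t \<in> S" and GS: "G t \<in> S" for t using mild_in_S[OF mild] by auto
  have WS: "W h t \<in> S" for h t
    unfolding W_def using US by (intro subspace_scale subspace_diff subspace_S)
  have "uniformly_convergent_on UNIV (\<lambda>n t. W (\<eta> n) t)"
    unfolding uniformly_convergent_eq_Cauchy uniformly_Cauchy_on_def
  proof (intro allI impI)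
    fix e :: real assume e: "0 < e"
    obtain d where d: "0 < d" "\<forall>h\<in>{0<..<d}. \<forall>k\<in>{0<..<d}. \<forall>t. norm (W h t - W k t) \<le> e / 2"
      using Cauchy[of "e / 2"] e by (auto simp: W_def)
    obtain N where N: "\<And>n. n \<ge> N \<Longrightarrow> \<eta> n \<in> {0<..<d}"
      using \<eta>_small[OF d(1)] by (auto simp: eventually_sequentially)
    show "\<exists>M. \<forall>x\<in>UNIV. \<forall>m\<ge>M. \<forall>n\<ge>M. dist (W (\<eta> m) x) (W (\<eta> n) x) < e"
    proof (intro exI[of _ N] ballI allI impI)
      fix t m n assume "N \<le> m" "N \<le> n"
      then have "norm (W (\<eta> m) t - W (\<eta> n) t) \<le> e / 2" using d(2) N by blast
      then show "dist (W (\<eta> m) t) (W (\<eta> n) t) < e" using e by (simp add: dist_norm)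
    qed
  qed
  then obtain Y where Y: "uniform_limit UNIV (\<lambda>n t. W (\<eta> n) t) Y sequentially"
    unfolding uniformly_convergent_on_def by blast
  have Ylim: "(\<lambda>n. W (\<eta> n) t) \<longlonglongrightarrow> Y t" for t using tendsto_uniform_limitI[OF Y] by simp
  have Wcont: "continuous_on UNIV (W h)" for h
    unfolding W_def by (intro continuous_intros continuous_on_compose2[OF U]) auto
  have Yc: "continuous_on UNIV Y"
    by (rule uniform_limit_theorem[OF _ Y]) (auto simp: Wcont)
  have YS: "Y t \<in> S" for t using closed_sequentially[OF closed_S _ Ylim] WS by blast
  have close: "\<exists>d>0. \<forall>h\<in>{0<..<d}. \<forall>t. norm (W h t - Y t) \<le> e" if e: "0 < e" for e
  proof -
    obtain d where d: "0 < d" "\<forall>h\<in>{0<..<d}. \<forall>k\<in>{0<..<d}. \<forall>t. norm (W h t - W k t) \<le> e"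
      using Cauchy[of e] e by (auto simp: W_def)
    have "norm (W h t - Y t) \<le> e" if h: "h \<in> {0<..<d}" for h t
    proof (rule LIMSEQ_le_const2)
      show "(\<lambda>n. norm (W h t - W (\<eta> n) t)) \<longlonglongrightarrow> norm (W h t - Y t)" using Ylim by (intro tendsto_intros)
      show "\<exists>N. \<forall>n\<ge>N. norm (W h t - W (\<eta> n) t) \<le> e"
        using \<eta>_small[OF d(1)] unfolding eventually_sequentially using d(2) h by blast
    qed
    then show ?thesis using d(1) by blast
  qed
  have right: "((\<lambda>h. W h t) \<longlongrightarrow> Y t) (at_right 0)" for t
  proof (rule tendstoI)
    fix e :: real assume "0 < e"
    then obtain d where "0 < d" "\<forall>h\<in>{0<..<d}. \<forall>t. norm (W h t - Y t) \<le> e / 2" using close[of "e / 2"] by auto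
    then have "dist (W h t) (Y t) < e" if "0 < h" "h < d" for h
      using that \<open>0 < e\<close> by (fastforce simp: dist_norm intro: le_less_trans[of _ "e / 2"])
    then show "\<forall>\<^sub>F h in at_right 0. dist (W h t) (Y t) < e"
      unfolding eventually_at_right_field using \<open>0 < d\<close> by (intro exI[of _ d]) auto
  qed
  have left: "((\<lambda>h. W (- h) t) \<longlongrightarrow> Y t) (at_right 0)" for t
  proof (rule tendstoI)
    fix e :: real assume e: "0 < e"
    then obtain d where d: "0 < d" "\<forall>h\<in>{0<..<d}. \<forall>t. norm (W h t - Y t) \<le> e / 2" using close[of "e / 2"] by auto
    obtain d' where d': "0 < d'" "\<And>s. dist s t < d' \<Longrightarrow> dist (Y s) (Y t) < e / 2"
      using Yc e unfolding continuous_on_iff by (metis UNIV_I half_gt_zero)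
    have "dist (W (- h) t) (Y t) < e" if h: "0 < h" "h < min d d'" for h
    proof -
      \<comment> \<open>A backward quotient at \<open>t\<close> is a forward quotient at
        \<open>t - h\<close>, where the uniform estimate applies; continuity of \<open>Y\<close>
        returns to \<open>t\<close>.\<close>
      have "W (- h) t = W h (t - h)" by (simp add: W_def algebra_simps)
      then have "dist (W (- h) t) (Y (t - h)) \<le> e / 2" using d(2) h by (auto simp: dist_norm)
      moreover have "dist (Y (t - h)) (Y t) < e / 2" using d'(2)[of "t - h"] h by (auto simp: dist_real_def)
      ultimately show ?thesis using dist_triangle[of "W (- h) t" "Y t" "Y (t - h)"] by linarith
    qed
    then show "\<forall>\<^sub>F h in at_right 0. dist (W (- h) t) (Y t) < e"
      unfolding eventually_at_right_field using d(1) d'(1) by (intro exI[of _ "min d d'"]) auto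
  qed
  have two: "((\<lambda>h. W h t) \<longlongrightarrow> Y t) (at 0)" for t
    unfolding filterlim_at_split using right left by (auto simp: filterlim_at_left_to_right)
  have gen: "U t \<in> D \<and> Y t - G t = B (U t)" for t
  proof -
    \<comment> \<open>Exactly the amount by which the quotient of \<open>U\<close> differs from the
      quotient \<open>(1/h) (T h (U t) - U t)\<close> of the semigroup.\<close>
    define N where "N h = (1 / h) *\<^sub>R (U (t + h) - T h (U t))" for h
    have "(N \<longlongrightarrow> G t) (at_right 0)"
    proof (rule tendstoI)
      fix e :: real assume e: "0 < e"
      have "continuous_on ({0..1} \<times> {t..t + 1}) (\<lambda>(r, p). T r (G p))"
        using G GS by (intro T_joint_continuous) (auto elim: continuous_on_subset)
      moreover have "(0::real, t) \<in> {0..1} \<times> {t..t + 1}" by simp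
      ultimately obtain d where d: "0 < d" "\<And>z. z \<in> {0..1} \<times> {t..t + 1} \<Longrightarrow> dist z (0, t) < d \<Longrightarrow>
          dist ((\<lambda>(r, p). T r (G p)) z) ((\<lambda>(r, p). T r (G p)) (0, t)) < e / 2"
        unfolding continuous_on_iff using e by (meson half_gt_zero)
      have "dist (N h) (G t) < e" if h: "0 < h" "h < min (d / 2) 1" for h
      proof -
        have "((\<lambda>q. T (t + h - q) (G q)) has_integral (U (t + h) - T h (U t))) {t..t + h}"
          using mild[unfolded mild_def, THEN conjunct2, rule_format, of t "t + h"] h by simp
        then have "((\<lambda>q. T (t + h - q) (G q) - G t) has_integral (U (t + h) - T h (U t) - h *\<^sub>R G t)) (cbox t (t + h))"
          using has_integral_diff[OF _ has_integral_const_real[of "G t" t "t + h"]] h by (simp add: cbox_interval)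
        then have "norm (U (t + h) - T h (U t) - h *\<^sub>R G t) \<le> e / 2 * measure lborel (cbox t (t + h))"
        proof (rule has_integral_bound[rotated])
          fix q assume q: "q \<in> cbox t (t + h)"
          have "dist (t + h - q, q) (0, t) \<le> \<bar>t + h - q\<bar> + \<bar>q - t\<bar>"
            by (auto simp: dist_prod_def dist_real_def intro: sqrt_sum_squares_le_sum_abs[THEN order_trans])
          then have "dist (t + h - q, q) (0, t) < d" using q h by (auto simp: cbox_interval)
          then have "dist (T (t + h - q) (G q)) (T 0 (G t)) < e / 2"
            using d(2)[of "(t + h - q, q)"] q h by (auto simp: cbox_interval)
          then show "norm (T (t + h - q) (G q) - G t) \<le> e / 2"
            using T_0[OF GS[of t]] by (simp add: dist_norm)
        qed (use e in auto)
        then have *: "norm (U (t + h) - T h (U t) - h *\<^sub>R G t) \<le> e / 2 * h" using h by simp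
        have "N h - G t = (1 / h) *\<^sub>R (U (t + h) - T h (U t) - h *\<^sub>R G t)"
          using h by (simp add: N_def algebra_simps)
        then have "norm (N h - G t) = norm (U (t + h) - T h (U t) - h *\<^sub>R G t) / h"
          using h by (simp only: norm_scaleR) simp
        also have "\<dots> \<le> e / 2" using * h by (simp add: divide_le_eq)
        finally show ?thesis using e by (simp add: dist_norm)
      qed
      then show "\<forall>\<^sub>F h in at_right 0. dist (N h) (G t) < e"
        unfolding eventually_at_right_field using d(1) by (intro exI[of _ "min (d / 2) 1"]) auto
    qed
    then have "((\<lambda>h. W h t - N h) \<longlongrightarrow> Y t - G t) (at_right 0)" using right by (intro tendsto_diff)
    moreover have "(\<lambda>h. W h t - N h) = (\<lambda>h. (1 / h) *\<^sub>R (T h (U t) - U t))"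
      by (auto simp: W_def N_def algebra_simps)
    ultimately show ?thesis using generator[OF US, of "Y t - G t" t] YS GS subspace_diff[OF subspace_S] by auto
  qed
  have "norm (Y t) \<le> L" for t
  proof (rule LIMSEQ_le_const2)
    show "(\<lambda>n. norm (W (\<eta> n) t)) \<longlonglongrightarrow> norm (Y t)" using Ylim by (intro tendsto_intros)
    have "norm (W (\<eta> n) t) \<le> L" if "1 \<le> n" for n
    proof -
      have "0 < \<eta> n" "\<eta> n < 1" using that by (auto simp: \<eta>_def inverse_eq_divide)
      then show ?thesis using L[of "\<eta> n" t] by (simp add: W_def)
    qed
    then show "\<exists>N. \<forall>n\<ge>N. norm (W (\<eta> n) t) \<le> L" by blast
  qed
  moreover have "Y t = B (U t) + G t" for t using gen[of t] by (auto simp: algebra_simps)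
  ultimately show ?thesis
    using gen YS Yc two by (intro that[of Y]) (auto simp: W_def)
qed

end

section \<open>The elliptic form\<close>

text \<open>Hoelder's inequality with exponents 3/2 and 3. It is derived from a pointwise Young
  inequality after normalising by \<open>r\<close> and \<open>s\<close>; when one of them is zero
  the integrand vanishes almost everywhere.\<close>

lemma nn_integral_Holder_6:
  fixes a b :: "'a \<Rightarrow> real"
  assumes [measurable]: "a \<in> borel_measurable M" "b \<in> borel_measurable M"
    and a: "(\<integral>\<^sup>+ x. ennreal (a x ^ 6) \<partial>M) \<le> ennreal (r ^ 6)" and b: "(\<integral>\<^sup>+ x. ennreal (b x ^ 6) \<partial>M) \<le> ennreal (s ^ 6)"
    and rs: "0 \<le> r" "0 \<le> s"
  shows "(\<integral>\<^sup>+ x. ennreal (a x ^ 4 * (b x)\<^sup>2) \<partial>M) \<le> ennreal (r ^ 4 * s\<^sup>2)"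
proof (cases "r = 0 \<or> s = 0")
  case True
  have zero: "AE x in M. c x = 0" if "c \<in> borel_measurable M" "(\<integral>\<^sup>+ x. ennreal (c x ^ 6) \<partial>M) \<le> ennreal (0 ^ 6)" for c :: "'a \<Rightarrow> real"
  proof -
    have "(\<integral>\<^sup>+ x. ennreal (c x ^ 6) \<partial>M) = 0" using that by simp
    then have "AE x in M. ennreal (c x ^ 6) = 0" using that(1) by (subst (asm) nn_integral_0_iff_AE) auto
    then show ?thesis by eventually_elim (auto simp: ennreal_eq_0_iff power_le_zero_eq)
  qed
  have "AE x in M. a x = 0 \<or> b x = 0"
    using True zero[of a] zero[of b] a b by (auto elim: eventually_mono)
  then have "(\<integral>\<^sup>+ x. ennreal (a x ^ 4 * (b x)\<^sup>2) \<partial>M) = (\<integral>\<^sup>+ x. 0 \<partial>M)"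
    by (intro nn_integral_cong_AE) (auto elim!: eventually_mono)
  then show ?thesis by simp
next
  case False
  then have rs: "0 < r" "0 < s" using rs by auto
  define c where "c = r ^ 4 * s\<^sup>2"
  have c: "0 < c" using rs by (simp add: c_def)
  have Young: "a x ^ 4 * (b x)\<^sup>2 \<le> (2 * c / (3 * r ^ 6)) * a x ^ 6 + (c / (3 * s ^ 6)) * b x ^ 6" for x
  proof -
    define X where "X = (a x / r)\<^sup>2"
    define Y where "Y = (b x / s)\<^sup>2"
    have XY: "0 \<le> X" "0 \<le> Y" by (auto simp: X_def Y_def)
    \<comment> \<open>The product equals \<open>2 X^3 - 3 X^2 Y + Y^3\<close>, so Young's inequality
      is the nonnegativity of a factored cubic.\<close>
    have "0 \<le> (X - Y)\<^sup>2 * (2 * X + Y)" using XY by simp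
    then have "3 * (X\<^sup>2 * Y) \<le> 2 * X ^ 3 + Y ^ 3"
      by (simp add: power2_eq_square power3_eq_cube algebra_simps)
    then have "c * (X\<^sup>2 * Y) \<le> c * ((2 * X ^ 3 + Y ^ 3) / 3)" using c by (intro mult_left_mono) auto
    moreover have "c * (X\<^sup>2 * Y) = a x ^ 4 * (b x)\<^sup>2"
      using rs by (simp add: X_def Y_def c_def power_divide flip: power_mult)
    moreover have "c * ((2 * X ^ 3 + Y ^ 3) / 3) = (2 * c / (3 * r ^ 6)) * a x ^ 6 + (c / (3 * s ^ 6)) * b x ^ 6"
      by (simp add: X_def Y_def power_divide add_divide_distrib distrib_left flip: power_mult)
    ultimately show ?thesis by simp
  qed
  have "(\<integral>\<^sup>+ x. ennreal (a x ^ 4 * (b x)\<^sup>2) \<partial>M)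
      \<le> (\<integral>\<^sup>+ x. ennreal (2 * c / (3 * r ^ 6)) * ennreal (a x ^ 6) + ennreal (c / (3 * s ^ 6)) * ennreal (b x ^ 6) \<partial>M)"
    using Young c rs by (intro nn_integral_mono) (simp add: ennreal_mult[symmetric] ennreal_plus[symmetric] del: ennreal_plus)
  also have "\<dots> = ennreal (2 * c / (3 * r ^ 6)) * (\<integral>\<^sup>+ x. ennreal (a x ^ 6) \<partial>M) + ennreal (c / (3 * s ^ 6)) * (\<integral>\<^sup>+ x. ennreal (b x ^ 6) \<partial>M)"
    by (simp add: nn_integral_add nn_integral_cmult)
  also have "\<dots> \<le> ennreal (2 * c / (3 * r ^ 6)) * ennreal (r ^ 6) + ennreal (c / (3 * s ^ 6)) * ennreal (s ^ 6)"
    by (intro add_mono mult_left_mono a b) auto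
  also have "\<dots> = ennreal c"
    using c rs by (simp add: ennreal_mult[symmetric] ennreal_plus[symmetric] del: ennreal_plus)
  finally show ?thesis by (simp add: c_def)
qed

lemma norm_L2_le_of_nn:
  assumes "(\<integral>\<^sup>+ x. ennreal ((rep_L2 z x)\<^sup>2) \<partial>lebesgue) \<le> ennreal (c\<^sup>2)" "0 \<le> c"
  shows "norm z \<le> c"
proof -
  have "(norm z)\<^sup>2 \<le> c\<^sup>2" using assms(1) unfolding nn_norm_L2 by (simp add: ennreal_le_iff)
  then show ?thesis using assms(2) by (rule power2_le_imp_le)
qed

lemma norm_L2_le_AE:
  assumes "AE x in lebesgue. \<bar>rep_L2 z x\<bar> \<le> c * \<bar>rep_L2 w x\<bar>" "0 \<le> c"
  shows "norm z \<le> c * norm w"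
proof (rule norm_L2_le_of_nn)
  have "(\<integral>\<^sup>+ x. ennreal ((rep_L2 z x)\<^sup>2) \<partial>lebesgue) \<le> (\<integral>\<^sup>+ x. ennreal (c\<^sup>2) * ennreal ((rep_L2 w x)\<^sup>2) \<partial>lebesgue)"
  proof (rule nn_integral_mono_AE)
    show "AE x in lebesgue. ennreal ((rep_L2 z x)\<^sup>2) \<le> ennreal (c\<^sup>2) * ennreal ((rep_L2 w x)\<^sup>2)"
      using assms(1)
    proof eventually_elim
      case (elim x)
      then have "\<bar>rep_L2 z x\<bar>\<^sup>2 \<le> (c * \<bar>rep_L2 w x\<bar>)\<^sup>2" by (intro power_mono) auto
      then show ?case by (simp add: power_mult_distrib ennreal_mult[symmetric])
    qed
  qed
  also have "\<dots> = ennreal (c\<^sup>2) * ennreal ((norm w)\<^sup>2)" by (simp add: nn_integral_cmult nn_norm_L2)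
  finally show "(\<integral>\<^sup>+ x. ennreal ((rep_L2 z x)\<^sup>2) \<partial>lebesgue) \<le> ennreal ((c * norm w)\<^sup>2)"
    by (simp add: ennreal_mult[symmetric] power_mult_distrib)
qed (use assms in auto)

lemma norm_vec_L2_le:
  assumes "\<And>i. norm (g $ i) \<le> c * norm (h $ i)" "0 \<le> c"
  shows "norm (g :: L2^3) \<le> c * norm (h :: L2^3)"
proof (rule power2_le_imp_le)
  have "(norm (g $ i))\<^sup>2 \<le> c\<^sup>2 * (norm (h $ i))\<^sup>2" for i
    using power_mono[OF assms(1), of i 2] by (simp add: power_mult_distrib)
  then show "(norm g)\<^sup>2 \<le> (c * norm h)\<^sup>2"
    unfolding power_mult_distrib norm_vec_L2_square sum_distrib_left by (intro sum_mono)
qed (use assms(2) in auto)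

lemma abs_mult_square_bounds:
  fixes b p :: real
  shows "- (\<bar>b\<bar> * p\<^sup>2) \<le> b * p * p" "b * p * p \<le> \<bar>b\<bar> * p\<^sup>2"
  using mult_right_mono[of "- \<bar>b\<bar>" b "p\<^sup>2"] mult_right_mono[of b "\<bar>b\<bar>" "p\<^sup>2"]
  by (simp_all add: power2_eq_square mult.assoc)

locale elliptic_form =
  fixes \<Omega> :: "(real^3) set" and a0 a1 lambda1 :: real and Cnu :: "real \<Rightarrow> real"
    and A :: "real^3 \<Rightarrow> real^3^3" and \<beta> :: "real^3 \<Rightarrow> real"
  assumes open_\<Omega>: "open \<Omega>" and a0: "0 < a0" and a1: "0 < a1" and lambda1: "0 < lambda1"
    and Cnu: "\<And>\<nu>. 0 < \<nu> \<Longrightarrow> 0 < Cnu \<nu>"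
    and coeff: "coefficient_assms \<Omega> a0 a1 lambda1 Cnu A \<beta>"
begin

lemma sets_\<Omega>: "\<Omega> \<in> sets lebesgue" by (rule open_lebesgue[OF open_\<Omega>])

lemma rep_measurable_on [measurable]: "rep_L2 u \<in> borel_measurable (lebesgue_on \<Omega>)"
  by (rule measurable_restrict_space1) measurable

lemma AE_on: "AE x in lebesgue. P x \<Longrightarrow> AE x in lebesgue_on \<Omega>. P x"
  unfolding AE_lebesgue_on[OF sets_\<Omega>] by (auto elim: eventually_mono)

lemma integrable_on: "integrable lebesgue k \<Longrightarrow> integrable (lebesgue_on \<Omega>) (k :: _ \<Rightarrow> real)"
  by (rule integrable_restrict_space[THEN iffD2]) (use sets_\<Omega> integrable_mult_indicator[OF sets_\<Omega>, of k] in auto)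

lemma integral_on_eq:
  assumes "AE x in lebesgue. x \<notin> \<Omega> \<longrightarrow> k x = 0" and [measurable]: "k \<in> borel_measurable lebesgue"
  shows "(LINT x|lebesgue_on \<Omega>. k x) = (LINT x|lebesgue. (k x :: real))"
  unfolding integral_lebesgue_on[OF sets_\<Omega>]
  using assms(1) sets_\<Omega> by (intro integral_cong_AE) (auto simp: indicator_def)

lemma integral_on_L2: "u \<in> L2_on \<Omega> \<Longrightarrow> (LINT x|lebesgue_on \<Omega>. (rep_L2 u x)\<^sup>2) = (norm u)\<^sup>2"
  unfolding norm_L2_square by (intro integral_on_eq) (auto simp: L2_on_def)

lemma norm_grad_at: "(norm (grad_at \<Omega> u x))\<^sup>2 = (\<Sum>i\<in>UNIV. (rep_L2 (grad \<Omega> u $ i) x)\<^sup>2)"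
  unfolding norm_vec_def L2_set_def by (simp add: sum_nonneg grad_at_def)

lemma integrable_on_square: "integrable (lebesgue_on \<Omega>) (\<lambda>x. (rep_L2 u x)\<^sup>2)"
  by (rule integrable_on[OF rep_L2_integrable_square])

lemma integral_on_grad:
  "u \<in> H10 \<Omega> \<Longrightarrow> (LINT x|lebesgue_on \<Omega>. (norm (grad_at \<Omega> u x))\<^sup>2) = (norm (grad \<Omega> u))\<^sup>2"
  unfolding norm_grad_at norm_vec_L2_square
  by (simp add: integrable_on_square integral_on_L2 grad_L2_on[OF open_\<Omega>])

lemma A_measurable: "(\<lambda>x. A x $ i $ j) \<in> borel_measurable (lebesgue_on \<Omega>)"
  and A_bounded: "\<exists>c. AE x in lebesgue_on \<Omega>. \<bar>A x $ i $ j\<bar> \<le> c"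
  and A_sym: "AE x in lebesgue_on \<Omega>. \<forall>i j. A x $ i $ j = A x $ j $ i"
  and A_elliptic: "AE x in lebesgue_on \<Omega>. \<forall>\<xi>. a0 * (norm \<xi>)\<^sup>2 \<le> (A x *v \<xi>) \<bullet> \<xi> \<and> (A x *v \<xi>) \<bullet> \<xi> \<le> a1 * (norm \<xi>)\<^sup>2"
  and \<beta>_measurable: "\<beta> \<in> borel_measurable (lebesgue_on \<Omega>)"
  and \<beta>_bound: "0 < \<nu> \<Longrightarrow> u \<in> H10 \<Omega> \<Longrightarrow> (\<integral>\<^sup>+ x. ennreal (\<bar>\<beta> x\<bar> * (rep_L2 u x)\<^sup>2) \<partial>lebesgue_on \<Omega>) \<le>
        ennreal (\<nu> * (norm (grad \<Omega> u))\<^sup>2 + Cnu \<nu> * (norm u)\<^sup>2)"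
  and form_positive: "u \<in> H10 \<Omega> \<Longrightarrow> lambda1 * (norm u)\<^sup>2 \<le> H10_inner \<Omega> A \<beta> u u"
proof -
  have eq: "(A x *v \<xi>) \<bullet> \<xi> = (\<Sum>i\<in>UNIV. \<Sum>j\<in>UNIV. A x $ i $ j * \<xi> $ i * \<xi> $ j)" for x \<xi>
    by (simp add: matrix_vector_mult_def inner_vec_def sum_distrib_left sum_distrib_right mult_ac)
  note c = coeff[unfolded coefficient_assms_def Linf_def, folded eq]
  show "(\<lambda>x. A x $ i $ j) \<in> borel_measurable (lebesgue_on \<Omega>)" "\<exists>c. AE x in lebesgue_on \<Omega>. \<bar>A x $ i $ j\<bar> \<le> c"
    "AE x in lebesgue_on \<Omega>. \<forall>i j. A x $ i $ j = A x $ j $ i"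
    "AE x in lebesgue_on \<Omega>. \<forall>\<xi>. a0 * (norm \<xi>)\<^sup>2 \<le> (A x *v \<xi>) \<bullet> \<xi> \<and> (A x *v \<xi>) \<bullet> \<xi> \<le> a1 * (norm \<xi>)\<^sup>2"
    "\<beta> \<in> borel_measurable (lebesgue_on \<Omega>)"
    using c by blast+
  show "(\<integral>\<^sup>+ x. ennreal (\<bar>\<beta> x\<bar> * (rep_L2 u x)\<^sup>2) \<partial>lebesgue_on \<Omega>) \<le>
        ennreal (\<nu> * (norm (grad \<Omega> u))\<^sup>2 + Cnu \<nu> * (norm u)\<^sup>2)" if "0 < \<nu>" "u \<in> H10 \<Omega>"
  proof -
    have "(\<integral>\<^sup>+ x. ennreal (\<bar>\<beta> x\<bar> * (rep_L2 u x)\<^sup>2) \<partial>lebesgue_on \<Omega>) \<le>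
        ennreal (\<nu> * (LINT x|lebesgue_on \<Omega>. (norm (grad_at \<Omega> u x))\<^sup>2) + Cnu \<nu> * (LINT x|lebesgue_on \<Omega>. (rep_L2 u x)\<^sup>2))"
      using c that by blast
    then show ?thesis using that by (simp add: integral_on_grad integral_on_L2 H10_L2_on[OF open_\<Omega>])
  qed
  show "lambda1 * (norm u)\<^sup>2 \<le> H10_inner \<Omega> A \<beta> u u" if "u \<in> H10 \<Omega>"
  proof -
    have "lambda1 * (LINT x|lebesgue_on \<Omega>. (rep_L2 u x)\<^sup>2) \<le>
        (LINT x|lebesgue_on \<Omega>. (A x *v grad_at \<Omega> u x) \<bullet> grad_at \<Omega> u x) + (LINT x|lebesgue_on \<Omega>. \<beta> x * (rep_L2 u x)\<^sup>2)"
      using c that by blast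
    then have "lambda1 * (norm u)\<^sup>2 \<le>
        (LINT x|lebesgue_on \<Omega>. (A x *v grad_at \<Omega> u x) \<bullet> grad_at \<Omega> u x) + (LINT x|lebesgue_on \<Omega>. \<beta> x * (rep_L2 u x)\<^sup>2)"
      using that by (simp add: integral_on_L2 H10_L2_on[OF open_\<Omega>])
    then show ?thesis unfolding H10_inner_def power2_eq_square mult.assoc .
  qed
qed

lemma integrable_A: "integrable (lebesgue_on \<Omega>) (\<lambda>x. (A x *v grad_at \<Omega> u x) \<bullet> grad_at \<Omega> v x)"
proof -
  have "integrable (lebesgue_on \<Omega>) (\<lambda>x. A x $ i $ j * (rep_L2 g x * rep_L2 h x))" for i j g h
  proof -
    obtain c where c: "AE x in lebesgue_on \<Omega>. \<bar>A x $ i $ j\<bar> \<le> c" using A_bounded by blast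
    have "integrable (lebesgue_on \<Omega>) (\<lambda>x. c * (rep_L2 g x * rep_L2 h x))"
      by (intro integrable_mult_right integrable_on integrable_rep_L2_mult)
    then show ?thesis
    proof (rule Bochner_Integration.integrable_bound)
      show "(\<lambda>x. A x $ i $ j * (rep_L2 g x * rep_L2 h x)) \<in> borel_measurable (lebesgue_on \<Omega>)"
        using A_measurable by (intro borel_measurable_times) auto
      show "AE x in lebesgue_on \<Omega>. norm (A x $ i $ j * (rep_L2 g x * rep_L2 h x)) \<le> norm (c * (rep_L2 g x * rep_L2 h x))"
        using c by eventually_elim (auto simp: abs_mult intro!: mult_right_mono)
    qed
  qed
  then have "integrable (lebesgue_on \<Omega>) (\<lambda>x. \<Sum>i\<in>UNIV. \<Sum>j\<in>UNIV. A x $ i $ j * (rep_L2 (grad \<Omega> u $ j) x * rep_L2 (grad \<Omega> v $ i) x))"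
    by (intro Bochner_Integration.integrable_sum)
  then show ?thesis
    by (simp add: matrix_vector_mult_def inner_vec_def grad_at_def sum_distrib_left sum_distrib_right mult_ac)
qed

lemma integrable_\<beta>_square:
  assumes "u \<in> H10 \<Omega>"
  shows "integrable (lebesgue_on \<Omega>) (\<lambda>x. \<bar>\<beta> x\<bar> * (rep_L2 u x)\<^sup>2)"
proof (rule integrableI_nonneg)
  show "(\<lambda>x. \<bar>\<beta> x\<bar> * (rep_L2 u x)\<^sup>2) \<in> borel_measurable (lebesgue_on \<Omega>)"
    using \<beta>_measurable by measurable
  show "(\<integral>\<^sup>+ x. ennreal (\<bar>\<beta> x\<bar> * (rep_L2 u x)\<^sup>2) \<partial>lebesgue_on \<Omega>) < \<infinity>"
    using \<beta>_bound[of 1 u] assms by (auto intro: le_less_trans)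
qed auto

lemma integrable_\<beta>:
  assumes "u \<in> H10 \<Omega>" "v \<in> H10 \<Omega>"
  shows "integrable (lebesgue_on \<Omega>) (\<lambda>x. \<beta> x * rep_L2 u x * rep_L2 v x)"
proof (rule Bochner_Integration.integrable_bound)
  show "integrable (lebesgue_on \<Omega>) (\<lambda>x. \<bar>\<beta> x\<bar> * (rep_L2 u x)\<^sup>2 + \<bar>\<beta> x\<bar> * (rep_L2 v x)\<^sup>2)"
    by (intro Bochner_Integration.integrable_add integrable_\<beta>_square assms)
  show "(\<lambda>x. \<beta> x * rep_L2 u x * rep_L2 v x) \<in> borel_measurable (lebesgue_on \<Omega>)"
    using \<beta>_measurable by measurable
  have "\<bar>b * p * q\<bar> \<le> \<bar>\<bar>b\<bar> * p\<^sup>2 + \<bar>b\<bar> * q\<^sup>2\<bar>" for b p q :: real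
  proof -
    have "2 * (\<bar>p\<bar> * \<bar>q\<bar>) \<le> p\<^sup>2 + q\<^sup>2" using sum_squares_bound[of "\<bar>p\<bar>" "\<bar>q\<bar>"] by (simp add: mult.assoc)
    moreover have "0 \<le> \<bar>p\<bar> * \<bar>q\<bar>" by simp
    ultimately have "\<bar>p\<bar> * \<bar>q\<bar> \<le> p\<^sup>2 + q\<^sup>2" by linarith
    then have "\<bar>b\<bar> * (\<bar>p\<bar> * \<bar>q\<bar>) \<le> \<bar>b\<bar> * (p\<^sup>2 + q\<^sup>2)" by (intro mult_left_mono) auto
    then show ?thesis by (simp add: abs_mult distrib_left mult.assoc)
  qed
  then show "AE x in lebesgue_on \<Omega>. norm (\<beta> x * rep_L2 u x * rep_L2 v x) \<le> norm (\<bar>\<beta> x\<bar> * (rep_L2 u x)\<^sup>2 + \<bar>\<beta> x\<bar> * (rep_L2 v x)\<^sup>2)"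
    by simp
qed

section \<open>Symmetry, coercivity and boundedness of the form\<close>

abbreviation form :: "L2 \<Rightarrow> L2 \<Rightarrow> real" where "form \<equiv> H10_inner \<Omega> A \<beta>"

abbreviation fnorm :: "L2 \<Rightarrow> real" where "fnorm \<equiv> H10_norm \<Omega> A \<beta>"

lemma form_add:
  assumes u: "u \<in> H10 \<Omega>" and v: "v \<in> H10 \<Omega>" and w: "w \<in> H10 \<Omega>"
  shows "form (u + v) w = form u w + form v w"
proof -
  have ae: "AE x in lebesgue_on \<Omega>. rep_L2 (u + v) x = rep_L2 u x + rep_L2 v x" by (rule AE_on[OF rep_L2_add])
  have "AE x in lebesgue_on \<Omega>. \<forall>i. rep_L2 (grad \<Omega> (u + v) $ i) x = rep_L2 (grad \<Omega> u $ i) x + rep_L2 (grad \<Omega> v $ i) x"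
    unfolding AE_all_countable by (auto simp: grad_add[OF open_\<Omega> u v] intro!: AE_on rep_L2_add)
  then have ag: "AE x in lebesgue_on \<Omega>. grad_at \<Omega> (u + v) x = grad_at \<Omega> u x + grad_at \<Omega> v x"
    by eventually_elim (simp add: vec_eq_iff grad_at_def)
  have "(LINT x|lebesgue_on \<Omega>. (A x *v grad_at \<Omega> (u + v) x) \<bullet> grad_at \<Omega> w x)
      = (LINT x|lebesgue_on \<Omega>. (A x *v grad_at \<Omega> u x) \<bullet> grad_at \<Omega> w x + (A x *v grad_at \<Omega> v x) \<bullet> grad_at \<Omega> w x)"
    using ag by (intro integral_cong_AE borel_measurable_integrable integrable_A Bochner_Integration.integrable_add)
      (auto simp: matrix_vector_right_distrib inner_add_left)
  moreover have "(LINT x|lebesgue_on \<Omega>. \<beta> x * rep_L2 (u + v) x * rep_L2 w x)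
      = (LINT x|lebesgue_on \<Omega>. \<beta> x * rep_L2 u x * rep_L2 w x + \<beta> x * rep_L2 v x * rep_L2 w x)"
    using ae by (intro integral_cong_AE borel_measurable_integrable integrable_\<beta> Bochner_Integration.integrable_add H10_add[OF open_\<Omega>] u v w)
      (auto simp: algebra_simps)
  ultimately show ?thesis
    unfolding H10_inner_def by (simp add: integrable_A integrable_\<beta> u v w)
qed

lemma form_scale:
  assumes u: "u \<in> H10 \<Omega>" and w: "w \<in> H10 \<Omega>"
  shows "form (c *\<^sub>R u) w = c * form u w"
proof -
  have ae: "AE x in lebesgue_on \<Omega>. rep_L2 (c *\<^sub>R u) x = c * rep_L2 u x" by (rule AE_on[OF rep_L2_scaleR])
  have "AE x in lebesgue_on \<Omega>. \<forall>i. rep_L2 (grad \<Omega> (c *\<^sub>R u) $ i) x = c * rep_L2 (grad \<Omega> u $ i) x"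
    unfolding AE_all_countable by (auto simp: grad_scale[OF open_\<Omega> u] intro!: AE_on rep_L2_scaleR)
  then have ag: "AE x in lebesgue_on \<Omega>. grad_at \<Omega> (c *\<^sub>R u) x = c *\<^sub>R grad_at \<Omega> u x"
    by eventually_elim (simp add: vec_eq_iff grad_at_def)
  have "(LINT x|lebesgue_on \<Omega>. (A x *v grad_at \<Omega> (c *\<^sub>R u) x) \<bullet> grad_at \<Omega> w x)
      = (LINT x|lebesgue_on \<Omega>. c * ((A x *v grad_at \<Omega> u x) \<bullet> grad_at \<Omega> w x))"
    using ag by (intro integral_cong_AE borel_measurable_integrable integrable_A integrable_mult_right)
      (auto simp: matrix_vector_mult_scaleR)
  moreover have "(LINT x|lebesgue_on \<Omega>. \<beta> x * rep_L2 (c *\<^sub>R u) x * rep_L2 w x)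
      = (LINT x|lebesgue_on \<Omega>. c * (\<beta> x * rep_L2 u x * rep_L2 w x))"
    using ae by (intro integral_cong_AE borel_measurable_integrable integrable_\<beta> integrable_mult_right H10_scale[OF open_\<Omega>] u w) auto
  ultimately show ?thesis
    unfolding H10_inner_def by (simp add: distrib_left)
qed

lemma form_sym: "form u w = form w u"
proof -
  have "(LINT x|lebesgue_on \<Omega>. (A x *v grad_at \<Omega> u x) \<bullet> grad_at \<Omega> w x) = (LINT x|lebesgue_on \<Omega>. (A x *v grad_at \<Omega> w x) \<bullet> grad_at \<Omega> u x)"
  proof (intro integral_cong_AE borel_measurable_integrable integrable_A)
    show "AE x in lebesgue_on \<Omega>. (A x *v grad_at \<Omega> u x) \<bullet> grad_at \<Omega> w x = (A x *v grad_at \<Omega> w x) \<bullet> grad_at \<Omega> u x"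
      using A_sym
    proof eventually_elim
      case (elim x)
      then have "transpose (A x) = A x" by (simp add: transpose_def vec_eq_iff)
      then show ?case by (metis dot_lmul_matrix inner_commute transpose_matrix_vector)
    qed
  qed
  then show ?thesis unfolding H10_inner_def by (simp add: mult_ac)
qed

lemma form_diff:
  assumes "u \<in> H10 \<Omega>" "v \<in> H10 \<Omega>" "w \<in> H10 \<Omega>"
  shows "form (u - v) w = form u w - form v w"
  using form_add[of u "(-1) *\<^sub>R v" w] form_scale[of v w "-1"] H10_scale[OF open_\<Omega>, of v "-1"] assms by simp

lemma form_nonneg: "u \<in> H10 \<Omega> \<Longrightarrow> 0 \<le> form u u"
  using form_positive[of u] lambda1 by (meson mult_nonneg_nonneg less_imp_le order_trans zero_le_power2)

lemma fnorm_square: "u \<in> H10 \<Omega> \<Longrightarrow> (fnorm u)\<^sup>2 = form u u"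
  by (simp add: H10_norm_def form_nonneg)

lemma fnorm_nonneg: "u \<in> H10 \<Omega> \<Longrightarrow> 0 \<le> fnorm u"
  by (simp add: H10_norm_def form_nonneg)

lemma form_zero: "u \<in> H10 \<Omega> \<Longrightarrow> form u 0 = 0"
  using form_scale[of u u 0] form_sym[of u 0] by simp

lemma form_Cauchy_Schwarz:
  assumes u: "u \<in> H10 \<Omega>" and v: "v \<in> H10 \<Omega>"
  shows "\<bar>form u v\<bar> \<le> fnorm u * fnorm v"
proof -
  have "(form u v)\<^sup>2 \<le> form u u * form v v"
  proof (cases "form v v = 0")
    case True
    then have "lambda1 * (norm v)\<^sup>2 \<le> 0" using form_positive[OF v] by simp
    then have "v = 0" using lambda1 by (simp add: mult_le_0_iff)
    then show ?thesis using form_zero[OF u] True by simp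
  next
    case False
    then have c: "0 < form v v" using form_nonneg[OF v] by simp
    define t where "t = - (form u v / form v v)"
    have tv: "t *\<^sub>R v \<in> H10 \<Omega>" "u + t *\<^sub>R v \<in> H10 \<Omega>" using H10_scale[OF open_\<Omega> v] H10_add[OF open_\<Omega> u] by auto
    have "form (u + t *\<^sub>R v) (u + t *\<^sub>R v) = form u u + 2 * t * form u v + t\<^sup>2 * form v v"
      using form_add[OF u tv(1) tv(2)] form_scale[OF v tv(2), of t] form_sym[of u "u + t *\<^sub>R v"] form_sym[of v "u + t *\<^sub>R v"]
        form_add[OF u tv(1) u] form_add[OF u tv(1) v] form_scale[OF v u, of t] form_scale[OF v v, of t] form_sym[of v u]
      by (simp add: algebra_simps power2_eq_square)
    also have "\<dots> = form u u - (form u v)\<^sup>2 / form v v"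
      using c by (simp add: t_def power2_eq_square field_simps)
    finally have "0 \<le> form u u - (form u v)\<^sup>2 / form v v" using form_nonneg[OF tv(2)] by simp
    then show ?thesis using c by (simp add: field_simps)
  qed
  then have "\<bar>form u v\<bar>\<^sup>2 \<le> (fnorm u * fnorm v)\<^sup>2" using u v by (simp add: power_mult_distrib fnorm_square)
  then show ?thesis by (rule power2_le_imp_le) (use fnorm_nonneg u v in simp)
qed

lemma \<beta>_lower: "u \<in> H10 \<Omega> \<Longrightarrow> 0 < \<nu> \<Longrightarrow> (LINT x|lebesgue_on \<Omega>. \<bar>\<beta> x\<bar> * (rep_L2 u x)\<^sup>2) \<le> \<nu> * (norm (grad \<Omega> u))\<^sup>2 + Cnu \<nu> * (norm u)\<^sup>2"
proof -
  assume u: "u \<in> H10 \<Omega>" and \<nu>: "0 < \<nu>"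
  have eq: "(\<integral>\<^sup>+ x. ennreal (\<bar>\<beta> x\<bar> * (rep_L2 u x)\<^sup>2) \<partial>lebesgue_on \<Omega>) = ennreal (LINT x|lebesgue_on \<Omega>. \<bar>\<beta> x\<bar> * (rep_L2 u x)\<^sup>2)"
    by (rule nn_integral_eq_integral[OF integrable_\<beta>_square[OF u]]) (intro AE_I2 mult_nonneg_nonneg abs_ge_zero zero_le_power2)
  have "0 \<le> \<nu> * (norm (grad \<Omega> u))\<^sup>2 + Cnu \<nu> * (norm u)\<^sup>2" using \<nu> Cnu[OF \<nu>] by simp
  then show ?thesis using \<beta>_bound[OF \<nu> u] unfolding eq by (rule ennreal_le_iff[THEN iffD1])
qed

text \<open>Positivity controls only the \<open>L2\<close> norm. With the parameter
  \<open>a0 / 2\<close> the potential consumes half of the ellipticity and an \<open>L2\<close>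
  term, and that term is returned to the form by the spectral gap \<open>lambda1\<close>.\<close>

lemma form_lower_grad:
  assumes u: "u \<in> H10 \<Omega>"
  shows "(norm (grad \<Omega> u))\<^sup>2 \<le> 2 / a0 * (1 + Cnu (a0 / 2) / lambda1) * form u u"
proof -
  have "a0 * (norm (grad \<Omega> u))\<^sup>2 = (LINT x|lebesgue_on \<Omega>. a0 * (norm (grad_at \<Omega> u x))\<^sup>2)"
    by (simp add: integral_on_grad[OF u])
  also have "\<dots> \<le> (LINT x|lebesgue_on \<Omega>. (A x *v grad_at \<Omega> u x) \<bullet> grad_at \<Omega> u x)"
  proof (rule integral_mono_AE)
    show "integrable (lebesgue_on \<Omega>) (\<lambda>x. a0 * (norm (grad_at \<Omega> u x))\<^sup>2)"
      unfolding norm_grad_at by (intro integrable_mult_right Bochner_Integration.integrable_sum integrable_on_square)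
  qed (use A_elliptic integrable_A in \<open>auto elim: eventually_mono\<close>)
  finally have 1: "a0 * (norm (grad \<Omega> u))\<^sup>2 \<le> (LINT x|lebesgue_on \<Omega>. (A x *v grad_at \<Omega> u x) \<bullet> grad_at \<Omega> u x)" .
  have "- (LINT x|lebesgue_on \<Omega>. \<bar>\<beta> x\<bar> * (rep_L2 u x)\<^sup>2) \<le> (LINT x|lebesgue_on \<Omega>. \<beta> x * rep_L2 u x * rep_L2 u x)"
    unfolding Bochner_Integration.integral_minus[symmetric]
    using u by (intro integral_mono integrable_\<beta> Bochner_Integration.integrable_minus integrable_\<beta>_square)
      (auto intro: abs_mult_square_bounds)
  moreover have "(LINT x|lebesgue_on \<Omega>. \<bar>\<beta> x\<bar> * (rep_L2 u x)\<^sup>2) \<le> a0 / 2 * (norm (grad \<Omega> u))\<^sup>2 + Cnu (a0 / 2) * (norm u)\<^sup>2"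
    using a0 by (intro \<beta>_lower u) auto
  ultimately have "a0 / 2 * (norm (grad \<Omega> u))\<^sup>2 \<le> form u u + Cnu (a0 / 2) * (norm u)\<^sup>2"
    using 1 by (simp add: H10_inner_def)
  moreover have "Cnu (a0 / 2) * (norm u)\<^sup>2 \<le> Cnu (a0 / 2) * (form u u / lambda1)"
    using form_positive[OF u] lambda1 Cnu[of "a0 / 2"] a0 by (intro mult_left_mono) (auto simp: field_simps)
  ultimately have "a0 / 2 * (norm (grad \<Omega> u))\<^sup>2 \<le> (1 + Cnu (a0 / 2) / lambda1) * form u u"
    by (simp add: algebra_simps)
  then have "2 / a0 * (a0 / 2 * (norm (grad \<Omega> u))\<^sup>2) \<le> 2 / a0 * ((1 + Cnu (a0 / 2) / lambda1) * form u u)"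
    using a0 by (intro mult_left_mono) auto
  moreover have "2 / a0 * (a0 / 2 * (norm (grad \<Omega> u))\<^sup>2) = (norm (grad \<Omega> u))\<^sup>2" using a0 by simp
  ultimately show ?thesis by (simp only: mult.assoc)
qed

lemma form_upper:
  assumes u: "u \<in> H10 \<Omega>"
  shows "form u u \<le> (a1 + 1) * (norm (grad \<Omega> u))\<^sup>2 + Cnu 1 * (norm u)\<^sup>2"
proof -
  have "(LINT x|lebesgue_on \<Omega>. (A x *v grad_at \<Omega> u x) \<bullet> grad_at \<Omega> u x) \<le> (LINT x|lebesgue_on \<Omega>. a1 * (norm (grad_at \<Omega> u x))\<^sup>2)"
  proof (rule integral_mono_AE)
    show "integrable (lebesgue_on \<Omega>) (\<lambda>x. a1 * (norm (grad_at \<Omega> u x))\<^sup>2)"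
      unfolding norm_grad_at by (intro integrable_mult_right Bochner_Integration.integrable_sum integrable_on_square)
  qed (use A_elliptic integrable_A in \<open>auto elim: eventually_mono\<close>)
  moreover have "(LINT x|lebesgue_on \<Omega>. \<beta> x * rep_L2 u x * rep_L2 u x) \<le> (LINT x|lebesgue_on \<Omega>. \<bar>\<beta> x\<bar> * (rep_L2 u x)\<^sup>2)"
    using u by (intro integral_mono integrable_\<beta> integrable_\<beta>_square)
      (auto intro: abs_mult_square_bounds)
  moreover have "(LINT x|lebesgue_on \<Omega>. \<bar>\<beta> x\<bar> * (rep_L2 u x)\<^sup>2) \<le> 1 * (norm (grad \<Omega> u))\<^sup>2 + Cnu 1 * (norm u)\<^sup>2"
    by (intro \<beta>_lower u) auto
  ultimately show ?thesis by (simp add: H10_inner_def integral_on_grad[OF u] algebra_simps)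
qed

lemma op_A:
  assumes "u \<in> dom_A \<Omega> A \<beta>"
  shows "op_A \<Omega> A \<beta> u \<in> L2_on \<Omega>" "\<And>v. v \<in> H10 \<Omega> \<Longrightarrow> form u v = op_A \<Omega> A \<beta> u \<bullet> v"
proof -
  obtain w where w: "w \<in> L2_on \<Omega>" "\<forall>v\<in>H10 \<Omega>. form u v = w \<bullet> v" using assms by (auto simp: dom_A_def)
  have "op_A \<Omega> A \<beta> u = w"
    unfolding op_A_def
  proof (rule the_equality)
    show "w \<in> L2_on \<Omega> \<and> (\<forall>v\<in>H10 \<Omega>. form u v = w \<bullet> v)" using w by blast
    show "w' = w" if "w' \<in> L2_on \<Omega> \<and> (\<forall>v\<in>H10 \<Omega>. form u v = w' \<bullet> v)" for w'
      by (rule L2_on_eqI[OF open_\<Omega>]) (use that w test_in_H10[OF open_\<Omega>] in auto)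
  qed
  then show "op_A \<Omega> A \<beta> u \<in> L2_on \<Omega>" "\<And>v. v \<in> H10 \<Omega> \<Longrightarrow> form u v = op_A \<Omega> A \<beta> u \<bullet> v" using w by auto
qed

lemma dom_A_H10: "u \<in> dom_A \<Omega> A \<beta> \<Longrightarrow> u \<in> H10 \<Omega>"
  by (simp add: dom_A_def)

end

section \<open>Higher integrability on the domain of the operator\<close>

text \<open>The multiplier \<open>psi\<close> is chosen such that \<open>s psi(s) = Psi(s)\<^sup>2\<close> and \<open>Psi'(s)\<^sup>2 \<le> 2 psi'(s)\<close>: testing
  the equation with \<open>psi(u)\<close> controls the gradient of \<open>Psi(u)\<close>, which tends to \<open>u\<^sup>3\<close> as \<open>d \<rightarrow> 0\<close>, while
  all growth is linear for \<open>d > 0\<close>.\<close>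

definition Psi :: "real \<Rightarrow> real \<Rightarrow> real" where "Psi d s = s ^ 3 * inverse (1 + d * s\<^sup>2)"
definition psi :: "real \<Rightarrow> real \<Rightarrow> real" where "psi d s = s ^ 5 * (inverse (1 + d * s\<^sup>2))\<^sup>2"
definition Psi' :: "real \<Rightarrow> real \<Rightarrow> real" where "Psi' d s = s\<^sup>2 * (3 + d * s\<^sup>2) * (inverse (1 + d * s\<^sup>2))\<^sup>2"
definition psi' :: "real \<Rightarrow> real \<Rightarrow> real" where "psi' d s = s ^ 4 * (5 + d * s\<^sup>2) * (inverse (1 + d * s\<^sup>2)) ^ 3"

context
  fixes d :: real
  assumes d: "0 < d"
begin

lemma psi_denominator: "0 < 1 + d * s\<^sup>2" "1 + d * s\<^sup>2 \<noteq> 0"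
  using d by (auto simp: add_pos_nonneg less_imp_neq[THEN not_sym])

lemma Psi_derivative: "(Psi d has_real_derivative Psi' d s) (at s)"
proof -
  define q where "q = inverse (1 + d * s\<^sup>2)"
  have q: "(1 + d * s\<^sup>2) * q = 1" using psi_denominator[of s] by (simp add: q_def)
  have "(Psi d has_real_derivative (3 * s\<^sup>2 * q + s ^ 3 * (- (q * (d * (2 * s)) * q)))) (at s)"
    unfolding Psi_def[abs_def] q_def using psi_denominator[of s] by (auto intro!: derivative_eq_intros)
  also have "3 * s\<^sup>2 * q + s ^ 3 * (- (q * (d * (2 * s)) * q)) = 3 * s\<^sup>2 * q - 2 * d * s ^ 4 * q\<^sup>2"
    by (simp add: power2_eq_square power_numeral_reduce algebra_simps)
  \<comment> \<open>Multiplying by \<open>(1 + d s^2) q = 1\<close> brings both terms to the common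
    factor \<open>q^2\<close>.\<close>
  also have "\<dots> = 3 * s\<^sup>2 * q * ((1 + d * s\<^sup>2) * q) - 2 * d * s ^ 4 * q\<^sup>2" by (simp only: q mult_1_right)
  also have "\<dots> = Psi' d s"
    unfolding Psi'_def q_def[symmetric] by (simp add: power2_eq_square power_numeral_reduce algebra_simps)
  finally show ?thesis .
qed

lemma psi_derivative: "(psi d has_real_derivative psi' d s) (at s)"
proof -
  define q where "q = inverse (1 + d * s\<^sup>2)"
  have q: "(1 + d * s\<^sup>2) * q = 1" using psi_denominator[of s] by (simp add: q_def)
  have "(psi d has_real_derivative (5 * s ^ 4 * q\<^sup>2 + s ^ 5 * (2 * q * (- (q * (d * (2 * s)) * q))))) (at s)"
    unfolding psi_def[abs_def] q_def using psi_denominator[of s] by (auto intro!: derivative_eq_intros)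
  also have "5 * s ^ 4 * q\<^sup>2 + s ^ 5 * (2 * q * (- (q * (d * (2 * s)) * q))) = 5 * s ^ 4 * q\<^sup>2 - 4 * d * s ^ 6 * q ^ 3"
    by (simp add: power2_eq_square power_numeral_reduce algebra_simps)
  also have "\<dots> = 5 * s ^ 4 * q\<^sup>2 * ((1 + d * s\<^sup>2) * q) - 4 * d * s ^ 6 * q ^ 3" by (simp only: q mult_1_right)
  also have "\<dots> = psi' d s"
    unfolding psi'_def q_def[symmetric] by (simp add: power2_eq_square power_numeral_reduce algebra_simps)
  finally show ?thesis .
qed

lemma psi_mult: "s * psi d s = (Psi d s)\<^sup>2"
  by (simp add: psi_def Psi_def power_mult_distrib flip: power_mult power_Suc)

lemma inverse_le_1: "0 \<le> inverse (1 + d * s\<^sup>2)" "inverse (1 + d * s\<^sup>2) \<le> 1" "d * s\<^sup>2 * inverse (1 + d * s\<^sup>2) \<le> 1"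
proof -
  show "0 \<le> inverse (1 + d * s\<^sup>2)" using psi_denominator[of s] by simp
  show "inverse (1 + d * s\<^sup>2) \<le> 1" using d by (intro inverse_le_1_iff[THEN iffD2]) simp
  show "d * s\<^sup>2 * inverse (1 + d * s\<^sup>2) \<le> 1" using psi_denominator[of s] by (simp add: divide_inverse[symmetric] divide_le_eq)
qed

text \<open>With \<open>y = d s^2\<close> everything reduces to
  \<open>(3 + y)^2 \<le> 2 (5 + y) (1 + y)\<close>. In the limit \<open>y = 0\<close> this is 9
  against 10, which is the relation between the derivatives of \<open>s^3\<close> and
  \<open>s^5\<close>.\<close>

lemma Psi'_square_le: "(Psi' d s)\<^sup>2 \<le> 2 * psi' d s"
proof -
  define q where "q = inverse (1 + d * s\<^sup>2)"
  define y where "y = d * s\<^sup>2"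
  have y: "0 \<le> y" using d by (simp add: y_def)
  have q: "(1 + y) * q = 1" "0 \<le> q" using psi_denominator[of s] by (simp_all add: q_def y_def)
  have "(3 + y)\<^sup>2 \<le> 2 * ((5 + y) * (1 + y))" using y by (simp add: power2_eq_square algebra_simps)
  then have "s ^ 4 * q ^ 4 * (3 + y)\<^sup>2 \<le> s ^ 4 * q ^ 4 * (2 * ((5 + y) * (1 + y)))" by (intro mult_left_mono) auto
  also have "\<dots> = 2 * (s ^ 4 * (5 + y) * q ^ 3 * ((1 + y) * q))" by (simp add: power_numeral_reduce algebra_simps)
  also have "\<dots> = 2 * psi' d s" unfolding q by (simp add: psi'_def q_def y_def)
  also have "s ^ 4 * q ^ 4 * (3 + y)\<^sup>2 = (Psi' d s)\<^sup>2"
    by (simp add: Psi'_def q_def y_def power_mult_distrib flip: power_mult)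
  finally show ?thesis .
qed

lemma psi'_nonneg: "0 \<le> psi' d s"
  unfolding psi'_def by (intro mult_nonneg_nonneg) (use d inverse_le_1(1)[of s] in auto)

lemma psi_square_le: "(psi d s)\<^sup>2 \<le> s ^ 4 * (Psi d s)\<^sup>2"
proof -
  define q where "q = inverse (1 + d * s\<^sup>2)"
  have "q\<^sup>2 \<le> 1" using inverse_le_1[of s] by (simp add: q_def power_le_one)
  then have "(s ^ 4 * (Psi d s)\<^sup>2) * q\<^sup>2 \<le> (s ^ 4 * (Psi d s)\<^sup>2) * 1" by (intro mult_left_mono) auto
  moreover have "(psi d s)\<^sup>2 = (s ^ 4 * (Psi d s)\<^sup>2) * q\<^sup>2"
    by (simp add: psi_def Psi_def q_def power_numeral_reduce algebra_simps)
  ultimately show ?thesis by simp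
qed

lemma Psi_abs_le: "\<bar>Psi d s\<bar> \<le> \<bar>s\<bar> ^ 3"
proof -
  have "\<bar>s\<bar> ^ 3 * inverse (1 + d * s\<^sup>2) \<le> \<bar>s\<bar> ^ 3 * 1" using inverse_le_1[of s] by (intro mult_left_mono) auto
  then show ?thesis using inverse_le_1(1)[of s] by (simp add: Psi_def abs_mult power_abs)
qed

text \<open>For fixed \<open>d\<close> the multiplier grows linearly and is Lipschitz, so
  \<open>psi d\<close> keeps an \<open>H10\<close>-bounded sequence bounded in \<open>H10\<close>.
  The constant explodes as \<open>d\<close> tends to zero, harmlessly: it multiplies only an
  approximation error that vanishes while \<open>d\<close> is fixed.\<close>

lemma psi_abs_le: "\<bar>psi d s\<bar> \<le> 5 / d\<^sup>2 * \<bar>s\<bar>" and psi'_le: "psi' d s \<le> 5 / d\<^sup>2"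
proof -
  define q where "q = inverse (1 + d * s\<^sup>2)"
  define y where "y = d * s\<^sup>2"
  have q0: "0 \<le> q" "q \<le> 1" "y * q \<le> 1" "0 \<le> y" using inverse_le_1[of s] d by (simp_all add: q_def y_def)
  have q1: "(1 + y) * q = 1" using psi_denominator[of s] by (simp add: q_def y_def)
  have s4: "s ^ 4 = y\<^sup>2 / d\<^sup>2" using d by (simp add: y_def power_mult_distrib flip: power_mult)
  have yq: "(y * q)\<^sup>2 \<le> 1" using q0 by (intro power_le_one) auto
  have "psi d s = s * (s ^ 4 * q\<^sup>2)" by (simp add: psi_def q_def power_numeral_reduce)
  then have "\<bar>psi d s\<bar> = \<bar>s\<bar> * \<bar>s ^ 4 * q\<^sup>2\<bar>" by (simp only: abs_mult)
  also have "\<bar>s ^ 4 * q\<^sup>2\<bar> = s ^ 4 * q\<^sup>2" by (rule abs_of_nonneg) simp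
  also have "\<bar>s\<bar> * (s ^ 4 * q\<^sup>2) = \<bar>s\<bar> * s ^ 4 * q\<^sup>2" by simp
  also have "\<dots> = (\<bar>s\<bar> / d\<^sup>2) * (y * q)\<^sup>2" by (simp add: s4 power_mult_distrib)
  also have "\<dots> \<le> (\<bar>s\<bar> / d\<^sup>2) * 5" using yq by (intro mult_left_mono) auto
  finally show "\<bar>psi d s\<bar> \<le> 5 / d\<^sup>2 * \<bar>s\<bar>" by (simp add: mult.commute)
  have "(5 + y) * q \<le> 5"
  proof -
    have "(5 + y) * q \<le> (5 * (1 + y)) * q" using q0 by (intro mult_right_mono) auto
    moreover have "(5 * (1 + y)) * q = 5" unfolding mult.assoc q1 by simp
    ultimately show ?thesis by (simp only:)
  qed
  then have "(y * q)\<^sup>2 * ((5 + y) * q) \<le> 1 * 5" using yq q0 by (intro mult_mono) auto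
  moreover have "psi' d s = s ^ 4 * (5 + y) * q ^ 3" by (simp add: psi'_def q_def y_def)
  then have "psi' d s = (1 / d\<^sup>2) * ((y * q)\<^sup>2 * ((5 + y) * q))"
    unfolding s4 by (simp add: power2_eq_square power3_eq_cube)
  ultimately show "psi' d s \<le> 5 / d\<^sup>2" using d by (simp add: divide_right_mono)
qed

lemma test_function_Psi: "test_function \<Omega> \<xi> \<Longrightarrow> test_function \<Omega> (\<lambda>x. Psi d (\<xi> x))"
proof (rule test_function_supportI[of \<Omega> \<xi>])
  assume \<xi>: "test_function \<Omega> \<xi>"
  show "C_k k (\<lambda>x. Psi d (\<xi> x))" for k
    unfolding Psi_def using psi_denominator(2)
    by (intro C_k_mult C_k_power C_k_inverse C_k_add C_k_const test_function_C_k[OF \<xi>]) auto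
qed (auto simp: Psi_def)

lemma test_function_psi: "test_function \<Omega> \<xi> \<Longrightarrow> test_function \<Omega> (\<lambda>x. psi d (\<xi> x))"
proof (rule test_function_supportI[of \<Omega> \<xi>])
  assume \<xi>: "test_function \<Omega> \<xi>"
  show "C_k k (\<lambda>x. psi d (\<xi> x))" for k
    unfolding psi_def using psi_denominator(2)
    by (intro C_k_mult C_k_power C_k_inverse C_k_add C_k_const test_function_C_k[OF \<xi>]) auto
qed (auto simp: psi_def)

lemma partial_Psi: "test_function \<Omega> \<xi> \<Longrightarrow> partial_deriv i (\<lambda>x. Psi d (\<xi> x)) x = Psi' d (\<xi> x) * partial_deriv i \<xi> x"
  by (rule partial_deriv_chain[OF test_function_differentiable Psi_derivative])

lemma partial_psi: "test_function \<Omega> \<xi> \<Longrightarrow> partial_deriv i (\<lambda>x. psi d (\<xi> x)) x = psi' d (\<xi> x) * partial_deriv i \<xi> x"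
  by (rule partial_deriv_chain[OF test_function_differentiable psi_derivative])

end

context elliptic_form
begin

lemma AE_grad_test:
  assumes \<xi>: "test_function \<Omega> \<xi>"
  shows "AE x in lebesgue. grad_at \<Omega> (abs_L2 \<xi>) x = (\<chi> i. partial_deriv i \<xi> x)"
proof -
  have "AE x in lebesgue. \<forall>i. rep_L2 (grad \<Omega> (abs_L2 \<xi>) $ i) x = partial_deriv i \<xi> x"
    unfolding AE_all_countable grad_test[OF open_\<Omega> \<xi>]
    using rep_abs_L2[OF test_function_square_integrable[OF test_function_partial[OF \<xi>]]] by simp
  then show ?thesis by eventually_elim (simp add: grad_at_def vec_eq_iff)
qed

context
  fixes d :: real and \<xi> :: "real^3 \<Rightarrow> real"
  assumes d: "0 < d" and \<xi>: "test_function \<Omega> \<xi>"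
begin

abbreviation "XI \<equiv> abs_L2 \<xi>"
abbreviation "PSI \<equiv> abs_L2 (\<lambda>x. Psi d (\<xi> x))"
abbreviation "PS \<equiv> abs_L2 (\<lambda>x. psi d (\<xi> x))"

lemma rep_XI: "AE x in lebesgue. rep_L2 XI x = \<xi> x" "AE x in lebesgue. rep_L2 PSI x = Psi d (\<xi> x)"
  "AE x in lebesgue. rep_L2 PS x = psi d (\<xi> x)"
  using \<xi> test_function_Psi[OF d \<xi>] test_function_psi[OF d \<xi>]
  by (auto intro!: rep_abs_L2 test_function_square_integrable)

lemma XI_H10: "XI \<in> H10 \<Omega>" "PSI \<in> H10 \<Omega>" "PS \<in> H10 \<Omega>"
  using \<xi> test_function_Psi[OF d \<xi>] test_function_psi[OF d \<xi>] by (auto intro!: test_in_H10 open_\<Omega>)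

lemma grad_PSI: "AE x in lebesgue. grad_at \<Omega> PSI x = Psi' d (\<xi> x) *\<^sub>R grad_at \<Omega> XI x"
  using AE_grad_test[OF test_function_Psi[OF d \<xi>]] AE_grad_test[OF \<xi>]
  by eventually_elim (simp add: vec_eq_iff partial_Psi[OF d \<xi>])

lemma grad_PS: "AE x in lebesgue. grad_at \<Omega> PS x = psi' d (\<xi> x) *\<^sub>R grad_at \<Omega> XI x"
  using AE_grad_test[OF test_function_psi[OF d \<xi>]] AE_grad_test[OF \<xi>]
  by eventually_elim (simp add: vec_eq_iff partial_psi[OF d \<xi>])

lemma norm_PSI: "(norm PSI)\<^sup>2 \<le> (4 * norm (grad \<Omega> XI)) ^ 6"
proof -
  have "ennreal ((norm PSI)\<^sup>2) \<le> (\<integral>\<^sup>+ x. ennreal (rep_L2 XI x ^ 6) \<partial>lebesgue)"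
    unfolding nn_norm_L2[symmetric]
  proof (rule nn_integral_mono_AE)
    show "AE x in lebesgue. ennreal ((rep_L2 PSI x)\<^sup>2) \<le> ennreal (rep_L2 XI x ^ 6)"
      using rep_XI(1,2)
    proof eventually_elim
      case (elim x)
      have "\<bar>Psi d (\<xi> x)\<bar>\<^sup>2 \<le> (\<bar>\<xi> x\<bar> ^ 3)\<^sup>2" by (intro power_mono Psi_abs_le[OF d]) simp
      then show ?case using elim by (intro ennreal_leI) (simp flip: power_mult)
    qed
  qed
  also have "\<dots> \<le> ennreal ((4 * norm (grad \<Omega> XI)) ^ 6)" by (rule Sobolev_H10[OF open_\<Omega> XI_H10(1)])
  finally show ?thesis by (simp add: ennreal_le_iff)
qed

text \<open>From \<open>psi^2 \<le> s^4 Psi^2\<close> and Hoelder with Sobolev for both factors. The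
  bound is linear in the gradient of \<open>Psi\<close>, so paired with the right-hand side of the
  equation it can be absorbed into the square of that gradient.\<close>

lemma norm_PS: "norm PS \<le> 64 * (norm (grad \<Omega> XI))\<^sup>2 * norm (grad \<Omega> PSI)"
proof (rule norm_L2_le_of_nn)
  have "(\<integral>\<^sup>+ x. ennreal ((rep_L2 PS x)\<^sup>2) \<partial>lebesgue) \<le> (\<integral>\<^sup>+ x. ennreal (rep_L2 XI x ^ 4 * (rep_L2 PSI x)\<^sup>2) \<partial>lebesgue)"
  proof (rule nn_integral_mono_AE)
    show "AE x in lebesgue. ennreal ((rep_L2 PS x)\<^sup>2) \<le> ennreal (rep_L2 XI x ^ 4 * (rep_L2 PSI x)\<^sup>2)"
      using rep_XI by eventually_elim (simp add: ennreal_leI psi_square_le[OF d])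
  qed
  also have "\<dots> \<le> ennreal ((4 * norm (grad \<Omega> XI)) ^ 4 * (4 * norm (grad \<Omega> PSI))\<^sup>2)"
    by (intro nn_integral_Holder_6 Sobolev_H10 open_\<Omega> XI_H10) auto
  also have "(4 * norm (grad \<Omega> XI)) ^ 4 * (4 * norm (grad \<Omega> PSI))\<^sup>2 = (64 * (norm (grad \<Omega> XI))\<^sup>2 * norm (grad \<Omega> PSI))\<^sup>2"
    by (simp add: power_mult_distrib flip: power_mult)
  finally show "(\<integral>\<^sup>+ x. ennreal ((rep_L2 PS x)\<^sup>2) \<partial>lebesgue) \<le> ennreal ((64 * (norm (grad \<Omega> XI))\<^sup>2 * norm (grad \<Omega> PSI))\<^sup>2)" .
qed simp

lemma norm_PS_le: "norm PS \<le> 5 / d\<^sup>2 * norm XI" "norm (grad \<Omega> PS) \<le> 5 / d\<^sup>2 * norm (grad \<Omega> XI)"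
proof -
  show "norm PS \<le> 5 / d\<^sup>2 * norm XI"
    by (rule norm_L2_le_AE, use rep_XI(1,3) in eventually_elim) (use psi_abs_le[OF d] in auto)
  show "norm (grad \<Omega> PS) \<le> 5 / d\<^sup>2 * norm (grad \<Omega> XI)"
  proof (rule norm_vec_L2_le)
    fix i
    show "norm (grad \<Omega> PS $ i) \<le> 5 / d\<^sup>2 * norm (grad \<Omega> XI $ i)"
    proof (rule norm_L2_le_AE)
      show "AE x in lebesgue. \<bar>rep_L2 (grad \<Omega> PS $ i) x\<bar> \<le> 5 / d\<^sup>2 * \<bar>rep_L2 (grad \<Omega> XI $ i) x\<bar>"
        using grad_PS
      proof eventually_elim
        case (elim x)
        then have "rep_L2 (grad \<Omega> PS $ i) x = psi' d (\<xi> x) * rep_L2 (grad \<Omega> XI $ i) x"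
          by (simp add: vec_eq_iff grad_at_def)
        then show ?case
          using psi'_nonneg[OF d, of "\<xi> x"]
            mult_right_mono[OF psi'_le[OF d, of "\<xi> x"] abs_ge_zero[of "rep_L2 (grad \<Omega> XI $ i) x"]]
          by (simp add: abs_mult)
      qed
    qed simp
  qed simp
qed

text \<open>The principal part is at least \<open>a0 psi' |grad \<xi>|^2\<close>, hence at least
  \<open>a0 / 2\<close> times the squared gradient of \<open>Psi(\<xi>)\<close>. The potential part
  sees \<open>\<xi> psi(\<xi>) = Psi(\<xi>)^2\<close>, so its form bound, taken with parameter
  \<open>a0 / 4\<close>, costs half of that and an \<open>L2\<close> norm.\<close>

lemma form_test_lower: "form XI PS \<ge> a0 / 4 * (norm (grad \<Omega> PSI))\<^sup>2 - Cnu (a0 / 4) * (norm PSI)\<^sup>2"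
proof -
  have "a0 / 2 * (norm (grad \<Omega> PSI))\<^sup>2 = (LINT x|lebesgue_on \<Omega>. a0 / 2 * (norm (grad_at \<Omega> PSI x))\<^sup>2)"
    by (simp add: integral_on_grad[OF XI_H10(2)])
  also have "\<dots> \<le> (LINT x|lebesgue_on \<Omega>. (A x *v grad_at \<Omega> XI x) \<bullet> grad_at \<Omega> PS x)"
  proof (rule integral_mono_AE)
    show "integrable (lebesgue_on \<Omega>) (\<lambda>x. a0 / 2 * (norm (grad_at \<Omega> PSI x))\<^sup>2)"
      unfolding norm_grad_at by (intro integrable_mult_right Bochner_Integration.integrable_sum integrable_on_square)
    show "AE x in lebesgue_on \<Omega>. a0 / 2 * (norm (grad_at \<Omega> PSI x))\<^sup>2 \<le> (A x *v grad_at \<Omega> XI x) \<bullet> grad_at \<Omega> PS x"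
      using A_elliptic AE_on[OF grad_PSI] AE_on[OF grad_PS]
    proof eventually_elim
      case (elim x)
      let ?g = "grad_at \<Omega> XI x"
      have "a0 / 2 * (norm (grad_at \<Omega> PSI x))\<^sup>2 = (a0 / 2 * (norm ?g)\<^sup>2) * (Psi' d (\<xi> x))\<^sup>2"
        using elim by (simp add: power_mult_distrib)
      also have "\<dots> \<le> (a0 / 2 * (norm ?g)\<^sup>2) * (2 * psi' d (\<xi> x))"
        using a0 by (intro mult_left_mono Psi'_square_le[OF d]) auto
      also have "\<dots> = psi' d (\<xi> x) * (a0 * (norm ?g)\<^sup>2)" by simp
      also have "\<dots> \<le> psi' d (\<xi> x) * ((A x *v ?g) \<bullet> ?g)"
        using elim(1) by (intro mult_left_mono psi'_nonneg[OF d]) blast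
      finally show ?case using elim by simp
    qed
  qed (rule integrable_A)
  finally have 1: "a0 / 2 * (norm (grad \<Omega> PSI))\<^sup>2 \<le> (LINT x|lebesgue_on \<Omega>. (A x *v grad_at \<Omega> XI x) \<bullet> grad_at \<Omega> PS x)" .
  have "- (LINT x|lebesgue_on \<Omega>. \<bar>\<beta> x\<bar> * (rep_L2 PSI x)\<^sup>2) \<le> (LINT x|lebesgue_on \<Omega>. \<beta> x * rep_L2 XI x * rep_L2 PS x)"
    unfolding Bochner_Integration.integral_minus[symmetric]
  proof (rule integral_mono_AE)
    show "AE x in lebesgue_on \<Omega>. - (\<bar>\<beta> x\<bar> * (rep_L2 PSI x)\<^sup>2) \<le> \<beta> x * rep_L2 XI x * rep_L2 PS x"
      using AE_on[OF rep_XI(1)] AE_on[OF rep_XI(2)] AE_on[OF rep_XI(3)]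
    proof eventually_elim
      case (elim x)
      then have "\<beta> x * rep_L2 XI x * rep_L2 PS x = \<beta> x * (\<xi> x * psi d (\<xi> x))" by simp
      also have "\<dots> = \<beta> x * Psi d (\<xi> x) * Psi d (\<xi> x)" unfolding psi_mult[OF d] by (simp add: power2_eq_square)
      finally have eq: "\<beta> x * rep_L2 XI x * rep_L2 PS x = \<beta> x * Psi d (\<xi> x) * Psi d (\<xi> x)" .
      show ?case using abs_mult_square_bounds(1)[of "\<beta> x" "Psi d (\<xi> x)"] unfolding eq elim(2) .
    qed
  qed (intro Bochner_Integration.integrable_minus integrable_\<beta>_square integrable_\<beta> XI_H10)+
  moreover have "(LINT x|lebesgue_on \<Omega>. \<bar>\<beta> x\<bar> * (rep_L2 PSI x)\<^sup>2) \<le> a0 / 4 * (norm (grad \<Omega> PSI))\<^sup>2 + Cnu (a0 / 4) * (norm PSI)\<^sup>2"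
    using a0 by (intro \<beta>_lower XI_H10) auto
  ultimately show ?thesis using 1 by (simp add: H10_inner_def)
qed

end

text \<open>The cubed bracket bounds the squared gradient of \<open>Psi(u)\<close>, and 4096 = 4^6
  is the Sobolev constant for its sixth power. Here \<open>M\<close> bounds \<open>A u\<close> and
  \<open>r\<close> the gradient of \<open>u\<close>; besides them only \<open>a0\<close> and
  \<open>Cnu\<close> enter.\<close>

definition b18 :: "real \<Rightarrow> real \<Rightarrow> real" where
  "b18 M r = 4096 * (8 / a0 * (Cnu (a0 / 4) * (4 * r) ^ 6 + 2 / a0 * (64 * M * r\<^sup>2)\<^sup>2)) ^ 3"

text \<open>The equation for \<open>u\<close> is tested with \<open>psi d\<close> of smooth
  approximations of \<open>u\<close>, so that the chain rule is used for smooth functions only. The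
  approximation limit is taken for fixed \<open>d\<close>; the resulting bound is free of
  \<open>d\<close>, and letting \<open>d\<close> tend to zero turns \<open>Psi d u\<close> into
  \<open>u^3\<close>. Fatou serves in both limits.\<close>

lemma dom_A_L18:
  assumes u: "u \<in> dom_A \<Omega> A \<beta>" and M: "norm (op_A \<Omega> A \<beta> u) \<le> M" and r: "norm (grad \<Omega> u) \<le> r"
  shows "(\<integral>\<^sup>+ x. ennreal (rep_L2 u x ^ 18) \<partial>lebesgue) \<le> ennreal (b18 M r)"
proof -
  have uH: "u \<in> H10 \<Omega>" by (rule dom_A_H10[OF u])
  have M0: "0 \<le> M" using M norm_ge_zero order_trans by blast
  have c1: "0 < Cnu (a0 / 4)" using Cnu a0 by simp
  obtain \<phi>0 where \<phi>0: "\<And>n. test_function \<Omega> (\<phi>0 n)" "(\<lambda>n. abs_L2 (\<phi>0 n)) \<longlonglongrightarrow> u" "(\<lambda>n. grad \<Omega> (abs_L2 (\<phi>0 n))) \<longlonglongrightarrow> grad \<Omega> u"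
    using H10_approx[OF open_\<Omega> uH] by blast
  obtain k :: "nat \<Rightarrow> nat" where k: "strict_mono k" "AE x in lebesgue. (\<lambda>n. rep_L2 (abs_L2 (\<phi>0 (k n))) x) \<longlonglongrightarrow> rep_L2 u x"
    using L2_tendsto_AE_subseq[OF \<phi>0(2)] by blast
  define \<xi> where "\<xi> n = \<phi>0 (k n)" for n
  define X where "X n = abs_L2 (\<xi> n)" for n
  have \<xi>: "test_function \<Omega> (\<xi> n)" for n using \<phi>0(1) by (simp add: \<xi>_def)
  have XH: "X n \<in> H10 \<Omega>" for n unfolding X_def by (rule test_in_H10[OF open_\<Omega> \<xi>])
  have Xu: "X \<longlonglongrightarrow> u" using LIMSEQ_subseq_LIMSEQ[OF \<phi>0(2) k(1)] by (simp add: X_def[abs_def] \<xi>_def o_def)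
  have Gu: "(\<lambda>n. grad \<Omega> (X n)) \<longlonglongrightarrow> grad \<Omega> u"
    using LIMSEQ_subseq_LIMSEQ[OF \<phi>0(3) k(1)] by (simp add: X_def[abs_def] \<xi>_def o_def)
  have XAE: "AE x in lebesgue. (\<lambda>n. rep_L2 (X n) x) \<longlonglongrightarrow> rep_L2 u x" using k(2) by (simp add: X_def \<xi>_def)
  define G where "G n = norm (grad \<Omega> (X n))" for n
  have GR: "G \<longlonglongrightarrow> norm (grad \<Omega> u)" unfolding G_def by (intro tendsto_norm Gu)
  have diffH: "X n - u \<in> H10 \<Omega>" for n using subspace_diff[OF H10_subspace[OF open_\<Omega>] XH uH] .
  have f0: "(\<lambda>n. fnorm (X n - u)) \<longlonglongrightarrow> 0"
  proof (rule Lim_null_comparison)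
    have "fnorm (X n - u) \<le> sqrt ((a1 + 1) * (norm (grad \<Omega> (X n) - grad \<Omega> u))\<^sup>2 + Cnu 1 * (norm (X n - u))\<^sup>2)" for n
      using form_upper[OF diffH[of n]] unfolding H10_norm_def by (simp add: grad_diff[OF open_\<Omega> XH uH])
    then show "\<forall>\<^sub>F n in sequentially. norm (fnorm (X n - u)) \<le> sqrt ((a1 + 1) * (norm (grad \<Omega> (X n) - grad \<Omega> u))\<^sup>2 + Cnu 1 * (norm (X n - u))\<^sup>2)"
      using fnorm_nonneg[OF diffH] by simp
    have "(\<lambda>n. sqrt ((a1 + 1) * (norm (grad \<Omega> (X n) - grad \<Omega> u))\<^sup>2 + Cnu 1 * (norm (X n - u))\<^sup>2))
       \<longlonglongrightarrow> sqrt ((a1 + 1) * (norm (grad \<Omega> u - grad \<Omega> u))\<^sup>2 + Cnu 1 * (norm (u - u))\<^sup>2)"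
      by (intro tendsto_intros Gu Xu)
    then show "(\<lambda>n. sqrt ((a1 + 1) * (norm (grad \<Omega> (X n) - grad \<Omega> u))\<^sup>2 + Cnu 1 * (norm (X n - u))\<^sup>2)) \<longlonglongrightarrow> 0" by simp
  qed
  have bound_d: "(\<integral>\<^sup>+ x. ennreal (Psi d (rep_L2 u x) ^ 6) \<partial>lebesgue) \<le> ennreal (b18 M r)" if d: "0 < d" for d
  proof -
    define P where "P n = abs_L2 (\<lambda>x. Psi d (\<xi> n x))" for n
    define S where "S n = abs_L2 (\<lambda>x. psi d (\<xi> n x))" for n
    define Y where "Y n = norm (grad \<Omega> (P n))" for n
    have PH: "P n \<in> H10 \<Omega>" and SH: "S n \<in> H10 \<Omega>" for n using XI_H10[OF d \<xi>] by (auto simp: P_def S_def)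
    \<comment> \<open>The price of replacing \<open>u\<close> by its approximation in the form. The
      root bounds the form norm of the multiplier, uniformly in \<open>n\<close>, and the first
      factor tends to zero.\<close>
    define err where "err n = fnorm (X n - u) * sqrt ((a1 + 1) * (5 / d\<^sup>2 * G n)\<^sup>2 + Cnu 1 * (5 / d\<^sup>2 * norm (X n))\<^sup>2)" for n
    have err: "err \<longlonglongrightarrow> 0"
    proof -
      have "err \<longlonglongrightarrow> 0 * sqrt ((a1 + 1) * (5 / d\<^sup>2 * norm (grad \<Omega> u))\<^sup>2 + Cnu 1 * (5 / d\<^sup>2 * norm u)\<^sup>2)"
        unfolding err_def by (intro tendsto_intros f0 GR Xu)
      then show ?thesis by simp
    qed
    define y where "y n = 8 / a0 * (Cnu (a0 / 4) * (4 * G n) ^ 6 + 2 / a0 * (64 * M * (G n)\<^sup>2)\<^sup>2 + err n)" for n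
    have Yy: "(Y n)\<^sup>2 \<le> y n" for n
    proof -
      have "form (X n) (S n) = form u (S n) + form (X n - u) (S n)" using form_diff[OF XH uH SH] by simp
      also have "form u (S n) \<le> norm (op_A \<Omega> A \<beta> u) * norm (S n)"
        using op_A(2)[OF u SH] norm_cauchy_schwarz by simp
      also have "\<dots> \<le> M * (64 * (G n)\<^sup>2 * Y n)"
        using norm_PS[OF d \<xi>] M M0 by (intro mult_mono) (auto simp: G_def X_def S_def Y_def P_def)
      also have "form (X n - u) (S n) \<le> err n"
      proof -
        have "form (X n - u) (S n) \<le> fnorm (X n - u) * fnorm (S n)"
          using form_Cauchy_Schwarz[OF diffH SH] by (meson abs_le_D1)
        also have "\<dots> \<le> err n"
          unfolding err_def
        proof (intro mult_left_mono fnorm_nonneg diffH)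
          have "form (S n) (S n) \<le> (a1 + 1) * (norm (grad \<Omega> (S n)))\<^sup>2 + Cnu 1 * (norm (S n))\<^sup>2" by (rule form_upper[OF SH])
          also have "\<dots> \<le> (a1 + 1) * (5 / d\<^sup>2 * G n)\<^sup>2 + Cnu 1 * (5 / d\<^sup>2 * norm (X n))\<^sup>2"
            using norm_PS_le[OF d \<xi>[of n]] a1 Cnu[of 1]
            by (intro add_mono mult_left_mono power_mono) (auto simp: S_def G_def X_def)
          finally show "fnorm (S n) \<le> sqrt ((a1 + 1) * (5 / d\<^sup>2 * G n)\<^sup>2 + Cnu 1 * (5 / d\<^sup>2 * norm (X n))\<^sup>2)"
            by (simp add: H10_norm_def)
        qed
        finally show ?thesis .
      qed
      finally have "form (X n) (S n) \<le> M * (64 * (G n)\<^sup>2 * Y n) + err n" by simp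
      moreover have "a0 / 4 * (Y n)\<^sup>2 - Cnu (a0 / 4) * (norm (P n))\<^sup>2 \<le> form (X n) (S n)"
        using form_test_lower[OF d \<xi>] by (simp add: X_def S_def Y_def P_def)
      moreover have "Cnu (a0 / 4) * (norm (P n))\<^sup>2 \<le> Cnu (a0 / 4) * (4 * G n) ^ 6"
        using norm_PSI[OF d \<xi>, of n] c1 by (intro mult_left_mono) (auto simp: P_def G_def X_def)
      \<comment> \<open>Young's inequality spends half of the coefficient \<open>a0 / 4\<close> of
        the squared gradient; the other \<open>a0 / 8\<close> is the origin of the factor
        \<open>8 / a0\<close> in the final bound.\<close>
      moreover have "M * (64 * (G n)\<^sup>2 * Y n) \<le> a0 / 8 * (Y n)\<^sup>2 + 2 / a0 * (64 * M * (G n)\<^sup>2)\<^sup>2"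
      proof -
        define c where "c = 64 * M * (G n)\<^sup>2"
        have "0 \<le> (a0 / 4 * Y n - c)\<^sup>2" by simp
        then have "a0 / 2 * (c * Y n) \<le> a0 / 2 * (a0 / 8 * (Y n)\<^sup>2 + 2 / a0 * c\<^sup>2)"
          using a0 by (simp add: power2_eq_square algebra_simps)
        then have "c * Y n \<le> a0 / 8 * (Y n)\<^sup>2 + 2 / a0 * c\<^sup>2" using a0 by (simp only: mult_le_cancel_left_pos half_gt_zero)
        then show ?thesis by (simp add: c_def mult_ac)
      qed
      ultimately have "a0 / 8 * (Y n)\<^sup>2 \<le> Cnu (a0 / 4) * (4 * G n) ^ 6 + 2 / a0 * (64 * M * (G n)\<^sup>2)\<^sup>2 + err n" by linarith
      then have "8 / a0 * (a0 / 8 * (Y n)\<^sup>2) \<le> y n" unfolding y_def using a0 by (intro mult_left_mono) auto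
      then show ?thesis using a0 by simp
    qed
    have "(\<integral>\<^sup>+ x. ennreal (Psi d (rep_L2 u x) ^ 6) \<partial>lebesgue) \<le>
      ennreal (4096 * (8 / a0 * (Cnu (a0 / 4) * (4 * norm (grad \<Omega> u)) ^ 6 + 2 / a0 * (64 * M * (norm (grad \<Omega> u))\<^sup>2)\<^sup>2 + 0)) ^ 3)"
    proof (rule Fatou_LIMSEQ)
      show "AE x in lebesgue. (\<lambda>n. rep_L2 (P n) x ^ 6) \<longlonglongrightarrow> Psi d (rep_L2 u x) ^ 6"
      proof -
        have "AE x in lebesgue. \<forall>n. rep_L2 (P n) x = Psi d (rep_L2 (X n) x)"
          unfolding AE_all_countable
        proof
          fix n show "AE x in lebesgue. rep_L2 (P n) x = Psi d (rep_L2 (X n) x)"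
            using rep_XI(1,2)[OF d \<xi>[of n]] by eventually_elim (simp add: P_def X_def)
        qed
        with XAE show ?thesis
        proof eventually_elim
          case (elim x)
          have "isCont (Psi d) (rep_L2 u x)" using Psi_derivative[OF d] DERIV_isCont by blast
          then have "(\<lambda>n. Psi d (rep_L2 (X n) x)) \<longlonglongrightarrow> Psi d (rep_L2 u x)" using elim(1) by (rule isCont_tendsto_compose)
          then show ?case using elim(2) by (simp add: tendsto_power)
        qed
      qed
      show "\<forall>\<^sub>F n in sequentially. (\<integral>\<^sup>+ x. ennreal (rep_L2 (P n) x ^ 6) \<partial>lebesgue) \<le> ennreal (4096 * (y n) ^ 3)"
      proof (rule always_eventually, rule allI)
        fix n
        have "(\<integral>\<^sup>+ x. ennreal (rep_L2 (P n) x ^ 6) \<partial>lebesgue) \<le> ennreal ((4 * Y n) ^ 6)"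
          unfolding Y_def by (rule Sobolev_H10[OF open_\<Omega> PH])
        also have "(4 * Y n) ^ 6 = 4096 * ((Y n)\<^sup>2) ^ 3" by (simp add: power_mult_distrib flip: power_mult)
        also have "ennreal (4096 * ((Y n)\<^sup>2) ^ 3) \<le> ennreal (4096 * (y n) ^ 3)"
          using Yy[of n] by (intro ennreal_leI mult_left_mono power_mono) auto
        finally show "(\<integral>\<^sup>+ x. ennreal (rep_L2 (P n) x ^ 6) \<partial>lebesgue) \<le> ennreal (4096 * (y n) ^ 3)" .
      qed
      show "(\<lambda>n. ennreal (4096 * (y n) ^ 3)) \<longlonglongrightarrow>
        ennreal (4096 * (8 / a0 * (Cnu (a0 / 4) * (4 * norm (grad \<Omega> u)) ^ 6 + 2 / a0 * (64 * M * (norm (grad \<Omega> u))\<^sup>2)\<^sup>2 + 0)) ^ 3)"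
        unfolding y_def by (intro tendsto_ennrealI tendsto_mult tendsto_power tendsto_add tendsto_const GR err)
    qed measurable
    also have "\<dots> \<le> ennreal (b18 M r)"
    proof -
      have "(4 * norm (grad \<Omega> u)) ^ 6 \<le> (4 * r) ^ 6" "(64 * M * (norm (grad \<Omega> u))\<^sup>2)\<^sup>2 \<le> (64 * M * r\<^sup>2)\<^sup>2"
        using r M0 by (auto intro!: power_mono mult_left_mono)
      then have le: "8 / a0 * (Cnu (a0 / 4) * (4 * norm (grad \<Omega> u)) ^ 6 + 2 / a0 * (64 * M * (norm (grad \<Omega> u))\<^sup>2)\<^sup>2 + 0)
          \<le> 8 / a0 * (Cnu (a0 / 4) * (4 * r) ^ 6 + 2 / a0 * (64 * M * r\<^sup>2)\<^sup>2)"
        unfolding add_0_right using a0 c1 by (intro mult_left_mono add_mono) auto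
      have nn: "0 \<le> 8 / a0 * (Cnu (a0 / 4) * (4 * norm (grad \<Omega> u)) ^ 6 + 2 / a0 * (64 * M * (norm (grad \<Omega> u))\<^sup>2)\<^sup>2 + 0)"
        using a0 c1 by (intro mult_nonneg_nonneg add_nonneg_nonneg) auto
      show ?thesis unfolding b18_def by (rule ennreal_leI, rule mult_left_mono[OF power_mono[OF le nn]]) simp
    qed
    finally show ?thesis .
  qed
  define \<eta> where "\<eta> n = inverse (real (Suc n))" for n
  have \<eta>: "\<eta> \<longlonglongrightarrow> 0" "0 < \<eta> n" for n using LIMSEQ_inverse_real_of_nat by (auto simp: \<eta>_def[abs_def])
  have meas: "Psi d \<in> borel_measurable borel" for d unfolding Psi_def[abs_def] by measurable
  show ?thesis
  proof (rule Fatou_LIMSEQ_const)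
    show "(\<lambda>x. Psi (\<eta> n) (rep_L2 u x) ^ 6) \<in> borel_measurable lebesgue" for n
      using meas by (intro borel_measurable_power measurable_compose[OF _ meas]) auto
    show "AE x in lebesgue. (\<lambda>n. Psi (\<eta> n) (rep_L2 u x) ^ 6) \<longlonglongrightarrow> rep_L2 u x ^ 18"
    proof (rule AE_I2)
      fix x
      have "(\<lambda>n. (rep_L2 u x ^ 3 * inverse (1 + \<eta> n * (rep_L2 u x)\<^sup>2)) ^ 6) \<longlonglongrightarrow> (rep_L2 u x ^ 3 * inverse (1 + 0 * (rep_L2 u x)\<^sup>2)) ^ 6"
        by (intro tendsto_intros \<eta>(1)) auto
      then show "(\<lambda>n. Psi (\<eta> n) (rep_L2 u x) ^ 6) \<longlonglongrightarrow> rep_L2 u x ^ 18"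
        by (simp add: Psi_def flip: power_mult)
    qed
    show "\<forall>\<^sub>F n in sequentially. (\<integral>\<^sup>+ x. ennreal (Psi (\<eta> n) (rep_L2 u x) ^ 6) \<partial>lebesgue) \<le> ennreal (b18 M r)"
      using bound_d[OF \<eta>(2)] by simp
  qed
qed

end

section \<open>The damped wave semigroup\<close>

lemma norm_triple_square: "(norm (u, g, v))\<^sup>2 = (norm u)\<^sup>2 + (norm g)\<^sup>2 + (norm v)\<^sup>2"
  by (simp add: norm_Pair)

context elliptic_form
begin

text \<open>\<open>kg\<close> compares the gradient with the form norm, while \<open>kJ\<close> and
  \<open>kZ\<close> are the two constants of the norm equivalence between \<open>Z0\<close> and its
  image under \<open>emb\<close>. They involve only the structural constants, so later bounds do not
  see \<Omega>, \<open>A\<close> or \<beta>.\<close>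

definition kg :: real where "kg = 2 / a0 * (1 + Cnu (a0 / 2) / lambda1)"
definition kJ :: real where "kJ = 1 + 1 / lambda1 + kg"
definition kZ :: real where "kZ = a1 + 2 + Cnu 1"

lemma kg_pos: "0 < kg" unfolding kg_def using a0 Cnu[of "a0 / 2"] lambda1 by (simp add: add_pos_pos)
lemma kJ_ge: "1 \<le> kJ" unfolding kJ_def using kg_pos lambda1 by simp
lemma kZ_ge: "1 \<le> kZ" unfolding kZ_def using a1 Cnu[of 1] by simp

lemma norm_grad_le: "u \<in> H10 \<Omega> \<Longrightarrow> (norm (grad \<Omega> u))\<^sup>2 \<le> kg * (fnorm u)\<^sup>2"
  using form_lower_grad by (simp add: fnorm_square kg_def)

lemma norm_le_fnorm: "u \<in> H10 \<Omega> \<Longrightarrow> (norm u)\<^sup>2 \<le> (fnorm u)\<^sup>2 / lambda1"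
  using form_positive[of u] lambda1 by (simp add: fnorm_square field_simps)

text \<open>Up to equivalence of norms, \<open>emb\<close> turns \<open>Z0\<close> into the closed subspace \<open>ZS\<close> of the Banach space
  \<open>L2 \<times> L2^3 \<times> L2\<close>, where the calculus of the library applies.\<close>

definition emb :: "L2 \<times> L2 \<Rightarrow> L2 \<times> (L2^3) \<times> L2" where
  "emb z = (fst z, grad \<Omega> (fst z), snd z)"

definition unemb :: "L2 \<times> (L2^3) \<times> L2 \<Rightarrow> L2 \<times> L2" where
  "unemb x = (fst x, snd (snd x))"

definition ZS :: "(L2 \<times> (L2^3) \<times> L2) set" where
  "ZS = emb ` fst (Z0 \<Omega> A \<beta>)"

lemma fst_Z0: "fst (Z0 \<Omega> A \<beta>) = H10 \<Omega> \<times> L2_on \<Omega>"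
  by (simp add: Z0_def prod_nspace_def Hs1_def Hs0_def)

lemma fst_Z1: "fst (Z1 \<Omega> A \<beta>) = dom_A \<Omega> A \<beta> \<times> H10 \<Omega>"
  by (simp add: Z1_def prod_nspace_def Hs2_def Hs1_def)

lemma snd_Z0: "snd (Z0 \<Omega> A \<beta>) (u, v) = sqrt ((fnorm u)\<^sup>2 + (norm v)\<^sup>2)"
  by (simp add: Z0_def prod_nspace_def Hs1_def Hs0_def)

lemma snd_Z1: "snd (Z1 \<Omega> A \<beta>) (u, v) = sqrt ((norm (op_A \<Omega> A \<beta> u))\<^sup>2 + (fnorm v)\<^sup>2)"
  by (simp add: Z1_def prod_nspace_def Hs2_def Hs1_def)

lemma unemb_emb [simp]: "unemb (emb z) = z"
  by (simp add: unemb_def emb_def)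

lemma emb_unemb: "x \<in> ZS \<Longrightarrow> emb (unemb x) = x"
  by (auto simp: ZS_def)

lemma emb_in_ZS [simp]: "emb z \<in> ZS \<longleftrightarrow> z \<in> fst (Z0 \<Omega> A \<beta>)"
  unfolding ZS_def by (metis imageE imageI unemb_emb)

lemma unemb_in_Z0: "x \<in> ZS \<Longrightarrow> unemb x \<in> fst (Z0 \<Omega> A \<beta>)"
  by (auto simp: ZS_def)

lemma emb_add: "z \<in> fst (Z0 \<Omega> A \<beta>) \<Longrightarrow> w \<in> fst (Z0 \<Omega> A \<beta>) \<Longrightarrow> emb (z + w) = emb z + emb w"
  by (auto simp: emb_def fst_Z0 grad_add[OF open_\<Omega>])

lemma emb_scale: "z \<in> fst (Z0 \<Omega> A \<beta>) \<Longrightarrow> emb (c *\<^sub>R z) = c *\<^sub>R emb z"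
  by (auto simp: emb_def fst_Z0 grad_scale[OF open_\<Omega>])

lemma emb_diff: "z \<in> fst (Z0 \<Omega> A \<beta>) \<Longrightarrow> w \<in> fst (Z0 \<Omega> A \<beta>) \<Longrightarrow> emb (z - w) = emb z - emb w"
  by (auto simp: emb_def fst_Z0 grad_diff[OF open_\<Omega>])

lemma unemb_add: "unemb (x + y) = unemb x + unemb y"
  and unemb_scale: "unemb (c *\<^sub>R x) = c *\<^sub>R unemb x"
  by (simp_all add: unemb_def)

lemma Z0_subspace: "subspace (fst (Z0 \<Omega> A \<beta>))"
  unfolding fst_Z0 using H10_subspace[OF open_\<Omega>] L2_on_subspace[of \<Omega>] by (rule subspace_Times)

lemma ZS_subspace: "subspace ZS"
proof (rule subspaceI)
  show "0 \<in> ZS"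
    unfolding ZS_def using emb_scale[OF subspace_0[OF Z0_subspace], of 0] subspace_0[OF Z0_subspace] by force
next
  fix x y assume "x \<in> ZS" "y \<in> ZS"
  then show "x + y \<in> ZS" unfolding ZS_def using emb_add subspace_add[OF Z0_subspace] by (auto simp: image_iff) metis
next
  fix c x assume "x \<in> ZS"
  then show "c *\<^sub>R x \<in> ZS" unfolding ZS_def using emb_scale subspace_scale[OF Z0_subspace] by (auto simp: image_iff) metis
qed

lemma ZS_closed: "closed ZS"
  unfolding closed_sequential_limits
proof (intro allI impI)
  fix X l assume X: "(\<forall>n. X n \<in> ZS) \<and> X \<longlonglongrightarrow> l"
  obtain u g v where l: "l = (u, g, v)" by (cases l)
  have XZ: "fst (X n) \<in> H10 \<Omega>" "snd (snd (X n)) \<in> L2_on \<Omega>" "fst (snd (X n)) = grad \<Omega> (fst (X n))" for n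
    using X unemb_in_Z0[of "X n"] emb_unemb[of "X n"] by (auto simp: fst_Z0 unemb_def emb_def prod_eq_iff)
  have lims: "(\<lambda>n. fst (X n)) \<longlonglongrightarrow> u" "(\<lambda>n. fst (snd (X n))) \<longlonglongrightarrow> g" "(\<lambda>n. snd (snd (X n))) \<longlonglongrightarrow> v"
    using X tendsto_fst[of X l] tendsto_fst[OF tendsto_snd[of X l]] tendsto_snd[OF tendsto_snd[of X l]] by (auto simp: l)
  have "u \<in> H10 \<Omega>" "grad \<Omega> u = g"
    using H10_graph_closed[OF open_\<Omega> XZ(1) lims(1)] lims(2) by (auto simp: XZ(3))
  moreover have "v \<in> L2_on \<Omega>" by (rule closed_sequentially[OF L2_on_closed _ lims(3)]) (use XZ in auto)
  ultimately have "l = emb (u, v)" "(u, v) \<in> fst (Z0 \<Omega> A \<beta>)" by (auto simp: l emb_def fst_Z0)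
  then show "l \<in> ZS" by simp
qed

lemma norm_emb_square: "(norm (emb (u, v)))\<^sup>2 = (norm u)\<^sup>2 + (norm (grad \<Omega> u))\<^sup>2 + (norm v)\<^sup>2"
  by (simp add: emb_def norm_triple_square)

lemma norm_emb_upper:
  assumes z: "z \<in> fst (Z0 \<Omega> A \<beta>)"
  shows "(norm (emb z))\<^sup>2 \<le> kJ * (snd (Z0 \<Omega> A \<beta>) z)\<^sup>2"
proof -
  obtain u v where uv: "z = (u, v)" "u \<in> H10 \<Omega>" using z by (auto simp: fst_Z0)
  have "(norm (emb z))\<^sup>2 \<le> (fnorm u)\<^sup>2 / lambda1 + kg * (fnorm u)\<^sup>2 + (norm v)\<^sup>2"
    using norm_le_fnorm[OF uv(2)] norm_grad_le[OF uv(2)] by (simp add: uv norm_emb_square)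
  also have "\<dots> \<le> (kJ - 1) * (fnorm u)\<^sup>2 + 1 * (norm v)\<^sup>2" by (simp add: kJ_def algebra_simps)
  also have "\<dots> \<le> kJ * (fnorm u)\<^sup>2 + kJ * (norm v)\<^sup>2" using kJ_ge by (intro add_mono mult_right_mono) auto
  finally show ?thesis by (simp add: uv snd_Z0 distrib_left)
qed

lemma fnorm_le:
  assumes u: "u \<in> H10 \<Omega>"
  shows "(fnorm u)\<^sup>2 \<le> kZ * ((norm u)\<^sup>2 + (norm (grad \<Omega> u))\<^sup>2)"
proof -
  have "(fnorm u)\<^sup>2 \<le> (a1 + 1) * (norm (grad \<Omega> u))\<^sup>2 + Cnu 1 * (norm u)\<^sup>2" using form_upper[OF u] fnorm_square[OF u] by simp
  also have "\<dots> \<le> kZ * (norm (grad \<Omega> u))\<^sup>2 + kZ * (norm u)\<^sup>2"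
    using a1 Cnu[of 1] by (intro add_mono mult_right_mono) (auto simp: kZ_def)
  finally show ?thesis by (simp add: algebra_simps)
qed

lemma norm_emb_lower:
  assumes z: "z \<in> fst (Z0 \<Omega> A \<beta>)"
  shows "(snd (Z0 \<Omega> A \<beta>) z)\<^sup>2 \<le> kZ * (norm (emb z))\<^sup>2"
proof -
  obtain u v where uv: "z = (u, v)" "u \<in> H10 \<Omega>" using z by (auto simp: fst_Z0)
  have "(fnorm u)\<^sup>2 + (norm v)\<^sup>2 \<le> kZ * ((norm u)\<^sup>2 + (norm (grad \<Omega> u))\<^sup>2) + kZ * (norm v)\<^sup>2"
    using fnorm_le[OF uv(2)] mult_right_mono[OF kZ_ge, of "(norm v)\<^sup>2"] by simp
  then show ?thesis by (simp add: uv snd_Z0 norm_emb_square distrib_left)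
qed

lemma Z0_norm_nonneg: "0 \<le> snd (Z0 \<Omega> A \<beta>) z"
  by (cases z) (simp add: snd_Z0)

lemma norm_emb_upper': "z \<in> fst (Z0 \<Omega> A \<beta>) \<Longrightarrow> norm (emb z) \<le> sqrt kJ * snd (Z0 \<Omega> A \<beta>) z"
proof (rule power2_le_imp_le)
  assume "z \<in> fst (Z0 \<Omega> A \<beta>)"
  then show "(norm (emb z))\<^sup>2 \<le> (sqrt kJ * snd (Z0 \<Omega> A \<beta>) z)\<^sup>2"
    using norm_emb_upper[of z] kJ_ge by (simp add: power_mult_distrib)
qed (use Z0_norm_nonneg kJ_ge in auto)

lemma norm_emb_lower': "z \<in> fst (Z0 \<Omega> A \<beta>) \<Longrightarrow> snd (Z0 \<Omega> A \<beta>) z \<le> sqrt kZ * norm (emb z)"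
proof (rule power2_le_imp_le)
  assume "z \<in> fst (Z0 \<Omega> A \<beta>)"
  then show "(snd (Z0 \<Omega> A \<beta>) z)\<^sup>2 \<le> (sqrt kZ * norm (emb z))\<^sup>2"
    using norm_emb_lower[of z] kZ_ge by (simp add: power_mult_distrib)
qed (use kZ_ge in auto)

lemma Z0_tendsto_iff:
  assumes "\<forall>\<^sub>F s in F. f s \<in> fst (Z0 \<Omega> A \<beta>)" and a: "a \<in> fst (Z0 \<Omega> A \<beta>)"
  shows "((\<lambda>s. snd (Z0 \<Omega> A \<beta>) (f s - a)) \<longlongrightarrow> 0) F \<longleftrightarrow> ((\<lambda>s. emb (f s)) \<longlongrightarrow> emb a) F"
proof
  assume *: "((\<lambda>s. snd (Z0 \<Omega> A \<beta>) (f s - a)) \<longlongrightarrow> 0) F"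
  show "((\<lambda>s. emb (f s)) \<longlongrightarrow> emb a) F"
  proof (rule Lim_null[THEN iffD2], rule tendsto_0_le[OF *, where K = "sqrt kJ"])
    show "\<forall>\<^sub>F s in F. norm (emb (f s) - emb a) \<le> norm (snd (Z0 \<Omega> A \<beta>) (f s - a)) * sqrt kJ"
      using assms(1)
    proof eventually_elim
      case (elim s)
      then show ?case
        using norm_emb_upper'[of "f s - a"] emb_diff[OF elim a] subspace_diff[OF Z0_subspace elim a] Z0_norm_nonneg
        by (simp add: mult.commute)
    qed
  qed
next
  assume *: "((\<lambda>s. emb (f s)) \<longlongrightarrow> emb a) F"
  show "((\<lambda>s. snd (Z0 \<Omega> A \<beta>) (f s - a)) \<longlongrightarrow> 0) F"
  proof (rule tendsto_0_le[OF *[unfolded Lim_null[of "\<lambda>s. emb (f s)"]], where K = "sqrt kZ"])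
    show "\<forall>\<^sub>F s in F. norm (snd (Z0 \<Omega> A \<beta>) (f s - a)) \<le> norm (emb (f s) - emb a) * sqrt kZ"
      using assms(1)
    proof eventually_elim
      case (elim s)
      then show ?case
        using norm_emb_lower'[of "f s - a"] emb_diff[OF elim a] subspace_diff[OF Z0_subspace elim a] Z0_norm_nonneg
        by (simp add: mult.commute)
    qed
  qed
qed

text \<open>Riemann sums of a function with values in \<open>Z0\<close> stay in \<open>Z0\<close>
  and commute with \<open>emb\<close>, so the gauge for the intrinsic norm serves for the type norm
  once the error is divided by the equivalence constant.\<close>

lemma emb_has_integral:
  assumes "has_integral_into (Z0 \<Omega> A \<beta>) g I a b"
  shows "((\<lambda>p. emb (g p)) has_integral emb I) {a..b}"
  unfolding has_integral_real
proof (intro allI impI)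
  fix e :: real assume e: "0 < e"
  have I: "I \<in> fst (Z0 \<Omega> A \<beta>)" and g: "\<And>p. p \<in> {a..b} \<Longrightarrow> g p \<in> fst (Z0 \<Omega> A \<beta>)"
    using assms by (auto simp: has_integral_into_def)
  have "0 < e / sqrt kJ" using e kJ_ge by simp
  then obtain \<delta> where \<delta>: "gauge \<delta>" "\<forall>\<D>. \<D> tagged_division_of {a..b} \<and> \<delta> fine \<D> \<longrightarrow>
        snd (Z0 \<Omega> A \<beta>) ((\<Sum>(p, K)\<in>\<D>. measure lborel K *\<^sub>R g p) - I) < e / sqrt kJ"
    using assms unfolding has_integral_into_def by meson
  have "norm ((\<Sum>(x, k)\<in>\<D>. measure lborel k *\<^sub>R emb (g x)) - emb I) < e"
    if D: "\<D> tagged_division_of {a..b}" "\<delta> fine \<D>" for \<D>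
  proof -
    have "finite E \<Longrightarrow> E \<subseteq> \<D> \<Longrightarrow> (\<Sum>(x, k)\<in>E. measure lborel k *\<^sub>R g x) \<in> fst (Z0 \<Omega> A \<beta>) \<and>
        (\<Sum>(x, k)\<in>E. measure lborel k *\<^sub>R emb (g x)) = emb (\<Sum>(x, k)\<in>E. measure lborel k *\<^sub>R g x)" for E
    proof (induction E rule: finite_induct)
      case empty
      show ?case using emb_scale[OF I, of 0] subspace_0[OF Z0_subspace] by simp
    next
      case (insert z E)
      obtain x k where z: "z = (x, k)" by (cases z)
      have "x \<in> {a..b}" using D(1) insert.prems by (auto simp: z dest: tag_in_interval)
      then show ?case using insert g Z0_subspace
        by (auto simp: z emb_scale emb_add subspace_add subspace_scale)
    qed
    then have *: "(\<Sum>(x, k)\<in>\<D>. measure lborel k *\<^sub>R g x) \<in> fst (Z0 \<Omega> A \<beta>)"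
      "(\<Sum>(x, k)\<in>\<D>. measure lborel k *\<^sub>R emb (g x)) = emb (\<Sum>(x, k)\<in>\<D>. measure lborel k *\<^sub>R g x)"
      using tagged_division_of_finite[OF D(1)] by auto
    have "norm (emb ((\<Sum>(x, k)\<in>\<D>. measure lborel k *\<^sub>R g x) - I)) \<le> sqrt kJ * snd (Z0 \<Omega> A \<beta>) ((\<Sum>(x, k)\<in>\<D>. measure lborel k *\<^sub>R g x) - I)"
      using *(1) I by (intro norm_emb_upper' subspace_diff[OF Z0_subspace])
    also have "\<dots> < sqrt kJ * (e / sqrt kJ)" using \<delta>(2) D kJ_ge by (intro mult_strict_left_mono) auto
    finally show ?thesis using *(2) emb_diff[OF *(1) I] kJ_ge by simp
  qed
  then show "\<exists>\<gamma>. gauge \<gamma> \<and> (\<forall>\<D>. \<D> tagged_division_of {a..b} \<and> \<gamma> fine \<D> \<longrightarrow>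
      norm ((\<Sum>(x, k)\<in>\<D>. measure lborel k *\<^sub>R emb (g x)) - emb I) < e)" using \<delta>(1) by blast
qed

end

locale damped_wave = elliptic_form +
  fixes \<epsilon> :: real and T :: "real \<Rightarrow> L2 \<times> L2 \<Rightarrow> L2 \<times> L2"
  assumes \<epsilon>: "0 < \<epsilon>" "\<epsilon> \<le> 1" and T: "wave_semigroup \<Omega> A \<beta> \<epsilon> T"
begin

section \<open>The wave semigroup transported to \<open>ZS\<close>\<close>

definition TE :: "real \<Rightarrow> L2 \<times> (L2^3) \<times> L2 \<Rightarrow> L2 \<times> (L2^3) \<times> L2" where
  "TE t x = emb (T t (unemb x))"

definition DE :: "(L2 \<times> (L2^3) \<times> L2) set" where
  "DE = emb ` fst (Z1 \<Omega> A \<beta>)"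

definition BE :: "L2 \<times> (L2^3) \<times> L2 \<Rightarrow> L2 \<times> (L2^3) \<times> L2" where
  "BE x = emb (op_B \<Omega> A \<beta> \<epsilon> (unemb x))"

lemma Z1_Z0: "z \<in> fst (Z1 \<Omega> A \<beta>) \<Longrightarrow> z \<in> fst (Z0 \<Omega> A \<beta>)"
  by (auto simp: fst_Z0 fst_Z1 dom_A_H10 H10_L2_on[OF open_\<Omega>])

lemma op_B_Z0: "z \<in> fst (Z1 \<Omega> A \<beta>) \<Longrightarrow> op_B \<Omega> A \<beta> \<epsilon> z \<in> fst (Z0 \<Omega> A \<beta>)"
proof -
  assume "z \<in> fst (Z1 \<Omega> A \<beta>)"
  then obtain u v where z: "z = (u, v)" "u \<in> dom_A \<Omega> A \<beta>" "v \<in> H10 \<Omega>" by (auto simp: fst_Z1)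
  have "(1 / \<epsilon>) *\<^sub>R (v + op_A \<Omega> A \<beta> u) \<in> L2_on \<Omega>"
    using op_A(1)[OF z(2)] H10_L2_on[OF open_\<Omega> z(3)] by (intro subspace_scale[OF L2_on_subspace] subspace_add[OF L2_on_subspace])
  then have "- ((1 / \<epsilon>) *\<^sub>R (v + op_A \<Omega> A \<beta> u)) \<in> L2_on \<Omega>" by (rule subspace_neg[OF L2_on_subspace])
  then show ?thesis using z by (simp add: op_B_def fst_Z0)
qed

lemma semigroup_T: "C0_semigroup (Z0 \<Omega> A \<beta>) T"
  and generator_T: "x \<in> fst (Z0 \<Omega> A \<beta>) \<Longrightarrow> y \<in> fst (Z0 \<Omega> A \<beta>) \<Longrightarrow>
      ((\<lambda>h. snd (Z0 \<Omega> A \<beta>) ((1 / h) *\<^sub>R (T h x - x) - y)) \<longlongrightarrow> 0) (at_right 0) \<longleftrightarrow>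
      x \<in> fst (Z1 \<Omega> A \<beta>) \<and> y = op_B \<Omega> A \<beta> \<epsilon> x"
  using T by (auto simp: wave_semigroup_def generates_def)

lemma T_Z0: "0 \<le> t \<Longrightarrow> x \<in> fst (Z0 \<Omega> A \<beta>) \<Longrightarrow> T t x \<in> fst (Z0 \<Omega> A \<beta>)"
  using semigroup_T by (simp add: C0_semigroup_def)

lemma DE_iff: "x \<in> DE \<longleftrightarrow> x \<in> ZS \<and> unemb x \<in> fst (Z1 \<Omega> A \<beta>)"
  unfolding DE_def using emb_unemb Z1_Z0 by (metis emb_in_ZS image_iff unemb_emb)

text \<open>Each property of the semigroup on \<open>Z0\<close> is conjugated by \<open>emb\<close>.
  The exact description of the generator survives because convergence in \<open>Z0\<close> and
  convergence of the images are equivalent.\<close>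

sublocale sg: c0_semigroup ZS TE DE BE
proof
  note sg = semigroup_T[unfolded C0_semigroup_def]
  show "subspace ZS" "closed ZS" by (fact ZS_subspace, fact ZS_closed)
  show "DE \<subseteq> ZS" by (auto simp: DE_iff)
  show "BE x \<in> ZS" if "x \<in> DE" for x using that by (auto simp: BE_def DE_iff op_B_Z0)
  show "TE t x \<in> ZS" if "0 \<le> t" "x \<in> ZS" for t x using that by (simp add: TE_def T_Z0 unemb_in_Z0)
  show "TE t (x + y) = TE t x + TE t y" if "0 \<le> t" "x \<in> ZS" "y \<in> ZS" for t x y
    using that sg unemb_in_Z0 by (simp add: TE_def unemb_add emb_add[symmetric])
  show "TE t (c *\<^sub>R x) = c *\<^sub>R TE t x" if "0 \<le> t" "x \<in> ZS" for t x c
    using that sg unemb_in_Z0 by (simp add: TE_def unemb_scale emb_scale[symmetric])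
  show "\<exists>M. \<forall>x\<in>ZS. norm (TE t x) \<le> M * norm x" if t: "0 \<le> t" for t
  proof -
    have "\<exists>M. \<forall>z\<in>fst (Z0 \<Omega> A \<beta>). snd (Z0 \<Omega> A \<beta>) (T t z) \<le> M * snd (Z0 \<Omega> A \<beta>) z"
      using sg[THEN conjunct1] t by simp
    then obtain M where M: "\<And>z. z \<in> fst (Z0 \<Omega> A \<beta>) \<Longrightarrow> snd (Z0 \<Omega> A \<beta>) (T t z) \<le> M * snd (Z0 \<Omega> A \<beta>) z"
      by blast
    have "norm (TE t x) \<le> (sqrt kJ * (\<bar>M\<bar> * sqrt kZ)) * norm x" if x: "x \<in> ZS" for x
    proof -
      have z: "unemb x \<in> fst (Z0 \<Omega> A \<beta>)" using x by (rule unemb_in_Z0)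
      have "norm (TE t x) \<le> sqrt kJ * snd (Z0 \<Omega> A \<beta>) (T t (unemb x))"
        unfolding TE_def by (intro norm_emb_upper' T_Z0 t z)
      also have "\<dots> \<le> sqrt kJ * (\<bar>M\<bar> * snd (Z0 \<Omega> A \<beta>) (unemb x))"
        using kJ_ge order_trans[OF M[OF z] mult_right_mono[OF abs_ge_self[of M] Z0_norm_nonneg[of "unemb x"]]]
        by (intro mult_left_mono) auto
      also have "\<dots> \<le> sqrt kJ * (\<bar>M\<bar> * (sqrt kZ * norm x))"
        using kJ_ge norm_emb_lower'[OF z] emb_unemb[OF x] by (intro mult_left_mono) auto
      finally show ?thesis by (simp add: mult.assoc)
    qed
    then show ?thesis by blast
  qed
  show "TE 0 x = x" if "x \<in> ZS" for x using that sg by (simp add: TE_def unemb_in_Z0 emb_unemb)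
  show "TE (s + t) x = TE s (TE t x)" if "0 \<le> s" "0 \<le> t" "x \<in> ZS" for s t x
    using that sg by (simp add: TE_def unemb_in_Z0)
  show "((\<lambda>h. TE h x) \<longlongrightarrow> x) (at_right 0)" if x: "x \<in> ZS" for x
  proof -
    have z: "unemb x \<in> fst (Z0 \<Omega> A \<beta>)" using x by (rule unemb_in_Z0)
    have "((\<lambda>h. snd (Z0 \<Omega> A \<beta>) (T h (unemb x) - unemb x)) \<longlongrightarrow> 0) (at_right 0)" using sg z by blast
    moreover have "\<forall>\<^sub>F h in at_right 0. T h (unemb x) \<in> fst (Z0 \<Omega> A \<beta>)"
      unfolding eventually_at_right_field by (intro exI[of _ 1]) (auto intro: T_Z0 z)
    ultimately show ?thesis using z by (simp add: Z0_tendsto_iff TE_def emb_unemb[OF x])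
  qed
  show "((\<lambda>h. (1 / h) *\<^sub>R (TE h x - x)) \<longlongrightarrow> y) (at_right 0) \<longleftrightarrow> x \<in> DE \<and> y = BE x" if x: "x \<in> ZS" and y: "y \<in> ZS" for x y
  proof -
    have zx: "unemb x \<in> fst (Z0 \<Omega> A \<beta>)" and zy: "unemb y \<in> fst (Z0 \<Omega> A \<beta>)" using x y by (auto intro: unemb_in_Z0)
    have Tz: "(1 / h) *\<^sub>R (T h (unemb x) - unemb x) \<in> fst (Z0 \<Omega> A \<beta>)" if "0 < h" for h
      using that zx by (intro subspace_scale[OF Z0_subspace] subspace_diff[OF Z0_subspace] T_Z0) auto
    have "((\<lambda>h. (1 / h) *\<^sub>R (TE h x - x)) \<longlongrightarrow> y) (at_right 0) \<longleftrightarrow>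
        ((\<lambda>h. emb ((1 / h) *\<^sub>R (T h (unemb x) - unemb x))) \<longlongrightarrow> emb (unemb y)) (at_right 0)"
    proof (rule filterlim_cong)
      show "\<forall>\<^sub>F h in at_right 0. (1 / h) *\<^sub>R (TE h x - x) = emb ((1 / h) *\<^sub>R (T h (unemb x) - unemb x))"
        unfolding eventually_at_right_field
      proof (intro exI[of _ 1] conjI allI impI)
        fix h :: real assume h: "0 < h"
        show "(1 / h) *\<^sub>R (TE h x - x) = emb ((1 / h) *\<^sub>R (T h (unemb x) - unemb x))"
          using h zx T_Z0[of h "unemb x"] subspace_diff[OF Z0_subspace, of "T h (unemb x)" "unemb x"]
          by (simp only: TE_def emb_scale emb_diff emb_unemb[OF x] less_imp_le)
      qed auto
    qed (simp_all add: emb_unemb[OF y])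
    also have "\<dots> \<longleftrightarrow> ((\<lambda>h. snd (Z0 \<Omega> A \<beta>) ((1 / h) *\<^sub>R (T h (unemb x) - unemb x) - unemb y)) \<longlongrightarrow> 0) (at_right 0)"
      by (rule Z0_tendsto_iff[symmetric, OF _ zy]) (auto simp: eventually_at_right_field Tz intro!: exI[of _ 1])
    also have "\<dots> \<longleftrightarrow> unemb x \<in> fst (Z1 \<Omega> A \<beta>) \<and> unemb y = op_B \<Omega> A \<beta> \<epsilon> (unemb x)"
      by (rule generator_T[OF zx zy])
    also have "\<dots> \<longleftrightarrow> x \<in> DE \<and> y = BE x"
      using x emb_unemb[OF y] by (auto simp: DE_iff BE_def)
    finally show ?thesis .
  qed
qed

text \<open>The cross term in \<open>u\<close> and \<open>v\<close> makes the damping act on the potential energy as well.\<close>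

definition energy :: "L2 \<times> (L2^3) \<times> L2 \<Rightarrow> L2 \<times> (L2^3) \<times> L2 \<Rightarrow> real" where
  "energy x y = form (fst x) (fst y) + \<epsilon> * (snd (snd x) \<bullet> snd (snd y))
     + \<epsilon> / 2 * (fst x \<bullet> snd (snd y) + snd (snd x) \<bullet> fst y) + 1 / 2 * (fst x \<bullet> fst y)"

text \<open>Half of the form energy is dissipated per unit time, while \<open>energy\<close> is at
  most \<open>2 + 1/lambda1\<close> times the form energy; \<mu> is the quotient. \<open>K0\<close>
  collects the equivalence constants between \<open>energy\<close> and the squared norm, and \<tau>
  solves \<open>K0 exp (-2 \<mu> \<tau>) = 1/4\<close>, so that after time \<tau> norms are
  halved.\<close>

definition \<mu> :: real where "\<mu> = 1 / (2 * (2 + 1 / lambda1))"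
definition K0 :: real where "K0 = 2 * kJ * (kZ + 3) / \<epsilon>"
definition \<tau> :: real where "\<tau> = ln (4 * K0) / (2 * \<mu>)"

lemma K0_ge: "1 \<le> K0"
proof -
  have "1 * 1 \<le> 2 * kJ * (kZ + 3)" using kJ_ge kZ_ge by (intro mult_mono) auto
  then have "\<epsilon> \<le> 2 * kJ * (kZ + 3)" using \<epsilon> by linarith
  then show ?thesis using \<epsilon> by (simp add: K0_def)
qed

lemma \<mu>_pos: "0 < \<mu>" using lambda1 by (simp add: \<mu>_def add_pos_pos)

lemma ZS_fst: "x \<in> ZS \<Longrightarrow> fst x \<in> H10 \<Omega>"
  using unemb_in_Z0[of x] by (simp add: unemb_def fst_Z0)

lemma norm_ZS_square: "x \<in> ZS \<Longrightarrow> (norm x)\<^sup>2 = (norm (fst x))\<^sup>2 + (norm (grad \<Omega> (fst x)))\<^sup>2 + (norm (snd (snd x)))\<^sup>2"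
  using norm_emb_square[of "fst x" "snd (snd x)"] emb_unemb[of x] by (simp add: unemb_def)

text \<open>The indefinite cross term is half of the one in the square of
  \<open>u + \<epsilon> v\<close>. Half of that square uses up the \<open>L2\<close> term of
  \<open>u\<close> and at most half of \<open>\<epsilon> |v|^2\<close>; here
  \<open>\<epsilon> \<le> 1\<close> enters.\<close>

lemma energy_lower:
  assumes x: "x \<in> ZS"
  shows "\<epsilon> / (2 * kJ) * (norm x)\<^sup>2 \<le> energy x x"
proof -
  obtain u v where uv: "fst x = u" "snd (snd x) = v" "u \<in> H10 \<Omega>" using ZS_fst[OF x] by auto
  have "0 \<le> (norm (u + \<epsilon> *\<^sub>R v))\<^sup>2" by simp
  also have "(norm (u + \<epsilon> *\<^sub>R v))\<^sup>2 = (norm u)\<^sup>2 + 2 * \<epsilon> * (u \<bullet> v) + \<epsilon>\<^sup>2 * (norm v)\<^sup>2"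
    unfolding power2_norm_eq_inner by (simp add: inner_add_left inner_add_right inner_commute power2_eq_square algebra_simps)
  finally have 1: "0 \<le> (norm u)\<^sup>2 + 2 * \<epsilon> * (u \<bullet> v) + \<epsilon>\<^sup>2 * (norm v)\<^sup>2" .
  have "\<epsilon> * \<epsilon> \<le> \<epsilon> * 1" using \<epsilon> by (intro mult_left_mono) auto
  then have 2: "\<epsilon>\<^sup>2 * (norm v)\<^sup>2 \<le> \<epsilon> * (norm v)\<^sup>2" by (intro mult_right_mono) (auto simp: power2_eq_square)
  have E: "energy x x = (fnorm u)\<^sup>2 + \<epsilon> * (norm v)\<^sup>2 + \<epsilon> * (u \<bullet> v) + 1 / 2 * (norm u)\<^sup>2"
    by (simp add: energy_def uv fnorm_square power2_norm_eq_inner inner_commute)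
  have "\<epsilon> / 2 * (fnorm u)\<^sup>2 \<le> 1 * (fnorm u)\<^sup>2" using \<epsilon> by (intro mult_right_mono) auto
  then have "\<epsilon> / 2 * ((fnorm u)\<^sup>2 + (norm v)\<^sup>2) \<le> energy x x"
    unfolding E distrib_left using 1 2 by linarith
  moreover have "(norm x)\<^sup>2 \<le> kJ * ((fnorm u)\<^sup>2 + (norm v)\<^sup>2)"
    using norm_emb_upper[OF unemb_in_Z0[OF x]] emb_unemb[OF x] by (simp add: unemb_def snd_Z0 uv)
  then have "\<epsilon> / (2 * kJ) * (norm x)\<^sup>2 \<le> \<epsilon> / (2 * kJ) * (kJ * ((fnorm u)\<^sup>2 + (norm v)\<^sup>2))"
    using \<epsilon> kJ_ge by (intro mult_left_mono) auto
  moreover have "\<epsilon> / (2 * kJ) * (kJ * ((fnorm u)\<^sup>2 + (norm v)\<^sup>2)) = \<epsilon> / 2 * ((fnorm u)\<^sup>2 + (norm v)\<^sup>2)"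
    using kJ_ge by simp
  ultimately show ?thesis by linarith
qed

lemma energy_upper:
  assumes x: "x \<in> ZS" and y: "y \<in> ZS"
  shows "\<bar>energy x y\<bar> \<le> (kZ + 3) * norm x * norm y"
proof -
  have comp: "norm (fst z) \<le> norm z" "norm (snd (snd z)) \<le> norm z" for z :: "L2 \<times> (L2^3) \<times> L2"
    using norm_fst_le[of "fst z" "snd z"] norm_snd_le[of "snd z" "fst z"] norm_snd_le[of "snd (snd z)" "fst (snd z)"] by simp_all
  have f: "fnorm (fst z) \<le> sqrt kZ * norm z" if z: "z \<in> ZS" for z
  proof (rule power2_le_imp_le)
    have "kZ * ((norm (fst z))\<^sup>2 + (norm (grad \<Omega> (fst z)))\<^sup>2) \<le> kZ * (norm z)\<^sup>2"
      using kZ_ge by (intro mult_left_mono) (auto simp: norm_ZS_square[OF z])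
    with fnorm_le[OF ZS_fst[OF z]] have "(fnorm (fst z))\<^sup>2 \<le> kZ * (norm z)\<^sup>2" by (rule order_trans)
    then show "(fnorm (fst z))\<^sup>2 \<le> (sqrt kZ * norm z)\<^sup>2"
      using kZ_ge by (simp add: power_mult_distrib)
  qed (use kZ_ge in auto)
  have in1: "\<bar>a \<bullet> b\<bar> \<le> norm x * norm y" if "norm a \<le> norm x" "norm b \<le> norm y" for a b :: L2
    using Cauchy_Schwarz_ineq2[of a b] mult_mono[OF that] by auto
  have "\<bar>form (fst x) (fst y)\<bar> \<le> fnorm (fst x) * fnorm (fst y)" by (intro form_Cauchy_Schwarz ZS_fst x y)
  also have "\<dots> \<le> (sqrt kZ * norm x) * (sqrt kZ * norm y)"
    using f[OF x] f[OF y] kZ_ge by (intro mult_mono fnorm_nonneg ZS_fst y) auto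
  also have "\<dots> = kZ * (norm x * norm y)" using kZ_ge by simp
  finally have 1: "\<bar>form (fst x) (fst y)\<bar> \<le> kZ * (norm x * norm y)" .
  have sc: "\<bar>c * a\<bar> \<le> norm x * norm y" if "\<bar>a\<bar> \<le> norm x * norm y" "0 \<le> c" "c \<le> 1" for a c :: real
    using mult_mono[OF that(3) that(1)] that by (simp add: abs_mult)
  have 2: "\<bar>\<epsilon> * (snd (snd x) \<bullet> snd (snd y))\<bar> \<le> norm x * norm y" using \<epsilon> comp by (intro sc in1) auto
  have 3: "\<bar>\<epsilon> / 2 * (fst x \<bullet> snd (snd y) + snd (snd x) \<bullet> fst y)\<bar> \<le> norm x * norm y"
  proof -
    have "\<bar>\<epsilon> * ((fst x \<bullet> snd (snd y) + snd (snd x) \<bullet> fst y) / 2)\<bar> \<le> norm x * norm y"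
      using \<epsilon> in1[of "fst x" "snd (snd y)"] in1[of "snd (snd x)" "fst y"] comp by (intro sc) auto
    then show ?thesis by simp
  qed
  have 4: "\<bar>1 / 2 * (fst x \<bullet> fst y)\<bar> \<le> norm x * norm y" using comp by (intro sc in1) auto
  show ?thesis unfolding energy_def using 1 2 3 4 by (simp add: distrib_right mult.assoc)
qed

text \<open>The two form terms in \<open>u\<close> and \<open>v\<close> cancel. The term
  \<open>1/2 (u, u)\<close> of the energy is there to cancel the product of \<open>u\<close> and
  \<open>v\<close> that the damping creates in the cross term. What is left is
  \<open>-|v|^2 + \<epsilon>/2 |v|^2\<close> minus half of the squared form norm of
  \<open>u\<close>.\<close>

lemma energy_dissipative:
  assumes x: "x \<in> DE"
  shows "energy x (BE x) \<le> - \<mu> * energy x x"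
proof -
  obtain u v where uv: "x = emb (u, v)" "u \<in> dom_A \<Omega> A \<beta>" "v \<in> H10 \<Omega>" using x by (auto simp: DE_def fst_Z1)
  have uH: "u \<in> H10 \<Omega>" by (rule dom_A_H10[OF uv(2)])
  let ?a = "op_A \<Omega> A \<beta> u"
  have "BE x = emb (v, - ((1 / \<epsilon>) *\<^sub>R (v + ?a)))" by (simp add: BE_def uv(1) op_B_def)
  then have BE: "fst (BE x) = v" "snd (snd (BE x)) = - ((1 / \<epsilon>) *\<^sub>R (v + ?a))"
    by (simp_all add: emb_def)
  have xs: "fst x = u" "snd (snd x) = v" by (simp_all add: uv(1) emb_def)
  have av: "?a \<bullet> v = form u v" "?a \<bullet> u = (fnorm u)\<^sup>2" using op_A(2)[OF uv(2)] uv(3) uH by (auto simp: fnorm_square)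
  define w where "w = - ((1 / \<epsilon>) *\<^sub>R (v + ?a))"
  have w: "\<epsilon> * (y \<bullet> w) = - (y \<bullet> (v + ?a))" for y
  proof -
    have "\<epsilon> * (y \<bullet> - ((1 / \<epsilon>) *\<^sub>R b)) = - (y \<bullet> b)" for b using \<epsilon> by simp
    then show ?thesis by (simp only: w_def)
  qed
  have "energy x (BE x) = form u v + \<epsilon> * (v \<bullet> w) + \<epsilon> / 2 * (u \<bullet> w + v \<bullet> v) + 1 / 2 * (u \<bullet> v)"
    by (simp only: energy_def BE xs w_def)
  also have "\<dots> = form u v + \<epsilon> * (v \<bullet> w) + 1 / 2 * (\<epsilon> * (u \<bullet> w)) + \<epsilon> / 2 * (v \<bullet> v) + 1 / 2 * (u \<bullet> v)"
    by (simp add: algebra_simps)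
  also have "\<dots> = form u v - (v \<bullet> (v + ?a)) + (- (1 / 2) * (u \<bullet> (v + ?a)) + \<epsilon> / 2 * (v \<bullet> v)) + 1 / 2 * (u \<bullet> v)"
    unfolding w by simp
  also have "\<dots> = - (v \<bullet> v) + \<epsilon> / 2 * (v \<bullet> v) - 1 / 2 * (fnorm u)\<^sup>2"
    using av by (simp add: inner_add_right inner_commute algebra_simps)
  also have "\<dots> \<le> - (1 / 2) * ((fnorm u)\<^sup>2 + (norm v)\<^sup>2)"
  proof -
    have "\<epsilon> / 2 * (v \<bullet> v) \<le> 1 / 2 * (v \<bullet> v)" using \<epsilon>(2) by (intro mult_right_mono) auto
    then show ?thesis unfolding power2_norm_eq_inner[of v] distrib_left by linarith
  qed
  finally have 1: "energy x (BE x) \<le> - (1 / 2) * ((fnorm u)\<^sup>2 + (norm v)\<^sup>2)" .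
  have "energy x x = (fnorm u)\<^sup>2 + \<epsilon> * (norm v)\<^sup>2 + \<epsilon> * (u \<bullet> v) + 1 / 2 * (norm u)\<^sup>2"
    by (simp add: energy_def xs fnorm_square uH power2_norm_eq_inner inner_commute)
  also have "\<dots> \<le> (fnorm u)\<^sup>2 + 2 * (norm v)\<^sup>2 + (norm u)\<^sup>2"
  proof -
    have "\<epsilon> * (norm v)\<^sup>2 \<le> 1 * (norm v)\<^sup>2" using \<epsilon> by (intro mult_right_mono) auto
    moreover have "\<epsilon> * (u \<bullet> v) \<le> 1 / 2 * (norm u)\<^sup>2 + 1 / 2 * (norm v)\<^sup>2"
    proof -
      have "\<epsilon> * (u \<bullet> v) \<le> \<epsilon> * (norm u * norm v)" using \<epsilon> by (intro mult_left_mono norm_cauchy_schwarz) auto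
      also have "\<dots> \<le> 1 * (norm u * norm v)" using \<epsilon> by (intro mult_right_mono) auto
      also have "\<dots> \<le> 1 / 2 * (norm u)\<^sup>2 + 1 / 2 * (norm v)\<^sup>2"
        using sum_squares_bound[of "norm u" "norm v"] by simp
      finally show ?thesis .
    qed
    moreover have "0 \<le> (norm v)\<^sup>2" by simp
    ultimately show ?thesis by linarith
  qed
  also have "\<dots> \<le> (2 + 1 / lambda1) * ((fnorm u)\<^sup>2 + (norm v)\<^sup>2)"
  proof -
    have "0 \<le> (fnorm u)\<^sup>2" "0 \<le> (norm v)\<^sup>2 / lambda1" using lambda1 by auto
    moreover have "(2 + 1 / lambda1) * ((fnorm u)\<^sup>2 + (norm v)\<^sup>2)
        = 2 * (fnorm u)\<^sup>2 + 2 * (norm v)\<^sup>2 + (fnorm u)\<^sup>2 / lambda1 + (norm v)\<^sup>2 / lambda1"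
      by (simp add: algebra_simps add_divide_distrib)
    ultimately show ?thesis using norm_le_fnorm[OF uH] by linarith
  qed
  finally have "\<mu> * energy x x \<le> \<mu> * ((2 + 1 / lambda1) * ((fnorm u)\<^sup>2 + (norm v)\<^sup>2))"
    using \<mu>_pos by (intro mult_left_mono) auto
  also have "\<mu> * ((2 + 1 / lambda1) * ((fnorm u)\<^sup>2 + (norm v)\<^sup>2)) = (\<mu> * (2 + 1 / lambda1)) * ((fnorm u)\<^sup>2 + (norm v)\<^sup>2)"
    by (simp only: mult.assoc)
  also have "\<mu> * (2 + 1 / lambda1) = 1 / 2"
  proof -
    have "2 + 1 / lambda1 \<noteq> 0" using lambda1 by (simp add: add_pos_pos less_imp_neq[THEN not_sym])
    then show ?thesis by (simp add: \<mu>_def)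
  qed
  finally show ?thesis using 1 by linarith
qed

section \<open>Exponential decay and the response to a bounded forcing\<close>

lemma TE_decay:
  assumes x: "x \<in> ZS" and t: "0 \<le> t"
  shows "(norm (TE t x))\<^sup>2 \<le> K0 * exp (- 2 * \<mu> * t) * (norm x)\<^sup>2"
proof -
  have "energy (TE t x) (TE t x) \<le> exp (- 2 * \<mu> * t) * energy x x"
  proof (rule sg.energy_decay[OF _ _ _ energy_upper energy_dissipative x t])
    fix x y z assume "x \<in> ZS" "y \<in> ZS" "z \<in> ZS"
    then show "energy (x + y) z = energy x z + energy y z"
      using form_add[OF ZS_fst ZS_fst ZS_fst] by (simp add: energy_def inner_add_left algebra_simps)
  next
    fix c x z assume "x \<in> ZS" "z \<in> ZS"
    then show "energy (c *\<^sub>R x) z = c * energy x z"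
      using form_scale[OF ZS_fst ZS_fst] by (simp add: energy_def algebra_simps)
  next
    fix x z show "energy x z = energy z x"
      using form_sym by (simp add: energy_def inner_commute add.commute)
  qed
  also have "\<dots> \<le> exp (- 2 * \<mu> * t) * ((kZ + 3) * (norm x)\<^sup>2)"
    using energy_upper[OF x x] by (intro mult_left_mono) (auto simp: power2_eq_square mult.assoc)
  finally have "\<epsilon> / (2 * kJ) * (norm (TE t x))\<^sup>2 \<le> exp (- 2 * \<mu> * t) * ((kZ + 3) * (norm x)\<^sup>2)"
    using energy_lower[OF sg.T_in[OF t x]] by linarith
  then have "2 * kJ / \<epsilon> * (\<epsilon> / (2 * kJ) * (norm (TE t x))\<^sup>2) \<le> 2 * kJ / \<epsilon> * (exp (- 2 * \<mu> * t) * ((kZ + 3) * (norm x)\<^sup>2))"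
    using \<epsilon> kJ_ge by (intro mult_left_mono) auto
  moreover have "2 * kJ / \<epsilon> * (\<epsilon> / (2 * kJ) * (norm (TE t x))\<^sup>2) = (norm (TE t x))\<^sup>2" using \<epsilon> kJ_ge by simp
  moreover have "2 * kJ / \<epsilon> * (exp (- 2 * \<mu> * t) * ((kZ + 3) * (norm x)\<^sup>2)) = K0 * exp (- 2 * \<mu> * t) * (norm x)\<^sup>2"
    by (simp add: K0_def)
  ultimately show ?thesis by linarith
qed

lemma TE_bound: "x \<in> ZS \<Longrightarrow> 0 \<le> t \<Longrightarrow> norm (TE t x) \<le> sqrt K0 * norm x"
proof (rule power2_le_imp_le)
  assume x: "x \<in> ZS" and t: "0 \<le> t"
  have "K0 * exp (- 2 * \<mu> * t) * (norm x)\<^sup>2 \<le> K0 * 1 * (norm x)\<^sup>2"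
    using K0_ge \<mu>_pos t by (intro mult_right_mono mult_left_mono) auto
  with TE_decay[OF x t] have "(norm (TE t x))\<^sup>2 \<le> K0 * 1 * (norm x)\<^sup>2" by (rule order_trans)
  then show "(norm (TE t x))\<^sup>2 \<le> (sqrt K0 * norm x)\<^sup>2"
    using K0_ge by (simp add: power_mult_distrib)
qed (use K0_ge in auto)

lemma \<tau>_pos: "0 < \<tau>"
  using K0_ge \<mu>_pos by (simp add: \<tau>_def)

lemma TE_half: "x \<in> ZS \<Longrightarrow> norm (TE \<tau> x) \<le> 1 / 2 * norm x"
proof (rule power2_le_imp_le)
  assume x: "x \<in> ZS"
  have "exp (- 2 * \<mu> * \<tau>) = inverse (4 * K0)"
    using \<mu>_pos K0_ge by (simp add: \<tau>_def exp_minus)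
  then have "K0 * exp (- 2 * \<mu> * \<tau>) = 1 / 4" using K0_ge by (simp only:) (simp add: field_simps)
  then have "(norm (TE \<tau> x))\<^sup>2 \<le> 1 / 4 * (norm x)\<^sup>2"
    using TE_decay[OF x less_imp_le[OF \<tau>_pos]] by (simp only:)
  then show "(norm (TE \<tau> x))\<^sup>2 \<le> (1 / 2 * norm x)\<^sup>2"
    by (simp add: power_divide)
qed simp

definition Kb :: real where "Kb = 2 * sqrt K0 * \<tau>"

lemma Kb_nonneg: "0 \<le> Kb" using K0_ge \<tau>_pos by (simp add: Kb_def)

lemma mild_bounded:
  assumes "sg.mild U G" "\<And>t. norm (U t) \<le> R" "\<And>t. norm (G t) \<le> g"
  shows "norm (U t) \<le> Kb * g"
  unfolding Kb_def using K0_ge by (intro sg.mild_bound[OF assms(1) TE_bound \<tau>_pos TE_half assms(2,3)]) auto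

end

section \<open>The nonlinearity\<close>

lemma mvt_between:
  fixes g :: "real \<Rightarrow> real"
  assumes g: "\<And>r. (g has_real_derivative deriv g r) (at r)"
  obtains \<zeta> where "min r s \<le> \<zeta>" "\<zeta> \<le> max r s" "g r - g s = (r - s) * deriv g \<zeta>"
proof -
  consider "r < s" | "s < r" | "r = s" by linarith
  then show thesis
  proof cases
    case 1
    obtain \<zeta> where "r < \<zeta>" "\<zeta> < s" "g s - g r = (s - r) * deriv g \<zeta>" using MVT2[OF 1, of g "deriv g"] g by blast
    then show thesis using 1 by (intro that[of \<zeta>]) (auto simp: algebra_simps)
  next
    case 2
    obtain \<zeta> where "s < \<zeta>" "\<zeta> < r" "g r - g s = (r - s) * deriv g \<zeta>" using MVT2[OF 2, of g "deriv g"] g by blast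
    then show thesis using 2 by (intro that[of \<zeta>]) auto
  qed (auto intro: that[of r])
qed

lemma square_between: "min r s \<le> \<zeta> \<Longrightarrow> \<zeta> \<le> max r s \<Longrightarrow> \<zeta>\<^sup>2 \<le> r\<^sup>2 + (s\<^sup>2 :: real)"
proof -
  assume "min r s \<le> \<zeta>" "\<zeta> \<le> max r s"
  then have "\<bar>\<zeta>\<bar> \<le> max \<bar>r\<bar> \<bar>s\<bar>" by (auto simp: min_def max_def abs_if split: if_splits)
  then have "\<zeta>\<^sup>2 \<le> (max \<bar>r\<bar> \<bar>s\<bar>)\<^sup>2" by (metis abs_ge_zero power2_abs power_mono)
  also have "\<dots> \<le> r\<^sup>2 + s\<^sup>2" by (auto simp: max_def)
  finally show ?thesis .
qed

lemma square_sum3: "(a + b + c)\<^sup>2 \<le> 3 * (a\<^sup>2 + b\<^sup>2 + (c::real)\<^sup>2)"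
proof -
  have "0 \<le> (a - b)\<^sup>2 + (b - c)\<^sup>2 + (a - c)\<^sup>2" by simp
  then show ?thesis by (simp add: power2_eq_square algebra_simps)
qed

text \<open>The nonlinearity with the space variable frozen: all pointwise estimates are made here
  for a single real function and used at almost every point of \<Omega>.\<close>

locale cubic_growth =
  fixes C \<alpha> \<gamma> c0 :: real and g :: "real \<Rightarrow> real"
  assumes C: "0 < C" and \<gamma>: "0 < \<gamma>" "\<gamma> \<le> 1" and \<alpha>: "1 \<le> \<alpha>" and sum2: "\<alpha> + \<gamma> = 2"
    and C1: "g C1_differentiable_on UNIV" and g0: "\<bar>deriv g 0\<bar> \<le> c0"
    and Hoelder: "\<And>r1 r2. \<bar>deriv g r1 - deriv g r2\<bar> \<le> C * (1 + \<bar>r1\<bar> powr \<alpha> + \<bar>r2\<bar> powr \<alpha>) * \<bar>r1 - r2\<bar> powr \<gamma>"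
begin

lemma deriv_g: "(g has_real_derivative deriv g r) (at r)"
  using C1 unfolding C1_differentiable_on_def
  by (metis DERIV_imp_deriv UNIV_I has_real_derivative_iff_has_vector_derivative)

lemma g_continuous: "isCont g r"
  using deriv_g DERIV_isCont by blast

text \<open>Hoelder continuity compared with the point 0. The relation
  \<open>\<alpha> + \<gamma> = 2\<close> turns the product of the powers into \<open>r^2\<close>,
  which is the critical growth of the derivative.\<close>

lemma deriv_growth: "\<bar>deriv g r\<bar> \<le> (c0 + 2 * C) * (1 + r\<^sup>2)"
proof -
  have c0: "0 \<le> c0" using g0 abs_ge_zero order_trans by blast
  have "\<bar>deriv g r - deriv g 0\<bar> \<le> C * (1 + \<bar>r\<bar> powr \<alpha>) * \<bar>r\<bar> powr \<gamma>"
    using Hoelder[of r 0] \<alpha> by simp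
  also have "\<dots> = C * (\<bar>r\<bar> powr \<gamma> + \<bar>r\<bar> powr 2)"
    by (simp add: algebra_simps powr_add[symmetric] sum2)
  also have "\<dots> \<le> C * (1 + r\<^sup>2 + r\<^sup>2)"
  proof (intro mult_left_mono add_mono)
    show "\<bar>r\<bar> powr 2 \<le> r\<^sup>2" by (cases "r = 0") (auto simp: powr_numeral)
    show "\<bar>r\<bar> powr \<gamma> \<le> 1 + r\<^sup>2"
    proof (cases "\<bar>r\<bar> \<le> 1")
      case True
      then have "\<bar>r\<bar> powr \<gamma> \<le> 1" using \<gamma> by (intro powr_le1) auto
      then show ?thesis by (simp add: add_increasing2)
    next
      case False
      then have "\<bar>r\<bar> powr \<gamma> \<le> \<bar>r\<bar> powr 2" using \<gamma> by (intro powr_mono) auto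
      then show ?thesis using False by (simp add: powr_numeral)
    qed
  qed (use C in auto)
  finally have 1: "\<bar>deriv g r - deriv g 0\<bar> \<le> C * (1 + r\<^sup>2 + r\<^sup>2)" .
  have "c0 * 1 \<le> c0 * (1 + r\<^sup>2)" using c0 by (intro mult_left_mono) auto
  moreover have "C * (1 + r\<^sup>2 + r\<^sup>2) \<le> 2 * C * (1 + r\<^sup>2)" using C by (simp add: algebra_simps)
  ultimately show ?thesis using 1 g0 by (simp add: distrib_right)
qed

lemma g_Lipschitz: "\<bar>g r - g s\<bar> \<le> (c0 + 2 * C) * (1 + r\<^sup>2 + s\<^sup>2) * \<bar>r - s\<bar>"
proof -
  have c0: "0 \<le> c0" using g0 abs_ge_zero order_trans by blast
  obtain \<zeta> where \<zeta>: "min r s \<le> \<zeta>" "\<zeta> \<le> max r s" "g r - g s = (r - s) * deriv g \<zeta>"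
    using mvt_between[OF deriv_g] by blast
  have "\<bar>deriv g \<zeta>\<bar> \<le> (c0 + 2 * C) * (1 + \<zeta>\<^sup>2)" by (rule deriv_growth)
  also have "\<dots> \<le> (c0 + 2 * C) * (1 + r\<^sup>2 + s\<^sup>2)"
    using square_between[OF \<zeta>(1,2)] c0 C by (intro mult_left_mono) auto
  finally have "\<bar>r - s\<bar> * \<bar>deriv g \<zeta>\<bar> \<le> \<bar>r - s\<bar> * ((c0 + 2 * C) * (1 + r\<^sup>2 + s\<^sup>2))" by (intro mult_left_mono) auto
  then show ?thesis by (simp add: \<zeta>(3) abs_mult mult_ac)
qed

text \<open>By the mean value theorem the remainder is the increment of the derivative over a
  distance at most \<open>h |z|\<close>, so Hoelder continuity supplies the factor
  \<open>h powr \<gamma>\<close>. The growth of all terms is collected in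
  \<open>m = 1 + |u| + |z|\<close>, where the exponents add up to 2; 9 is three powers of
  \<open>m\<close> times the 3 from the square of a sum of three terms.\<close>

lemma g_Taylor:
  assumes h: "0 < h" "h \<le> 1"
  shows "\<bar>(g (u + h * z) - g u) / h - deriv g u * z\<bar> \<le> 9 * C * h powr \<gamma> * (1 + u\<^sup>2 + z\<^sup>2) * \<bar>z\<bar>"
proof -
  obtain \<zeta> where \<zeta>: "min (u + h * z) u \<le> \<zeta>" "\<zeta> \<le> max (u + h * z) u" "g (u + h * z) - g u = (u + h * z - u) * deriv g \<zeta>"
    using mvt_between[OF deriv_g] by blast
  define m where "m = 1 + \<bar>u\<bar> + \<bar>z\<bar>"
  have m: "1 \<le> m" "\<bar>u\<bar> \<le> m" "\<bar>z\<bar> \<le> m" by (auto simp: m_def)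
  have hz: "\<bar>h * z\<bar> \<le> \<bar>z\<bar>" using h by (simp add: abs_mult mult_left_le_one_le)
  have \<zeta>m: "\<bar>\<zeta>\<bar> \<le> m" using \<zeta>(1,2) hz by (auto simp: m_def min_def max_def split: if_splits)
  have \<zeta>u: "\<bar>\<zeta> - u\<bar> \<le> h * \<bar>z\<bar>"
  proof -
    have "\<bar>\<zeta> - u\<bar> \<le> \<bar>h * z\<bar>" using \<zeta>(1,2) by (auto simp: min_def max_def split: if_splits)
    then show ?thesis using h by (simp add: abs_mult)
  qed
  have "\<bar>deriv g \<zeta> - deriv g u\<bar> \<le> C * (1 + \<bar>\<zeta>\<bar> powr \<alpha> + \<bar>u\<bar> powr \<alpha>) * \<bar>\<zeta> - u\<bar> powr \<gamma>" by (rule Hoelder)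
  also have "\<dots> \<le> C * (m powr \<alpha> + m powr \<alpha> + m powr \<alpha>) * (h powr \<gamma> * m powr \<gamma>)"
  proof (intro mult_mono mult_left_mono add_mono)
    show "1 \<le> m powr \<alpha>" using m \<alpha> by (intro ge_one_powr_ge_zero) auto
    show "\<bar>\<zeta>\<bar> powr \<alpha> \<le> m powr \<alpha>" "\<bar>u\<bar> powr \<alpha> \<le> m powr \<alpha>" using m \<zeta>m \<alpha> by (auto intro!: powr_mono2)
    have "\<bar>\<zeta> - u\<bar> powr \<gamma> \<le> (h * m) powr \<gamma>"
      using order_trans[OF \<zeta>u mult_left_mono[OF m(3), of h]] h \<gamma> by (intro powr_mono2) auto
    then show "\<bar>\<zeta> - u\<bar> powr \<gamma> \<le> h powr \<gamma> * m powr \<gamma>" using h m by (simp add: powr_mult)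
  qed (use C m in auto)
  also have "\<dots> = 3 * C * h powr \<gamma> * m\<^sup>2"
  proof -
    have "m powr \<alpha> * m powr \<gamma> = m\<^sup>2" using m by (simp add: powr_add[symmetric] sum2 powr_numeral)
    moreover have "C * (m powr \<alpha> + m powr \<alpha> + m powr \<alpha>) * (h powr \<gamma> * m powr \<gamma>) = 3 * C * h powr \<gamma> * (m powr \<alpha> * m powr \<gamma>)" by simp
    ultimately show ?thesis by simp
  qed
  also have "\<dots> \<le> 3 * C * h powr \<gamma> * (3 * (1 + u\<^sup>2 + z\<^sup>2))"
    using square_sum3[of 1 "\<bar>u\<bar>" "\<bar>z\<bar>"] C by (intro mult_left_mono) (auto simp: m_def)
  finally have "\<bar>deriv g \<zeta> - deriv g u\<bar> * \<bar>z\<bar> \<le> 3 * C * h powr \<gamma> * (3 * (1 + u\<^sup>2 + z\<^sup>2)) * \<bar>z\<bar>" by (intro mult_right_mono) auto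
  moreover have "(g (u + h * z) - g u) / h - deriv g u * z = (deriv g \<zeta> - deriv g u) * z"
    using h unfolding \<zeta>(3) by (simp add: algebra_simps)
  moreover have "3 * C * h powr \<gamma> * (3 * (1 + u\<^sup>2 + z\<^sup>2)) * \<bar>z\<bar> = 9 * C * h powr \<gamma> * (1 + u\<^sup>2 + z\<^sup>2) * \<bar>z\<bar>"
    by simp
  ultimately show ?thesis by (simp only: abs_mult)
qed

text \<open>Both quotients are compared with the derivative at the common point \<open>u\<close>.
  Only the linear term contains the difference of the directions; the two remainders vanish with the
  step sizes.\<close>

lemma g_quotient_diff:
  assumes h: "0 < h" "h \<le> 1" and k: "0 < k" "k \<le> 1"
  shows "\<bar>(g (u + h * z) - g u) / h - (g (u + k * y) - g u) / k\<bar> \<le> (c0 + 2 * C) * (1 + u\<^sup>2) * \<bar>z - y\<bar>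
     + 9 * C * h powr \<gamma> * (1 + u\<^sup>2 + z\<^sup>2) * \<bar>z\<bar> + 9 * C * k powr \<gamma> * (1 + u\<^sup>2 + y\<^sup>2) * \<bar>y\<bar>"
proof -
  have "\<bar>deriv g u * (z - y)\<bar> \<le> (c0 + 2 * C) * (1 + u\<^sup>2) * \<bar>z - y\<bar>"
    unfolding abs_mult by (intro mult_right_mono deriv_growth) auto
  moreover define p q where "p = (g (u + h * z) - g u) / h - deriv g u * z" and "q = (g (u + k * y) - g u) / k - deriv g u * y"
  have "\<bar>p\<bar> \<le> 9 * C * h powr \<gamma> * (1 + u\<^sup>2 + z\<^sup>2) * \<bar>z\<bar>" "\<bar>q\<bar> \<le> 9 * C * k powr \<gamma> * (1 + u\<^sup>2 + y\<^sup>2) * \<bar>y\<bar>"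
    using g_Taylor[OF h, of u z] g_Taylor[OF k, of u y] unfolding p_def q_def .
  moreover have "(g (u + h * z) - g u) / h - (g (u + k * y) - g u) / k = deriv g u * (z - y) + p - q"
    by (simp add: p_def q_def algebra_simps)
  moreover have "\<bar>deriv g u * (z - y) + p - q\<bar> \<le> \<bar>deriv g u * (z - y)\<bar> + \<bar>p\<bar> + \<bar>q\<bar>" by linarith
  ultimately show ?thesis by (smt (verit))
qed

end

text \<open>The argument \<open>w\<close> is approximated by functions with countably many values,
  the multiples of \<open>1/(n+1)\<close> below it; for these, measurability in \<open>x\<close> at
  each fixed value suffices, and continuity in the second variable passes to the limit.\<close>

lemma Caratheodory_measurable:
  fixes f :: "'a \<Rightarrow> real \<Rightarrow> real"
  assumes f: "\<And>r. (\<lambda>x. f x r) \<in> borel_measurable M" and cont: "\<And>x r. isCont (f x) r" and w[measurable]: "w \<in> borel_measurable M"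
  shows "(\<lambda>x. f x (w x)) \<in> borel_measurable M"
proof (rule borel_measurable_LIMSEQ_real)
  define s where "s n x = real_of_int \<lfloor>real (Suc n) * w x\<rfloor> / real (Suc n)" for n x
  show "(\<lambda>x. f x (s n x)) \<in> borel_measurable M" for n
    unfolding s_def
  proof (rule measurable_compose_countable[where f = "\<lambda>i x. f x (real_of_int i / real (Suc n))"])
    show "(\<lambda>x. \<lfloor>real (Suc n) * w x\<rfloor>) \<in> M \<rightarrow>\<^sub>M count_space UNIV" by measurable
  qed (rule f)
  have "(\<lambda>n. s n x) \<longlonglongrightarrow> w x" for x
  proof (rule Lim_null[THEN iffD2], rule Lim_null_comparison[OF _ LIMSEQ_inverse_real_of_nat], rule always_eventually, rule allI)
    fix n
    have "s n x - w x = (real_of_int \<lfloor>real (Suc n) * w x\<rfloor> - real (Suc n) * w x) / real (Suc n)"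
      by (simp add: s_def field_simps)
    moreover have "\<bar>real_of_int \<lfloor>real (Suc n) * w x\<rfloor> - real (Suc n) * w x\<bar> \<le> 1" by linarith
    ultimately show "norm (s n x - w x) \<le> inverse (real (Suc n))" by (simp add: divide_right_mono inverse_eq_divide)
  qed
  then show "(\<lambda>n. f x (s n x)) \<longlonglongrightarrow> f x (w x)" for x using cont isCont_tendsto_compose by blast
qed

lemma lebesgue_measurable_AE_cong:
  assumes "f \<in> borel_measurable lebesgue" "AE x in lebesgue. f x = g x"
  shows "g \<in> borel_measurable (lebesgue :: 'a::euclidean_space measure)"
proof (rule measurableI)
  fix X :: "'b set" assume X: "X \<in> sets borel"
  show "g -` X \<inter> space lebesgue \<in> sets lebesgue"
    by (rule completion.in_sets_AE[OF _ measurable_sets[OF assms(1) X]]) (use assms(2) in auto)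
qed simp

lemma norm_L2_square_le_of_nn:
  assumes "(\<integral>\<^sup>+ x. ennreal ((rep_L2 z x)\<^sup>2) \<partial>lebesgue) \<le> ennreal c" "0 \<le> c"
  shows "(norm z)\<^sup>2 \<le> c"
  using assms unfolding nn_norm_L2 by (simp add: ennreal_le_iff)

lemma nn_integral_add3:
  fixes a b c :: "'a \<Rightarrow> real"
  assumes [measurable]: "a \<in> borel_measurable M" "b \<in> borel_measurable M" "c \<in> borel_measurable M"
    and nn: "\<And>x. 0 \<le> a x" "\<And>x. 0 \<le> b x" "\<And>x. 0 \<le> c x" and k: "0 \<le> k" and abc: "0 \<le> A" "0 \<le> B" "0 \<le> C"
    and "(\<integral>\<^sup>+ x. ennreal (a x) \<partial>M) \<le> ennreal A" "(\<integral>\<^sup>+ x. ennreal (b x) \<partial>M) \<le> ennreal B"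
      "(\<integral>\<^sup>+ x. ennreal (c x) \<partial>M) \<le> ennreal C"
  shows "(\<integral>\<^sup>+ x. ennreal (k * (a x + b x + c x)) \<partial>M) \<le> ennreal (k * (A + B + C))"
proof -
  have "(\<integral>\<^sup>+ x. ennreal (k * (a x + b x + c x)) \<partial>M) = ennreal k * ((\<integral>\<^sup>+ x. ennreal (a x) \<partial>M) + (\<integral>\<^sup>+ x. ennreal (b x) \<partial>M) + (\<integral>\<^sup>+ x. ennreal (c x) \<partial>M))"
    using nn k by (simp add: ennreal_mult ennreal_plus nn_integral_cmult nn_integral_add)
  also have "\<dots> \<le> ennreal k * (ennreal A + ennreal B + ennreal C)"
    using assms by (intro mult_left_mono add_mono) auto
  also have "\<dots> = ennreal (k * (A + B + C))" using k abc by (simp add: ennreal_mult ennreal_plus)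
  finally show ?thesis .
qed

section \<open>The superposition operator from \<open>H10\<close> to \<open>L2\<close>\<close>

locale semilinear_wave = damped_wave +
  fixes C \<alpha> \<gamma> F0 F1 :: real and f :: "real^3 \<Rightarrow> real \<Rightarrow> real"
  assumes exps: "0 < C" "0 < \<gamma>" "\<gamma> \<le> 1" "1 \<le> \<alpha>" "\<alpha> + \<gamma> = 2"
    and nonlin: "nonlinearity_assms \<Omega> C \<alpha> \<gamma> f"
    and F0: "sqrt (LINT x|lebesgue_on \<Omega>. (f x 0)\<^sup>2) = F0"
    and F1: "Linf_norm (lebesgue_on \<Omega>) (\<lambda>x. deriv (f x) 0) = F1"
begin

text \<open>\<open>F1\<close> is an infimum of essential bounds. Raising it to
  \<open>|F1| + 1\<close> gives a number that exceeds some admissible bound, hence is itself an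
  essential bound for the derivative at zero.\<close>

definition C1 :: real where "C1 = (\<bar>F1\<bar> + 1) + 2 * C"

lemma C1_pos: "0 < C1" using exps by (simp add: C1_def)

lemma AE_cubic_growth: "AE x in lebesgue. x \<in> \<Omega> \<longrightarrow> cubic_growth C \<alpha> \<gamma> (\<bar>F1\<bar> + 1) (f x)"
proof -
  note n = nonlin[unfolded nonlinearity_assms_def]
  define V where "V = {c. 0 \<le> c \<and> (AE x in lebesgue_on \<Omega>. \<bar>deriv (f x) 0\<bar> \<le> c)}"
  obtain c where c: "AE x in lebesgue_on \<Omega>. \<bar>deriv (f x) 0\<bar> \<le> c" using n by (auto simp: Linf_def)
  have "\<bar>c\<bar> \<in> V" using c by (auto simp: V_def elim: eventually_mono)
  moreover have "Inf V = F1" using F1 by (simp add: Linf_norm_def V_def)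
  moreover have "F1 < \<bar>F1\<bar> + 1" by linarith
  ultimately have "\<exists>c\<in>V. c < \<bar>F1\<bar> + 1" by (intro cInf_lessD) auto
  then have "AE x in lebesgue_on \<Omega>. \<bar>deriv (f x) 0\<bar> \<le> \<bar>F1\<bar> + 1" by (auto simp: V_def elim: eventually_mono)
  moreover have "AE x in lebesgue_on \<Omega>. f x C1_differentiable_on UNIV" using n by blast
  moreover have "AE x in lebesgue_on \<Omega>. \<forall>r1 r2. \<bar>deriv (f x) r1 - deriv (f x) r2\<bar> \<le>
        C * (1 + \<bar>r1\<bar> powr \<alpha> + \<bar>r2\<bar> powr \<alpha>) * \<bar>r1 - r2\<bar> powr \<gamma>" using n by blast
  ultimately have "AE x in lebesgue_on \<Omega>. cubic_growth C \<alpha> \<gamma> (\<bar>F1\<bar> + 1) (f x)"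
    by eventually_elim (unfold_locales, use exps in auto)
  then show ?thesis by (simp add: AE_lebesgue_on[OF sets_\<Omega>])
qed

definition superpos :: "L2 \<Rightarrow> real^3 \<Rightarrow> real" where
  "superpos u x = (if x \<in> \<Omega> then f x (rep_L2 u x) else 0)"

text \<open>The growth and continuity of \<open>f x\<close> hold outside a null set
  \<open>N\<close>. Setting \<open>f\<close> to zero there makes it a Caratheodory function at every
  point, and completeness of Lebesgue measure carries measurability back.\<close>

lemma superpos_measurable [measurable]: "superpos u \<in> borel_measurable lebesgue"
proof -
  obtain N where N: "N \<in> null_sets lebesgue" "{x. \<not> (x \<in> \<Omega> \<longrightarrow> cubic_growth C \<alpha> \<gamma> (\<bar>F1\<bar> + 1) (f x))} \<subseteq> N"
    using AE_cubic_growth unfolding eventually_ae_filter by auto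
  define f' where "f' x r = (if x \<in> \<Omega> - N then f x r else 0)" for x r
  have "(\<lambda>x. f' x (rep_L2 u x)) \<in> borel_measurable lebesgue"
  proof (rule Caratheodory_measurable[where f = f' and w = "rep_L2 u"])
    fix r
    have "(\<lambda>x. f x r) \<in> borel_measurable (lebesgue_on \<Omega>)" using nonlin by (simp add: nonlinearity_assms_def)
    then have m: "(\<lambda>x. if x \<in> \<Omega> then f x r else 0) \<in> borel_measurable lebesgue"
      using sets_\<Omega> by (subst borel_measurable_if) auto
    have "N \<inter> space lebesgue \<in> sets lebesgue" using N by auto
    then have "(\<lambda>x. if x \<in> N then 0 else (if x \<in> \<Omega> then f x r else 0)) \<in> borel_measurable lebesgue"
      by (rule measurable_If_set[OF borel_measurable_const m])
    moreover have "(\<lambda>x. if x \<in> N then 0 else (if x \<in> \<Omega> then f x r else 0)) = (\<lambda>x. f' x r)" by (auto simp: f'_def)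
    ultimately show "(\<lambda>x. f' x r) \<in> borel_measurable lebesgue" by simp
  next
    fix x r
    show "isCont (f' x) r"
    proof (cases "x \<in> \<Omega> - N")
      case True
      then have "cubic_growth C \<alpha> \<gamma> (\<bar>F1\<bar> + 1) (f x)" using N by blast
      then have "isCont (f x) r" by (rule cubic_growth.g_continuous)
      moreover have "f' x = f x" using True by (auto simp: f'_def)
      ultimately show ?thesis by simp
    next
      case False
      then have "f' x = (\<lambda>r. 0)" by (auto simp: f'_def)
      then show ?thesis by simp
    qed
  qed measurable
  moreover have "AE x in lebesgue. f' x (rep_L2 u x) = superpos u x"
    using AE_not_in[OF N(1)] by eventually_elim (auto simp: f'_def superpos_def)
  ultimately show ?thesis by (rule lebesgue_measurable_AE_cong)
qed

lemma nn_Q: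
  assumes "u \<in> H10 \<Omega>" "w \<in> H10 \<Omega>" and r: "norm (grad \<Omega> u) \<le> r"
  shows "(\<integral>\<^sup>+ x. ennreal (rep_L2 u x ^ 4 * (rep_L2 w x)\<^sup>2) \<partial>lebesgue) \<le> ennreal (4096 * r ^ 4 * (norm (grad \<Omega> w))\<^sup>2)"
proof -
  have "(\<integral>\<^sup>+ x. ennreal (rep_L2 u x ^ 4 * (rep_L2 w x)\<^sup>2) \<partial>lebesgue) \<le> ennreal ((4 * norm (grad \<Omega> u)) ^ 4 * (4 * norm (grad \<Omega> w))\<^sup>2)"
    using assms by (intro nn_integral_Holder_6 Sobolev_H10 open_\<Omega>) auto
  also have "(4 * norm (grad \<Omega> u)) ^ 4 * (4 * norm (grad \<Omega> w))\<^sup>2 = 4096 * norm (grad \<Omega> u) ^ 4 * (norm (grad \<Omega> w))\<^sup>2"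
    by (simp add: power_mult_distrib)
  also have "ennreal \<dots> \<le> ennreal (4096 * r ^ 4 * (norm (grad \<Omega> w))\<^sup>2)"
    using r by (intro ennreal_leI mult_right_mono mult_left_mono power_mono) auto
  finally show ?thesis .
qed

text \<open>The bound \<open>q\<close> for the critical integrals of \<open>u^4 w^2\<close> and
  \<open>v^4 w^2\<close>, with \<open>w = u - v\<close>, is left open. Sobolev fills it with a fixed
  multiple of the squared gradient of \<open>w\<close>; for the solution it is filled later with an
  arbitrarily small multiple plus an \<open>L2\<close> term.\<close>

lemma superpos_diff_nn:
  assumes q: "(\<integral>\<^sup>+ x. ennreal (rep_L2 u x ^ 4 * (rep_L2 (u - v) x)\<^sup>2) \<partial>lebesgue) \<le> ennreal q"
      "(\<integral>\<^sup>+ x. ennreal (rep_L2 v x ^ 4 * (rep_L2 (u - v) x)\<^sup>2) \<partial>lebesgue) \<le> ennreal q" "0 \<le> q"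
  shows "(\<integral>\<^sup>+ x. ennreal ((superpos u x - superpos v x)\<^sup>2) \<partial>lebesgue) \<le> ennreal (3 * C1\<^sup>2 * ((norm (u - v))\<^sup>2 + q + q))"
proof -
  have "(\<integral>\<^sup>+ x. ennreal ((superpos u x - superpos v x)\<^sup>2) \<partial>lebesgue)
      \<le> (\<integral>\<^sup>+ x. ennreal (3 * C1\<^sup>2 * ((rep_L2 (u - v) x)\<^sup>2 + rep_L2 u x ^ 4 * (rep_L2 (u - v) x)\<^sup>2 + rep_L2 v x ^ 4 * (rep_L2 (u - v) x)\<^sup>2)) \<partial>lebesgue)"
  proof (rule nn_integral_mono_AE)
    show "AE x in lebesgue. ennreal ((superpos u x - superpos v x)\<^sup>2)
        \<le> ennreal (3 * C1\<^sup>2 * ((rep_L2 (u - v) x)\<^sup>2 + rep_L2 u x ^ 4 * (rep_L2 (u - v) x)\<^sup>2 + rep_L2 v x ^ 4 * (rep_L2 (u - v) x)\<^sup>2))"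
      using AE_cubic_growth rep_L2_diff[of u v]
    proof eventually_elim
      case (elim x)
      let ?u = "rep_L2 u x" and ?v = "rep_L2 v x"
      have "\<bar>superpos u x - superpos v x\<bar> \<le> C1 * (1 + ?u\<^sup>2 + ?v\<^sup>2) * \<bar>?u - ?v\<bar>"
      proof (cases "x \<in> \<Omega>")
        case True
        then show ?thesis using elim(1) cubic_growth.g_Lipschitz[of C \<alpha> \<gamma> "\<bar>F1\<bar> + 1" "f x" ?u ?v] by (simp add: superpos_def C1_def)
      next
        case False
        then show ?thesis using C1_pos by (simp add: superpos_def)
      qed
      then have "\<bar>superpos u x - superpos v x\<bar>\<^sup>2 \<le> (C1 * (1 + ?u\<^sup>2 + ?v\<^sup>2) * \<bar>?u - ?v\<bar>)\<^sup>2" by (intro power_mono) auto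
      also have "\<dots> = C1\<^sup>2 * (?u - ?v)\<^sup>2 * (1 + ?u\<^sup>2 + ?v\<^sup>2)\<^sup>2" by (simp add: power_mult_distrib)
      also have "\<dots> \<le> C1\<^sup>2 * (?u - ?v)\<^sup>2 * (3 * (1\<^sup>2 + (?u\<^sup>2)\<^sup>2 + (?v\<^sup>2)\<^sup>2))"
        by (intro mult_left_mono square_sum3) auto
      also have "\<dots> = 3 * C1\<^sup>2 * ((rep_L2 (u - v) x)\<^sup>2 + ?u ^ 4 * (rep_L2 (u - v) x)\<^sup>2 + ?v ^ 4 * (rep_L2 (u - v) x)\<^sup>2)"
        by (simp add: elim(2) algebra_simps flip: power_mult)
      finally show ?case by (intro ennreal_leI) simp
    qed
  qed
  also have "\<dots> \<le> ennreal (3 * C1\<^sup>2 * ((norm (u - v))\<^sup>2 + q + q))"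
    using q by (intro nn_integral_add3) (auto simp: nn_norm_L2)
  finally show ?thesis .
qed

lemma superpos_zero: "AE x in lebesgue. superpos 0 x = (if x \<in> \<Omega> then f x 0 else 0)"
  using rep_L2_zero by eventually_elim (simp add: superpos_def)

lemma nn_superpos_zero: "(\<integral>\<^sup>+ x. ennreal ((superpos 0 x)\<^sup>2) \<partial>lebesgue) = ennreal (F0\<^sup>2)"
proof -
  have "(\<integral>\<^sup>+ x. ennreal ((superpos 0 x)\<^sup>2) \<partial>lebesgue) = (\<integral>\<^sup>+ x. ennreal ((f x 0)\<^sup>2) * indicator \<Omega> x \<partial>lebesgue)"
    using superpos_zero by (intro nn_integral_cong_AE) (auto elim!: eventually_mono simp: indicator_def)
  also have "\<dots> = (\<integral>\<^sup>+ x. ennreal ((f x 0)\<^sup>2) \<partial>lebesgue_on \<Omega>)" by (rule nn_integral_lebesgue_on[OF sets_\<Omega>, symmetric])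
  also have "\<dots> = ennreal (LINT x|lebesgue_on \<Omega>. (f x 0)\<^sup>2)"
    using nonlin by (intro nn_integral_eq_integral) (auto simp: nonlinearity_assms_def square_integrable_def)
  also have "(LINT x|lebesgue_on \<Omega>. (f x 0)\<^sup>2) = F0\<^sup>2"
    unfolding F0[symmetric] by (simp add: integral_nonneg_AE)
  finally show ?thesis .
qed

lemma H10_0: "0 \<in> H10 \<Omega>" by (rule subspace_0[OF H10_subspace[OF open_\<Omega>]])

lemma H10_diff: "u \<in> H10 \<Omega> \<Longrightarrow> v \<in> H10 \<Omega> \<Longrightarrow> u - v \<in> H10 \<Omega>" by (rule subspace_diff[OF H10_subspace[OF open_\<Omega>]])

lemma superpos_square_integrable:
  assumes u: "u \<in> H10 \<Omega>"
  shows "square_integrable lebesgue (superpos u)"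
proof -
  have z: "square_integrable lebesgue (superpos 0)"
    by (rule square_integrable_nn) (auto simp: nn_superpos_zero)
  have "grad \<Omega> 0 = 0" using grad_scale[OF open_\<Omega> u, of 0] by simp
  then have "square_integrable lebesgue (\<lambda>x. superpos u x - superpos 0 x)"
    using superpos_diff_nn[of u 0 "4096 * (norm (grad \<Omega> u)) ^ 4 * (norm (grad \<Omega> (u - 0)))\<^sup>2"]
      nn_Q[OF u H10_diff[OF u H10_0], of "norm (grad \<Omega> u)"] nn_Q[OF H10_0 H10_diff[OF u H10_0], of "norm (grad \<Omega> u)"]
    by (intro square_integrable_nn) (auto intro: le_less_trans)
  from square_integrable_add[OF this z] show ?thesis by simp
qed

abbreviation NF :: "L2 \<Rightarrow> L2" where "NF \<equiv> nemytskii \<Omega> f"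

lemma NF_superpos: "NF u = abs_L2 (superpos u)"
  unfolding nemytskii_def L2_class_def superpos_def[abs_def] ..

lemma rep_NF: "u \<in> H10 \<Omega> \<Longrightarrow> AE x in lebesgue. rep_L2 (NF u) x = superpos u x"
  unfolding NF_superpos by (rule rep_abs_L2[OF superpos_square_integrable])

lemma NF_L2_on: "u \<in> H10 \<Omega> \<Longrightarrow> NF u \<in> L2_on \<Omega>"
  unfolding NF_superpos by (rule abs_L2_in_L2_on[OF superpos_square_integrable]) (auto simp: superpos_def)

lemma NF_Lipschitz:
  assumes u: "u \<in> H10 \<Omega>" and v: "v \<in> H10 \<Omega>"
    and q: "(\<integral>\<^sup>+ x. ennreal (rep_L2 u x ^ 4 * (rep_L2 (u - v) x)\<^sup>2) \<partial>lebesgue) \<le> ennreal q"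
      "(\<integral>\<^sup>+ x. ennreal (rep_L2 v x ^ 4 * (rep_L2 (u - v) x)\<^sup>2) \<partial>lebesgue) \<le> ennreal q" "0 \<le> q"
  shows "(norm (NF u - NF v))\<^sup>2 \<le> 3 * C1\<^sup>2 * ((norm (u - v))\<^sup>2 + q + q)"
proof (rule norm_L2_square_le_of_nn)
  have "(\<integral>\<^sup>+ x. ennreal ((rep_L2 (NF u - NF v) x)\<^sup>2) \<partial>lebesgue) = (\<integral>\<^sup>+ x. ennreal ((superpos u x - superpos v x)\<^sup>2) \<partial>lebesgue)"
    using rep_NF[OF u] rep_NF[OF v] rep_L2_diff[of "NF u" "NF v"] by (intro nn_integral_cong_AE) auto
  then show "(\<integral>\<^sup>+ x. ennreal ((rep_L2 (NF u - NF v) x)\<^sup>2) \<partial>lebesgue) \<le> ennreal (3 * C1\<^sup>2 * ((norm (u - v))\<^sup>2 + q + q))"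
    using superpos_diff_nn[OF q] by simp
qed (use q in auto)

lemma NF_Lipschitz_H1:
  assumes u: "u \<in> H10 \<Omega>" "norm (grad \<Omega> u) \<le> r" and v: "v \<in> H10 \<Omega>" "norm (grad \<Omega> v) \<le> r"
  shows "(norm (NF u - NF v))\<^sup>2 \<le> 3 * C1\<^sup>2 * ((norm (u - v))\<^sup>2 + 8192 * r ^ 4 * (norm (grad \<Omega> (u - v)))\<^sup>2)"
  using NF_Lipschitz[OF u(1) v(1) nn_Q[OF u(1) H10_diff[OF u(1) v(1)] u(2)] nn_Q[OF v(1) H10_diff[OF u(1) v(1)] v(2)]]
  by (simp add: algebra_simps)

lemma norm_NF_0: "norm (NF 0) = \<bar>F0\<bar>"
proof -
  have "ennreal ((norm (NF 0))\<^sup>2) = ennreal (F0\<^sup>2)"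
    unfolding nn_norm_L2[symmetric] nn_superpos_zero[symmetric]
    using rep_NF[OF H10_0] by (intro nn_integral_cong_AE) auto
  then have "(norm (NF 0))\<^sup>2 = F0\<^sup>2" by simp
  then have "sqrt ((norm (NF 0))\<^sup>2) = sqrt (F0\<^sup>2)" by (rule arg_cong)
  then show ?thesis by simp
qed

text \<open>Only the leading term, with its open bound \<open>q\<close>, sees the difference of the
  directions. The remainders involve \<open>z\<close> and \<open>y\<close> separately, to the third
  power, so the \<open>H10\<close> bound \<open>s\<close> on each of them and Sobolev suffice; they
  carry \<open>h powr \<gamma>\<close> and \<open>k powr \<gamma>\<close>. The factor 243 is 3 *
  9^2.\<close>

lemma NF_quotient:
  assumes u: "u \<in> H10 \<Omega>" "norm (grad \<Omega> u) \<le> r"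
    and z: "z \<in> H10 \<Omega>" "norm z \<le> s" "norm (grad \<Omega> z) \<le> s" and y: "y \<in> H10 \<Omega>" "norm y \<le> s" "norm (grad \<Omega> y) \<le> s"
    and h: "0 < h" "h \<le> 1" and k: "0 < k" "k \<le> 1"
    and q: "(\<integral>\<^sup>+ x. ennreal (rep_L2 u x ^ 4 * (rep_L2 (z - y) x)\<^sup>2) \<partial>lebesgue) \<le> ennreal q" "0 \<le> q"
  shows "(norm ((1 / h) *\<^sub>R (NF (u + h *\<^sub>R z) - NF u) - (1 / k) *\<^sub>R (NF (u + k *\<^sub>R y) - NF u)))\<^sup>2
    \<le> 3 * (3 * C1\<^sup>2 * ((norm (z - y))\<^sup>2 + q) + 243 * C\<^sup>2 * (s\<^sup>2 + 4096 * r ^ 4 * s\<^sup>2 + 4096 * s ^ 4 * s\<^sup>2) * (h powr \<gamma>)\<^sup>2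
       + 243 * C\<^sup>2 * (s\<^sup>2 + 4096 * r ^ 4 * s\<^sup>2 + 4096 * s ^ 4 * s\<^sup>2) * (k powr \<gamma>)\<^sup>2)"
proof (rule norm_L2_square_le_of_nn)
  let ?W = "(1 / h) *\<^sub>R (NF (u + h *\<^sub>R z) - NF u) - (1 / k) *\<^sub>R (NF (u + k *\<^sub>R y) - NF u)"
  define b where "b = s\<^sup>2 + 4096 * r ^ 4 * s\<^sup>2 + 4096 * s ^ 4 * s\<^sup>2"
  define T1 where "T1 x = 3 * C1\<^sup>2 * ((rep_L2 (z - y) x)\<^sup>2 + rep_L2 u x ^ 4 * (rep_L2 (z - y) x)\<^sup>2 + 0)" for x
  define T2 where "T2 h z x = 243 * C\<^sup>2 * (h powr \<gamma>)\<^sup>2 * ((rep_L2 z x)\<^sup>2 + rep_L2 u x ^ 4 * (rep_L2 z x)\<^sup>2 + rep_L2 z x ^ 4 * (rep_L2 z x)\<^sup>2)" for h z x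
  have s0: "0 \<le> s" using z(2) norm_ge_zero order_trans by blast
  have r0: "0 \<le> r" using u(2) norm_ge_zero order_trans by blast
  have meas: "T1 \<in> borel_measurable lebesgue" "T2 h z \<in> borel_measurable lebesgue" for h z
    unfolding T1_def[abs_def] T2_def[abs_def] by measurable
  have uhz: "u + h *\<^sub>R z \<in> H10 \<Omega>" "u + k *\<^sub>R y \<in> H10 \<Omega>"
    using u z y by (auto intro!: H10_add[OF open_\<Omega>] H10_scale[OF open_\<Omega>])
  have "AE x in lebesgue. rep_L2 ?W x = (1 / h) * (superpos (u + h *\<^sub>R z) x - superpos u x) - (1 / k) * (superpos (u + k *\<^sub>R y) x - superpos u x)"
    using rep_L2_diff[of "(1 / h) *\<^sub>R (NF (u + h *\<^sub>R z) - NF u)" "(1 / k) *\<^sub>R (NF (u + k *\<^sub>R y) - NF u)"]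
      rep_L2_scaleR[of "1 / h" "NF (u + h *\<^sub>R z) - NF u"] rep_L2_scaleR[of "1 / k" "NF (u + k *\<^sub>R y) - NF u"]
      rep_L2_diff[of "NF (u + h *\<^sub>R z)" "NF u"] rep_L2_diff[of "NF (u + k *\<^sub>R y)" "NF u"]
      rep_NF[OF uhz(1)] rep_NF[OF uhz(2)] rep_NF[OF u(1)]
    by eventually_elim simp
  moreover have "AE x in lebesgue. rep_L2 (u + h *\<^sub>R z) x = rep_L2 u x + h * rep_L2 z x"
    using rep_L2_add[of u "h *\<^sub>R z"] rep_L2_scaleR[of h z] by eventually_elim simp
  moreover have "AE x in lebesgue. rep_L2 (u + k *\<^sub>R y) x = rep_L2 u x + k * rep_L2 y x"
    using rep_L2_add[of u "k *\<^sub>R y"] rep_L2_scaleR[of k y] by eventually_elim simp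
  ultimately have AE: "AE x in lebesgue. (rep_L2 ?W x)\<^sup>2 \<le> 3 * (T1 x + T2 h z x + T2 k y x)"
    using AE_cubic_growth rep_L2_diff[of z y]
  proof eventually_elim
    case (elim x)
    let ?u = "rep_L2 u x" and ?z = "rep_L2 z x" and ?y = "rep_L2 y x"
    define a1 where "a1 = C1 * (1 + ?u\<^sup>2) * \<bar>?z - ?y\<bar>"
    define a2 where "a2 h z = 9 * C * h powr \<gamma> * (1 + ?u\<^sup>2 + z\<^sup>2) * \<bar>z\<bar>" for h z :: real
    have "\<bar>rep_L2 ?W x\<bar> \<le> a1 + a2 h ?z + a2 k ?y"
    proof (cases "x \<in> \<Omega>")
      case True
      then have "rep_L2 ?W x = (f x (?u + h * ?z) - f x ?u) / h - (f x (?u + k * ?y) - f x ?u) / k"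
        using elim by (simp add: superpos_def)
      then show ?thesis using cubic_growth.g_quotient_diff[OF _ h k, of C \<alpha> \<gamma> "\<bar>F1\<bar> + 1" "f x" ?u ?z ?y] elim(4) True
        by (simp add: a1_def a2_def C1_def)
    next
      case False
      then have "rep_L2 ?W x = 0" using elim by (simp add: superpos_def)
      then show ?thesis using C1_pos exps(1) by (auto simp: a1_def a2_def intro!: add_nonneg_nonneg mult_nonneg_nonneg)
    qed
    then have "\<bar>rep_L2 ?W x\<bar>\<^sup>2 \<le> (a1 + a2 h ?z + a2 k ?y)\<^sup>2" by (intro power_mono) auto
    also have "\<dots> \<le> 3 * (a1\<^sup>2 + (a2 h ?z)\<^sup>2 + (a2 k ?y)\<^sup>2)" by (rule square_sum3)
    also have "\<dots> \<le> 3 * (T1 x + T2 h z x + T2 k y x)"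
    proof (intro mult_left_mono add_mono)
      have "a1\<^sup>2 = C1\<^sup>2 * (?z - ?y)\<^sup>2 * (1 + ?u\<^sup>2 + 0)\<^sup>2" by (simp add: a1_def power_mult_distrib)
      also have "\<dots> \<le> C1\<^sup>2 * (?z - ?y)\<^sup>2 * (3 * (1\<^sup>2 + (?u\<^sup>2)\<^sup>2 + 0\<^sup>2))" by (intro mult_left_mono square_sum3) auto
      also have "\<dots> = T1 x" by (simp add: T1_def elim(5) algebra_simps flip: power_mult)
      finally show "a1\<^sup>2 \<le> T1 x" .
      have "(a2 h (rep_L2 z x))\<^sup>2 \<le> T2 h z x" for h z
      proof -
        let ?z = "rep_L2 z x"
        have "(a2 h ?z)\<^sup>2 = 81 * C\<^sup>2 * (h powr \<gamma>)\<^sup>2 * ?z\<^sup>2 * (1 + ?u\<^sup>2 + ?z\<^sup>2)\<^sup>2" by (simp add: a2_def power_mult_distrib)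
        also have "\<dots> \<le> 81 * C\<^sup>2 * (h powr \<gamma>)\<^sup>2 * ?z\<^sup>2 * (3 * (1\<^sup>2 + (?u\<^sup>2)\<^sup>2 + (?z\<^sup>2)\<^sup>2))"
          by (intro mult_left_mono square_sum3) auto
        also have "\<dots> = T2 h z x" by (simp add: T2_def algebra_simps flip: power_mult)
        finally show ?thesis .
      qed
      then show "(a2 h ?z)\<^sup>2 \<le> T2 h z x" "(a2 k ?y)\<^sup>2 \<le> T2 k y x" by auto
    qed simp
    finally show ?case by simp
  qed
  have "(\<integral>\<^sup>+ x. ennreal ((rep_L2 ?W x)\<^sup>2) \<partial>lebesgue) \<le> (\<integral>\<^sup>+ x. ennreal (3 * (T1 x + T2 h z x + T2 k y x)) \<partial>lebesgue)"
    using AE by (intro nn_integral_mono_AE) (auto elim!: eventually_mono intro!: ennreal_leI)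
  also have "\<dots> \<le> ennreal (3 * (3 * C1\<^sup>2 * ((norm (z - y))\<^sup>2 + q + 0) + 243 * C\<^sup>2 * (h powr \<gamma>)\<^sup>2 * b + 243 * C\<^sup>2 * (k powr \<gamma>)\<^sup>2 * b))"
  proof (rule nn_integral_add3)
    show "(\<integral>\<^sup>+ x. ennreal (T1 x) \<partial>lebesgue) \<le> ennreal (3 * C1\<^sup>2 * ((norm (z - y))\<^sup>2 + q + 0))"
      unfolding T1_def using q by (intro nn_integral_add3) (auto simp: nn_norm_L2)
    have T2: "(\<integral>\<^sup>+ x. ennreal (T2 h z x) \<partial>lebesgue) \<le> ennreal (243 * C\<^sup>2 * (h powr \<gamma>)\<^sup>2 * b)"
      if z: "z \<in> H10 \<Omega>" "norm z \<le> s" "norm (grad \<Omega> z) \<le> s" for h z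
    proof -
      have g2: "(norm (grad \<Omega> z))\<^sup>2 \<le> s\<^sup>2" "(norm z)\<^sup>2 \<le> s\<^sup>2" using z by (auto intro!: power_mono)
      have m: "ennreal (4096 * a ^ 4 * (norm (grad \<Omega> z))\<^sup>2) \<le> ennreal (4096 * a ^ 4 * s\<^sup>2)" for a
        using g2 by (intro ennreal_leI mult_left_mono) auto
      show ?thesis
        unfolding T2_def b_def using g2 r0 s0
        by (intro nn_integral_add3 order_trans[OF nn_Q[OF u(1) z(1) u(2)] m] order_trans[OF nn_Q[OF z(1) z(1) z(3)] m])
          (auto simp: nn_norm_L2 intro!: ennreal_leI)
    qed
    show "(\<integral>\<^sup>+ x. ennreal (T2 h z x) \<partial>lebesgue) \<le> ennreal (243 * C\<^sup>2 * (h powr \<gamma>)\<^sup>2 * b)" by (rule T2[OF z])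
    show "(\<integral>\<^sup>+ x. ennreal (T2 k y x) \<partial>lebesgue) \<le> ennreal (243 * C\<^sup>2 * (k powr \<gamma>)\<^sup>2 * b)" by (rule T2[OF y])
  qed (use meas q r0 s0 in \<open>auto simp: T1_def T2_def b_def\<close>)
  finally show "(\<integral>\<^sup>+ x. ennreal ((rep_L2 ?W x)\<^sup>2) \<partial>lebesgue) \<le> ennreal (3 * (3 * C1\<^sup>2 * ((norm (z - y))\<^sup>2 + q)
      + 243 * C\<^sup>2 * (s\<^sup>2 + 4096 * r ^ 4 * s\<^sup>2 + 4096 * s ^ 4 * s\<^sup>2) * (h powr \<gamma>)\<^sup>2
      + 243 * C\<^sup>2 * (s\<^sup>2 + 4096 * r ^ 4 * s\<^sup>2 + 4096 * s ^ 4 * s\<^sup>2) * (k powr \<gamma>)\<^sup>2))"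
    unfolding b_def by (simp add: mult_ac)
qed (use q exps in auto)

end

section \<open>Bounded solutions\<close>

context elliptic_form
begin

lemma op_A_eq: "u \<in> H10 \<Omega> \<Longrightarrow> w \<in> L2_on \<Omega> \<Longrightarrow> (\<And>v. v \<in> H10 \<Omega> \<Longrightarrow> form u v = w \<bullet> v) \<Longrightarrow> u \<in> dom_A \<Omega> A \<beta> \<and> op_A \<Omega> A \<beta> u = w"
proof -
  assume u: "u \<in> H10 \<Omega>" and w: "w \<in> L2_on \<Omega>" "\<And>v. v \<in> H10 \<Omega> \<Longrightarrow> form u v = w \<bullet> v"
  have ud: "u \<in> dom_A \<Omega> A \<beta>" using u w by (auto simp: dom_A_def)
  moreover have "op_A \<Omega> A \<beta> u = w"
    by (rule L2_on_eqI[OF open_\<Omega> op_A(1)[OF ud] w(1)]) (simp add: w(2)[symmetric] op_A(2)[OF ud, symmetric] test_in_H10[OF open_\<Omega>])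
  ultimately show ?thesis by blast
qed

lemma op_A_diff:
  assumes u: "u \<in> dom_A \<Omega> A \<beta>" and v: "v \<in> dom_A \<Omega> A \<beta>"
  shows "op_A \<Omega> A \<beta> (u - v) = op_A \<Omega> A \<beta> u - op_A \<Omega> A \<beta> v"
proof -
  note uH = dom_A_H10[OF u] and vH = dom_A_H10[OF v]
  have "u - v \<in> dom_A \<Omega> A \<beta> \<and> op_A \<Omega> A \<beta> (u - v) = op_A \<Omega> A \<beta> u - op_A \<Omega> A \<beta> v"
    by (rule op_A_eq) (auto simp: form_diff uH vH op_A u v inner_diff_left
        intro!: subspace_diff[OF H10_subspace[OF open_\<Omega>]] subspace_diff[OF L2_on_subspace])
  then show ?thesis by blast
qed

lemma b18_nonneg: "0 \<le> b18 M r"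
proof -
  have "0 \<le> Cnu (a0 / 4) * (4 * r) ^ 6 + 2 / a0 * (64 * M * r\<^sup>2)\<^sup>2"
    using a0 Cnu[of "a0 / 4"] by (intro add_nonneg_nonneg) simp_all
  moreover have "0 \<le> 4096 * (8 / a0 * x) ^ 3" if "0 \<le> x" for x using that a0 by simp
  ultimately show ?thesis unfolding b18_def by blast
qed

end

lemma quadratic_absorb:
  fixes m :: real
  assumes "m\<^sup>2 \<le> K * (a * m\<^sup>2 + b)" "K * a \<le> 1 / 2"
  shows "m\<^sup>2 \<le> 2 * K * b"
proof -
  have "K * (a * m\<^sup>2 + b) = K * a * m\<^sup>2 + K * b" by (simp add: algebra_simps)
  moreover have "K * a * m\<^sup>2 \<le> 1 / 2 * m\<^sup>2" using assms(2) by (intro mult_right_mono) auto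
  ultimately have "m\<^sup>2 \<le> 1 / 2 * m\<^sup>2 + K * b" using assms(1) by linarith
  then show ?thesis by simp
qed

lemma fourth_power_sum: "(a + b) ^ 4 \<le> 8 * a ^ 4 + 8 * (b::real) ^ 4"
proof -
  have s: "(x + y)\<^sup>2 \<le> 2 * x\<^sup>2 + 2 * y\<^sup>2" for x y :: real
    using zero_le_power2[of "x - y"] by (simp add: power2_eq_square algebra_simps)
  have "((a + b)\<^sup>2)\<^sup>2 \<le> (2 * a\<^sup>2 + 2 * b\<^sup>2)\<^sup>2" by (intro power_mono s) auto
  also have "\<dots> \<le> 2 * (2 * a\<^sup>2)\<^sup>2 + 2 * (2 * b\<^sup>2)\<^sup>2" by (rule s)
  finally show ?thesis by (simp add: power_mult_distrib flip: power_mult)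
qed

lemma component_norms:
  fixes x :: "L2 \<times> (L2^3) \<times> L2"
  shows "norm (fst x) \<le> norm x" "norm (fst (snd x)) \<le> norm x" "norm (snd (snd x)) \<le> norm x"
  using norm_fst_le[of "fst x" "snd x"] norm_snd_le[of "snd x" "fst x"]
    norm_snd_le[of "snd (snd x)" "fst (snd x)"] norm_fst_le[of "fst (snd x)" "snd (snd x)"] by simp_all

lemma norm_0_0: "norm ((0, 0, w) :: L2 \<times> (L2^3) \<times> L2) = norm w"
  using norm_triple_square[of 0 0 w] by (simp add: power2_eq_iff_nonneg)

lemma norm_diff3: "norm (a - b - c) \<le> norm a + norm b + norm (c :: _ :: real_normed_vector)"
  using norm_triangle_ineq4[of "a - b" c] norm_triangle_ineq4[of a b] by linarith

locale bounded_solution = semilinear_wave +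
  fixes u v :: "real \<Rightarrow> L2" and R :: real and \<omega> :: "real \<Rightarrow> real"
  assumes sol: "full_solution \<Omega> A \<beta> f \<epsilon> T u v"
    and bnd: "\<And>t. (fnorm (u t))\<^sup>2 + \<epsilon> * (norm (v t))\<^sup>2 \<le> R"
    and modulus: "modulus_function \<omega>" and has_mod: "has_modulus fnorm \<omega> u"
begin

text \<open>A priori bounds in \<open>L2\<close> for the gradient of \<open>u t\<close>, for
  \<open>v t\<close> and for \<open>NF (u t)\<close>, in this order, in terms of \<open>R\<close>
  and the structural constants.\<close>

definition rg :: real where "rg = sqrt (kg * R)"
definition Vm :: real where "Vm = sqrt (R / \<epsilon>)"
definition NFm :: real where "NFm = \<bar>F0\<bar> + sqrt (3 * C1\<^sup>2 * (R / lambda1 + 8192 * rg ^ 4 * rg\<^sup>2))"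

lemma uH: "u t \<in> H10 \<Omega>" and vL: "v t \<in> L2_on \<Omega>"
  using sol by (auto simp: full_solution_def fst_Z0)

lemma R_nonneg: "0 \<le> R"
  using bnd[of 0] \<epsilon> by (meson add_nonneg_nonneg mult_nonneg_nonneg less_imp_le order_trans zero_le_power2)

lemma fnorm_u: "(fnorm (u t))\<^sup>2 \<le> R"
proof -
  have "0 \<le> \<epsilon> * (norm (v t))\<^sup>2" using \<epsilon> by simp
  then show ?thesis using bnd[of t] by linarith
qed

lemma norm_v: "norm (v t) \<le> Vm"
proof (rule power2_le_imp_le)
  have "\<epsilon> * (norm (v t))\<^sup>2 \<le> R" using bnd[of t] zero_le_power2[of "fnorm (u t)"] by linarith
  then show "(norm (v t))\<^sup>2 \<le> Vm\<^sup>2" using \<epsilon> R_nonneg by (simp add: Vm_def field_simps)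
qed (use R_nonneg \<epsilon> in \<open>simp add: Vm_def\<close>)

lemma rg_nonneg: "0 \<le> rg" and Vm_nonneg: "0 \<le> Vm"
  using R_nonneg \<epsilon> kg_pos by (auto simp: rg_def Vm_def)

lemma grad_u: "norm (grad \<Omega> (u t)) \<le> rg"
proof (rule power2_le_imp_le)
  have "(norm (grad \<Omega> (u t)))\<^sup>2 \<le> kg * R"
    using norm_grad_le[OF uH, of t] mult_left_mono[OF fnorm_u[of t] less_imp_le[OF kg_pos]] by linarith
  then show "(norm (grad \<Omega> (u t)))\<^sup>2 \<le> rg\<^sup>2" using kg_pos R_nonneg by (simp add: rg_def)
qed (rule rg_nonneg)

lemma norm_u: "(norm (u t))\<^sup>2 \<le> R / lambda1"
  using norm_le_fnorm[OF uH, of t] divide_right_mono[OF fnorm_u[of t], of lambda1] lambda1 by linarith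

lemma grad_0: "grad \<Omega> 0 = 0" using grad_scale[OF open_\<Omega> H10_0, of 0] by simp

lemma norm_NF: "norm (NF (u t)) \<le> NFm"
proof -
  have "(norm (NF (u t) - NF 0))\<^sup>2 \<le> 3 * C1\<^sup>2 * ((norm (u t - 0))\<^sup>2 + 8192 * rg ^ 4 * (norm (grad \<Omega> (u t - 0)))\<^sup>2)"
    by (rule NF_Lipschitz_H1) (use uH grad_u H10_0 rg_nonneg in \<open>auto simp: grad_0\<close>)
  also have "\<dots> \<le> 3 * C1\<^sup>2 * (R / lambda1 + 8192 * rg ^ 4 * rg\<^sup>2)"
    using norm_u grad_u by (intro mult_left_mono add_mono power_mono) auto
  finally have "sqrt ((norm (NF (u t) - NF 0))\<^sup>2) \<le> sqrt (3 * C1\<^sup>2 * (R / lambda1 + 8192 * rg ^ 4 * rg\<^sup>2))"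
    by (rule real_sqrt_le_mono)
  then have "norm (NF (u t) - NF 0) \<le> sqrt (3 * C1\<^sup>2 * (R / lambda1 + 8192 * rg ^ 4 * rg\<^sup>2))" by simp
  then show ?thesis using norm_triangle_sub[of "NF (u t)" "NF 0"] by (simp add: NFm_def norm_NF_0)
qed

section \<open>The given solution as a continuous mild solution in \<open>ZS\<close>\<close>

definition U :: "real \<Rightarrow> L2 \<times> (L2^3) \<times> L2" where "U t = emb (u t, v t)"
definition G :: "real \<Rightarrow> L2 \<times> (L2^3) \<times> L2" where "G t = emb (0, (1 / \<epsilon>) *\<^sub>R NF (u t))"

lemma U_Z0: "(u t, v t) \<in> fst (Z0 \<Omega> A \<beta>)" by (simp add: fst_Z0 uH vL)

lemma G_Z0: "(0, (1 / \<epsilon>) *\<^sub>R NF (u t)) \<in> fst (Z0 \<Omega> A \<beta>)"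
  by (simp add: fst_Z0 H10_0 subspace_scale[OF L2_on_subspace] NF_L2_on uH)

lemma U_comp: "fst (U t) = u t" "fst (snd (U t)) = grad \<Omega> (u t)" "snd (snd (U t)) = v t"
  by (simp_all add: U_def emb_def)

lemma G_comp: "G t = (0, 0, (1 / \<epsilon>) *\<^sub>R NF (u t))"
  by (simp add: G_def emb_def grad_0)

lemma mild: "sg.mild U G"
  unfolding sg.mild_def
proof (intro conjI allI impI)
  show "U t \<in> ZS" "G t \<in> ZS" for t by (simp_all add: U_def G_def U_Z0 G_Z0)
  fix s t :: real assume st: "s \<le> t"
  then obtain I where I: "has_integral_into (Z0 \<Omega> A \<beta>) (\<lambda>p. T (t - p) (0, (1 / \<epsilon>) *\<^sub>R NF (u p))) I s t"
    "(u t, v t) = T (t - s) (u s, v s) + I" using sol unfolding full_solution_def by meson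
  have "I = (u t, v t) - T (t - s) (u s, v s)" using I(2) by (simp add: algebra_simps)
  then have "emb I = U t - TE (t - s) (U s)"
    using st by (simp add: U_def TE_def emb_diff[OF U_Z0 T_Z0[OF _ U_Z0]])
  then show "((\<lambda>p. TE (t - p) (G p)) has_integral (U t - TE (t - s) (U s))) {s..t}"
    using emb_has_integral[OF I(1)] by (simp add: TE_def G_def)
qed

definition Rm :: real where "Rm = sqrt (kJ * (R + Vm\<^sup>2))"

lemma norm_U: "norm (U t) \<le> Rm"
proof -
  have "(norm (U t))\<^sup>2 \<le> kJ * ((fnorm (u t))\<^sup>2 + (norm (v t))\<^sup>2)"
    using norm_emb_upper[OF U_Z0, of t] by (simp add: U_def snd_Z0)
  also have "\<dots> \<le> kJ * (R + Vm\<^sup>2)"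
    using fnorm_u norm_v kJ_ge by (intro mult_left_mono add_mono power_mono) auto
  finally have "sqrt ((norm (U t))\<^sup>2) \<le> Rm" unfolding Rm_def by (rule real_sqrt_le_mono)
  then show ?thesis by simp
qed

lemma norm_U_diff: "norm (U s - U t) \<le> 2 * Rm"
  using norm_triangle_ineq4[of "U s" "U t"] norm_U[of s] norm_U[of t] by simp

lemma norm_G_diff: "norm (G s - G t) = (1 / \<epsilon>) * norm (NF (u s) - NF (u t))"
proof -
  have "G s - G t = (0, 0, (1 / \<epsilon>) *\<^sub>R (NF (u s) - NF (u t)))" by (simp add: G_comp scaleR_right_diff_distrib)
  then show ?thesis using \<epsilon> by (simp only: norm_0_0) simp
qed

definition LF :: real where "LF = sqrt (3 * C1\<^sup>2 * (1 / lambda1 + 8192 * rg ^ 4 * kg))"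

lemma LF_nonneg: "0 \<le> LF" using lambda1 kg_pos by (simp add: LF_def)

lemma NF_fnorm: "norm (NF (u s) - NF (u t)) \<le> LF * fnorm (u s - u t)"
proof -
  let ?w = "u s - u t"
  have wH: "?w \<in> H10 \<Omega>" using H10_diff uH by simp
  have "(norm (NF (u s) - NF (u t)))\<^sup>2 \<le> 3 * C1\<^sup>2 * ((norm ?w)\<^sup>2 + 8192 * rg ^ 4 * (norm (grad \<Omega> ?w))\<^sup>2)"
    by (rule NF_Lipschitz_H1) (use uH grad_u in auto)
  also have "\<dots> \<le> 3 * C1\<^sup>2 * ((fnorm ?w)\<^sup>2 / lambda1 + 8192 * rg ^ 4 * (kg * (fnorm ?w)\<^sup>2))"
    using norm_le_fnorm[OF wH] norm_grad_le[OF wH] by (intro mult_left_mono add_mono) auto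
  also have "\<dots> = 3 * C1\<^sup>2 * (1 / lambda1 + 8192 * rg ^ 4 * kg) * (fnorm ?w)\<^sup>2" by (simp add: algebra_simps)
  finally have "sqrt ((norm (NF (u s) - NF (u t)))\<^sup>2) \<le> sqrt (3 * C1\<^sup>2 * (1 / lambda1 + 8192 * rg ^ 4 * kg) * (fnorm ?w)\<^sup>2)"
    by (rule real_sqrt_le_mono)
  then show ?thesis using fnorm_nonneg[OF wH] by (simp add: LF_def real_sqrt_mult)
qed

lemma \<omega>_bound: "\<bar>s - t\<bar> \<le> 1 \<Longrightarrow> fnorm (u s - u t) \<le> \<omega> \<bar>s - t\<bar>"
  using has_mod by (simp add: has_modulus_def)

lemma \<omega>_small: "0 < e \<Longrightarrow> \<exists>\<eta>. 0 < \<eta> \<and> \<eta> \<le> 1 \<and> \<omega> \<eta> \<le> e"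
proof -
  assume e: "0 < e"
  have "continuous_on {0..1} \<omega>" "\<omega> 0 = 0" using modulus by (auto simp: modulus_function_def)
  then obtain d where d: "0 < d" "\<And>x. x \<in> {0..1} \<Longrightarrow> dist x 0 < d \<Longrightarrow> dist (\<omega> x) (\<omega> 0) < e"
    unfolding continuous_on_iff using e by (metis atLeastAtMost_iff order_refl zero_le_one)
  have "\<bar>\<omega> (min (d / 2) 1)\<bar> < e" using d(2)[of "min (d / 2) 1"] d(1) \<open>\<omega> 0 = 0\<close> by (auto simp: dist_real_def)
  then show ?thesis using d(1) by (intro exI[of _ "min (d / 2) 1"]) auto
qed

lemma \<omega>_mono: "0 \<le> x \<Longrightarrow> x \<le> y \<Longrightarrow> y \<le> 1 \<Longrightarrow> \<omega> x \<le> \<omega> y"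
  using modulus by (auto simp: modulus_function_def mono_on_def)

text \<open>The modulus of continuity concerns \<open>u\<close> alone and yields uniform continuity
  of the forcing \<open>G\<close>. Continuity of the velocity follows because the difference of
  \<open>U\<close> and a time shift of \<open>U\<close> is a bounded mild solution, hence controlled
  by the difference of the forcings.\<close>

lemma continuous_U: "continuous_on UNIV U" and continuous_G: "continuous_on UNIV G"
proof -
  have small: "\<exists>d>0. \<forall>h t. \<bar>h\<bar> < d \<longrightarrow> norm (G (t + h) - G t) \<le> e" if e: "0 < e" for e
  proof -
    define e' where "e' = e * \<epsilon> / (LF + 1)"
    have e': "0 < e'" using e \<epsilon> LF_nonneg by (simp add: e'_def)
    obtain \<eta> where \<eta>: "0 < \<eta>" "\<eta> \<le> 1" "\<omega> \<eta> \<le> e'" using \<omega>_small[OF e'] by blast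
    have "norm (G (t + h) - G t) \<le> e" if h: "\<bar>h\<bar> < \<eta>" for h t
    proof -
      have "norm (NF (u (t + h)) - NF (u t)) \<le> LF * fnorm (u (t + h) - u t)" by (rule NF_fnorm)
      also have "\<dots> \<le> LF * e'"
        using \<omega>_bound[of "t + h" t] \<omega>_mono[of "\<bar>h\<bar>" \<eta>] \<eta> h LF_nonneg by (intro mult_left_mono) auto
      also have "\<dots> \<le> (LF + 1) * e'" using e' by (intro mult_right_mono) auto
      also have "\<dots> = e * \<epsilon>" using LF_nonneg by (simp add: e'_def)
      finally show ?thesis using \<epsilon> by (simp add: norm_G_diff divide_le_eq)
    qed
    then show ?thesis using \<eta>(1) by blast
  qed
  show "continuous_on UNIV G"
    unfolding continuous_on_iff
  proof (intro ballI allI impI)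
    fix t e :: real assume "0 < e"
    then obtain d where d: "0 < d" "\<And>h t. \<bar>h\<bar> < d \<Longrightarrow> norm (G (t + h) - G t) \<le> e / 2" using small[of "e / 2"] by auto
    show "\<exists>d>0. \<forall>x\<in>UNIV. dist x t < d \<longrightarrow> dist (G x) (G t) < e"
    proof (intro exI[of _ d] conjI ballI impI)
      fix x assume "dist x t < d"
      then have "norm (G (t + (x - t)) - G t) \<le> e / 2" by (intro d(2)) (simp add: dist_real_def)
      then show "dist (G x) (G t) < e" using \<open>0 < e\<close> by (simp add: dist_norm)
    qed (rule d)
  qed
  have diff: "norm (U (t + h) - U t) \<le> Kb * e" if "\<And>t. norm (G (t + h) - G t) \<le> e" for h t e
    using mild_bounded[OF sg.mild_diff[OF sg.mild_shift[OF mild] mild] norm_U_diff that] .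
  show "continuous_on UNIV U"
    unfolding continuous_on_iff
  proof (intro ballI allI impI)
    fix t e :: real assume e: "0 < e"
    define e' where "e' = e / (2 * (Kb + 1))"
    have e': "0 < e'" using e Kb_nonneg by (simp add: e'_def)
    then obtain d where d: "0 < d" "\<And>h t. \<bar>h\<bar> < d \<Longrightarrow> norm (G (t + h) - G t) \<le> e'" using small[of e'] by auto
    show "\<exists>d>0. \<forall>x\<in>UNIV. dist x t < d \<longrightarrow> dist (U x) (U t) < e"
    proof (intro exI[of _ d] conjI ballI impI)
      fix x assume "dist x t < d"
      then have "norm (U (t + (x - t)) - U t) \<le> Kb * e'" by (intro diff d(2)) (simp add: dist_real_def)
      also have "\<dots> \<le> (Kb + 1) * e'" using e' by (intro mult_right_mono) auto
      also have "\<dots> = e / 2"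
      proof -
        have "k * (e / (2 * k)) = e / 2" if "k \<noteq> 0" for k using that by simp
        moreover have "Kb + 1 \<noteq> 0" using Kb_nonneg by linarith
        ultimately show ?thesis unfolding e'_def by blast
      qed
      finally show "dist (U x) (U t) < e" using e by (simp add: dist_norm)
    qed (rule d)
  qed
qed

text \<open>The generator identity for the mean of \<open>U\<close> is read in components. The first
  one says that \<open>q\<close> is a difference quotient of \<open>u\<close>; the last one is the
  elliptic equation for the mean \<open>p\<close>, whose operator value is the mean of
  \<open>NF (u s)\<close> minus \<open>q\<close> minus \<epsilon> times the difference quotient of
  \<open>v\<close>. All of this is bounded in \<open>L2\<close> for fixed \<eta>.\<close>

lemma average_data:
  assumes \<eta>: "0 < \<eta>"
  obtains p q where "p \<in> dom_A \<Omega> A \<beta>" "q \<in> H10 \<Omega>" "(1 / \<eta>) *\<^sub>R integral {t..t + \<eta>} U = emb (p, q)"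
    "q = (1 / \<eta>) *\<^sub>R (u (t + \<eta>) - u t)" "norm (op_A \<Omega> A \<beta> p) \<le> Vm + 2 * \<epsilon> * Vm / \<eta> + NFm"
    "norm q \<le> Vm" "(v has_integral (u (t + \<eta>) - u t)) {t..t + \<eta>}"
proof -
  let ?I = "integral {t..t + \<eta>} U" and ?J = "integral {t..t + \<eta>} G"
  have I: "?I \<in> DE" "BE ?I = U (t + \<eta>) - U t - ?J"
    using \<eta> by (auto intro!: sg.mild_average[OF mild continuous_U continuous_G])
  have sc: "(1 / \<eta>) *\<^sub>R ?I \<in> DE" "BE ((1 / \<eta>) *\<^sub>R ?I) = (1 / \<eta>) *\<^sub>R (U (t + \<eta>) - U t - ?J)"
    using sg.D_scale[OF I(1), of "1 / \<eta>"] I(2) by auto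
  then obtain p q where pq: "p \<in> dom_A \<Omega> A \<beta>" "q \<in> H10 \<Omega>" "(1 / \<eta>) *\<^sub>R ?I = emb (p, q)"
    by (auto simp: DE_def fst_Z1)
  have Gint: "(G has_integral ?J) {t..t + \<eta>}"
    using continuous_G by (intro integrable_integral integrable_continuous_real) (auto elim: continuous_on_subset)
  have Uint: "(U has_integral ?I) {t..t + \<eta>}"
    using continuous_U by (intro integrable_integral integrable_continuous_real) (auto elim: continuous_on_subset)
  have J1: "fst ?J = 0"
  proof -
    have "((fst \<circ> G) has_integral fst ?J) {t..t + \<eta>}" by (rule has_integral_linear[OF Gint bounded_linear_fst])
    moreover have "fst \<circ> G = (\<lambda>_. 0)" by (auto simp: G_comp)
    ultimately show ?thesis by (auto dest: has_integral_unique[OF has_integral_0])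
  qed
  have J3: "norm (snd (snd ?J)) \<le> NFm / \<epsilon> * \<eta>"
  proof -
    have "norm ?J \<le> NFm / \<epsilon> * measure lborel (cbox t (t + \<eta>))"
    proof (rule has_integral_bound)
      show "(G has_integral ?J) (cbox t (t + \<eta>))" using Gint by (simp add: cbox_interval)
      show "norm (G x) \<le> NFm / \<epsilon>" for x
        using norm_NF[of x] \<epsilon> by (simp add: G_comp norm_0_0 divide_right_mono)
      show "0 \<le> NFm / \<epsilon>" using order_trans[OF norm_ge_zero norm_NF] \<epsilon> by simp
    qed
    then show ?thesis using component_norms(3)[of ?J] \<eta> by simp
  qed
  have "BE (emb (p, q)) = emb (q, - ((1 / \<epsilon>) *\<^sub>R (q + op_A \<Omega> A \<beta> p)))" by (simp add: BE_def op_B_def)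
  then have eq: "emb (q, - ((1 / \<epsilon>) *\<^sub>R (q + op_A \<Omega> A \<beta> p))) = (1 / \<eta>) *\<^sub>R (U (t + \<eta>) - U t - ?J)" using sc pq by simp
  have q: "q = (1 / \<eta>) *\<^sub>R (u (t + \<eta>) - u t)"
    using arg_cong[OF eq, of fst] by (simp add: emb_def U_comp J1)
  have vint: "(v has_integral snd (snd ?I)) {t..t + \<eta>}"
    using has_integral_linear[OF Uint, of "\<lambda>x. snd (snd x)"]
    by (simp add: o_def U_comp bounded_linear_compose[OF bounded_linear_snd bounded_linear_snd])
  \<comment> \<open>The same \<open>q\<close> is also the mean of \<open>v\<close>, and therefore
    bounded by \<open>Vm\<close> independently of \<eta>. This is the Lipschitz bound of
    \<open>u\<close> in \<open>L2\<close>.\<close>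
  have q2: "q = (1 / \<eta>) *\<^sub>R snd (snd ?I)" using arg_cong[OF pq(3), of "\<lambda>x. snd (snd x)"] by (simp add: emb_def)
  then have vint': "(v has_integral (u (t + \<eta>) - u t)) {t..t + \<eta>}" using q vint \<eta> by simp
  have "norm (snd (snd ?I)) \<le> Vm * measure lborel (cbox t (t + \<eta>))"
    by (rule has_integral_bound[OF Vm_nonneg]) (use vint norm_v in \<open>auto simp: cbox_interval\<close>)
  then have normq: "norm q \<le> Vm" using \<eta> q2 by (simp add: divide_le_eq mult.commute)
  have "- ((1 / \<epsilon>) *\<^sub>R (q + op_A \<Omega> A \<beta> p)) = (1 / \<eta>) *\<^sub>R (v (t + \<eta>) - v t - snd (snd ?J))"
    using arg_cong[OF eq, of "\<lambda>x. snd (snd x)"] by (simp add: emb_def U_comp)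
  then have "(- \<epsilon>) *\<^sub>R (- ((1 / \<epsilon>) *\<^sub>R (q + op_A \<Omega> A \<beta> p))) = (- \<epsilon>) *\<^sub>R ((1 / \<eta>) *\<^sub>R (v (t + \<eta>) - v t - snd (snd ?J)))"
    by (rule arg_cong)
  moreover have "(- \<epsilon>) *\<^sub>R (- ((1 / \<epsilon>) *\<^sub>R b)) = b" for b :: L2 using \<epsilon> by simp
  ultimately have "op_A \<Omega> A \<beta> p = (- \<epsilon>) *\<^sub>R ((1 / \<eta>) *\<^sub>R (v (t + \<eta>) - v t - snd (snd ?J))) - q"
    by (metis add_diff_cancel_left')
  then have "norm (op_A \<Omega> A \<beta> p) \<le> \<epsilon> * (1 / \<eta> * norm (v (t + \<eta>) - v t - snd (snd ?J))) + norm q"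
    using norm_triangle_ineq4[of "(- \<epsilon>) *\<^sub>R ((1 / \<eta>) *\<^sub>R (v (t + \<eta>) - v t - snd (snd ?J)))" q] \<epsilon> \<eta> by simp
  also have "\<dots> \<le> \<epsilon> * (1 / \<eta> * (Vm + Vm + NFm / \<epsilon> * \<eta>)) + Vm"
  proof (intro add_mono mult_left_mono)
    have "norm (v (t + \<eta>) - v t - snd (snd ?J)) \<le> norm (v (t + \<eta>)) + norm (v t) + norm (snd (snd ?J))"
      by (meson add_mono norm_triangle_ineq4 order_refl order_trans)
    then show "norm (v (t + \<eta>) - v t - snd (snd ?J)) \<le> Vm + Vm + NFm / \<epsilon> * \<eta>"
      using norm_v[of "t + \<eta>"] norm_v[of t] J3 by linarith
    show "norm q \<le> Vm" by (rule normq)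
  qed (use \<epsilon> \<eta> in auto)
  also have "\<dots> = Vm + 2 * \<epsilon> * Vm / \<eta> + NFm" using \<epsilon> \<eta> by (simp add: field_simps)
  finally show thesis using that[OF pq q] normq vint' by blast
qed

text \<open>The choice refers to \<omega>, \<open>kg\<close> and \<delta> only, never to the
  solution, so the constants built on it are uniform. \<open>Mt\<close> bounds \<open>A\<close> on
  the mean, \<open>Nt\<close> is the level at which the mean is truncated, \<open>Ct\<close> the
  price of the truncated part. In 32768 = 8 * 4096 the 8 stems from a fourth power of a sum and 4096
  from Sobolev; 512 leaves ample room under the other half of \<delta>.\<close>

definition eta :: "real \<Rightarrow> real" where
  "eta \<delta> = (SOME \<eta>. 0 < \<eta> \<and> \<eta> \<le> 1 \<and> \<omega> \<eta> \<le> min 1 (\<delta> / 2 / 32768) / sqrt kg)"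
definition Mt :: "real \<Rightarrow> real" where "Mt \<delta> = Vm + 2 * \<epsilon> * Vm / eta \<delta> + NFm"
definition Nt :: "real \<Rightarrow> real" where "Nt \<delta> = 1 + b18 (Mt \<delta>) (rg + 1) / (min 1 (\<delta> / 512)) ^ 6"
definition Ct :: "real \<Rightarrow> real" where "Ct \<delta> = 8 * Nt \<delta> ^ 4"

lemma eta:
  assumes "0 < \<delta>"
  shows "0 < eta \<delta>" "eta \<delta> \<le> 1" "sqrt kg * \<omega> (eta \<delta>) \<le> min 1 (\<delta> / 2 / 32768)"
proof -
  have "0 < min 1 (\<delta> / 2 / 32768) / sqrt kg" using assms kg_pos by simp
  from someI_ex[OF \<omega>_small[OF this], folded eta_def]
  have "0 < eta \<delta>" "eta \<delta> \<le> 1" "\<omega> (eta \<delta>) \<le> min 1 (\<delta> / 2 / 32768) / sqrt kg" by auto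
  then show "0 < eta \<delta>" "eta \<delta> \<le> 1" "sqrt kg * \<omega> (eta \<delta>) \<le> min 1 (\<delta> / 2 / 32768)"
    using kg_pos by (auto simp: pos_le_divide_eq mult.commute)
qed

text \<open>The mean of \<open>u\<close> over a short time interval lies in a bounded subset of \<open>D(A)\<close>, hence is bounded in
  \<open>L\<^sup>1\<^sup>8\<close>, and it is close to \<open>u(t)\<close> in \<open>H10\<close>.  Therefore multiplication by \<open>u(t)\<^sup>2\<close>, which just fails to be
  compact from \<open>H10\<close> to \<open>L2\<close>, is small up to a lower order term, uniformly in \<open>t\<close>.\<close>

lemma critical_potential_small:
  assumes \<delta>: "0 < \<delta>" and w: "w \<in> H10 \<Omega>"
  shows "(\<integral>\<^sup>+ x. ennreal (rep_L2 (u t) x ^ 4 * (rep_L2 w x)\<^sup>2) \<partial>lebesgue) \<le> ennreal (\<delta> * (norm (grad \<Omega> w))\<^sup>2 + Ct \<delta> * (norm w)\<^sup>2)"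
proof -
  define \<eta> where "\<eta> = eta \<delta>"
  have \<eta>: "0 < \<eta>" "\<eta> \<le> 1" "sqrt kg * \<omega> \<eta> \<le> 1" "sqrt kg * \<omega> \<eta> \<le> \<delta> / 2 / 32768"
    using eta[OF \<delta>] by (auto simp: \<eta>_def)
  obtain p q where pq: "p \<in> dom_A \<Omega> A \<beta>" "q \<in> H10 \<Omega>" "(1 / \<eta>) *\<^sub>R integral {t..t + \<eta>} U = emb (p, q)"
    "norm (op_A \<Omega> A \<beta> p) \<le> Mt \<delta>"
    using average_data[OF \<eta>(1), of t] unfolding Mt_def \<eta>_def by metis
  have pH: "p \<in> H10 \<Omega>" by (rule dom_A_H10[OF pq(1)])
  define k where "k = sqrt kg * \<omega> \<eta>"
  have gd: "norm (grad \<Omega> (u s) - grad \<Omega> (u t)) \<le> k" if s: "s \<in> {t..t + \<eta>}" for s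
  proof -
    have wH: "u s - u t \<in> H10 \<Omega>" using H10_diff uH by simp
    have "fnorm (u s - u t) \<le> \<omega> \<eta>" using \<omega>_bound[of s t] \<omega>_mono[of "\<bar>s - t\<bar>" \<eta>] s \<eta> by auto
    then have "(norm (grad \<Omega> (u s - u t)))\<^sup>2 \<le> kg * (\<omega> \<eta>)\<^sup>2"
      using norm_grad_le[OF wH] kg_pos fnorm_nonneg[OF wH] by (meson mult_left_mono order_trans power_mono less_imp_le)
    moreover have "0 \<le> \<omega> \<eta>" using modulus \<eta> by (auto simp: modulus_function_def)
    ultimately have "sqrt ((norm (grad \<Omega> (u s - u t)))\<^sup>2) \<le> sqrt kg * \<omega> \<eta>"
      using real_sqrt_le_mono[of _ "kg * (\<omega> \<eta>)\<^sup>2"] by (fastforce simp: real_sqrt_mult)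
    then show ?thesis by (simp add: k_def grad_diff[OF open_\<Omega> uH uH])
  qed
  have k0: "0 \<le> k" using order_trans[OF norm_ge_zero gd[of t]] \<eta> by simp
  \<comment> \<open>The gradient is a component of \<open>U\<close>, so it commutes with the time
    integral, and the gradient of \<open>p\<close> is a mean of gradients each within
    \<open>k\<close> of the one at time \<open>t\<close>.\<close>
  have gp: "norm (grad \<Omega> (u t - p)) \<le> k"
  proof -
    let ?I = "integral {t..t + \<eta>} U"
    have bl: "bounded_linear (\<lambda>x :: L2 \<times> (L2^3) \<times> L2. fst (snd x))"
      by (rule bounded_linear_compose[OF bounded_linear_fst bounded_linear_snd])
    have "(U has_integral ?I) {t..t + \<eta>}"
      using continuous_U by (intro integrable_integral integrable_continuous_real) (auto elim: continuous_on_subset)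
    from has_integral_linear[OF this bl]
    have "((\<lambda>s. grad \<Omega> (u s)) has_integral fst (snd ?I)) {t..t + \<eta>}" by (simp add: o_def U_comp)
    from has_integral_diff[OF this has_integral_const_real[of "grad \<Omega> (u t)" t "t + \<eta>"]]
    have "((\<lambda>s. grad \<Omega> (u s) - grad \<Omega> (u t)) has_integral (fst (snd ?I) - \<eta> *\<^sub>R grad \<Omega> (u t))) (cbox t (t + \<eta>))"
      using \<eta>(1) by (simp add: cbox_interval)
    then have "norm (fst (snd ?I) - \<eta> *\<^sub>R grad \<Omega> (u t)) \<le> k * measure lborel (cbox t (t + \<eta>))"
      by (rule has_integral_bound[OF k0]) (use gd in \<open>auto simp: cbox_interval\<close>)
    then have *: "norm (fst (snd ?I) - \<eta> *\<^sub>R grad \<Omega> (u t)) \<le> k * \<eta>" using \<eta>(1) by simp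
    have "grad \<Omega> p = (1 / \<eta>) *\<^sub>R fst (snd ?I)" using arg_cong[OF pq(3), of "\<lambda>x. fst (snd x)"] by (simp add: emb_def)
    then have "grad \<Omega> (u t - p) = - ((1 / \<eta>) *\<^sub>R (fst (snd ?I) - \<eta> *\<^sub>R grad \<Omega> (u t)))"
      using \<eta>(1) by (simp add: grad_diff[OF open_\<Omega> uH pH] algebra_simps)
    then have "norm (grad \<Omega> (u t - p)) = norm (fst (snd ?I) - \<eta> *\<^sub>R grad \<Omega> (u t)) / \<eta>"
      using \<eta>(1) by (simp only: norm_minus_cancel norm_scaleR) simp
    then show ?thesis using * \<eta>(1) by (simp add: divide_le_eq)
  qed
  have gpr: "norm (grad \<Omega> p) \<le> rg + 1"
  proof -
    have "norm (grad \<Omega> p) \<le> norm (grad \<Omega> (u t)) + norm (grad \<Omega> (u t) - grad \<Omega> p)" by (rule norm_triangle_sub[of "grad \<Omega> p" "grad \<Omega> (u t)", unfolded norm_minus_commute[of "grad \<Omega> p"]])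
    then show ?thesis using gp grad_u[of t] \<eta>(3) by (simp add: grad_diff[OF open_\<Omega> uH pH] k_def)
  qed
  define b where "b = b18 (Mt \<delta>) (rg + 1)"
  define N where "N = Nt \<delta>"
  define e where "e = min 1 (\<delta> / 512)"
  have e: "0 < e" "e \<le> 1" "512 * e \<le> \<delta>" using \<delta> by (auto simp: e_def)
  have b0: "0 \<le> b" unfolding b_def by (rule b18_nonneg)
  have N: "N = 1 + b / e ^ 6" by (simp add: N_def Nt_def b_def e_def)
  have N1: "1 \<le> N" using N b0 e by simp
  \<comment> \<open>Above the level \<open>N\<close> the sixth power is at most
    \<open>N^(-12)\<close> times the eighteenth; the choice of \<open>N\<close> makes the tail of
    the \<open>L^18\<close> bound at most \<open>e^6\<close>.\<close>
  have Ne: "b / N ^ 12 \<le> e ^ 6"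
  proof -
    have "b / e ^ 6 \<le> N" using N by simp
    also have "N \<le> N ^ 12" using N1 by (intro self_le_power) auto
    finally show ?thesis using e N1 by (simp add: field_simps)
  qed
  have L18: "(\<integral>\<^sup>+ x. ennreal (rep_L2 p x ^ 18) \<partial>lebesgue) \<le> ennreal b"
    unfolding b_def by (rule dom_A_L18[OF pq(1) pq(4) gpr])
  define P where "P x = (if \<bar>rep_L2 p x\<bar> \<le> N then 0 else rep_L2 p x)" for x
  have [measurable]: "P \<in> borel_measurable lebesgue" unfolding P_def[abs_def] by measurable
  have P6: "(\<integral>\<^sup>+ x. ennreal (P x ^ 6) \<partial>lebesgue) \<le> ennreal (e ^ 6)"
  proof -
    have "(\<integral>\<^sup>+ x. ennreal (P x ^ 6) \<partial>lebesgue) \<le> (\<integral>\<^sup>+ x. ennreal (1 / N ^ 12) * ennreal (rep_L2 p x ^ 18) \<partial>lebesgue)"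
    proof (rule nn_integral_mono)
      fix x
      have "P x ^ 6 \<le> 1 / N ^ 12 * rep_L2 p x ^ 18"
      proof (cases "\<bar>rep_L2 p x\<bar> \<le> N")
        case False
        then have "N ^ 12 \<le> \<bar>rep_L2 p x\<bar> ^ 12" using N1 by (intro power_mono) auto
        then have "N ^ 12 \<le> rep_L2 p x ^ 12" by simp
        then have "rep_L2 p x ^ 6 * N ^ 12 \<le> rep_L2 p x ^ 6 * rep_L2 p x ^ 12" by (intro mult_left_mono) auto
        also have "\<dots> = rep_L2 p x ^ 18" by (simp flip: power_add)
        finally show ?thesis using False N1 by (simp add: P_def pos_le_divide_eq)
      qed (use N1 in \<open>simp add: P_def\<close>)
      then show "ennreal (P x ^ 6) \<le> ennreal (1 / N ^ 12) * ennreal (rep_L2 p x ^ 18)"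
        using N1 by (simp add: ennreal_mult[symmetric] ennreal_leI)
    qed
    also have "\<dots> \<le> ennreal (1 / N ^ 12) * ennreal b" by (subst nn_integral_cmult) (auto intro!: mult_left_mono L18)
    also have "\<dots> = ennreal (b / N ^ 12)" using N1 b0 by (simp add: ennreal_mult[symmetric])
    also have "\<dots> \<le> ennreal (e ^ 6)" using Ne by (rule ennreal_leI)
    finally show ?thesis .
  qed
  have wS: "(\<integral>\<^sup>+ x. ennreal (rep_L2 w x ^ 6) \<partial>lebesgue) \<le> ennreal ((4 * norm (grad \<Omega> w)) ^ 6)" by (rule Sobolev_H10[OF open_\<Omega> w])
  have I1: "(\<integral>\<^sup>+ x. ennreal (rep_L2 (u t - p) x ^ 4 * (rep_L2 w x)\<^sup>2) \<partial>lebesgue) \<le> ennreal (4096 * k ^ 4 * (norm (grad \<Omega> w))\<^sup>2)"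
    by (rule nn_Q[OF H10_diff[OF uH pH] w gp])
  have I2: "(\<integral>\<^sup>+ x. ennreal (P x ^ 4 * (rep_L2 w x)\<^sup>2) \<partial>lebesgue) \<le> ennreal (e ^ 4 * (4 * norm (grad \<Omega> w))\<^sup>2)"
    using e by (intro nn_integral_Holder_6 P6 wS) auto
  have I3: "(\<integral>\<^sup>+ x. ennreal (N ^ 4 * (rep_L2 w x)\<^sup>2) \<partial>lebesgue) \<le> ennreal (N ^ 4 * (norm w)\<^sup>2)"
  proof -
    have "(\<integral>\<^sup>+ x. ennreal (N ^ 4 * (rep_L2 w x)\<^sup>2) \<partial>lebesgue) = ennreal (N ^ 4) * (\<integral>\<^sup>+ x. ennreal ((rep_L2 w x)\<^sup>2) \<partial>lebesgue)"
      by (subst nn_integral_cmult[symmetric]) (auto simp: ennreal_mult)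
    then show ?thesis by (simp add: nn_norm_L2 ennreal_mult)
  qed
  \<comment> \<open>The value of \<open>u t\<close> is split into its distance to the mean, the mean
    where it exceeds \<open>N\<close>, and the mean where it is at most \<open>N\<close>. The first
    two are small in \<open>L^6\<close> and cost a small gradient term; the last is bounded and
    costs an \<open>L2\<close> term.\<close>
  have "(\<integral>\<^sup>+ x. ennreal (rep_L2 (u t) x ^ 4 * (rep_L2 w x)\<^sup>2) \<partial>lebesgue)
      \<le> (\<integral>\<^sup>+ x. ennreal (8 * (rep_L2 (u t - p) x ^ 4 * (rep_L2 w x)\<^sup>2 + P x ^ 4 * (rep_L2 w x)\<^sup>2 + N ^ 4 * (rep_L2 w x)\<^sup>2)) \<partial>lebesgue)"
  proof (rule nn_integral_mono_AE)
    show "AE x in lebesgue. ennreal (rep_L2 (u t) x ^ 4 * (rep_L2 w x)\<^sup>2)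
      \<le> ennreal (8 * (rep_L2 (u t - p) x ^ 4 * (rep_L2 w x)\<^sup>2 + P x ^ 4 * (rep_L2 w x)\<^sup>2 + N ^ 4 * (rep_L2 w x)\<^sup>2))"
      using rep_L2_diff[of "u t" p]
    proof eventually_elim
      case (elim x)
      have "rep_L2 (u t) x ^ 4 \<le> 8 * rep_L2 (u t - p) x ^ 4 + 8 * rep_L2 p x ^ 4"
        using fourth_power_sum[of "rep_L2 (u t - p) x" "rep_L2 p x"] by (simp add: elim)
      moreover have "rep_L2 p x ^ 4 \<le> P x ^ 4 + N ^ 4"
      proof (cases "\<bar>rep_L2 p x\<bar> \<le> N")
        case True
        then have "\<bar>rep_L2 p x\<bar> ^ 4 \<le> N ^ 4" by (intro power_mono) auto
        then show ?thesis using True by (simp add: P_def)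
      next
        case False
        then show ?thesis using N1 by (simp add: P_def)
      qed
      moreover have "a \<le> 8 * (b + d + n)" if "a \<le> 8 * b + 8 * c" "c \<le> d + n" for a b c d n :: real
        using that by simp
      ultimately have "rep_L2 (u t) x ^ 4 \<le> 8 * (rep_L2 (u t - p) x ^ 4 + P x ^ 4 + N ^ 4)" by blast
      then have "rep_L2 (u t) x ^ 4 * (rep_L2 w x)\<^sup>2 \<le> 8 * (rep_L2 (u t - p) x ^ 4 + P x ^ 4 + N ^ 4) * (rep_L2 w x)\<^sup>2"
        by (intro mult_right_mono) auto
      then show ?case by (intro ennreal_leI) (simp add: algebra_simps)
    qed
  qed
  also have "\<dots> \<le> ennreal (8 * (4096 * k ^ 4 * (norm (grad \<Omega> w))\<^sup>2 + e ^ 4 * (4 * norm (grad \<Omega> w))\<^sup>2 + N ^ 4 * (norm w)\<^sup>2))"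
    using I1 I2 I3 k0 N1 e by (intro nn_integral_add3) auto
  also have "\<dots> \<le> ennreal (\<delta> * (norm (grad \<Omega> w))\<^sup>2 + Ct \<delta> * (norm w)\<^sup>2)"
  proof (rule ennreal_leI)
    have p4: "x ^ 4 \<le> x" if "0 \<le> x" "x \<le> 1" for x :: real
      using power_decreasing[of 1 4 x] that by simp
    have "k ^ 4 \<le> k" using p4[OF k0] \<eta>(3) by (simp add: k_def)
    then have "32768 * k ^ 4 \<le> \<delta> / 2" using \<eta>(4) by (simp add: k_def)
    moreover have "128 * e ^ 4 \<le> \<delta> / 2" using p4[of e] e by linarith
    ultimately have "32768 * k ^ 4 + 128 * e ^ 4 \<le> \<delta>" by linarith
    then have "(32768 * k ^ 4 + 128 * e ^ 4) * (norm (grad \<Omega> w))\<^sup>2 \<le> \<delta> * (norm (grad \<Omega> w))\<^sup>2" by (intro mult_right_mono) auto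
    moreover have "8 * (4096 * k ^ 4 * (norm (grad \<Omega> w))\<^sup>2 + e ^ 4 * (4 * norm (grad \<Omega> w))\<^sup>2 + N ^ 4 * (norm w)\<^sup>2)
      = (32768 * k ^ 4 + 128 * e ^ 4) * (norm (grad \<Omega> w))\<^sup>2 + Ct \<delta> * (norm w)\<^sup>2"
      by (simp add: Ct_def N_def power_mult_distrib algebra_simps)
    ultimately show "8 * (4096 * k ^ 4 * (norm (grad \<Omega> w))\<^sup>2 + e ^ 4 * (4 * norm (grad \<Omega> w))\<^sup>2 + N ^ 4 * (norm w)\<^sup>2)
      \<le> \<delta> * (norm (grad \<Omega> w))\<^sup>2 + Ct \<delta> * (norm w)\<^sup>2" by linarith
  qed
  finally show ?thesis .
qed

end

context damped_wave
begin

text \<open>The forcing is controlled by the supremum \<open>m\<close> of the solution, and the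
  solution by the forcing. If the coefficient of \<open>m^2\<close> in the closed loop is at most
  1/2, it moves to the left-hand side; the bound \<open>B\<close> makes \<open>m\<close> finite and
  is absent from the result.\<close>

lemma mild_absorb:
  assumes W: "sg.mild W H" and B: "\<And>t. norm (W t) \<le> B"
    and step: "\<And>m t. (\<And>s. norm (W s) \<le> m) \<Longrightarrow> (norm (H t))\<^sup>2 \<le> P * (a * m\<^sup>2 + b)"
    and small: "Kb\<^sup>2 * P * a \<le> 1 / 2"
  shows "(norm (W t))\<^sup>2 \<le> 2 * (Kb\<^sup>2 * P) * b"
proof -
  define m where "m = (SUP t. norm (W t))"
  have bdd: "bdd_above (range (\<lambda>t. norm (W t)))" using B by (auto intro!: bdd_aboveI)
  have m: "norm (W s) \<le> m" for s unfolding m_def by (rule cSUP_upper[OF _ bdd]) simp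
  define g where "g = sqrt (P * (a * m\<^sup>2 + b))"
  have nn: "0 \<le> P * (a * m\<^sup>2 + b)" using order_trans[OF zero_le_power2 step[OF m]] .
  have "norm (H s) \<le> g" for s
    using real_sqrt_le_mono[OF step[OF m, of s]] by (simp add: g_def)
  from mild_bounded[OF W B this] have "m \<le> Kb * g" unfolding m_def by (intro cSUP_least) auto
  moreover have "0 \<le> m" using order_trans[OF norm_ge_zero m] .
  ultimately have "m\<^sup>2 \<le> (Kb * g)\<^sup>2" by (intro power_mono)
  also have "\<dots> = (Kb\<^sup>2 * P) * (a * m\<^sup>2 + b)" using nn by (simp add: g_def power_mult_distrib mult.assoc)
  finally have "m\<^sup>2 \<le> 2 * (Kb\<^sup>2 * P) * b" using small by (rule quadratic_absorb)
  moreover have "(norm (W t))\<^sup>2 \<le> m\<^sup>2" using m by (intro power_mono) auto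
  ultimately show ?thesis by linarith
qed

end

context bounded_solution
begin

text \<open>\<open>q\<epsilon>\<close> is the squared gain from \<open>NF\<close> to the solution.
  \<open>dl\<close> is the small parameter for the critical potential: it makes
  \<open>9 C1^2 q\<epsilon> dl\<close> at most 1/2, enough both for the bound on the quotients,
  which needs 6 in place of 9, and for their differences. \<open>Lp\<close> is the resulting
  Lipschitz constant of the solution.\<close>

definition q\<epsilon> :: real where "q\<epsilon> = Kb\<^sup>2 * (1 / \<epsilon>)\<^sup>2"
definition dl :: real where "dl = 1 / (18 * C1\<^sup>2 * q\<epsilon> + 1)"
definition Lp :: real where "Lp = sqrt (2 * q\<epsilon> * (3 * C1\<^sup>2 * (1 + 2 * Ct dl))) * Vm"

lemma q\<epsilon>_nonneg: "0 \<le> q\<epsilon>" by (simp add: q\<epsilon>_def)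

lemma dl: "0 < dl" "9 * C1\<^sup>2 * q\<epsilon> * dl \<le> 1 / 2"
proof -
  have "0 \<le> 18 * C1\<^sup>2 * q\<epsilon>" using q\<epsilon>_nonneg by simp
  then have p: "0 < 18 * C1\<^sup>2 * q\<epsilon> + 1" by linarith
  then show "0 < dl" by (simp add: dl_def)
  show "9 * C1\<^sup>2 * q\<epsilon> * dl \<le> 1 / 2" using p by (simp add: dl_def divide_le_eq)
qed

lemma Ct_nonneg: "0 \<le> Ct dl" by (simp add: Ct_def)

lemma Lp_nonneg: "0 \<le> Lp"
  using q\<epsilon>_nonneg Ct_nonneg Vm_nonneg by (simp add: Lp_def)

section \<open>Difference quotients of the solution\<close>

definition dU :: "real \<Rightarrow> real \<Rightarrow> L2 \<times> (L2^3) \<times> L2" where "dU h t = (1 / h) *\<^sub>R (U (t + h) - U t)"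
definition du :: "real \<Rightarrow> real \<Rightarrow> L2" where "du h t = (1 / h) *\<^sub>R (u (t + h) - u t)"

lemma du_H10: "du h t \<in> H10 \<Omega>"
  unfolding du_def using uH by (intro H10_scale[OF open_\<Omega>] H10_diff)

lemma dU_comp: "fst (dU h t) = du h t" "fst (snd (dU h t)) = grad \<Omega> (du h t)"
  using uH by (simp_all add: dU_def du_def U_comp grad_scale[OF open_\<Omega> H10_diff] grad_diff[OF open_\<Omega>])

lemma norm_du: "0 < h \<Longrightarrow> norm (du h t) \<le> Vm"
  using average_data[of h t] unfolding du_def by metis

text \<open>Here the loop closes: the critical potential contributes \<open>dl\<close> times the
  squared gradient of the quotient, which is absorbed, and \<open>Ct dl\<close> times its squared
  \<open>L2\<close> norm, which is at most \<open>Vm^2\<close> because the quotient of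
  \<open>u\<close> is a mean of \<open>v\<close>.\<close>

lemma dU_bound:
  assumes h: "0 < h"
  shows "norm (dU h t) \<le> Lp"
proof (rule power2_le_imp_le)
  let ?H = "\<lambda>t. (1 / h) *\<^sub>R (G (t + h) - G t)"
  have mld: "sg.mild (dU h) ?H"
    unfolding dU_def[abs_def] by (rule sg.mild_scale[OF sg.mild_diff[OF sg.mild_shift[OF mild] mild]])
  \<comment> \<open>This preliminary bound blows up as \<open>h\<close> tends to zero; it serves
    only to make the supremum finite before absorption.\<close>
  have B: "norm (dU h t) \<le> (1 / h) * (2 * Rm)" for t
    unfolding dU_def using norm_U_diff[of "t + h" t] h by (simp add: divide_right_mono)
  have "(norm (dU h t))\<^sup>2 \<le> 2 * (Kb\<^sup>2 * ((1 / \<epsilon>)\<^sup>2 * (3 * C1\<^sup>2))) * ((1 + 2 * Ct dl) * Vm\<^sup>2)"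
  proof (rule mild_absorb[OF mld B, where a = "2 * dl"])
    fix m t assume m: "\<And>s. norm (dU h s) \<le> m"
    define w where "w = du h t"
    have wH: "w \<in> H10 \<Omega>" by (simp add: w_def du_H10)
    have gw: "(norm (grad \<Omega> w))\<^sup>2 \<le> m\<^sup>2"
      using component_norms(2)[of "dU h t"] m[of t] by (intro power_mono) (auto simp: w_def dU_comp)
    have nw: "(norm w)\<^sup>2 \<le> Vm\<^sup>2" using norm_du[OF h, of t] by (intro power_mono) (auto simp: w_def)
    define q where "q = h\<^sup>2 * (dl * m\<^sup>2 + Ct dl * Vm\<^sup>2)"
    have q: "(\<integral>\<^sup>+ x. ennreal (rep_L2 (u s) x ^ 4 * (rep_L2 (u (t + h) - u t) x)\<^sup>2) \<partial>lebesgue) \<le> ennreal q" for s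
    proof -
      have eq: "u (t + h) - u t = h *\<^sub>R w" using h by (simp add: w_def du_def)
      have "dl * (norm (grad \<Omega> (h *\<^sub>R w)))\<^sup>2 + Ct dl * (norm (h *\<^sub>R w))\<^sup>2 = h\<^sup>2 * (dl * (norm (grad \<Omega> w))\<^sup>2 + Ct dl * (norm w)\<^sup>2)"
        by (simp add: grad_scale[OF open_\<Omega> wH] power_mult_distrib algebra_simps)
      also have "\<dots> \<le> q"
        unfolding q_def using gw nw dl Ct_nonneg by (intro mult_left_mono add_mono) auto
      finally show ?thesis
        using critical_potential_small[OF dl(1) H10_scale[OF open_\<Omega> wH, of h], of s] unfolding eq
        by (meson ennreal_leI order_trans)
    qed
    have q0: "0 \<le> q" using dl Ct_nonneg by (simp add: q_def)
    have "(norm (NF (u (t + h)) - NF (u t)))\<^sup>2 \<le> 3 * C1\<^sup>2 * ((norm (u (t + h) - u t))\<^sup>2 + q + q)"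
      by (rule NF_Lipschitz[OF uH uH q q q0])
    also have "\<dots> \<le> 3 * C1\<^sup>2 * (h\<^sup>2 * Vm\<^sup>2 + q + q)"
    proof -
      have "(norm (u (t + h) - u t))\<^sup>2 = h\<^sup>2 * (norm w)\<^sup>2" using h by (simp add: w_def du_def power_divide)
      then show ?thesis using nw by (intro mult_left_mono add_right_mono) (auto intro: mult_left_mono)
    qed
    also have "\<dots> = h\<^sup>2 * (3 * C1\<^sup>2 * (2 * dl * m\<^sup>2 + (1 + 2 * Ct dl) * Vm\<^sup>2))" by (simp add: q_def algebra_simps)
    finally have *: "(norm (NF (u (t + h)) - NF (u t)))\<^sup>2 / h\<^sup>2 \<le> 3 * C1\<^sup>2 * (2 * dl * m\<^sup>2 + (1 + 2 * Ct dl) * Vm\<^sup>2)"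
      using h by (simp add: divide_le_eq mult.commute)
    have "(norm ((1 / h) *\<^sub>R (G (t + h) - G t)))\<^sup>2 = (1 / \<epsilon>)\<^sup>2 * ((norm (NF (u (t + h)) - NF (u t)))\<^sup>2 / h\<^sup>2)"
      by (simp add: norm_G_diff power_divide power_mult_distrib)
    also have "\<dots> \<le> (1 / \<epsilon>)\<^sup>2 * (3 * C1\<^sup>2 * (2 * dl * m\<^sup>2 + (1 + 2 * Ct dl) * Vm\<^sup>2))" using * by (intro mult_left_mono) auto
    finally show "(norm ((1 / h) *\<^sub>R (G (t + h) - G t)))\<^sup>2 \<le> (1 / \<epsilon>)\<^sup>2 * (3 * C1\<^sup>2) * (2 * dl * m\<^sup>2 + (1 + 2 * Ct dl) * Vm\<^sup>2)"
      by (simp only: mult.assoc)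
  next
    have "0 \<le> 9 * C1\<^sup>2 * q\<epsilon> * dl" using q\<epsilon>_nonneg dl by simp
    moreover have "Kb\<^sup>2 * ((1 / \<epsilon>)\<^sup>2 * (3 * C1\<^sup>2)) * (2 * dl) = 2 / 3 * (9 * C1\<^sup>2 * q\<epsilon> * dl)" by (simp add: q\<epsilon>_def)
    ultimately show "Kb\<^sup>2 * ((1 / \<epsilon>)\<^sup>2 * (3 * C1\<^sup>2)) * (2 * dl) \<le> 1 / 2" using dl(2) by linarith
  qed
  also have "\<dots> = (2 * q\<epsilon> * (3 * C1\<^sup>2 * (1 + 2 * Ct dl))) * Vm\<^sup>2" by (simp add: q\<epsilon>_def)
  also have "\<dots> = Lp\<^sup>2" using q\<epsilon>_nonneg Ct_nonneg by (simp add: Lp_def power_mult_distrib)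
  finally show "(norm (dU h t))\<^sup>2 \<le> Lp\<^sup>2" .
qed (rule Lp_nonneg)

text \<open>The quotient is a mean of \<open>v\<close>, and by the previous lemma \<open>v\<close>
  is Lipschitz in \<open>L2\<close> with constant \<open>Lp\<close>.\<close>

lemma du_v:
  assumes h: "0 < h"
  shows "norm (du h t - v t) \<le> Lp * h"
proof -
  have vs: "norm (v s - v t) \<le> Lp * h" if s: "s \<in> {t..t + h}" for s
  proof (cases "s = t")
    case False
    with s have st: "0 < s - t" by simp
    have "norm (v s - v t) \<le> norm (U s - U t)" using component_norms(3)[of "U s - U t"] by (simp add: U_comp)
    also have "U s - U t = (s - t) *\<^sub>R dU (s - t) t" using st by (simp add: dU_def)
    then have "norm (U s - U t) = (s - t) * norm (dU (s - t) t)" using st by simp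
    also have "\<dots> \<le> h * Lp" using st s dU_bound[OF st, of t] by (intro mult_mono) auto
    finally show ?thesis by (simp add: mult.commute)
  qed (use Lp_nonneg h in simp)
  have "(v has_integral (u (t + h) - u t)) {t..t + h}" using average_data[OF h, of t] by blast
  from has_integral_diff[OF this has_integral_const_real[of "v t" t "t + h"]]
  have "((\<lambda>s. v s - v t) has_integral (u (t + h) - u t - h *\<^sub>R v t)) (cbox t (t + h))"
    using h by (simp add: cbox_interval)
  then have "norm (u (t + h) - u t - h *\<^sub>R v t) \<le> Lp * h * measure lborel (cbox t (t + h))"
    by (rule has_integral_bound[rotated]) (use vs h Lp_nonneg in \<open>auto simp: cbox_interval\<close>)
  moreover have "du h t - v t = (1 / h) *\<^sub>R (u (t + h) - u t - h *\<^sub>R v t)" using h by (simp add: du_def scaleR_right_diff_distrib)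
  ultimately show ?thesis using h by (simp add: divide_le_eq)
qed

text \<open>The first summand is the lower order term, since quotients with steps up to
  \<open>d\<close> differ by at most \<open>2 Lp d\<close> in \<open>L2\<close>; the second one
  collects the Taylor remainders, with 1458 = 3 * (243 + 243). Both vanish with
  \<open>d\<close>.\<close>

definition quot_mod :: "real \<Rightarrow> real" where
  "quot_mod d = 2 * q\<epsilon> * (9 * C1\<^sup>2 * (1 + Ct dl) * (Lp * (2 * d))\<^sup>2
     + 1458 * C\<^sup>2 * (Lp\<^sup>2 + 4096 * rg ^ 4 * Lp\<^sup>2 + 4096 * Lp ^ 4 * Lp\<^sup>2) * (d powr \<gamma>)\<^sup>2)"

text \<open>A difference of quotients is again a bounded mild solution. Its forcing is linear in the
  difference up to Taylor remainders, which are small because the quotients are by now bounded in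
  \<open>H10\<close> by \<open>Lp\<close>; the leading term is absorbed as before.\<close>

lemma dU_Cauchy:
  assumes h: "0 < h" "h \<le> d" and k: "0 < k" "k \<le> d" and d: "d \<le> 1"
  shows "(norm (dU h t - dU k t))\<^sup>2 \<le> quot_mod d"
proof -
  let ?H = "\<lambda>h t. (1 / h) *\<^sub>R (G (t + h) - G t)"
  define c where "c = Lp\<^sup>2 + 4096 * rg ^ 4 * Lp\<^sup>2 + 4096 * Lp ^ 4 * Lp\<^sup>2"
  have c0: "0 \<le> c" by (simp add: c_def)
  define b where "b = 9 * C1\<^sup>2 * (1 + Ct dl) * (Lp * (2 * d))\<^sup>2 + 1458 * C\<^sup>2 * c * (d powr \<gamma>)\<^sup>2"
  have mld: "sg.mild (\<lambda>t. dU h t - dU k t) (\<lambda>t. ?H h t - ?H k t)"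
    unfolding dU_def[abs_def] by (intro sg.mild_scale sg.mild_diff sg.mild_shift mild)
  have B: "norm (dU h t - dU k t) \<le> Lp + Lp" for t
    using norm_triangle_ineq4[of "dU h t" "dU k t"] dU_bound[OF h(1), of t] dU_bound[OF k(1), of t] by linarith
  have "(norm (dU h t - dU k t))\<^sup>2 \<le> 2 * (Kb\<^sup>2 * (1 / \<epsilon>)\<^sup>2) * b"
  proof (rule mild_absorb[OF mld B, where a = "9 * C1\<^sup>2 * dl"])
    fix m t assume m: "\<And>s. norm (dU h s - dU k s) \<le> m"
    let ?z = "du h t" and ?y = "du k t"
    have H: "?z - ?y \<in> H10 \<Omega>" by (intro H10_diff du_H10)
    have gw: "(norm (grad \<Omega> (?z - ?y)))\<^sup>2 \<le> m\<^sup>2"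
      using component_norms(2)[of "dU h t - dU k t"] m[of t] grad_diff[OF open_\<Omega> du_H10 du_H10, of h t k t]
      by (intro power_mono) (auto simp: dU_comp)
    \<comment> \<open>Both quotients are close to \<open>v t\<close>. This makes the
      \<open>L2\<close> term left over by the critical potential small, rather than merely
      bounded.\<close>
    have nz: "(norm (?z - ?y))\<^sup>2 \<le> (Lp * (2 * d))\<^sup>2"
    proof (intro power_mono)
      have "norm (?z - ?y) \<le> norm (?z - v t) + norm (?y - v t)" using norm_triangle_ineq4[of "?z - v t" "?y - v t"] by simp
      also have "\<dots> \<le> Lp * d + Lp * d"
        using du_v[OF h(1), of t] du_v[OF k(1), of t] mult_left_mono[OF h(2) Lp_nonneg] mult_left_mono[OF k(2) Lp_nonneg] by linarith
      finally show "norm (?z - ?y) \<le> Lp * (2 * d)" by (simp add: mult_ac)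
    qed simp
    have sz: "norm (du h t) \<le> Lp" "norm (grad \<Omega> (du h t)) \<le> Lp" if "0 < h" for h
      using component_norms(1,2)[of "dU h t"] dU_bound[OF that, of t] by (auto simp: dU_comp)
    define q where "q = dl * m\<^sup>2 + Ct dl * (Lp * (2 * d))\<^sup>2"
    have q: "(\<integral>\<^sup>+ x. ennreal (rep_L2 (u t) x ^ 4 * (rep_L2 (?z - ?y) x)\<^sup>2) \<partial>lebesgue) \<le> ennreal q"
    proof (rule order_trans[OF critical_potential_small[OF dl(1) H]], rule ennreal_leI)
      show "dl * (norm (grad \<Omega> (?z - ?y)))\<^sup>2 + Ct dl * (norm (?z - ?y))\<^sup>2 \<le> q"
        unfolding q_def using gw nz dl Ct_nonneg by (intro mult_left_mono add_mono) auto
    qed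
    have q0: "0 \<le> q" using dl Ct_nonneg by (simp add: q_def)
    have uh: "u t + h *\<^sub>R du h t = u (t + h)" if "0 < h" for h using that by (simp add: du_def)
    let ?N = "(1 / h) *\<^sub>R (NF (u (t + h)) - NF (u t)) - (1 / k) *\<^sub>R (NF (u (t + k)) - NF (u t))"
    have "(norm ?N)\<^sup>2
      \<le> 3 * (3 * C1\<^sup>2 * ((norm (?z - ?y))\<^sup>2 + q) + 243 * C\<^sup>2 * c * (h powr \<gamma>)\<^sup>2 + 243 * C\<^sup>2 * c * (k powr \<gamma>)\<^sup>2)"
      using NF_quotient[OF uH grad_u du_H10 sz[OF h(1)] du_H10 sz[OF k(1)] h(1) _ k(1) _ q q0] h k d
      by (simp add: uh c_def)
    also have "\<dots> \<le> 3 * (3 * C1\<^sup>2 * ((Lp * (2 * d))\<^sup>2 + q) + 243 * C\<^sup>2 * c * (d powr \<gamma>)\<^sup>2 + 243 * C\<^sup>2 * c * (d powr \<gamma>)\<^sup>2)"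
    proof -
      have "(h powr \<gamma>)\<^sup>2 \<le> (d powr \<gamma>)\<^sup>2" "(k powr \<gamma>)\<^sup>2 \<le> (d powr \<gamma>)\<^sup>2"
        using h k exps by (intro power_mono powr_mono2; simp)+
      then show ?thesis using nz c0 by (intro mult_left_mono add_mono) auto
    qed
    also have "\<dots> = 9 * C1\<^sup>2 * dl * m\<^sup>2 + b" by (simp add: q_def b_def algebra_simps)
    finally have *: "(norm ?N)\<^sup>2 \<le> 9 * C1\<^sup>2 * dl * m\<^sup>2 + b" .
    have "?H h t - ?H k t = (0, 0, (1 / \<epsilon>) *\<^sub>R ?N)" by (simp add: G_comp algebra_simps)
    then have "norm (?H h t - ?H k t) = norm ((1 / \<epsilon>) *\<^sub>R ?N)" by (simp only: norm_0_0)
    then have "(norm (?H h t - ?H k t))\<^sup>2 = (1 / \<epsilon>)\<^sup>2 * (norm ?N)\<^sup>2" by (simp only: norm_scaleR power_mult_distrib power2_abs)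
    also have "\<dots> \<le> (1 / \<epsilon>)\<^sup>2 * (9 * C1\<^sup>2 * dl * m\<^sup>2 + b)" using * by (intro mult_left_mono) auto
    finally show "(norm (?H h t - ?H k t))\<^sup>2 \<le> (1 / \<epsilon>)\<^sup>2 * (9 * C1\<^sup>2 * dl * m\<^sup>2 + b)" .
  next
    show "Kb\<^sup>2 * (1 / \<epsilon>)\<^sup>2 * (9 * C1\<^sup>2 * dl) \<le> 1 / 2" using dl(2) by (simp add: q\<epsilon>_def mult_ac)
  qed
  then show ?thesis by (simp add: quot_mod_def b_def c_def q\<epsilon>_def)
qed

lemma quot_mod_tendsto: "(quot_mod \<longlongrightarrow> 0) (at_right 0)"
proof -
  have "((\<lambda>d. d powr \<gamma>) \<longlongrightarrow> 0) (at_right 0)"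
    by (rule tendsto_zero_powrI[OF tendsto_ident_at tendsto_const]) (use exps in \<open>auto simp: eventually_at_right_field intro: exI[of _ 1]\<close>)
  note p = tendsto_power[OF this, of 2]
  have "((\<lambda>d :: real. (Lp * (2 * d))\<^sup>2) \<longlongrightarrow> 0) (at_right 0)" by (auto intro!: tendsto_eq_intros)
  from tendsto_add[OF tendsto_mult_left[OF this] tendsto_mult_left[OF p], THEN tendsto_mult_left]
  show ?thesis unfolding quot_mod_def[abs_def] by simp
qed

text \<open>The first square bounds \<open>A u\<close> through the equation. The second summand
  bounds the time derivative \<open>(v, v')\<close> in \<open>Z0\<close>, thus the form norm of
  \<open>v\<close> and the \<open>L2\<close> norm of \<open>v'\<close> together.\<close>

definition Reps :: real where "Reps = (NFm + Vm + Lp)\<^sup>2 + kZ * Lp\<^sup>2"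

text \<open>The derivative in \<open>Z0\<close> has \<open>v\<close> as its first component, so
  \<open>v\<close> is continuous into \<open>H10\<close>. The equation writes \<open>A u\<close> as
  \<open>NF u - v - \<epsilon> v'\<close>, a sum of continuous \<open>L2\<close> functions, so
  \<open>u\<close> is continuous into the domain with its operator norm.\<close>

theorem regularity:
  shows "continuous_into (Z1 \<Omega> A \<beta>) (\<lambda>t. (u t, v t))"
    and "\<exists>F'. continuous_into (Z0 \<Omega> A \<beta>) F' \<and>
        (\<forall>t. has_deriv_into (Z0 \<Omega> A \<beta>) (\<lambda>t. (u t, v t)) (F' t) t \<and>
             F' t = op_B \<Omega> A \<beta> \<epsilon> (u t, v t) + (0, (1 / \<epsilon>) *\<^sub>R NF (u t)))"
    and "\<forall>t. \<exists>v'. has_deriv_into (Hs0 \<Omega>) v v' t \<and>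
        (norm (op_A \<Omega> A \<beta> (u t)))\<^sup>2 + (fnorm (v t))\<^sup>2 + \<epsilon> * (norm v')\<^sup>2 \<le> Reps"
proof -
  have Cau: "\<exists>d>0. \<forall>h\<in>{0<..<d}. \<forall>k\<in>{0<..<d}. \<forall>t.
      norm ((1 / h) *\<^sub>R (U (t + h) - U t) - (1 / k) *\<^sub>R (U (t + k) - U t)) \<le> e" if e: "0 < e" for e
  proof -
    have "\<forall>\<^sub>F d in at_right 0. quot_mod d < e\<^sup>2" by (rule order_tendstoD(2)[OF quot_mod_tendsto]) (use e in simp)
    moreover have "\<forall>\<^sub>F d in at_right 0. d \<in> {0<..<1::real}" by (rule eventually_at_right_real) simp
    ultimately have "\<forall>\<^sub>F d in at_right 0. quot_mod d < e\<^sup>2 \<and> 0 < d \<and> d \<le> 1" by eventually_elim auto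
    then obtain d where d: "quot_mod d < e\<^sup>2" "0 < d" "d \<le> 1" using eventually_happens trivial_limit_at_right_real by blast
    show ?thesis
    proof (intro exI[of _ d] conjI ballI allI)
      fix h k t assume "h \<in> {0<..<d}" "k \<in> {0<..<d}"
      then have "(norm (dU h t - dU k t))\<^sup>2 \<le> e\<^sup>2" using dU_Cauchy[of h d k t] d by auto
      then have "norm (dU h t - dU k t) \<le> e" by (rule power2_le_imp_le) (use e in simp)
      then show "norm ((1 / h) *\<^sub>R (U (t + h) - U t) - (1 / k) *\<^sub>R (U (t + k) - U t)) \<le> e" by (simp add: dU_def)
    qed (rule d)
  qed
  obtain Y where Y: "continuous_on UNIV Y" "\<And>t. Y t \<in> ZS" "\<And>t. U t \<in> DE" "\<And>t. Y t = BE (U t) + G t"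
    "\<And>t. ((\<lambda>h. (1 / h) *\<^sub>R (U (t + h) - U t)) \<longlongrightarrow> Y t) (at 0)" "\<And>t. norm (Y t) \<le> Lp"
  proof (rule sg.mild_C1[OF mild continuous_U continuous_G])
    fix e :: real assume "0 < e"
    then show "\<exists>d>0. \<forall>h\<in>{0<..<d}. \<forall>k\<in>{0<..<d}. \<forall>t.
      norm ((1 / h) *\<^sub>R (U (t + h) - U t) - (1 / k) *\<^sub>R (U (t + k) - U t)) \<le> e" by (rule Cau)
  next
    fix h t :: real assume "0 < h"
    then show "norm ((1 / h) *\<^sub>R (U (t + h) - U t)) \<le> Lp" using dU_bound by (simp add: dU_def)
  qed (rule that)
  define F' where "F' t = unemb (Y t)" for t
  have YF: "Y t = emb (F' t)" for t by (simp add: F'_def emb_unemb[OF Y(2)])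
  have F'Z: "F' t \<in> fst (Z0 \<Omega> A \<beta>)" for t unfolding F'_def by (rule unemb_in_Z0[OF Y(2)])
  have uvZ1: "(u t, v t) \<in> fst (Z1 \<Omega> A \<beta>)" for t using Y(3)[of t] by (simp add: DE_iff U_def)
  then have ud: "u t \<in> dom_A \<Omega> A \<beta>" and vH: "v t \<in> H10 \<Omega>" for t by (auto simp: fst_Z1)
  have F'eq: "F' t = op_B \<Omega> A \<beta> \<epsilon> (u t, v t) + (0, (1 / \<epsilon>) *\<^sub>R NF (u t))" for t
    unfolding F'_def Y(4) unemb_add by (simp add: BE_def U_def G_def)
  have fF: "fst (F' t) = v t" for t by (simp add: F'eq op_B_def)
  \<comment> \<open>The second component of the evolution equation solved for the elliptic term. It
    is used twice: for continuity of \<open>A u\<close> and for its bound.\<close>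
  have Au: "op_A \<Omega> A \<beta> (u t) = NF (u t) - v t - \<epsilon> *\<^sub>R snd (F' t)" for t
  proof -
    have "\<epsilon> *\<^sub>R snd (F' t) = \<epsilon> *\<^sub>R ((1 / \<epsilon>) *\<^sub>R NF (u t)) - \<epsilon> *\<^sub>R ((1 / \<epsilon>) *\<^sub>R (v t + op_A \<Omega> A \<beta> (u t)))"
      by (simp add: F'eq op_B_def scaleR_right_diff_distrib scaleR_add_right)
    also have "\<dots> = NF (u t) - (v t + op_A \<Omega> A \<beta> (u t))" using \<epsilon> by simp
    finally show ?thesis by simp
  qed
  have Ycomp: "fst (Y t) = v t" "snd (snd (Y t)) = snd (F' t)" for t by (simp_all add: YF emb_def fF)
  have cont: "(f \<longlongrightarrow> f t) (at t)" if "continuous_on UNIV f" for f :: "real \<Rightarrow> L2 \<times> (L2^3) \<times> L2" and t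
    using that by (simp add: continuous_on_def)
  show "continuous_into (Z1 \<Omega> A \<beta>) (\<lambda>t. (u t, v t))"
    unfolding continuous_into_def
  proof (intro conjI allI)
    fix t
    show "(u t, v t) \<in> fst (Z1 \<Omega> A \<beta>)" by (rule uvZ1)
    let ?b = "\<lambda>s. \<epsilon> * norm (G s - G t) + norm (U s - U t) + \<epsilon> * norm (Y s - Y t) + sqrt kZ * norm (Y s - Y t)"
    show "((\<lambda>s. snd (Z1 \<Omega> A \<beta>) ((u s, v s) - (u t, v t))) \<longlongrightarrow> 0) (at t)"
    proof (rule tendsto_sandwich[of "\<lambda>_. 0" _ _ ?b])
      have "((\<lambda>s. norm (f s - f t)) \<longlongrightarrow> 0) (at t)" if "continuous_on UNIV f" for f :: "real \<Rightarrow> L2 \<times> (L2^3) \<times> L2"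
        using cont[OF that, of t] tendsto_norm_zero Lim_null by blast
      note lims = this[OF continuous_G] this[OF continuous_U] this[OF Y(1)]
      show "(?b \<longlongrightarrow> 0) (at t)"
        using tendsto_add[OF tendsto_add[OF tendsto_add[OF tendsto_mult_right_zero[OF lims(1)] lims(2)]
          tendsto_mult_right_zero[OF lims(3)]] tendsto_mult_right_zero[OF lims(3)]] by simp
      show "\<forall>\<^sub>F s in at t. snd (Z1 \<Omega> A \<beta>) ((u s, v s) - (u t, v t)) \<le> ?b s"
      proof (rule always_eventually, rule allI)
        fix s
        have eq: "op_A \<Omega> A \<beta> (u s - u t) = (NF (u s) - NF (u t)) - (v s - v t) - \<epsilon> *\<^sub>R (snd (F' s) - snd (F' t))"
          by (simp add: op_A_diff[OF ud ud] Au scaleR_right_diff_distrib)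
        have "norm (op_A \<Omega> A \<beta> (u s - u t)) \<le> norm (NF (u s) - NF (u t)) + norm (v s - v t) + norm (\<epsilon> *\<^sub>R (snd (F' s) - snd (F' t)))"
          unfolding eq by (rule norm_diff3)
        also have "\<dots> \<le> \<epsilon> * norm (G s - G t) + norm (U s - U t) + \<epsilon> * norm (Y s - Y t)"
        proof (intro add_mono)
          show "norm (NF (u s) - NF (u t)) \<le> \<epsilon> * norm (G s - G t)" using \<epsilon> by (simp add: norm_G_diff)
          show "norm (v s - v t) \<le> norm (U s - U t)" using component_norms(3)[of "U s - U t"] by (simp add: U_comp)
          show "norm (\<epsilon> *\<^sub>R (snd (F' s) - snd (F' t))) \<le> \<epsilon> * norm (Y s - Y t)"
            using component_norms(3)[of "Y s - Y t"] \<epsilon> by (simp add: Ycomp)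
        qed
        moreover have "fnorm (v s - v t) \<le> sqrt kZ * norm (Y s - Y t)"
        proof -
          have d: "F' s - F' t \<in> fst (Z0 \<Omega> A \<beta>)" by (rule subspace_diff[OF Z0_subspace F'Z F'Z])
          have "F' s - F' t = (v s - v t, snd (F' s) - snd (F' t))" by (simp add: prod_eq_iff fF)
          then have "fnorm (v s - v t) \<le> snd (Z0 \<Omega> A \<beta>) (F' s - F' t)"
            using fnorm_nonneg[OF H10_diff[OF vH vH]] by (simp add: snd_Z0 real_le_rsqrt)
          also have "\<dots> \<le> sqrt kZ * norm (Y s - Y t)"
            using norm_emb_lower'[OF d] emb_diff[OF F'Z F'Z] by (simp add: YF)
          finally show ?thesis .
        qed
        moreover have "snd (Z1 \<Omega> A \<beta>) ((u s, v s) - (u t, v t)) \<le> norm (op_A \<Omega> A \<beta> (u s - u t)) + fnorm (v s - v t)"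
          using sqrt_sum_squares_le_sum[of "norm (op_A \<Omega> A \<beta> (u s - u t))" "fnorm (v s - v t)"] fnorm_nonneg[OF H10_diff[OF vH vH]]
          by (simp add: snd_Z1)
        ultimately show "snd (Z1 \<Omega> A \<beta>) ((u s, v s) - (u t, v t)) \<le> ?b s" by linarith
      qed
      show "\<forall>\<^sub>F s in at t. 0 \<le> snd (Z1 \<Omega> A \<beta>) ((u s, v s) - (u t, v t))" by (simp add: snd_Z1)
    qed simp
  qed
  have quot: "(1 / h) *\<^sub>R ((u (t + h), v (t + h)) - (u t, v t)) \<in> fst (Z0 \<Omega> A \<beta>)" for h t
    by (intro subspace_scale[OF Z0_subspace] subspace_diff[OF Z0_subspace] U_Z0)
  have "continuous_into (Z0 \<Omega> A \<beta>) F'"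
    unfolding continuous_into_def
  proof (intro conjI allI)
    fix t show "((\<lambda>s. snd (Z0 \<Omega> A \<beta>) (F' s - F' t)) \<longlongrightarrow> 0) (at t)"
      using cont[OF Y(1), of t] by (subst Z0_tendsto_iff) (auto simp: F'Z YF[symmetric])
  qed (rule F'Z)
  moreover have "has_deriv_into (Z0 \<Omega> A \<beta>) (\<lambda>t. (u t, v t)) (F' t) t" for t
    unfolding has_deriv_into_def
  proof (intro conjI allI F'Z U_Z0)
    have "emb ((1 / h) *\<^sub>R ((u (t + h), v (t + h)) - (u t, v t))) = (1 / h) *\<^sub>R (U (t + h) - U t)" for h
      unfolding U_def by (simp only: emb_scale[OF subspace_diff[OF Z0_subspace U_Z0 U_Z0]] emb_diff[OF U_Z0 U_Z0])
    then show "((\<lambda>h. snd (Z0 \<Omega> A \<beta>) ((1 / h) *\<^sub>R ((u (t + h), v (t + h)) - (u t, v t)) - F' t)) \<longlongrightarrow> 0) (at 0)"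
      using Y(5)[of t] by (subst Z0_tendsto_iff[OF always_eventually[OF allI[OF quot]] F'Z]) (simp only: YF)
  qed
  ultimately show "\<exists>F'. continuous_into (Z0 \<Omega> A \<beta>) F' \<and>
        (\<forall>t. has_deriv_into (Z0 \<Omega> A \<beta>) (\<lambda>t. (u t, v t)) (F' t) t \<and>
             F' t = op_B \<Omega> A \<beta> \<epsilon> (u t, v t) + (0, (1 / \<epsilon>) *\<^sub>R NF (u t)))"
    using F'eq by blast
  show "\<forall>t. \<exists>v'. has_deriv_into (Hs0 \<Omega>) v v' t \<and>
        (norm (op_A \<Omega> A \<beta> (u t)))\<^sup>2 + (fnorm (v t))\<^sup>2 + \<epsilon> * (norm v')\<^sup>2 \<le> Reps"
  proof (intro allI exI conjI)
    fix t
    let ?v' = "snd (F' t)"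
    show "has_deriv_into (Hs0 \<Omega>) v ?v' t"
      unfolding has_deriv_into_def
    proof (intro conjI allI)
      show "?v' \<in> fst (Hs0 \<Omega>)" "v s \<in> fst (Hs0 \<Omega>)" for s using F'Z[of t] vL by (auto simp: Hs0_def fst_Z0)
      have "((\<lambda>h. (1 / h) *\<^sub>R (v (t + h) - v t)) \<longlongrightarrow> ?v') (at 0)"
        using tendsto_snd[OF tendsto_snd[OF Y(5)[of t]]] by (simp add: U_comp Ycomp)
      then show "((\<lambda>h. snd (Hs0 \<Omega>) ((1 / h) *\<^sub>R (v (t + h) - v t) - ?v')) \<longlongrightarrow> 0) (at 0)"
        unfolding Hs0_def snd_conv by (rule tendsto_norm_zero[OF Lim_null[THEN iffD1]])
    qed
    have v': "norm ?v' \<le> Lp" using component_norms(3)[of "Y t"] Y(6)[of t] by (simp add: Ycomp)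
    have "norm (op_A \<Omega> A \<beta> (u t)) \<le> norm (NF (u t)) + norm (v t) + norm (\<epsilon> *\<^sub>R ?v')"
      unfolding Au by (rule norm_diff3)
    also have "\<dots> \<le> NFm + Vm + 1 * Lp"
      using norm_NF norm_v v' \<epsilon> mult_mono[of \<epsilon> 1 "norm ?v'" Lp] by (intro add_mono) auto
    finally have a: "(norm (op_A \<Omega> A \<beta> (u t)))\<^sup>2 \<le> (NFm + Vm + Lp)\<^sup>2" by (intro power_mono) auto
    have "F' t = (v t, ?v')" by (simp add: prod_eq_iff fF)
    then have "(fnorm (v t))\<^sup>2 + (norm ?v')\<^sup>2 = (snd (Z0 \<Omega> A \<beta>) (F' t))\<^sup>2"
      by (metis snd_Z0 real_sqrt_pow2 sum_power2_ge_zero)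
    also have "\<dots> \<le> kZ * (norm (Y t))\<^sup>2" unfolding YF by (rule norm_emb_lower[OF F'Z])
    also have "\<dots> \<le> kZ * Lp\<^sup>2" using kZ_ge Y(6)[of t] by (intro mult_left_mono power_mono) auto
    finally have "(fnorm (v t))\<^sup>2 + (norm ?v')\<^sup>2 \<le> kZ * Lp\<^sup>2" .
    moreover have "\<epsilon> * (norm ?v')\<^sup>2 \<le> 1 * (norm ?v')\<^sup>2" using \<epsilon> by (intro mult_right_mono) auto
    ultimately show "(norm (op_A \<Omega> A \<beta> (u t)))\<^sup>2 + (fnorm (v t))\<^sup>2 + \<epsilon> * (norm ?v')\<^sup>2 \<le> Reps"
      unfolding Reps_def using a by linarith
  qed
qed

end

theorem theorem2p7:
  fixes \<epsilon> R a0 a1 lambda1 C \<alpha> \<gamma> F0 F1 :: real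
    and \<omega> Cnu :: "real \<Rightarrow> real"
  assumes "0 < \<epsilon>" "\<epsilon> \<le> 1"
    and "0 < a0" "0 < a1" "0 < lambda1" "\<And>\<nu>. 0 < \<nu> \<Longrightarrow> 0 < Cnu \<nu>"
    and "0 < C" "0 < \<gamma>" "\<gamma> \<le> 1" "1 \<le> \<alpha>" "\<alpha> < 2" "\<alpha> + \<gamma> = 2"
    and "modulus_function \<omega>"
  shows "\<exists>Reps>0. \<forall>(\<Omega> :: (real^3) set) A \<beta> f T u v.
     open \<Omega> \<and>
     coefficient_assms \<Omega> a0 a1 lambda1 Cnu A \<beta> \<and>
     nonlinearity_assms \<Omega> C \<alpha> \<gamma> f \<and>
     sqrt (LINT x|lebesgue_on \<Omega>. (f x 0)\<^sup>2) = F0 \<and>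
     Linf_norm (lebesgue_on \<Omega>) (\<lambda>x. deriv (f x) 0) = F1 \<and>
     wave_semigroup \<Omega> A \<beta> \<epsilon> T \<and>
     full_solution \<Omega> A \<beta> f \<epsilon> T u v \<and>
     (\<forall>t. (H10_norm \<Omega> A \<beta> (u t))\<^sup>2 + \<epsilon> * (norm (v t))\<^sup>2 \<le> R) \<and>
     has_modulus (H10_norm \<Omega> A \<beta>) \<omega> u
     \<longrightarrow>
     continuous_into (Z1 \<Omega> A \<beta>) (\<lambda>t. (u t, v t)) \<and>
     (\<exists>F'. continuous_into (Z0 \<Omega> A \<beta>) F' \<and>
        (\<forall>t. has_deriv_into (Z0 \<Omega> A \<beta>) (\<lambda>t. (u t, v t)) (F' t) t \<and>
             F' t = op_B \<Omega> A \<beta> \<epsilon> (u t, v t) + (0, (1 / \<epsilon>) *\<^sub>R nemytskii \<Omega> f (u t)))) \<and>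
     (\<forall>t. \<exists>v'. has_deriv_into (Hs0 \<Omega>) v v' t \<and>
        (norm (op_A \<Omega> A \<beta> (u t)))\<^sup>2 + (H10_norm \<Omega> A \<beta> (v t))\<^sup>2 + \<epsilon> * (norm v')\<^sup>2 \<le> Reps)"
\<comment> \<open>Outside its locale \<open>Reps\<close> takes as arguments only the structural
  constants, \<epsilon>, \<open>R\<close> and \<omega>; fixing it before \<Omega>, the coefficients
  and the solution is the asserted dependence. The maximum with 1 makes it positive.\<close>
proof (intro exI[of _ "max 1 (bounded_solution.Reps a0 a1 lambda1 Cnu \<epsilon> C F0 F1 R \<omega>)"] conjI allI impI)
  show "0 < max 1 (bounded_solution.Reps a0 a1 lambda1 Cnu \<epsilon> C F0 F1 R \<omega>)" by simp
next
  fix \<Omega> :: "(real^3) set" and A :: "real^3 \<Rightarrow> real^3^3" and \<beta> :: "real^3 \<Rightarrow> real" and f T u v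
  assume *: "open \<Omega> \<and>
     coefficient_assms \<Omega> a0 a1 lambda1 Cnu A \<beta> \<and>
     nonlinearity_assms \<Omega> C \<alpha> \<gamma> f \<and>
     sqrt (LINT x|lebesgue_on \<Omega>. (f x 0)\<^sup>2) = F0 \<and>
     Linf_norm (lebesgue_on \<Omega>) (\<lambda>x. deriv (f x) 0) = F1 \<and>
     wave_semigroup \<Omega> A \<beta> \<epsilon> T \<and>
     full_solution \<Omega> A \<beta> f \<epsilon> T u v \<and>
     (\<forall>t. (H10_norm \<Omega> A \<beta> (u t))\<^sup>2 + \<epsilon> * (norm (v t))\<^sup>2 \<le> R) \<and>
     has_modulus (H10_norm \<Omega> A \<beta>) \<omega> u"
  interpret bounded_solution \<Omega> a0 a1 lambda1 Cnu A \<beta> \<epsilon> T C \<alpha> \<gamma> F0 F1 f u v R \<omega>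
    by unfold_locales (use * assms in auto)
  show "continuous_into (Z1 \<Omega> A \<beta>) (\<lambda>t. (u t, v t))" by (rule regularity(1))
  show "\<exists>F'. continuous_into (Z0 \<Omega> A \<beta>) F' \<and>
      (\<forall>t. has_deriv_into (Z0 \<Omega> A \<beta>) (\<lambda>t. (u t, v t)) (F' t) t \<and>
        F' t = op_B \<Omega> A \<beta> \<epsilon> (u t, v t) + (0, (1 / \<epsilon>) *\<^sub>R nemytskii \<Omega> f (u t)))"
    by (rule regularity(2))
  fix t
  show "\<exists>v'. has_deriv_into (Hs0 \<Omega>) v v' t \<and>
      (norm (op_A \<Omega> A \<beta> (u t)))\<^sup>2 + (H10_norm \<Omega> A \<beta> (v t))\<^sup>2 + \<epsilon> * (norm v')\<^sup>2
        \<le> max 1 (bounded_solution.Reps a0 a1 lambda1 Cnu \<epsilon> C F0 F1 R \<omega>)"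
    using regularity(3) by (meson max.coboundedI2)
qed

end
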